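(* Let $K\le 0$ be a real number, $N\in[1,\infty)$, and let $(X,d,m)$ be a $CD(K,N)$ space. Then for every continuous function $u\colon X\to\mathbb{R}$, every upper gradient $g$ of $u$, every point $x\in X$ and every radius $r>0$, \[ \frac{1}{m(B(x,r))}\int_{B(x,r)}|u-\langle u\rangle_{B(x,r)}|\,dm \le 2^{N+2}\, r\, e^{\sqrt{(N-1)|K|}\,2r}\;\frac{1}{m(B(x,2r))}\int_{B(x,2r)} g\,dm . \] In particular, if $(X,d,m)$ is a $CD(0,N)$ space, then for all such $u,g,x,r$, \[ \frac{1}{m(B(x,r))}\int_{B(x,r)}|u-\langle u\rangle_{B(x,r)}|\,dm \le 2^{N+2}\, r\;\frac{1}{m(B(x,2r))}\int_{B(x,2r)} g\,dm . \]
   Context: Standing assumptions: $(X,d,m)$ is a metric measure space, $(X,d)$ is a complete geodesic metric space, $m$ is a Borel measure on $X$ with support $X$. $B(x,r)=\{y : d(x,y)<r\}$, and $\langle u\rangle_{B} = \frac{1}{m(B)}\int_B u\,dm$ is the average of $u$ over the ball $B$ (averages presuppose $0<m(B)<\infty$). Upper gradient: a Borel function $g\colon X \to [0,\infty]$ is an upper gradient of $u$ if for every constant speed curve $\gamma\colon[0,1]\to X$ with length $l(\gamma)<\infty$ one has $|u(\gamma(0))-u(\gamma(1))| \le l(\gamma)\int_0^1 g(\gamma(t))\,dt$. Geodesics: $\operatorname{Geo}(X)$ is the set of continuous $\gamma\colon[0,1]\to X$ with $d(\gamma(t),\gamma(s)) = |t-s|\,d(\gamma(0),\gamma(1))$ for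 all $s,t\in[0,1]$; $e_t(\gamma)=\gamma(t)$. Wasserstein space: $\mathcal{P}(X)$ is the set of Borel probability measures on $X$, and $W_2(\mu,\nu) = \left(\inf_\sigma \int_{X\times X} d(x,y)^2\,d\sigma(x,y)\right)^{1/2}$ (possibly $+\infty$), the infimum being over $\sigma\in\mathcal{P}(X\times X)$ with first marginal $\mu$ and second marginal $\nu$. $\operatorname{GeoOpt}(\mu,\nu)$ is the set of $\pi\in\mathcal{P}(\operatorname{Geo}(X))$ such that $t\mapsto (e_t)_\#\pi$ is a (constant speed) geodesic in $(\mathcal{P}(X),W_2)$ from $\mu=(e_0)_\#\pi$ to $\nu=(e_1)_\#\pi$. Functionals: for $N\in[1,\infty)$, $\mathcal{DC}_N$ is the class of continuous convex $F\colon[0,\infty)\to\mathbb{R}$ with $F(0)=0$ such that $\lambda\mapsto \lambda^N F(\lambda^{-N})$ is convex on $(0,\infty)$. For such $F$, set $F'(\infty)=\lim_{r\to\infty}F(r)/r$ and $\mathscr{F}(\mu)=\int_X F(\rho)\,dm + F'(\infty)\mu^\perp(X)$, where $\mu=\rho m+\mu^\perp$ is the Lebesgue decomposition of $\mu$ with respect to $m$. $CD(K,N)$ space (for $K\le0$, $N\in[1,\infty)$): put $\beta_t(x,y)=1$ if $K=0$ or $N=1$, and $\beta_t(x,y)=\left(\frac{\sinh(t\alpha)}{t\sinh\alpha}\right)^{N-1}$ with $\alpha=\sqrt{\frac{|K|}{N-1}}\,d(x,y)$ if $K<0$ and $N>1$ (values at $t=0$ or $\alpha=0$ being understood as limits).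 $(X,d,m)$ is a $CD(K,N)$ space if for any $\mu_0,\mu_1\in\mathcal{P}(X)$ with $W_2(\mu_0,\mu_1)<\infty$ there exists $\pi\in\operatorname{GeoOpt}(\mu_0,\mu_1)$ such that, with $\mu_t=(e_t)_\#\pi$, for every $F\in\mathcal{DC}_N$ and every $t\in[0,1]$, \[ \begin{aligned} \mathscr{F}(\mu_t)\le\;& (1-t)\iint_{X\times X}\beta_{1-t}(x_0,x_1)F\left(\tfrac{\rho_0(x_0)}{\beta_{1-t}(x_0,x_1)}\right)d\sigma(x_1|x_0)\,dm(x_0)\\ &+ t\iint_{X\times X}\beta_t(x_0,x_1)F\left(\tfrac{\rho_1(x_1)}{\beta_t(x_0,x_1)}\right)d\sigma(x_0|x_1)\,dm(x_1)\\ &+F'(\infty)\left((1-t)\mu_0^\perp(X)+t\mu_1^\perp(X)\right), \end{aligned} \] where $\mu_i=\rho_i m+\mu_i^\perp$ is the Lebesgue decomposition with respect to $m$, $\sigma=(e_0,e_1)_\#\pi$, and $\sigma(\cdot|x_0)$, $\sigma(\cdot|x_1)$ denote the disintegrations of $\sigma$ with respect to $\mu_0$ and $\mu_1$. *)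

theory Defs
  imports "HOL-Probability.Probability"
begin

section \<open>Metric measure spaces, curves and upper gradients\<close>

definition geodesic_on_unit_interval :: "(real \<Rightarrow> 'a::metric_space) \<Rightarrow> bool" where
  "geodesic_on_unit_interval \<gamma> \<longleftrightarrow>
     (\<forall>s\<in>{0..1}. \<forall>t\<in>{0..1}. dist (\<gamma> t) (\<gamma> s) = \<bar>t - s\<bar> * dist (\<gamma> 0) (\<gamma> 1))"

definition geodesic_space :: "'a::metric_space itself \<Rightarrow> bool" where
  "geodesic_space _ \<longleftrightarrow>
     (\<forall>x y::'a. \<exists>\<gamma>. geodesic_on_unit_interval \<gamma> \<and> \<gamma> 0 = x \<and> \<gamma> 1 = y)"

definition measure_support :: "'a::topological_space measure \<Rightarrow> 'a set" where
  "measure_support m = {x. \<forall>U. open U \<and> x \<in> U \<longrightarrow> emeasure m U > 0}"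

text \<open>
  The space is the whole type; completeness is the type class. Averages over balls presuppose
  that balls have positive and finite measure: positivity follows from full support, finiteness
  is required here. It makes \<open>m\<close> \<open>\<sigma>\<close>-finite (so Lebesgue decompositions with respect to \<open>m\<close>
  exist) and, together with full support, makes the space separable.
\<close>

definition metric_measure_space :: "'a::complete_space measure \<Rightarrow> bool" where
  "metric_measure_space m \<longleftrightarrow>
     geodesic_space TYPE('a) \<and> sets m = sets borel \<and> measure_support m = UNIV \<and>
     (\<forall>x r. emeasure m (ball x r) < \<infinity>)"

definition curve_length :: "(real \<Rightarrow> 'a::metric_space) \<Rightarrow> real \<Rightarrow> real \<Rightarrow> ennreal" where
  "curve_length \<gamma> a b =
     (SUP (n, \<tau>) \<in> {(n::nat, \<tau>::nat \<Rightarrow> real). mono \<tau> \<and> range \<tau> \<subseteq> {a..b}}.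
        \<Sum>i<n. ennreal (dist (\<gamma> (\<tau> i)) (\<gamma> (\<tau> (Suc i)))))"

definition constant_speed :: "(real \<Rightarrow> 'a::metric_space) \<Rightarrow> bool" where
  "constant_speed \<gamma> \<longleftrightarrow> continuous_on {0..1} \<gamma> \<and>
     (\<forall>s t. 0 \<le> s \<and> s \<le> t \<and> t \<le> 1 \<longrightarrow>
        curve_length \<gamma> s t = ennreal (t - s) * curve_length \<gamma> 0 1)"

definition upper_gradient :: "('a::metric_space \<Rightarrow> ennreal) \<Rightarrow> ('a \<Rightarrow> real) \<Rightarrow> bool" where
  "upper_gradient g u \<longleftrightarrow> g \<in> borel_measurable borel \<and>
     (\<forall>\<gamma>. constant_speed \<gamma> \<and> curve_length \<gamma> 0 1 < \<infinity> \<longrightarrow>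
        ennreal \<bar>u (\<gamma> 0) - u (\<gamma> 1)\<bar>
          \<le> curve_length \<gamma> 0 1 * (\<integral>\<^sup>+t\<in>{0..1}. g (\<gamma> t) \<partial>lborel))"

definition average :: "'a measure \<Rightarrow> 'a set \<Rightarrow> ('a \<Rightarrow> real) \<Rightarrow> real" where
  "average m B u = (LINT y:B|m. u y) / measure m B"

definition nn_average :: "'a measure \<Rightarrow> 'a set \<Rightarrow> ('a \<Rightarrow> ennreal) \<Rightarrow> ennreal" where
  "nn_average m B f = (\<integral>\<^sup>+y\<in>B. f y \<partial>m) / emeasure m B"


section \<open>Wasserstein space and optimal geodesic plans\<close>

definition borel_probs :: "'a::topological_space measure set" where
  "borel_probs = {\<mu>. prob_space \<mu> \<and> sets \<mu> = sets borel}"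

definition couplings ::
  "'a::topological_space measure \<Rightarrow> 'a measure \<Rightarrow> ('a \<times> 'a) measure set" where
  "couplings \<mu> \<nu> = {\<sigma> \<in> borel_probs. distr \<sigma> borel fst = \<mu> \<and> distr \<sigma> borel snd = \<nu>}"

definition W2 :: "'a::metric_space measure \<Rightarrow> 'a measure \<Rightarrow> ennreal" where
  "W2 \<mu> \<nu> =
     (let c = (INF \<sigma> \<in> couplings \<mu> \<nu>. \<integral>\<^sup>+(x, y). ennreal ((dist x y)\<^sup>2) \<partial>\<sigma>)
      in if c = \<infinity> then \<infinity> else ennreal (sqrt (enn2real c)))"

text \<open>
  A geodesic on \<open>[0,1]\<close> is represented by its extension to the real line that is constant to the
  left of \<open>0\<close> and to the right of \<open>1\<close>. This identifies \<open>Geo(X)\<close>, with the uniform distance,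
  with a subset of the metric space of bounded continuous functions.
\<close>

definition Geo :: "(real \<Rightarrow>\<^sub>C 'a::metric_space) set" where
  "Geo = {\<gamma>. geodesic_on_unit_interval (apply_bcontfun \<gamma>) \<and>
            (\<forall>t. apply_bcontfun \<gamma> t = apply_bcontfun \<gamma> (max 0 (min 1 t)))}"

definition geo_probs :: "(real \<Rightarrow>\<^sub>C 'a::metric_space) measure set" where
  "geo_probs = {\<pi>. prob_space \<pi> \<and> sets \<pi> = sets (restrict_space borel Geo)}"

definition eval_push :: "real \<Rightarrow> (real \<Rightarrow>\<^sub>C 'a::metric_space) measure \<Rightarrow> 'a measure" where
  "eval_push t \<pi> = distr \<pi> borel (\<lambda>\<gamma>. apply_bcontfun \<gamma> t)"

definition endpoint_push ::
  "(real \<Rightarrow>\<^sub>C 'a::metric_space) measure \<Rightarrow> ('a \<times> 'a) measure" where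
  "endpoint_push \<pi> = distr \<pi> borel (\<lambda>\<gamma>. (apply_bcontfun \<gamma> 0, apply_bcontfun \<gamma> 1))"

definition GeoOpt ::
  "'a::metric_space measure \<Rightarrow> 'a measure \<Rightarrow> (real \<Rightarrow>\<^sub>C 'a) measure set" where
  "GeoOpt \<mu> \<nu> = {\<pi> \<in> geo_probs. eval_push 0 \<pi> = \<mu> \<and> eval_push 1 \<pi> = \<nu> \<and>
     (\<forall>s\<in>{0..1}. \<forall>t\<in>{0..1}.
        W2 (eval_push t \<pi>) (eval_push s \<pi>) = ennreal \<bar>t - s\<bar> * W2 \<mu> \<nu>)}"


section \<open>Lebesgue decomposition and disintegration\<close>

definition lebesgue_decomposition ::
  "'a::topological_space measure \<Rightarrow> 'a measure \<Rightarrow> ('a \<Rightarrow> real) \<Rightarrow> 'a measure \<Rightarrow> bool" where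
  "lebesgue_decomposition m \<mu> \<rho> \<nu> \<longleftrightarrow>
     \<rho> \<in> borel_measurable borel \<and> (\<forall>x. 0 \<le> \<rho> x) \<and> sets \<nu> = sets borel \<and>
     (\<exists>A\<in>sets borel. emeasure m A = 0 \<and> emeasure \<nu> (- A) = 0) \<and>
     (\<forall>A\<in>sets borel. emeasure \<mu> A = (\<integral>\<^sup>+x\<in>A. ennreal (\<rho> x) \<partial>m) + emeasure \<nu> A)"

definition ac_density :: "'a::topological_space measure \<Rightarrow> 'a measure \<Rightarrow> 'a \<Rightarrow> real" where
  "ac_density m \<mu> = (SOME \<rho>. \<exists>\<nu>. lebesgue_decomposition m \<mu> \<rho> \<nu>)"

definition singular_part :: "'a::topological_space measure \<Rightarrow> 'a measure \<Rightarrow> 'a measure" where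
  "singular_part m \<mu> = (SOME \<nu>. \<exists>\<rho>. lebesgue_decomposition m \<mu> \<rho> \<nu>)"

text \<open>
  \<open>\<kappa>\<close> disintegrates \<open>\<sigma>\<close> with respect to its first marginal \<open>\<mu>\<close>, i.e.
  \<open>d\<sigma>(x,y) = d\<kappa>(x)(y) d\<mu>(x)\<close>.
\<close>

definition disintegrates ::
  "('a::topological_space \<times> 'a) measure \<Rightarrow> 'a measure \<Rightarrow> ('a \<Rightarrow> 'a measure) \<Rightarrow> bool" where
  "disintegrates \<sigma> \<mu> \<kappa> \<longleftrightarrow> \<kappa> \<in> borel \<rightarrow>\<^sub>M prob_algebra borel \<and>
     (\<forall>C\<in>sets borel. emeasure \<sigma> C = (\<integral>\<^sup>+x. emeasure (\<kappa> x) {y. (x, y) \<in> C} \<partial>\<mu>))"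


section \<open>The functionals and the curvature-dimension condition\<close>

definition DC :: "real \<Rightarrow> (real \<Rightarrow> real) set" where
  "DC N = {F. continuous_on {0..} F \<and> convex_on {0..} F \<and> F 0 = 0 \<and>
             convex_on {0<..} (\<lambda>l. l powr N * F (l powr (- N)))}"

definition slope_at_infinity :: "(real \<Rightarrow> real) \<Rightarrow> ereal" where
  "slope_at_infinity F = Lim at_top (\<lambda>r::real. ereal (F r / r))"

text \<open>
  The integrands \<open>F(\<rho>)\<close> may change sign and neither their positive nor their negative part need
  be integrable. So an integral is recorded as the two-element list of its positive part and
  its negated negative part, and a sum of such terms has a well-defined value in
  \<open>[-\<infinity>,\<infinity>]\<close> unless both infinite values occur among the summands. Here \<open>I\<close> is the
  integration of nonnegative functions, either over a measure or iterated.
  Note that \<open>0 * \<infinity> = 0\<close> in type \<open>ereal\<close>.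
\<close>

definition signed_integral_terms ::
  "(('b \<Rightarrow> ennreal) \<Rightarrow> ennreal) \<Rightarrow> ('b \<Rightarrow> real) \<Rightarrow> ereal list" where
  "signed_integral_terms I f =
     [enn2ereal (I (\<lambda>x. ennreal (f x))), - enn2ereal (I (\<lambda>x. ennreal (- f x)))]"

definition defined_sum :: "ereal list \<Rightarrow> bool" where
  "defined_sum ts \<longleftrightarrow> \<not> (\<infinity> \<in> set ts \<and> - \<infinity> \<in> set ts)"

text \<open>The functional \<open>\<F>(\<mu>)\<close> is the sum of these terms.\<close>

definition energy_terms ::
  "'a::topological_space measure \<Rightarrow> (real \<Rightarrow> real) \<Rightarrow> 'a measure \<Rightarrow> ereal list" where
  "energy_terms m F \<mu> =
     signed_integral_terms (nn_integral m) (\<lambda>x. F (ac_density m \<mu> x)) @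
     [slope_at_infinity F * ereal (measure (singular_part m \<mu>) UNIV)]"

text \<open>The distortion coefficient as a function of \<open>t\<close> and the distance \<open>\<delta> = d(x,y)\<close>.\<close>

definition distortion :: "real \<Rightarrow> real \<Rightarrow> real \<Rightarrow> real \<Rightarrow> real" where
  "distortion K N t \<delta> =
     (let \<alpha> = sqrt (\<bar>K\<bar> / (N - 1)) * \<delta>
      in if K = 0 \<or> N = 1 \<or> \<alpha> = 0 then 1
         else if t = 0 then (\<alpha> / sinh \<alpha>) powr (N - 1)
         else (sinh (t * \<alpha>) / (t * sinh \<alpha>)) powr (N - 1))"

text \<open>
  The terms of the double integral
  \<open>\<integral>\<integral> \<beta>\<^sub>t(x,y) F(\<rho>(x) / \<beta>\<^sub>t(x,y)) d\<kappa>(x)(y) dm(x)\<close>. The kernel \<open>\<kappa>\<close> is determined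
  only almost everywhere with respect to \<open>\<mu>\<close>, which suffices since the integrand vanishes
  where \<open>\<rho> = 0\<close>.
\<close>

definition distorted_terms ::
  "real \<Rightarrow> real \<Rightarrow> 'a::metric_space measure \<Rightarrow> (real \<Rightarrow> real) \<Rightarrow> real \<Rightarrow>
     ('a \<Rightarrow> real) \<Rightarrow> ('a \<Rightarrow> 'a measure) \<Rightarrow> ereal list" where
  "distorted_terms K N m F t \<rho> \<kappa> =
     signed_integral_terms (\<lambda>h. \<integral>\<^sup>+x. (\<integral>\<^sup>+y. h (x, y) \<partial>\<kappa> x) \<partial>m)
       (\<lambda>(x, y). distortion K N t (dist x y) * F (\<rho> x / distortion K N t (dist x y)))"

text \<open>
  The right-hand side of the convexity inequality; \<open>\<kappa>\<^sub>0 x\<^sub>0\<close> stands for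
  \<open>\<sigma>(\<cdot>|x\<^sub>0)\<close> and \<open>\<kappa>\<^sub>1 x\<^sub>1\<close> for \<open>\<sigma>(\<cdot>|x\<^sub>1)\<close>. In the second integral the
  roles of the variables are exchanged, which is harmless as \<open>\<beta>\<^sub>t\<close> is symmetric.
\<close>

definition cd_bound_terms ::
  "real \<Rightarrow> real \<Rightarrow> 'a::metric_space measure \<Rightarrow> (real \<Rightarrow> real) \<Rightarrow> real \<Rightarrow> 'a measure \<Rightarrow>
     'a measure \<Rightarrow> ('a \<Rightarrow> 'a measure) \<Rightarrow> ('a \<Rightarrow> 'a measure) \<Rightarrow> ereal list" where
  "cd_bound_terms K N m F t \<mu>\<^sub>0 \<mu>\<^sub>1 \<kappa>\<^sub>0 \<kappa>\<^sub>1 =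
     map ((*) (ereal (1 - t))) (distorted_terms K N m F (1 - t) (ac_density m \<mu>\<^sub>0) \<kappa>\<^sub>0) @
     map ((*) (ereal t)) (distorted_terms K N m F t (ac_density m \<mu>\<^sub>1) \<kappa>\<^sub>1) @
     [slope_at_infinity F *
        ereal ((1 - t) * measure (singular_part m \<mu>\<^sub>0) UNIV +
               t * measure (singular_part m \<mu>\<^sub>1) UNIV)]"

text \<open>
  The inequality is imposed for those \<open>F\<close> and \<open>t\<close> for which both sides have a well-defined
  value. On the (complete separable) spaces considered here disintegrations exist and are unique
  up to null sets that do not affect the inequality, so it does not matter which ones are used.
\<close>

definition CD_space :: "'a::complete_space measure \<Rightarrow> real \<Rightarrow> real \<Rightarrow> bool" where
  "CD_space m K N \<longleftrightarrow>
     (\<forall>\<mu>\<^sub>0\<in>borel_probs. \<forall>\<mu>\<^sub>1\<in>borel_probs. W2 \<mu>\<^sub>0 \<mu>\<^sub>1 < \<infinity> \<longrightarrow>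
        (\<exists>\<pi>\<in>GeoOpt \<mu>\<^sub>0 \<mu>\<^sub>1. \<exists>\<kappa>\<^sub>0 \<kappa>\<^sub>1.
           disintegrates (endpoint_push \<pi>) \<mu>\<^sub>0 \<kappa>\<^sub>0 \<and>
           disintegrates (distr (endpoint_push \<pi>) borel prod.swap) \<mu>\<^sub>1 \<kappa>\<^sub>1 \<and>
           (\<forall>F\<in>DC N. \<forall>t\<in>{0..1}.
              defined_sum (energy_terms m F (eval_push t \<pi>)) \<and>
              defined_sum (cd_bound_terms K N m F t \<mu>\<^sub>0 \<mu>\<^sub>1 \<kappa>\<^sub>0 \<kappa>\<^sub>1) \<longrightarrow>
              sum_list (energy_terms m F (eval_push t \<pi>))
                \<le> sum_list (cd_bound_terms K N m F t \<mu>\<^sub>0 \<mu>\<^sub>1 \<kappa>\<^sub>0 \<kappa>\<^sub>1))))"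

end

theory Submission
  imports Defs "HOL-Library.Diagonal_Subsequence"
begin

text \<open>Let \<open>B\<close> be the ball of radius \<open>r\<close>, let \<open>a = curv * r\<close> with \<open>curv = sqrt (\<bar>K\<bar> / (N - 1))\<close>, and \<open>n = N - 1\<close>.
  By the coarea idea it suffices to separate level sets: if \<open>v\<close> is a truncation of \<open>u\<close> that equals \<open>1\<close> on \<open>E\<close>
  and \<open>0\<close> on \<open>F\<close>, with \<open>E\<close>, \<open>F\<close> disjoint subsets of \<open>B\<close>, and \<open>h\<close> is the corresponding piece of
  the upper gradient, then
  \<open>m(E) m(F) \<le> 2 r m(B) (e\<^bsup>2a\<^esup> / cosh a)\<^bsup>n\<^esup> \<integral>\<^bsub>B(x,2r)\<^esub> h dm\<close> (\<open>level_sets_separated\<close>).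
  Integrating this over all levels (Fubini) bounds \<open>\<integral>\<integral> \<bar>u(y) - u(z)\<bar>\<close> over \<open>B \<times> B\<close> by twice the right
  side with \<open>h\<close> replaced by \<open>g\<close> (\<open>pair_energy\<close>), and \<open>m(B(x,2r)) \<le> 2\<^bsup>N\<^esup> cosh(a)\<^bsup>n\<^esup> m(B)\<close> turns
  the constant into \<open>2\<^bsup>N+2\<^esup> r e\<^bsup>2na\<^esup>\<close>: the factor \<open>cosh(a)\<^bsup>n\<^esup>\<close> cancels.

  The separation estimate compares \<open>v\<close> on the two sets along a family of geodesics that does not
  concentrate. The condition \<open>CD(K,N)\<close> is used with two kinds of test data. With the uniform measure on a set
  and a Dirac mass it gives a Brunn-Minkowski inequality for the contraction of a set towards a point
  (\<open>brunn_minkowski_point\<close>). With two measures of bounded density, and the integrand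
  \<open>max 0 (k s - s\<^bsup>1-1/N\<^esup>)\<close>, which vanishes exactly up to a threshold, it gives an optimal
  plan whose intermediate measures have bounded density (\<open>bounded_density_plan\<close>).

  Transporting \<open>E\<close> directly to \<open>F\<close> is good enough for \<open>a \<le> 1\<close>. For large \<open>a\<close> the density of such a transport
  may grow like \<open>e\<^bsup>2na\<^esup>\<close>, because geodesics of length \<open>2r\<close> can first spread out and then focus. So the two sets are
  first contracted towards the centre of \<open>B\<close>, to balls of radii \<open>t\<^sub>0 r\<close> and \<open>t\<^sub>1 r\<close>, and the transport only
  joins the contracted measures. As geodesics may branch, there is no map that realizes the contraction.
  Instead, one works with the value function \<open>stop_cost\<close> of the problem "move radially inwards, pay the
  integral of the gradient, stop anywhere at cost \<open>v\<close>": its superlevel sets can be contracted in many small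
  steps by the Brunn-Minkowski inequality (\<open>contraction\<close>), and a bathtub argument converts the result into a measure of
  bounded density on the small ball (\<open>contracted_measure\<close>). The parameters \<open>t\<^sub>0\<close>, \<open>t\<^sub>1\<close> are chosen according to \<open>n\<close>,
  \<open>a\<close> and the ratio of \<open>m(E)\<close> and \<open>m(F)\<close>; what remains are elementary inequalities.\<close>

section \<open>Distortion coefficients\<close>

text \<open>The base of the distortion coefficient, with the limit \<open>1\<close> at \<open>\<alpha> = 0\<close>, so that \<open>distortion\<close> becomes its power
  with exponent \<open>N - 1\<close> without case distinctions.\<close>

definition sinh_ratio :: "real \<Rightarrow> real \<Rightarrow> real" where
  "sinh_ratio t \<alpha> = (if \<alpha> = 0 then 1 else sinh (t * \<alpha>) / (t * sinh \<alpha>))"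

lemma distortion_eq_sinh_ratio:
  assumes "0 < t" "1 \<le> N" "0 \<le> \<delta>"
  shows "distortion K N t \<delta> = sinh_ratio t (sqrt (\<bar>K\<bar> / (N - 1)) * \<delta>) powr (N - 1)"
proof -
  have "sinh_ratio t \<alpha> > 0" if "\<alpha> \<ge> 0" for \<alpha>
    using assms that by (auto simp: sinh_ratio_def)
  moreover have "sqrt (\<bar>K\<bar> / (N - 1)) * \<delta> \<ge> 0" using assms by simp
  ultimately have "sinh_ratio t (sqrt (\<bar>K\<bar> / (N - 1)) * \<delta>) \<noteq> 0" by (metis less_irrefl)
  then show ?thesis
    using assms by (auto simp: distortion_def sinh_ratio_def Let_def)
qed

lemma sinh_ratio_pos: "0 < t \<Longrightarrow> 0 \<le> \<alpha> \<Longrightarrow> 0 < sinh_ratio t \<alpha>"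
  by (auto simp: sinh_ratio_def)

lemma sinh_ratio_half: "0 \<le> \<alpha> \<Longrightarrow> sinh_ratio (1/2) \<alpha> = 1 / cosh (\<alpha> / 2)"
proof -
  assume "0 \<le> \<alpha>"
  have "sinh \<alpha> = 2 * sinh (\<alpha>/2) * cosh (\<alpha>/2)" using sinh_double[of "\<alpha>/2"] by simp
  moreover have "\<alpha> \<noteq> 0 \<Longrightarrow> sinh (\<alpha>/2) \<noteq> 0" by simp
  ultimately show ?thesis by (auto simp: sinh_ratio_def)
qed

lemma DERIV_pos_imp_ge_0:
  fixes g :: "real \<Rightarrow> real"
  assumes "\<And>x. 0 \<le> x \<Longrightarrow> (g has_real_derivative g' x) (at x)" "\<And>x. 0 \<le> x \<Longrightarrow> 0 \<le> g' x" "0 \<le> g 0" "0 \<le> x"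
  shows "0 \<le> g x"
proof -
  have "g 0 \<le> g x"
    by (rule DERIV_nonneg_imp_nondecreasing[OF assms(4)]) (use assms in blast)
  then show ?thesis using assms by simp
qed

lemma sinh_ge_self: assumes "0 \<le> x" shows "x \<le> sinh (x::real)"
proof -
  have "0 \<le> sinh x - x"
    by (rule DERIV_pos_imp_ge_0[of "\<lambda>x. sinh x - x" "\<lambda>x. cosh x - 1"])
       (use assms in \<open>auto intro!: derivative_eq_intros cosh_real_ge_1\<close>)
  then show ?thesis by simp
qed

lemma sinh_scaled_le:
  assumes "0 \<le> t" "t \<le> 1" "0 \<le> x" shows "sinh (t * x) \<le> t * sinh (x::real)"
proof -
  have "0 \<le> t * sinh x - sinh (t * x)"
  proof (rule DERIV_pos_imp_ge_0[of "\<lambda>x. t * sinh x - sinh (t * x)" "\<lambda>x. t * (cosh x - cosh (t * x))"])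
    show "0 \<le> t * (cosh x - cosh (t * x))" if "0 \<le> x" for x
      using assms that by (intro mult_nonneg_nonneg) (auto simp: cosh_real_nonneg_le_iff mult_left_le_one_le)
  qed (use assms in \<open>auto intro!: derivative_eq_intros simp: algebra_simps\<close>)
  then show ?thesis by simp
qed

text \<open>\<open>tanh (t x) \<ge> t tanh x\<close> by concavity of \<open>tanh\<close>; this is the sign of the derivative in the next lemma.\<close>

lemma sinh_cross_le:
  assumes "0 \<le> t" "t \<le> 1" "0 \<le> (x::real)"
  shows "t * cosh (t * x) * sinh x \<le> sinh (t * x) * cosh x"
proof -
  have "0 \<le> sinh (t * x) * cosh x - t * cosh (t * x) * sinh x"
  proof (rule DERIV_pos_imp_ge_0[of "\<lambda>x. sinh (t * x) * cosh x - t * cosh (t * x) * sinh x" "\<lambda>x. (1 - t^2) * (sinh (t * x) * sinh x)"])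
    show "((\<lambda>x. sinh (t * x) * cosh x - t * cosh (t * x) * sinh x) has_real_derivative
        (1 - t^2) * (sinh (t * x) * sinh x)) (at x)" for x
      by (auto intro!: derivative_eq_intros simp: algebra_simps power2_eq_square)
    show "0 \<le> (1 - t^2) * (sinh (t * x) * sinh x)" if "0 \<le> x" for x
      using assms that by (auto intro!: mult_nonneg_nonneg simp: power_le_one)
  qed (use assms in auto)
  then show ?thesis by simp
qed

lemma sinh_ratio_antimono:
  assumes t: "0 < t" "t \<le> 1" and xy: "0 \<le> x" "x \<le> y"
  shows "sinh_ratio t y \<le> sinh_ratio t x"
proof (cases "x = 0")
  case True
  then show ?thesis using t xy sinh_scaled_le[of t y] by (auto simp: sinh_ratio_def)
next
  case False
  then have x: "0 < x" using xy by simp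
  have "(\<lambda>z. sinh (t*z) / sinh z) y \<le> (\<lambda>z. sinh (t*z) / sinh z) x"
  proof (rule DERIV_nonpos_imp_nonincreasing[OF xy(2)])
    fix z assume z: "x \<le> z" "z \<le> y"
    then have "0 < z" using x by simp
    have "((\<lambda>z. sinh (t*z) / sinh z) has_real_derivative
        (t * cosh (t*z) * sinh z - sinh (t*z) * cosh z) / (sinh z * sinh z)) (at z)"
      using \<open>0 < z\<close> by (auto intro!: derivative_eq_intros simp: algebra_simps)
    moreover have "(t * cosh (t*z) * sinh z - sinh (t*z) * cosh z) / (sinh z * sinh z) \<le> 0"
      using sinh_cross_le[of t z] t \<open>0 < z\<close> by (auto intro!: divide_nonpos_nonneg)
    ultimately show "\<exists>D. ((\<lambda>z. sinh (t*z) / sinh z) has_real_derivative D) (at z) \<and> D \<le> 0" by blast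
  qed
  then have "(sinh (t*y) / sinh y) / t \<le> (sinh (t*x) / sinh x) / t" using t by (intro divide_right_mono) auto
  then show ?thesis using x xy by (simp add: sinh_ratio_def mult.commute)
qed

text \<open>The exponential bound is what makes the loss of a contraction by a factor close to \<open>1\<close> proportional to
  the displacement, uniformly in the distance.\<close>

lemma sinh_ratio_ge_exp:
  assumes t: "0 < t" "t \<le> 1" and x: "0 \<le> x"
  shows "exp (- ((1 - t) * x)) \<le> sinh_ratio t x"
proof (cases "x = 0")
  case True then show ?thesis using t by (simp add: sinh_ratio_def)
next
  case False
  then have "0 < x" using x by simp
  have "0 \<le> (1 - exp (-2*t*x)) - t * (1 - exp (-2*x))"
    by (rule DERIV_pos_imp_ge_0[of "\<lambda>x. (1 - exp (-2*t*x)) - t * (1 - exp (-2*x))" "\<lambda>x. 2*t*(exp (-2*t*x) - exp (-2*x))"])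
       (use t x in \<open>auto intro!: derivative_eq_intros simp: algebra_simps mult_left_le\<close>)
  then have le: "t * (1 - exp (-2*x)) \<le> 1 - exp (-2*t*x)" by simp
  have e1: "sinh x = exp x * (1 - exp (-2*x)) / 2" and e2: "sinh (t*x) = exp (t*x) * (1 - exp (-2*t*x)) / 2"
    by (simp_all add: sinh_field_def algebra_simps flip: exp_add)
  have "exp (- ((1 - t) * x)) * (t * sinh x) = exp (t*x) * (t * (1 - exp (-2*x))) / 2"
    by (simp add: e1 algebra_simps flip: exp_add)
  also have "\<dots> \<le> exp (t*x) * (1 - exp (-2*t*x)) / 2"
    by (intro divide_right_mono mult_left_mono le) auto
  also have "\<dots> = sinh (t*x)" by (simp add: e2)
  finally show ?thesis using False t \<open>0 < x\<close> by (simp add: sinh_ratio_def pos_le_divide_eq)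
qed

lemma sinh_ratio_ge_inverse:
  assumes t: "0 < t" "t \<le> 1" and x: "0 < x"
  shows "x / sinh x \<le> sinh_ratio t x"
proof -
  have "x / sinh x = (t * x) / (t * sinh x)" using t by simp
  also have "\<dots> \<le> sinh (t * x) / (t * sinh x)"
    by (intro divide_right_mono sinh_ge_self) (use t x in auto)
  finally show ?thesis using x by (simp add: sinh_ratio_def)
qed

section \<open>Integrands that measure the excess over a threshold\<close>

text \<open>Both terms \<open>k s\<close> and \<open>- s\<^bsup>1-1/N\<^esup>\<close> are admissible, and so is the maximum. For \<open>k = C\<^bsup>-1/N\<^esup>\<close> the
  function vanishes exactly for densities \<open>s \<le> C\<close>, so a vanishing energy is a density bound. The linear term also makes the
  integrals bounded below, so that the convexity inequality has well-defined sides.\<close>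

definition excess_fun :: "real \<Rightarrow> real \<Rightarrow> real \<Rightarrow> real" where
  "excess_fun N k s = max 0 (k * s - s powr (1 - 1/N))"

lemma excess_fun_nonneg: "0 \<le> excess_fun N k s" by (simp add: excess_fun_def)

lemma excess_fun_0 [simp]: "excess_fun N k 0 = 0" by (simp add: excess_fun_def)

lemma excess_fun_le: "0 \<le> s \<Longrightarrow> 0 \<le> k \<Longrightarrow> excess_fun N k s \<le> k * s"
  by (simp add: excess_fun_def)

lemma powr_frac_eq:
  assumes "(N::real) \<ge> 1" "s > 0" shows "s powr (1 - 1/N) = s * s powr (- (1/N))"
proof -
  have "s powr (1 - 1/N) = s powr 1 * s powr (- (1/N))" by (subst powr_add[symmetric]) simp
  then show ?thesis using assms by simp
qed

lemma excess_fun_pos_eq: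
  assumes "N \<ge> 1" "s > 0" shows "excess_fun N k s = s * max 0 (k - s powr (- (1/N)))"
proof -
  have "k * s - s powr (1 - 1/N) = s * (k - s powr (- (1/N)))"
    using powr_frac_eq[OF assms] by (simp add: algebra_simps)
  then show ?thesis using assms by (simp add: excess_fun_def max_mult_distrib_left)
qed

lemma excess_fun_eq_0_iff:
  assumes "N \<ge> 1" "s \<ge> 0" "C > 0"
  shows "excess_fun N (C powr (- (1/N))) s = 0 \<longleftrightarrow> s \<le> C"
proof (cases "s = 0")
  case False
  then have s: "s > 0" using assms by simp
  have "C powr (- (1/N)) \<le> s powr (- (1/N)) \<longleftrightarrow> s \<le> C"
    using assms s by (metis divide_pos_pos less_le_trans neg_less_0_iff_less not_less powr_less_mono2_neg powr_mono2' zero_less_one less_imp_le)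
  then show ?thesis using s assms by (auto simp: excess_fun_pos_eq max_def)
qed (use assms in auto)

lemma excess_fun_DC:
  assumes N: "N \<ge> 1" and k: "k > 0"
  shows "excess_fun N k \<in> DC N"
proof -
  define s0 where "s0 = k powr (- N)"
  have s0: "s0 > 0" using k by (simp add: s0_def)
  have s0k: "s0 powr (- (1/N)) = k" using N k by (simp add: s0_def powr_powr)
  have zero: "excess_fun N k s = 0" if "0 \<le> s" "s \<le> s0" for s
    using excess_fun_eq_0_iff[OF N that(1) s0] that s0k by simp
  have cont_pos: "continuous_on {0<..} (excess_fun N k)"
    unfolding excess_fun_def by (intro continuous_intros) auto
  have cont: "continuous_on {0..} (excess_fun N k)"
  proof -
    have "continuous_on ({0..s0} \<union> {s0..}) (excess_fun N k)"
    proof (rule continuous_on_closed_Un)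
      show "continuous_on {0..s0} (excess_fun N k)"
        using zero by (subst continuous_on_cong[OF refl, where g="\<lambda>_. 0"]) auto
      show "continuous_on {s0..} (excess_fun N k)"
        by (rule continuous_on_subset[OF cont_pos]) (use s0 in auto)
    qed auto
    then show ?thesis by (rule continuous_on_subset) auto
  qed
  have q: "0 \<le> 1 - 1/N" "1 - 1/N \<le> 1" using N by auto
  have conv_neg: "convex_on {0<..} (\<lambda>s. - (s powr (1 - 1/N)))"
  proof (rule f''_ge0_imp_convex)
    fix x :: real assume x: "x \<in> {0<..}"
    show "((\<lambda>s. - (s powr (1 - 1/N))) has_real_derivative - ((1 - 1/N) * x powr (1 - 1/N - 1))) (at x)"
      using x by (auto intro!: derivative_eq_intros)
    show "((\<lambda>s. - ((1 - 1/N) * s powr (1 - 1/N - 1))) has_real_derivative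
        - ((1 - 1/N) * ((1 - 1/N - 1) * x powr (1 - 1/N - 1 - 1)))) (at x)"
      using x by (auto intro!: derivative_eq_intros)
    show "0 \<le> - ((1 - 1/N) * ((1 - 1/N - 1) * x powr (1 - 1/N - 1 - 1)))"
      using q by (simp add: mult_nonneg_nonpos mult_nonpos_nonneg)
  qed simp
  have conv_lin: "convex_on {0<..} (\<lambda>s. k * s + - (s powr (1 - 1/N)))"
    by (intro convex_on_add conv_neg) (auto intro!: convex_onI simp: algebra_simps)
  have conv_pos: "convex_on {0<..} (excess_fun N k)"
  proof (rule convex_onI)
    fix t x y :: real assume t: "0 < t" "t < 1" and xy: "x \<in> {0<..}" "y \<in> {0<..}"
    let ?G = "\<lambda>s. k * s + - (s powr (1 - 1/N))"
    have "?G ((1 - t) *\<^sub>R x + t *\<^sub>R y) \<le> (1 - t) * ?G x + t * ?G y"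
      using convex_onD[OF conv_lin, of t x y] t xy by simp
    also have "\<dots> \<le> (1 - t) * excess_fun N k x + t * excess_fun N k y"
      using t by (intro add_mono mult_left_mono) (auto simp: excess_fun_def)
    finally show "excess_fun N k ((1 - t) *\<^sub>R x + t *\<^sub>R y) \<le> (1 - t) * excess_fun N k x + t * excess_fun N k y"
      using t excess_fun_nonneg[of N k x] excess_fun_nonneg[of N k y] by (subst excess_fun_def) auto
  qed simp
  have ray: "excess_fun N k (t * y) \<le> t * excess_fun N k y" if "0 < t" "t < 1" "0 \<le> y" for t y
  proof (cases "y = 0")
    case False
    have "t powr 1 \<le> t powr (1 - 1/N)" using that q by (intro powr_mono') auto
    then have "t * y powr (1 - 1/N) \<le> (t * y) powr (1 - 1/N)"
      using that by (simp add: powr_mult mult_right_mono)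
    then have "k * (t * y) - (t * y) powr (1 - 1/N) \<le> t * (k * y - y powr (1 - 1/N))"
      by (simp add: algebra_simps)
    also have "\<dots> \<le> t * excess_fun N k y"
      using that by (intro mult_left_mono) (auto simp: excess_fun_def)
    finally show ?thesis using that excess_fun_nonneg[of N k y] by (subst excess_fun_def) auto
  qed simp
  have conv: "convex_on {0..} (excess_fun N k)"
  proof (rule convex_onI)
    fix t x y :: real assume t: "0 < t" "t < 1" and xy: "x \<in> {0..}" "y \<in> {0..}"
    show "excess_fun N k ((1 - t) *\<^sub>R x + t *\<^sub>R y) \<le> (1 - t) * excess_fun N k x + t * excess_fun N k y"
    proof (cases "x = 0 \<or> y = 0")
      case True
      then show ?thesis using ray[of t y] ray[of "1 - t" x] t xy by auto
    next
      case False
      then show ?thesis using convex_onD[OF conv_pos, of t x y] t xy by auto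
    qed
  qed simp
  have dil: "l powr N * excess_fun N k (l powr (- N)) = max 0 (k - l)" if "l > 0" for l
  proof -
    have "(l powr (- N)) powr (- (1/N)) = l" using that N by (simp add: powr_powr)
    then have "excess_fun N k (l powr (- N)) = l powr (- N) * max 0 (k - l)"
      using excess_fun_pos_eq[OF N, of "l powr (- N)" k] that by simp
    then show ?thesis using that by (simp add: powr_minus)
  qed
  have "convex_on {0<..} (\<lambda>l. max 0 (k - l))"
  proof (rule convex_onI)
    fix t x y :: real assume t: "0 < t" "t < 1"
    have "k - ((1 - t) * x + t * y) = (1 - t) * (k - x) + t * (k - y)" by (simp add: algebra_simps)
    also have "\<dots> \<le> (1 - t) * max 0 (k - x) + t * max 0 (k - y)"
      using t by (intro add_mono mult_left_mono) auto
    finally show "max 0 (k - ((1 - t) *\<^sub>R x + t *\<^sub>R y)) \<le> (1 - t) * max 0 (k - x) + t * max 0 (k - y)"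
      using t by auto
  qed simp
  then have "convex_on {0<..} (\<lambda>l. l powr N * excess_fun N k (l powr (- N)))"
    unfolding convex_on_def
  proof (intro conjI ballI allI impI)
    fix x y u v :: real
    assume h: "convex {0::real<..} \<and> (\<forall>x\<in>{0<..}. \<forall>y\<in>{0<..}. \<forall>u\<ge>0. \<forall>v\<ge>0. u + v = 1 \<longrightarrow>
         max 0 (k - (u *\<^sub>R x + v *\<^sub>R y)) \<le> u * max 0 (k - x) + v * max 0 (k - y))"
      and xy: "x \<in> {0<..}" "y \<in> {0<..}" and uv: "0 \<le> u" "0 \<le> v" "u + v = 1"
    have "u *\<^sub>R x + v *\<^sub>R y \<in> {0<..}" using h xy uv unfolding convex_def by blast
    then show "(u *\<^sub>R x + v *\<^sub>R y) powr N * excess_fun N k ((u *\<^sub>R x + v *\<^sub>R y) powr - N)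
        \<le> u * (x powr N * excess_fun N k (x powr - N)) + v * (y powr N * excess_fun N k (y powr - N))"
      using h xy uv by (simp only: dil greaterThan_iff)
  qed auto
  then show ?thesis using cont conv by (simp add: DC_def)
qed

lemma slope_excess_fun:
  assumes N: "N \<ge> 1" and k: "k > 0"
  shows "slope_at_infinity (excess_fun N k) = ereal k"
proof -
  have "((\<lambda>s. s powr (- (1/N))) \<longlongrightarrow> 0) at_top"
    using N by (intro tendsto_neg_powr filterlim_ident) auto
  then have "((\<lambda>s. max 0 (k - s powr (- (1/N)))) \<longlongrightarrow> max 0 (k - 0)) at_top"
    by (intro tendsto_intros)
  then have "((\<lambda>s. max 0 (k - s powr (- (1/N)))) \<longlongrightarrow> k) at_top" using k by simp
  moreover have "\<forall>\<^sub>F s in at_top. max 0 (k - s powr (- (1/N))) = excess_fun N k s / s"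
    using eventually_gt_at_top[of 0] by eventually_elim (simp add: excess_fun_pos_eq[OF N])
  ultimately have "((\<lambda>s. excess_fun N k s / s) \<longlongrightarrow> k) at_top"
    by (rule Lim_transform_eventually)
  then have "((\<lambda>s. ereal (excess_fun N k s / s)) \<longlongrightarrow> ereal k) at_top" by simp
  then show ?thesis unfolding slope_at_infinity_def by (intro tendsto_Lim) auto
qed

section \<open>Lebesgue decompositions\<close>

lemma lebesgue_decomposition_exists:
  fixes m \<mu> :: "'a::topological_space measure"
  assumes m: "sigma_finite_measure m" "sets m = sets borel" and \<mu>: "finite_measure \<mu>" "sets \<mu> = sets borel"
  shows "\<exists>\<rho> \<nu>. lebesgue_decomposition m \<mu> \<rho> \<nu>"
proof -
  interpret m: sigma_finite_measure m by fact
  interpret \<mu>: finite_measure \<mu> by fact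
  define s where "s = (SUP A\<in>null_sets m. measure \<mu> A)"
  have bdd: "bdd_above (measure \<mu> ` null_sets m)"
    by (auto intro!: bdd_aboveI[of _ "measure \<mu> (space \<mu>)"] \<mu>.bounded_measure)
  have ne: "null_sets m \<noteq> {}" by auto
  have "\<exists>A\<in>null_sets m. s - 1 / Suc n < measure \<mu> A" for n
    using less_cSUP_iff[OF ne bdd, of "s - 1 / Suc n"] by (simp add: s_def)
  then obtain A where A: "\<And>n. A n \<in> null_sets m" "\<And>n. s - 1 / Suc n < measure \<mu> (A n)" by metis
  define B where "B = (\<Union>n. A n)"
  have B: "B \<in> null_sets m" unfolding B_def using A(1) by auto
  have Bs: "B \<in> sets \<mu>" using B m \<mu> by auto
  have "s \<le> measure \<mu> B"
  proof (rule field_le_epsilon)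
    fix e :: real assume "0 < e"
    then obtain n where "1 / Suc n < e" using nat_approx_posE by blast
    moreover have "measure \<mu> (A n) \<le> measure \<mu> B"
      using Bs by (intro \<mu>.finite_measure_mono) (auto simp: B_def)
    ultimately show "s \<le> measure \<mu> B + e" using A(2)[of n] by linarith
  qed
  have null: "emeasure \<mu> (C - B) = 0" if C: "C \<in> null_sets m" for C
  proof -
    have Cs: "C \<in> sets \<mu>" using C m \<mu> by auto
    have "measure \<mu> (B \<union> C) \<le> s" unfolding s_def using B C bdd by (intro cSUP_upper) auto
    moreover have "measure \<mu> (B \<union> C) = measure \<mu> B + measure \<mu> (C - B)"
      using Bs Cs by (simp add: \<mu>.finite_measure_Union' Un_commute)
    ultimately have "measure \<mu> (C - B) \<le> 0" using \<open>s \<le> measure \<mu> B\<close> by simp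
    then have "measure \<mu> (C - B) = 0" using measure_nonneg[of \<mu> "C - B"] by linarith
    then show ?thesis by (simp add: \<mu>.emeasure_eq_measure)
  qed
  define \<mu>' where "\<mu>' = density \<mu> (indicator (- B))"
  have Bc: "- B \<in> sets \<mu>" using Bs \<mu> by auto
  have em: "emeasure \<mu>' C = emeasure \<mu> (C - B)" if "C \<in> sets borel" for C
  proof -
    have "emeasure \<mu>' C = (\<integral>\<^sup>+x. indicator (C - B) x \<partial>\<mu>)"
      using that Bc \<mu> unfolding \<mu>'_def
      by (subst emeasure_density) (auto intro!: nn_integral_cong simp: indicator_def)
    also have "\<dots> = emeasure \<mu> (C - B)" using that Bs \<mu> by (intro nn_integral_indicator) auto
    finally show ?thesis .
  qed
  have "absolutely_continuous m \<mu>'"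
    unfolding absolutely_continuous_def
    using em null m \<mu> by (auto simp: null_sets_def \<mu>'_def)
  then obtain f where f: "f \<in> borel_measurable m" "density m f = \<mu>'"
    using m.Radon_Nikodym[of \<mu>'] m \<mu> by (auto simp: \<mu>'_def)
  have "(\<integral>\<^sup>+x. f x \<partial>m) = emeasure \<mu>' (space m)"
    using f by (simp flip: f(2) add: emeasure_density nn_integral_set_ennreal indicator_def cong: nn_integral_cong)
  also have "\<dots> \<le> emeasure \<mu> (space \<mu>)"
  proof -
    have "space m = UNIV" using sets_eq_imp_space_eq[OF m(2)] by simp
    then show ?thesis using em[of UNIV] by (simp add: emeasure_space)
  qed
  finally have "(\<integral>\<^sup>+x. f x \<partial>m) \<noteq> \<infinity>" using \<mu>.finite_emeasure_space by (auto simp: top_unique)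
  then have fin: "AE x in m. f x \<noteq> \<infinity>" using f(1) by (rule nn_integral_PInf_AE[rotated])
  define \<rho> where "\<rho> x = enn2real (f x)" for x
  define \<nu> where "\<nu> = density \<mu> (indicator B)"
  have em\<nu>: "emeasure \<nu> C = emeasure \<mu> (C \<inter> B)" if "C \<in> sets borel" for C
  proof -
    have "emeasure \<nu> C = (\<integral>\<^sup>+x. indicator (C \<inter> B) x \<partial>\<mu>)"
      using that Bs \<mu> unfolding \<nu>_def
      by (subst emeasure_density) (auto intro!: nn_integral_cong simp: indicator_def simp del: nn_integral_indicator)
    also have "\<dots> = emeasure \<mu> (C \<inter> B)" using that Bs \<mu> by (subst nn_integral_indicator) auto
    finally show ?thesis .
  qed
  have fb: "f \<in> borel_measurable borel" using f(1) m(2) by (simp cong: measurable_cong_sets)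
  have "lebesgue_decomposition m \<mu> \<rho> \<nu>"
    unfolding lebesgue_decomposition_def
  proof (intro conjI ballI)
    show "\<rho> \<in> borel_measurable borel" unfolding \<rho>_def using fb by measurable
    show "\<forall>x. 0 \<le> \<rho> x" by (simp add: \<rho>_def)
    show "sets \<nu> = sets borel" using \<mu> by (simp add: \<nu>_def)
    show "\<exists>A\<in>sets borel. emeasure m A = 0 \<and> emeasure \<nu> (- A) = 0"
      using B Bs \<mu> m by (intro bexI[of _ B]) (auto simp: em\<nu> null_sets_def)
    fix C assume C: "C \<in> sets (borel :: 'a measure)"
    have "(\<integral>\<^sup>+x\<in>C. ennreal (\<rho> x) \<partial>m) = (\<integral>\<^sup>+x\<in>C. f x \<partial>m)"
      using fin by (intro nn_integral_cong_AE) (auto simp: \<rho>_def top.not_eq_extremum)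
    also have "\<dots> = emeasure \<mu>' C" using C f m by (simp flip: f(2) add: emeasure_density)
    also have "\<dots> = emeasure \<mu> (C - B)" using em C by simp
    finally show "emeasure \<mu> C = (\<integral>\<^sup>+x\<in>C. ennreal (\<rho> x) \<partial>m) + emeasure \<nu> C"
      using C Bs \<mu> em\<nu>[OF C] plus_emeasure[of "C - B" \<mu> "C \<inter> B"] by (simp add: Un_Diff_Int Diff_Int_distrib2)
  qed
  then show ?thesis by blast
qed

lemma powr_le_tangent:
  assumes "0 \<le> q" "q \<le> (1::real)" "0 \<le> s" "0 < c"
  shows "s powr q \<le> q * c powr (q - 1) * s + (1 - q) * c powr q"
proof (cases "s = 0")
  case False
  then have s: "s > 0" using assms by simp
  have "exp ((1 - q) * 0 + q * ln (s / c)) \<le> (1 - q) * exp 0 + q * exp (ln (s / c))"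
    using convex_onD[OF exp_convex, of q 0 "ln (s/c)"] assms by simp
  then have "(s / c) powr q \<le> (1 - q) + q * (s / c)" using s assms by (simp add: powr_def)
  then have "(s / c) powr q * c powr q \<le> ((1 - q) + q * (s / c)) * c powr q"
    by (intro mult_right_mono) auto
  then show ?thesis using s assms by (simp add: powr_divide powr_diff algebra_simps)
qed (use assms in auto)

text \<open>The functions \<open>ac_density\<close> and \<open>singular_part\<close> are chosen by two separate epsilon operators.
  Uniqueness of the decomposition shows that the two choices belong together.\<close>

lemma lebesgue_decomposition_choice:
  assumes ex: "\<exists>\<rho> \<nu>. lebesgue_decomposition m \<mu> \<rho> \<nu>" and sm: "sets m = sets borel"
  obtains \<nu> where "lebesgue_decomposition m \<mu> (ac_density m \<mu>) \<nu>"
    "emeasure (singular_part m \<mu>) UNIV = emeasure \<nu> UNIV"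
proof -
  have 1: "\<exists>\<nu>. lebesgue_decomposition m \<mu> (ac_density m \<mu>) \<nu>"
    unfolding ac_density_def using ex by (rule someI_ex)
  have "\<exists>\<rho>. lebesgue_decomposition m \<mu> \<rho> (singular_part m \<mu>)"
    unfolding singular_part_def by (rule someI_ex) (use ex in blast)
  with 1 obtain \<nu> \<rho>' where ld: "lebesgue_decomposition m \<mu> (ac_density m \<mu>) \<nu>"
      "lebesgue_decomposition m \<mu> \<rho>' (singular_part m \<mu>)" by blast
  have sing: "emeasure \<nu>1 UNIV = emeasure \<mu> (A \<union> A')"
    if h: "lebesgue_decomposition m \<mu> \<rho>1 \<nu>1" and A: "A \<in> sets borel" "emeasure m A = 0" "emeasure \<nu>1 (- A) = 0"
      and A': "A' \<in> sets borel" "emeasure m A' = 0" and sm: "sets m = sets borel" for \<rho>1 \<nu>1 A A'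
  proof -
    have s: "sets \<nu>1 = sets borel" using h by (simp add: lebesgue_decomposition_def)
    have "emeasure m (A \<union> A') \<le> emeasure m A + emeasure m A'"
      using A A' sm by (intro emeasure_subadditive) auto
    then have n: "A \<union> A' \<in> null_sets m" using A A' sm by (auto simp: null_sets_def)
    have "emeasure \<mu> (A \<union> A') = (\<integral>\<^sup>+x\<in>A \<union> A'. ennreal (\<rho>1 x) \<partial>m) + emeasure \<nu>1 (A \<union> A')"
      using h A A' by (auto simp: lebesgue_decomposition_def)
    also have "(\<integral>\<^sup>+x\<in>A \<union> A'. ennreal (\<rho>1 x) \<partial>m) = 0"
      using n by (intro nn_integral_null_set) 
    also have "emeasure \<nu>1 (A \<union> A') = emeasure \<nu>1 UNIV"
    proof (rule antisym)
      have "emeasure \<nu>1 UNIV \<le> emeasure \<nu>1 ((A \<union> A') \<union> - A)"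
        using s A A' by (intro emeasure_mono) auto
      also have "\<dots> \<le> emeasure \<nu>1 (A \<union> A') + emeasure \<nu>1 (- A)"
        using s A A' by (intro emeasure_subadditive) auto
      finally show "emeasure \<nu>1 UNIV \<le> emeasure \<nu>1 (A \<union> A')" using A by simp
      show "emeasure \<nu>1 (A \<union> A') \<le> emeasure \<nu>1 UNIV" using s by (intro emeasure_mono) auto
    qed
    finally show ?thesis by simp
  qed
  obtain A where A: "A \<in> sets borel" "emeasure m A = 0" "emeasure \<nu> (- A) = 0"
    using ld(1) by (auto simp: lebesgue_decomposition_def)
  obtain A' where A': "A' \<in> sets borel" "emeasure m A' = 0" "emeasure (singular_part m \<mu>) (- A') = 0"
    using ld(2) by (auto simp: lebesgue_decomposition_def)
  have "emeasure (singular_part m \<mu>) UNIV = emeasure \<nu> UNIV"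
    using sing[OF ld(1) A A'(1,2) sm] sing[OF ld(2) A' A(1,2) sm] by (simp add: Un_commute)
  then show ?thesis using that ld by blast
qed

lemma lebesgue_decomposition_bounded:
  assumes ld: "lebesgue_decomposition m \<mu> \<rho> \<nu>" and sm: "sets m = sets borel" and sf: "sigma_finite_measure m"
    and le: "\<And>S. S \<in> sets borel \<Longrightarrow> emeasure \<mu> S \<le> ennreal A * emeasure m S" and A: "0 \<le> A"
  shows "AE x in m. \<rho> x \<le> A" "emeasure \<nu> UNIV = 0"
proof -
  interpret sigma_finite_measure m by fact
  have \<rho>: "\<rho> \<in> borel_measurable m" "\<And>x. 0 \<le> \<rho> x"
    and eq: "\<And>S. S \<in> sets borel \<Longrightarrow> emeasure \<mu> S = (\<integral>\<^sup>+x\<in>S. ennreal (\<rho> x) \<partial>m) + emeasure \<nu> S"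
    and s\<nu>: "sets \<nu> = sets borel"
    using ld sm by (auto simp: lebesgue_decomposition_def cong: measurable_cong_sets)
  obtain Z where Z: "Z \<in> sets borel" "emeasure m Z = 0" "emeasure \<nu> (- Z) = 0"
    using ld by (auto simp: lebesgue_decomposition_def)
  have "emeasure \<nu> Z = 0" using le[OF Z(1)] eq[OF Z(1)] Z(2) by auto
  moreover have "emeasure \<nu> UNIV \<le> emeasure \<nu> Z + emeasure \<nu> (- Z)"
    using s\<nu> Z emeasure_subadditive[of Z \<nu> "- Z"] by auto
  ultimately show "emeasure \<nu> UNIV = 0" using Z by simp
  have dens: "emeasure (density m (\<lambda>x. ennreal (\<rho> x))) S \<le> ennreal A * emeasure m S" if "S \<in> sets m" for S
  proof -
    have "emeasure (density m (\<lambda>x. ennreal (\<rho> x))) S = (\<integral>\<^sup>+x\<in>S. ennreal (\<rho> x) \<partial>m)"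
      using that \<rho> by (subst emeasure_density) auto
    also have "\<dots> \<le> emeasure \<mu> S" using eq[of S] that sm by auto
    finally show ?thesis using le[of S] that sm by auto
  qed
  obtain F :: "nat \<Rightarrow> 'a set" where F: "range F \<subseteq> sets m" "(\<Union>i. F i) = space m" "\<And>i. emeasure m (F i) \<noteq> \<infinity>"
    using sigma_finite by metis
  have "AE x in m. x \<in> F i \<longrightarrow> \<rho> x \<le> A + 1 / Suc j" for i j
  proof -
    define S where "S = {x\<in>space m. x \<in> F i \<and> \<rho> x > A + 1 / Suc j}"
    have Fi: "F i \<in> sets m" using F by auto
    have S: "S \<in> sets m" unfolding S_def using \<rho>(1) Fi by measurable
    have finS: "emeasure m S < \<infinity>"
    proof -
      have "emeasure m S \<le> emeasure m (F i)" using Fi by (intro emeasure_mono) (auto simp: S_def)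
      then show ?thesis using F(3)[of i] by (metis le_less_trans top.not_eq_extremum infinity_ennreal_def)
    qed
    have "ennreal (A + 1 / Suc j) * emeasure m S = (\<integral>\<^sup>+x. ennreal (A + 1 / Suc j) * indicator S x \<partial>m)"
      using S by (simp add: nn_integral_cmult_indicator)
    also have "\<dots> \<le> (\<integral>\<^sup>+x\<in>S. ennreal (\<rho> x) \<partial>m)"
      by (intro nn_integral_mono) (auto simp: S_def indicator_def intro!: ennreal_leI)
    also have "\<dots> = emeasure (density m (\<lambda>x. ennreal (\<rho> x))) S"
      using S \<rho> by (subst emeasure_density) auto
    also have "\<dots> \<le> ennreal A * emeasure m S" using dens S by blast
    finally have le2: "ennreal (A + 1 / Suc j) * emeasure m S \<le> ennreal A * emeasure m S" .
    have "measure m S = 0"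
    proof (rule ccontr)
      assume "measure m S \<noteq> 0"
      then have pos: "measure m S > 0" by (simp add: zero_less_measure_iff)
      have "emeasure m S = ennreal (measure m S)" using finS by (intro emeasure_eq_ennreal_measure) auto
      then have "(A + 1 / Suc j) * measure m S \<le> A * measure m S"
        using le2 A pos by (simp only: ennreal_mult[symmetric] ennreal_le_iff mult_nonneg_nonneg
            measure_nonneg add_nonneg_nonneg zero_le_divide_1_iff of_nat_0_le_iff)
      then show False using pos by (simp add: mult_le_cancel_right)
    qed
    then have "emeasure m S = 0" using finS by (auto simp: measure_def enn2real_eq_0_iff)
    then have "S \<in> null_sets m" using S by auto
    then show ?thesis by (rule AE_I') (auto simp: S_def)
  qed
  then have "AE x in m. \<forall>i j. x \<in> F i \<longrightarrow> \<rho> x \<le> A + 1 / Suc j"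
    by (simp only: AE_all_countable) blast
  then show "AE x in m. \<rho> x \<le> A"
  proof (rule AE_mp, intro AE_I2 impI)
    fix x assume x: "x \<in> space m" and h: "\<forall>i j. x \<in> F i \<longrightarrow> \<rho> x \<le> A + 1 / Suc j"
    then obtain i where "x \<in> F i" using F by blast
    show "\<rho> x \<le> A"
    proof (rule field_le_epsilon)
      fix e :: real assume "0 < e"
      then obtain j where "1 / Suc j < e" using nat_approx_posE by blast
      then show "\<rho> x \<le> A + e" using h \<open>x \<in> F i\<close> by (smt (verit))
    qed
  qed
qed

section \<open>The curvature-dimension condition for excess integrands\<close>

locale mm_space =
  fixes m :: "'a::complete_space measure"
  assumes mms: "metric_measure_space m"
begin

lemma sets_m [measurable_cong, simp]: "sets m = sets borel"
  using mms by (simp add: metric_measure_space_def)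

lemma space_m [simp]: "space m = UNIV"
  using sets_eq_imp_space_eq[OF sets_m] by simp

lemma geodesic_space: "\<exists>\<gamma>. geodesic_on_unit_interval \<gamma> \<and> \<gamma> 0 = x \<and> \<gamma> 1 = (y::'a)"
  using mms by (simp add: metric_measure_space_def geodesic_space_def)

lemma emeasure_open_pos: "open U \<Longrightarrow> x \<in> U \<Longrightarrow> 0 < emeasure m U"
  using mms by (auto simp: metric_measure_space_def measure_support_def)

lemma emeasure_ball_finite: "emeasure m (ball x r) < \<infinity>"
  using mms by (simp add: metric_measure_space_def)

lemma emeasure_finite_of_subset_ball: "A \<subseteq> ball x r \<Longrightarrow> emeasure m A < \<infinity>"
  using emeasure_mono[of A "ball x r" m] emeasure_ball_finite[of x r] by (auto intro: le_less_trans)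

lemma emeasure_ball_pos: "0 < r \<Longrightarrow> 0 < emeasure m (ball x r)"
  by (rule emeasure_open_pos[of _ x]) auto

lemma measure_ball_pos: "0 < r \<Longrightarrow> 0 < measure m (ball x r)"
  using emeasure_ball_pos[of r x] emeasure_ball_finite[of x r]
  by (simp add: measure_def enn2real_positive_iff)

lemma emeasure_ball: "emeasure m (ball x r) = ennreal (measure m (ball x r))"
  using emeasure_ball_finite[of x r] by (intro emeasure_eq_ennreal_measure) auto

lemma sigma_finite_m: "sigma_finite_measure m"
proof
  obtain x :: 'a where True by blast
  show "\<exists>A. countable A \<and> A \<subseteq> sets m \<and> \<Union>A = space m \<and> (\<forall>a\<in>A. emeasure m a \<noteq> \<infinity>)"
  proof (intro exI[of _ "range (\<lambda>n::nat. ball x (real n))"] conjI ballI)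
    show "\<Union>(range (\<lambda>n::nat. ball x (real n))) = space m"
      using reals_Archimedean2[of "dist x _"] by auto
  qed (use emeasure_ball_finite in \<open>auto simp: less_top\<close>)
qed

lemma decomposition_exists:
  assumes "\<mu> \<in> borel_probs" shows "\<exists>\<rho> \<nu>. lebesgue_decomposition m \<mu> \<rho> \<nu>"
  using assms
  by (intro lebesgue_decomposition_exists sigma_finite_m sets_m)
     (auto simp: borel_probs_def prob_space.axioms(1))

end

lemma enn2ereal_const_mult: "0 \<le> c \<Longrightarrow> ereal c * enn2ereal x = enn2ereal (ennreal c * x)"
  by (simp add: times_ennreal.rep_eq)

locale cd_space = mm_space m for m :: "'a::complete_space measure" +
  fixes K N :: real
  assumes N: "1 \<le> N" and K: "K \<le> 0" and CD: "CD_space m K N"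
begin

lemma distortion_nonneg: "0 \<le> distortion K N t \<delta>"
  by (auto simp: distortion_def Let_def)

definition "distorted_integral k t \<rho> \<kappa> =
  (\<integral>\<^sup>+x. (\<integral>\<^sup>+y. ennreal (distortion K N t (dist x y) * excess_fun N k (\<rho> x / distortion K N t (dist x y))) \<partial>\<kappa> x) \<partial>m)"

lemma distorted_terms_excess:
  "distorted_terms K N m (excess_fun N k) t \<rho> \<kappa> = [enn2ereal (distorted_integral k t \<rho> \<kappa>), 0]"
proof -
  have "ennreal (- (distortion K N t d * excess_fun N k s)) = 0" for d s
    using distortion_nonneg excess_fun_nonneg by (intro ennreal_neg) (simp add: mult_nonneg_nonneg)
  then show ?thesis
    by (simp add: distorted_terms_def signed_integral_terms_def distorted_integral_def zero_ennreal.rep_eq)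
qed

lemma energy_terms_excess:
  assumes "0 < k"
  shows "energy_terms m (excess_fun N k) \<mu> =
    [enn2ereal (\<integral>\<^sup>+x. ennreal (excess_fun N k (ac_density m \<mu> x)) \<partial>m), 0, ereal (k * measure (singular_part m \<mu>) UNIV)]"
proof -
  have "ennreal (- excess_fun N k s) = 0" for s
    using excess_fun_nonneg by (intro ennreal_neg) simp
  then show ?thesis using slope_excess_fun[OF N assms]
    by (simp add: energy_terms_def signed_integral_terms_def zero_ennreal.rep_eq)
qed

text \<open>For the excess integrand all negative parts vanish and every term is bounded, so the side condition on well-defined
  sums holds and the inequality can be stated between nonnegative extended reals.\<close>

lemma CD_excess:
  assumes \<mu>: "\<mu>\<^sub>0 \<in> borel_probs" "\<mu>\<^sub>1 \<in> borel_probs" and W: "W2 \<mu>\<^sub>0 \<mu>\<^sub>1 < \<infinity>"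
  obtains \<pi> \<kappa>\<^sub>0 \<kappa>\<^sub>1 where "\<pi> \<in> GeoOpt \<mu>\<^sub>0 \<mu>\<^sub>1" "disintegrates (endpoint_push \<pi>) \<mu>\<^sub>0 \<kappa>\<^sub>0"
    "disintegrates (distr (endpoint_push \<pi>) borel prod.swap) \<mu>\<^sub>1 \<kappa>\<^sub>1"
    "\<And>k t. 0 < k \<Longrightarrow> 0 \<le> t \<Longrightarrow> t \<le> 1 \<Longrightarrow>
      (\<integral>\<^sup>+x. ennreal (excess_fun N k (ac_density m (eval_push t \<pi>) x)) \<partial>m)
         + ennreal (k * measure (singular_part m (eval_push t \<pi>)) UNIV)
      \<le> ennreal (1 - t) * distorted_integral k (1 - t) (ac_density m \<mu>\<^sub>0) \<kappa>\<^sub>0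
        + ennreal t * distorted_integral k t (ac_density m \<mu>\<^sub>1) \<kappa>\<^sub>1
        + ennreal (k * ((1 - t) * measure (singular_part m \<mu>\<^sub>0) UNIV + t * measure (singular_part m \<mu>\<^sub>1) UNIV))"
proof -
  obtain \<pi> \<kappa>\<^sub>0 \<kappa>\<^sub>1 where p: "\<pi> \<in> GeoOpt \<mu>\<^sub>0 \<mu>\<^sub>1" "disintegrates (endpoint_push \<pi>) \<mu>\<^sub>0 \<kappa>\<^sub>0"
      "disintegrates (distr (endpoint_push \<pi>) borel prod.swap) \<mu>\<^sub>1 \<kappa>\<^sub>1"
    and ineq: "\<And>F t. F \<in> DC N \<Longrightarrow> t \<in> {0..1} \<Longrightarrow>
              defined_sum (energy_terms m F (eval_push t \<pi>)) \<Longrightarrow>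
              defined_sum (cd_bound_terms K N m F t \<mu>\<^sub>0 \<mu>\<^sub>1 \<kappa>\<^sub>0 \<kappa>\<^sub>1) \<Longrightarrow>
              sum_list (energy_terms m F (eval_push t \<pi>))
                \<le> sum_list (cd_bound_terms K N m F t \<mu>\<^sub>0 \<mu>\<^sub>1 \<kappa>\<^sub>0 \<kappa>\<^sub>1)"
    using CD \<mu> W unfolding CD_space_def by meson
  show ?thesis
  proof (rule that[OF p])
    fix k t :: real assume k: "0 < k" and t: "0 \<le> t" "t \<le> 1"
    let ?F = "excess_fun N k"
    let ?e = "energy_terms m ?F (eval_push t \<pi>)" and ?c = "cd_bound_terms K N m ?F t \<mu>\<^sub>0 \<mu>\<^sub>1 \<kappa>\<^sub>0 \<kappa>\<^sub>1"
    let ?I = "\<integral>\<^sup>+x. ennreal (?F (ac_density m (eval_push t \<pi>) x)) \<partial>m"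
    let ?s = "measure (singular_part m (eval_push t \<pi>)) UNIV"
    let ?s01 = "(1 - t) * measure (singular_part m \<mu>\<^sub>0) UNIV + t * measure (singular_part m \<mu>\<^sub>1) UNIV"
    let ?D0 = "distorted_integral k (1 - t) (ac_density m \<mu>\<^sub>0) \<kappa>\<^sub>0"
    let ?D1 = "distorted_integral k t (ac_density m \<mu>\<^sub>1) \<kappa>\<^sub>1"
    have s01: "0 \<le> ?s01" using t by auto
    have e: "?e = [enn2ereal ?I, 0, ereal (k * ?s)]" by (rule energy_terms_excess[OF k])
    have c: "?c = [enn2ereal (ennreal (1 - t) * ?D0), 0, enn2ereal (ennreal t * ?D1), 0, ereal (k * ?s01)]"
      using t slope_excess_fun[OF N k]
      by (simp add: cd_bound_terms_def distorted_terms_excess enn2ereal_const_mult)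
    have noninf: "defined_sum ts" if "\<forall>x\<in>set ts. 0 \<le> x" for ts
      using that by (force simp: defined_sum_def)
    have "sum_list ?e \<le> sum_list ?c"
    proof (rule ineq)
      show "?F \<in> DC N" by (rule excess_fun_DC[OF N k])
      show "defined_sum ?e" "defined_sum ?c"
        unfolding e c using k s01 by (auto intro!: noninf)
    qed (use t in auto)
    then have "enn2ereal (?I + ennreal (k * ?s)) \<le> enn2ereal (ennreal (1 - t) * ?D0 + ennreal t * ?D1 + ennreal (k * ?s01))"
      unfolding e c using k s01 by (simp add: plus_ennreal.rep_eq enn2ereal_ennreal add.assoc)
    then show "?I + ennreal (k * ?s) \<le> ennreal (1 - t) * ?D0 + ennreal t * ?D1 + ennreal (k * ?s01)"
      by (simp add: less_eq_ennreal.rep_eq)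
  qed
qed

end

section \<open>Geodesic plans and disintegrations\<close>

lemma continuous_apply_bcontfun: "continuous_on UNIV (\<lambda>\<gamma> :: real \<Rightarrow>\<^sub>C 'a::metric_space. apply_bcontfun \<gamma> t)"
  unfolding continuous_on_iff
proof (intro ballI allI impI)
  fix f :: "real \<Rightarrow>\<^sub>C 'a" and e :: real assume "0 < e"
  then show "\<exists>d>0. \<forall>g\<in>UNIV. dist g f < d \<longrightarrow> dist (apply_bcontfun g t) (apply_bcontfun f t) < e"
    using dist_bounded[of _ t f] by (intro exI[of _ e]) (auto intro: le_less_trans)
qed

lemma geo_probsD:
  assumes "\<pi> \<in> geo_probs"
  shows "prob_space \<pi>" "space \<pi> = Geo" "sets \<pi> = sets (restrict_space borel Geo)"
    "(\<lambda>\<gamma>. apply_bcontfun \<gamma> t) \<in> \<pi> \<rightarrow>\<^sub>M borel"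
    "(\<lambda>\<gamma>. (apply_bcontfun \<gamma> 0, apply_bcontfun \<gamma> 1)) \<in> \<pi> \<rightarrow>\<^sub>M borel"
proof -
  show s: "sets \<pi> = sets (restrict_space borel Geo)" and "prob_space \<pi>"
    using assms by (auto simp: geo_probs_def)
  show "space \<pi> = Geo" using sets_eq_imp_space_eq[OF s] by (simp add: space_restrict_space)
  have "f \<in> \<pi> \<rightarrow>\<^sub>M borel" if "continuous_on UNIV f" for f :: "_ \<Rightarrow> 'c::topological_space"
    using borel_measurable_continuous_onI[OF that] by (subst measurable_cong_sets[OF s refl]) (rule measurable_restrict_space1)
  then show "(\<lambda>\<gamma>. apply_bcontfun \<gamma> t) \<in> \<pi> \<rightarrow>\<^sub>M borel"
    "(\<lambda>\<gamma>. (apply_bcontfun \<gamma> 0, apply_bcontfun \<gamma> 1)) \<in> \<pi> \<rightarrow>\<^sub>M borel"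
    by (auto intro!: continuous_on_Pair continuous_apply_bcontfun)
qed

lemma GeoD:
  assumes "\<gamma> \<in> Geo"
  shows "geodesic_on_unit_interval (apply_bcontfun \<gamma>)"
    "apply_bcontfun \<gamma> t = apply_bcontfun \<gamma> (max 0 (min 1 t))"
  using assms by (auto simp: Geo_def)

lemma geodesic_dist:
  assumes "geodesic_on_unit_interval \<gamma>" "s \<in> {0..1}" "t \<in> {0..1}"
  shows "dist (\<gamma> s) (\<gamma> t) = \<bar>s - t\<bar> * dist (\<gamma> 0) (\<gamma> 1)"
  using assms(1)[unfolded geodesic_on_unit_interval_def, rule_format, OF assms(3,2)] .

lemma GeoOptD:
  assumes "\<pi> \<in> GeoOpt \<mu> \<nu>"
  shows "\<pi> \<in> geo_probs" "eval_push 0 \<pi> = \<mu>" "eval_push 1 \<pi> = \<nu>"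
  using assms by (auto simp: GeoOpt_def)

lemma eval_push_borel_probs: "\<pi> \<in> geo_probs \<Longrightarrow> eval_push t \<pi> \<in> borel_probs"
  unfolding eval_push_def borel_probs_def
  using prob_space.prob_space_distr[OF geo_probsD(1) geo_probsD(4)] by simp

lemma AE_eval_push:
  assumes "\<pi> \<in> geo_probs" "AE x in eval_push t \<pi>. P x"
  shows "AE \<gamma> in \<pi>. P (apply_bcontfun \<gamma> t)"
  using AE_distrD[OF geo_probsD(4)[OF assms(1)]] assms(2) unfolding eval_push_def by blast

lemma W2_finite_of_coupling:
  assumes "\<sigma> \<in> couplings \<mu> \<nu>" "(\<integral>\<^sup>+(x, y). ennreal ((dist x y)\<^sup>2) \<partial>\<sigma>) < \<infinity>"
  shows "W2 \<mu> \<nu> < \<infinity>"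
proof -
  have "(INF \<sigma> \<in> couplings \<mu> \<nu>. \<integral>\<^sup>+(x, y). ennreal ((dist x y)\<^sup>2) \<partial>\<sigma>) < \<infinity>"
    using INF_lower[OF assms(1)] assms(2) by (rule le_less_trans)
  moreover have "(let c = C in if c = \<infinity> then \<infinity> else ennreal (sqrt (enn2real c))) < \<infinity>" if "C < \<infinity>" for C :: ennreal
    using that by (simp add: Let_def)
  ultimately show ?thesis unfolding W2_def by blast
qed

lemma disintegratesD:
  assumes "disintegrates \<sigma> \<mu> \<kappa>"
  shows "\<And>x. prob_space (\<kappa> x)" "\<And>x. sets (\<kappa> x) = sets borel"
    "\<And>C. C \<in> sets borel \<Longrightarrow> emeasure \<sigma> C = (\<integral>\<^sup>+x. emeasure (\<kappa> x) {y. (x, y) \<in> C} \<partial>\<mu>)"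
    "\<kappa> \<in> borel \<rightarrow>\<^sub>M subprob_algebra borel"
proof -
  have m: "\<kappa> \<in> borel \<rightarrow>\<^sub>M prob_algebra borel" using assms by (simp add: disintegrates_def)
  then have "\<kappa> x \<in> space (prob_algebra borel)" for x using measurable_space[OF m, of x] by simp
  then show "\<And>x. prob_space (\<kappa> x)" "\<And>x. sets (\<kappa> x) = sets borel"
    by (auto simp: space_prob_algebra)
  show "\<kappa> \<in> borel \<rightarrow>\<^sub>M subprob_algebra borel" using m by (rule measurable_prob_algebraD)
  show "\<And>C. C \<in> sets borel \<Longrightarrow> emeasure \<sigma> C = (\<integral>\<^sup>+x. emeasure (\<kappa> x) {y. (x, y) \<in> C} \<partial>\<mu>)"
    using assms by (simp add: disintegrates_def)
qed

context cd_space begin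

text \<open>The integrand lies below its linear part, so each side of the convexity inequality is at most \<open>k\<close> times a mass.\<close>

lemma distorted_integral_le:
  assumes "lebesgue_decomposition m \<mu> \<rho> \<nu>" "\<And>x. prob_space (\<kappa> x)" "0 < k"
  shows "distorted_integral k t \<rho> \<kappa> + ennreal k * emeasure \<nu> UNIV \<le> ennreal k * emeasure \<mu> UNIV"
proof -
  have \<rho>: "\<rho> \<in> borel_measurable borel" "\<And>x. 0 \<le> \<rho> x"
    and eq: "emeasure \<mu> UNIV = (\<integral>\<^sup>+x. ennreal (\<rho> x) \<partial>m) + emeasure \<nu> UNIV"
    using assms(1) by (auto simp: lebesgue_decomposition_def)
  have "distorted_integral k t \<rho> \<kappa> \<le> (\<integral>\<^sup>+x. ennreal k * ennreal (\<rho> x) \<partial>m)"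
    unfolding distorted_integral_def
  proof (intro nn_integral_mono)
    fix x
    interpret prob_space "\<kappa> x" by (rule assms)
    have "(\<integral>\<^sup>+y. ennreal (distortion K N t (dist x y) * excess_fun N k (\<rho> x / distortion K N t (dist x y))) \<partial>\<kappa> x)
      \<le> (\<integral>\<^sup>+y. ennreal (k * \<rho> x) \<partial>\<kappa> x)"
    proof (intro nn_integral_mono ennreal_leI)
      fix y
      let ?b = "distortion K N t (dist x y)"
      have b: "0 \<le> ?b" by (rule distortion_nonneg)
      show "?b * excess_fun N k (\<rho> x / ?b) \<le> k * \<rho> x"
      proof (cases "?b = 0")
        case False
        have "?b * excess_fun N k (\<rho> x / ?b) \<le> ?b * (k * (\<rho> x / ?b))"
          using b \<rho>(2)[of x] assms(3) by (intro mult_left_mono excess_fun_le) auto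
        then show ?thesis using False by simp
      qed (use \<rho>(2)[of x] assms(3) in simp)
    qed
    also have "\<dots> = ennreal k * ennreal (\<rho> x)"
      using \<rho>(2)[of x] assms(3) emeasure_space_1 by (simp add: ennreal_mult)
    finally show "(\<integral>\<^sup>+y. ennreal (distortion K N t (dist x y) * excess_fun N k (\<rho> x / distortion K N t (dist x y))) \<partial>\<kappa> x)
      \<le> ennreal k * ennreal (\<rho> x)" .
  qed
  also have "\<dots> = ennreal k * (\<integral>\<^sup>+x. ennreal (\<rho> x) \<partial>m)"
    using \<rho>(1) by (intro nn_integral_cmult) (simp cong: measurable_cong_sets)
  finally show ?thesis unfolding eq by (simp add: distrib_left add_right_mono)
qed

text \<open>With the slope adapted to the threshold \<open>C\<close> the integrand vanishes as soon as the density does not exceed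
  \<open>C\<close> times the distortion coefficient.\<close>

lemma distorted_integral_eq_0:
  assumes \<rho>: "\<And>x. 0 \<le> \<rho> x" and C: "0 < C"
    and AE: "AE x in m. 0 < \<rho> x \<longrightarrow> (AE y in \<kappa> x. \<rho> x \<le> C * distortion K N t (dist x y))"
  shows "distorted_integral (C powr (- (1/N))) t \<rho> \<kappa> = 0"
proof -
  have "distorted_integral (C powr (- (1/N))) t \<rho> \<kappa> \<le> (\<integral>\<^sup>+x. 0 \<partial>m)"
    unfolding distorted_integral_def
  proof (rule nn_integral_mono_AE, rule AE_mp[OF AE], intro AE_I2 impI)
    fix x assume h: "0 < \<rho> x \<longrightarrow> (AE y in \<kappa> x. \<rho> x \<le> C * distortion K N t (dist x y))"
    show "(\<integral>\<^sup>+y. ennreal (distortion K N t (dist x y) *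
        excess_fun N (C powr (- (1/N))) (\<rho> x / distortion K N t (dist x y))) \<partial>\<kappa> x) \<le> 0"
    proof (cases "\<rho> x = 0")
      case False
      then have pos: "0 < \<rho> x" using \<rho>[of x] by simp
      have "(\<integral>\<^sup>+y. ennreal (distortion K N t (dist x y) *
        excess_fun N (C powr (- (1/N))) (\<rho> x / distortion K N t (dist x y))) \<partial>\<kappa> x) \<le> (\<integral>\<^sup>+y. 0 \<partial>\<kappa> x)"
      proof (rule nn_integral_mono_AE, rule AE_mp[OF h[rule_format, OF pos]], intro AE_I2 impI)
        fix y assume le: "\<rho> x \<le> C * distortion K N t (dist x y)"
        let ?b = "distortion K N t (dist x y)"
        have "0 < ?b" using le pos C distortion_nonneg[of t "dist x y"] by (smt (verit) mult_nonneg_nonpos)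
        then have "excess_fun N (C powr (- (1/N))) (\<rho> x / ?b) = 0"
          using le pos C by (subst excess_fun_eq_0_iff[OF N]) (auto simp: pos_divide_le_eq)
        then show "ennreal (?b * excess_fun N (C powr (- (1/N))) (\<rho> x / ?b)) \<le> 0" by simp
      qed
      then show ?thesis by simp
    qed simp
  qed
  then show ?thesis by simp
qed

lemma borel_meas_m [simp]: "f \<in> borel_measurable borel \<Longrightarrow> f \<in> borel_measurable m"
  by (simp cong: measurable_cong_sets)

text \<open>Jensen's inequality in disguise: on a set of finite measure \<open>\<rho>\<^bsup>1-1/N\<^esup>\<close> is bounded by its tangent at the
  constant density \<open>1 / m S\<close>, and the total mass is one. Singular mass only helps, since it costs the slope \<open>k\<close>.\<close>

lemma energy_lower_bound:
  assumes ld: "lebesgue_decomposition m \<mu> \<rho> \<nu>" and \<mu>: "\<mu> \<in> borel_probs" and k: "0 < k"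
    and S: "S \<in> sets borel" "emeasure \<mu> (- S) = 0" "emeasure m S < \<infinity>"
  shows "ennreal k \<le> (\<integral>\<^sup>+x. ennreal (excess_fun N k (\<rho> x)) \<partial>m) + ennreal k * emeasure \<nu> UNIV
      + ennreal (measure m S powr (1/N))"
proof -
  have \<rho>: "\<rho> \<in> borel_measurable borel" "\<And>x. 0 \<le> \<rho> x"
    and eq: "\<And>A. A \<in> sets borel \<Longrightarrow> emeasure \<mu> A = (\<integral>\<^sup>+x\<in>A. ennreal (\<rho> x) \<partial>m) + emeasure \<nu> A"
    using ld by (auto simp: lebesgue_decomposition_def)
  note [measurable] = \<rho>(1) S(1)
  have one: "1 = (\<integral>\<^sup>+x. ennreal (\<rho> x) \<partial>m) + emeasure \<nu> UNIV"
  proof -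
    have "sets \<mu> = sets borel" "prob_space \<mu>" using \<mu> by (auto simp: borel_probs_def)
    then have "emeasure \<mu> UNIV = 1"
      using prob_space.emeasure_space_1[of \<mu>] sets_eq_imp_space_eq[of \<mu> borel] by simp
    then show ?thesis using eq[of UNIV] by simp
  qed
  let ?q = "1 - 1/N" and ?v = "measure m S"
  have q: "0 \<le> ?q" "?q \<le> 1" using N by auto
  have "(\<integral>\<^sup>+x\<in>-S. ennreal (\<rho> x) \<partial>m) = 0" using eq[of "- S"] S by auto
  then have "AE x in m. ennreal (\<rho> x) * indicator (- S) x = 0"
    by (subst (asm) nn_integral_0_iff_AE) auto
  then have out: "AE x in m. x \<notin> S \<longrightarrow> \<rho> x = 0"
  proof (rule AE_mp, intro AE_I2 impI)
    fix x assume "ennreal (\<rho> x) * indicator (- S) x = 0" "x \<notin> S"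
    then have "ennreal (\<rho> x) = 0" by simp
    then show "\<rho> x = 0" using \<rho>(2)[of x] by (simp add: ennreal_eq_0_iff)
  qed
  have int: "(\<integral>\<^sup>+x. ennreal (\<rho> x powr ?q) \<partial>m) \<le> ennreal (?v powr (1/N))"
  proof (cases "?v = 0")
    case True
    then have "emeasure m S = 0" using S(3) by (auto simp: measure_def enn2real_eq_0_iff)
    then have "AE x in m. x \<notin> S" by (intro AE_I[of _ _ S]) auto
    with out have "AE x in m. ennreal (\<rho> x powr ?q) = 0" by eventually_elim simp
    then show ?thesis by (subst nn_integral_cong_AE) auto
  next
    case False
    then have v: "0 < ?v" by (simp add: zero_less_measure_iff)
    let ?c = "1 / ?v"
    have "(\<integral>\<^sup>+x. ennreal (\<rho> x powr ?q) \<partial>m)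
      \<le> (\<integral>\<^sup>+x. ennreal (?q * ?c powr (?q - 1)) * ennreal (\<rho> x) + ennreal ((1 - ?q) * ?c powr ?q) * indicator S x \<partial>m)"
    proof (rule nn_integral_mono_AE, rule AE_mp[OF out], intro AE_I2 impI)
      fix x assume h: "x \<notin> S \<longrightarrow> \<rho> x = 0"
      have "ennreal (\<rho> x powr ?q) \<le> ennreal (?q * ?c powr (?q - 1) * \<rho> x + (1 - ?q) * ?c powr ?q)"
        using powr_le_tangent[OF q \<rho>(2)[of x], of ?c] v by (intro ennreal_leI) auto
      also have "\<dots> = ennreal (?q * ?c powr (?q - 1)) * ennreal (\<rho> x) + ennreal ((1 - ?q) * ?c powr ?q)"
        using q \<rho>(2)[of x] by (simp add: ennreal_mult)
      finally show "ennreal (\<rho> x powr ?q) \<le> ennreal (?q * ?c powr (?q - 1)) * ennreal (\<rho> x)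
          + ennreal ((1 - ?q) * ?c powr ?q) * indicator S x"
        using h by (cases "x \<in> S") auto
    qed
    also have "\<dots> = ennreal (?q * ?c powr (?q - 1)) * (\<integral>\<^sup>+x. ennreal (\<rho> x) \<partial>m) + ennreal ((1 - ?q) * ?c powr ?q) * emeasure m S"
      by (subst nn_integral_add) (auto simp: nn_integral_cmult nn_integral_cmult_indicator)
    also have "\<dots> \<le> ennreal (?q * ?c powr (?q - 1)) * 1 + ennreal ((1 - ?q) * ?c powr ?q) * ennreal ?v"
    proof (intro add_mono mult_left_mono)
      show "(\<integral>\<^sup>+x. ennreal (\<rho> x) \<partial>m) \<le> 1" by (subst one) simp
      show "emeasure m S \<le> ennreal ?v" using S(3) by (subst emeasure_eq_ennreal_measure) auto
    qed simp_all
    also have "\<dots> = ennreal (?q * ?c powr (?q - 1) + (1 - ?q) * ?c powr ?q * ?v)"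
    proof -
      have A0: "0 \<le> ?q * ?c powr (?q - 1)" and B0: "0 \<le> (1 - ?q) * ?c powr ?q"
        using q by (intro mult_nonneg_nonneg; simp)+
      show ?thesis
        by (simp only: mult_1_right ennreal_mult[OF B0 measure_nonneg] ennreal_plus[OF A0 mult_nonneg_nonneg[OF B0 measure_nonneg]])
    qed
    also have "?q * ?c powr (?q - 1) + (1 - ?q) * ?c powr ?q * ?v = ?v powr (1/N)"
    proof -
      have inv: "?c powr z = ?v powr (- z)" for z
        using v by (simp add: powr_divide powr_minus_divide)
      have e1: "?c powr (?q - 1) = ?v powr (1/N)" unfolding inv by simp
      have "?v powr (- ?q) * ?v powr 1 = ?v powr (1/N)"
        by (simp only: powr_add[symmetric]) simp
      then have e2: "?c powr ?q * ?v = ?v powr (1/N)" unfolding inv using v by simp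
      show ?thesis unfolding e1 mult.assoc[of "1 - ?q"] e2 by (simp only: distrib_right[symmetric]) simp
    qed
    finally show ?thesis .
  qed
  have "ennreal k = ennreal k * 1" by simp
  also have "\<dots> = ennreal k * (\<integral>\<^sup>+x. ennreal (\<rho> x) \<partial>m) + ennreal k * emeasure \<nu> UNIV"
    by (subst one) (rule distrib_left)
  also have "ennreal k * (\<integral>\<^sup>+x. ennreal (\<rho> x) \<partial>m) = (\<integral>\<^sup>+x. ennreal k * ennreal (\<rho> x) \<partial>m)"
    by (intro nn_integral_cmult[symmetric]) auto
  also have "\<dots> \<le> (\<integral>\<^sup>+x. ennreal (excess_fun N k (\<rho> x)) + ennreal (\<rho> x powr ?q) \<partial>m)"
  proof (intro nn_integral_mono)
    fix x
    have "k * \<rho> x \<le> excess_fun N k (\<rho> x) + \<rho> x powr ?q" by (simp add: excess_fun_def)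
    then show "ennreal k * ennreal (\<rho> x) \<le> ennreal (excess_fun N k (\<rho> x)) + ennreal (\<rho> x powr ?q)"
      using k \<rho>(2)[of x] excess_fun_nonneg[of N k "\<rho> x"]
      by (simp only: ennreal_mult[symmetric] ennreal_plus[symmetric] powr_ge_zero less_imp_le ennreal_leI)
  qed
  also have "\<dots> = (\<integral>\<^sup>+x. ennreal (excess_fun N k (\<rho> x)) \<partial>m) + (\<integral>\<^sup>+x. ennreal (\<rho> x powr ?q) \<partial>m)"
    by (intro nn_integral_add) (auto simp: excess_fun_def)
  also have "\<dots> \<le> (\<integral>\<^sup>+x. ennreal (excess_fun N k (\<rho> x)) \<partial>m) + ennreal (?v powr (1/N))"
    by (intro add_left_mono int)
  finally have "ennreal k \<le> ((\<integral>\<^sup>+x. ennreal (excess_fun N k (\<rho> x)) \<partial>m) + ennreal (?v powr (1/N))) + ennreal k * emeasure \<nu> UNIV"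
    by (simp add: add_right_mono)
  then show ?thesis by (simp only: ac_simps)
qed

end

section \<open>Contracting a set towards a point\<close>

context cd_space begin

definition curv :: real where "curv = sqrt (\<bar>K\<bar> / (N - 1))"

lemma curv_nonneg: "0 \<le> curv" using N by (simp add: curv_def)

lemma distortion_ge:
  assumes t: "0 < t" "t \<le> 1" and d: "0 \<le> \<delta>" "\<delta> \<le> D"
  shows "sinh_ratio t (curv * D) powr (N - 1) \<le> distortion K N t \<delta>"
proof -
  have "sinh_ratio t (curv * D) \<le> sinh_ratio t (curv * \<delta>)"
    using t d curv_nonneg by (intro sinh_ratio_antimono mult_left_mono) auto
  moreover have "0 \<le> sinh_ratio t (curv * D)"
    using t d curv_nonneg by (intro less_imp_le[OF sinh_ratio_pos]) auto
  ultimately show ?thesis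
    using distortion_eq_sinh_ratio[OF t(1) N d(1)] N by (simp add: curv_def powr_mono2)
qed

lemma uniform_measure_borel_probs:
  assumes "A \<in> sets borel" "emeasure m A \<noteq> 0" "emeasure m A < \<infinity>"
  shows "uniform_measure m A \<in> borel_probs"
  using assms by (auto simp: borel_probs_def intro!: prob_space_uniform_measure)

lemma return_borel_probs: "return borel x \<in> (borel_probs :: 'b::topological_space measure set)"
  by (auto simp: borel_probs_def intro!: prob_space_return)

lemma W2_return_finite:
  fixes x :: 'a
  assumes \<mu>: "\<mu> \<in> borel_probs" and A: "AE y in \<mu>. dist y x < R"
  shows "W2 \<mu> (return borel x) < \<infinity>"
proof -
  have p: "prob_space \<mu>" and s: "sets \<mu> = sets borel" using \<mu> by (auto simp: borel_probs_def)
  interpret prob_space \<mu> by fact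
  have c: "continuous_on UNIV (\<lambda>y. (y, x))" by (intro continuous_intros)
  have mb: "(\<lambda>y. (y, x)) \<in> \<mu> \<rightarrow>\<^sub>M borel"
    using borel_measurable_continuous_onI[OF c] s by (simp cong: measurable_cong_sets)
  have fst: "fst \<in> (borel :: ('a \<times> 'a) measure) \<rightarrow>\<^sub>M borel" and snd: "snd \<in> (borel :: ('a \<times> 'a) measure) \<rightarrow>\<^sub>M borel"
    by (auto intro!: borel_measurable_continuous_onI continuous_intros)
  define \<sigma> where "\<sigma> = distr \<mu> borel (\<lambda>y. (y, x))"
  have dm: "(\<lambda>(y, z). ennreal ((dist y z)\<^sup>2)) \<in> borel_measurable (borel :: ('a \<times> 'a) measure)"
    unfolding split_beta by (intro measurable_compose[OF _ measurable_ennreal] borel_measurable_continuous_onI continuous_intros)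
  have "\<sigma> \<in> couplings \<mu> (return borel x)"
  proof -
    have "distr \<sigma> borel fst = \<mu>"
      unfolding \<sigma>_def distr_distr[OF fst mb] using s by (simp add: comp_def distr_id2)
    moreover have "distr \<sigma> borel snd = return borel x"
    proof (rule measure_eqI)
      fix B assume "B \<in> sets (distr \<sigma> borel snd)"
      then have B: "B \<in> sets borel" by simp
      have "emeasure (distr \<sigma> borel snd) B = emeasure (distr \<mu> borel (\<lambda>y. x)) B"
        unfolding \<sigma>_def distr_distr[OF snd mb] by (simp add: comp_def)
      also have "\<dots> = emeasure (return borel x) B"
        using B emeasure_space_1 by (subst emeasure_distr) (auto simp: indicator_def)
      finally show "emeasure (distr \<sigma> borel snd) B = emeasure (return borel x) B" .
    qed simp
    moreover have "\<sigma> \<in> borel_probs" unfolding \<sigma>_def borel_probs_def using prob_space_distr[OF mb] by simp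
    ultimately show ?thesis by (simp add: couplings_def)
  qed
  moreover have "(\<integral>\<^sup>+(y, z). ennreal ((dist y z)\<^sup>2) \<partial>\<sigma>) < \<infinity>"
  proof -
    have "(\<integral>\<^sup>+(y, z). ennreal ((dist y z)\<^sup>2) \<partial>\<sigma>) = (\<integral>\<^sup>+y. ennreal ((dist y x)\<^sup>2) \<partial>\<mu>)"
      unfolding \<sigma>_def by (subst nn_integral_distr[OF mb]) (use dm in \<open>simp_all\<close>)
    also have "\<dots> \<le> (\<integral>\<^sup>+y. ennreal (R\<^sup>2) \<partial>\<mu>)"
      by (rule nn_integral_mono_AE, rule AE_mp[OF A], intro AE_I2 impI ennreal_leI power_mono) auto
    also have "\<dots> < \<infinity>" using emeasure_space_1 by simp
    finally show ?thesis .
  qed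
  ultimately show ?thesis by (rule W2_finite_of_coupling)
qed

lemma ac_density_uniform:
  assumes A: "A \<in> sets borel" "emeasure m A \<noteq> 0" "emeasure m A < \<infinity>"
  obtains \<nu> where "lebesgue_decomposition m (uniform_measure m A) (ac_density m (uniform_measure m A)) \<nu>"
    "measure (singular_part m (uniform_measure m A)) UNIV = 0"
    "AE x in m. ac_density m (uniform_measure m A) x \<le> (if x \<in> A then 1 / measure m A else 0)"
proof -
  let ?u = "uniform_measure m A"
  have pos: "0 < measure m A" using A by (simp add: measure_def enn2real_positive_iff zero_less_iff_neq_zero)
  obtain \<nu> where ld: "lebesgue_decomposition m ?u (ac_density m ?u) \<nu>"
    and sg: "emeasure (singular_part m ?u) UNIV = emeasure \<nu> UNIV"
    using lebesgue_decomposition_choice[OF decomposition_exists[OF uniform_measure_borel_probs[OF A]] sets_m] by blast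
  have le: "emeasure ?u S \<le> ennreal (1 / measure m A) * emeasure m S" if "S \<in> sets borel" for S
  proof -
    have "emeasure ?u S = emeasure m (A \<inter> S) / emeasure m A" using A that by simp
    also have "\<dots> \<le> emeasure m S / emeasure m A"
      using A that by (intro divide_right_mono_ennreal emeasure_mono) auto
    also have "\<dots> = ennreal (1 / measure m A) * emeasure m S"
      using A pos by (simp add: emeasure_eq_ennreal_measure divide_ennreal_def inverse_ennreal mult.commute inverse_eq_divide)
    finally show ?thesis .
  qed
  note b = lebesgue_decomposition_bounded[OF ld sets_m sigma_finite_m le]
  have \<rho>: "ac_density m ?u \<in> borel_measurable borel" "\<And>x. 0 \<le> ac_density m ?u x"
    and eq: "\<And>S. S \<in> sets borel \<Longrightarrow> emeasure ?u S = (\<integral>\<^sup>+x\<in>S. ennreal (ac_density m ?u x) \<partial>m) + emeasure \<nu> S"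
    using ld by (auto simp: lebesgue_decomposition_def)
  have "emeasure ?u (- A) = 0" using A by simp
  then have "(\<integral>\<^sup>+x\<in>-A. ennreal (ac_density m ?u x) \<partial>m) = 0" using eq[of "- A"] A by simp
  then have "AE x in m. ennreal (ac_density m ?u x) * indicator (- A) x = 0"
    using A \<rho>(1) by (subst (asm) nn_integral_0_iff_AE) auto
  then have "AE x in m. ac_density m ?u x \<le> (if x \<in> A then 1 / measure m A else 0)"
    using b(1) pos
    by (auto simp: indicator_def ennreal_eq_0_iff elim!: eventually_elim2 split: if_splits)
  moreover have "measure (singular_part m ?u) UNIV = 0"
    using sg b(2) pos by (simp add: measure_def)
  ultimately show ?thesis using that ld by blast
qed

text \<open>The condition is applied to the uniform measure on \<open>A\<close> and the Dirac mass at \<open>x\<close>. The Dirac mass is singular and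
  contributes \<open>t k\<close>, so after cancelling the linear terms the inequality compares \<open>m(A)\<^bsup>1/N\<^esup>\<close> with \<open>m(S)\<^bsup>1/N\<^esup>\<close>: the intermediate measure lives on \<open>S\<close>.\<close>

theorem brunn_minkowski_point:
  assumes A: "A \<in> sets borel" "A \<subseteq> ball x R" and S: "S \<in> sets borel" and t: "0 < t" "t < 1"
    and AS: "\<And>y p. y \<in> A \<Longrightarrow> dist y p = t * dist y x \<Longrightarrow> dist p x = (1 - t) * dist y x \<Longrightarrow> p \<in> S"
  shows "ennreal ((1 - t) powr N * sinh_ratio (1 - t) (curv * R) powr (N - 1)) * emeasure m A \<le> emeasure m S"
proof (cases "emeasure m A = 0 \<or> emeasure m S = \<infinity>")
  case True
  then show ?thesis by auto
next
  case False
  then have A0: "emeasure m A \<noteq> 0" and Sf: "emeasure m S < \<infinity>" by (auto simp: less_top)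
  have Af: "emeasure m A < \<infinity>" using A emeasure_finite_of_subset_ball by blast
  have "A \<noteq> {}" using A0 by auto
  then have R: "0 < R" using A(2) by (metis ball_eq_empty not_less subset_empty)
  have mA: "0 < measure m A" using A0 Af by (simp add: measure_def enn2real_positive_iff zero_less_iff_neq_zero)
  let ?\<mu> = "uniform_measure m A" and ?b = "sinh_ratio (1 - t) (curv * R) powr (N - 1)"
  have b: "0 < ?b"
    using sinh_ratio_pos[of "1 - t" "curv * R"] t R curv_nonneg by simp
  define k where "k = (?b * measure m A) powr (1/N)"
  have k: "0 < k" using b mA by (simp add: k_def)
  have kC: "k = (1 / (?b * measure m A)) powr (- (1/N))"
    using b mA by (simp add: k_def powr_divide powr_minus_divide)
  have \<mu>: "?\<mu> \<in> borel_probs" using A(1) A0 Af by (rule uniform_measure_borel_probs)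
  have inA: "AE y in ?\<mu>. y \<in> A" using A(1) by (intro AE_uniform_measureI) auto
  then have "AE y in ?\<mu>. dist y x < R"
    by (rule AE_mp) (use A(2) in \<open>auto simp: dist_commute subset_eq\<close>)
  then have "W2 ?\<mu> (return borel x) < \<infinity>" by (rule W2_return_finite[OF \<mu>])
  from CD_excess[OF \<mu> return_borel_probs this]
  obtain \<pi> \<kappa>\<^sub>0 \<kappa>\<^sub>1 where \<pi>: "\<pi> \<in> GeoOpt ?\<mu> (return borel x)"
    and \<kappa>0: "disintegrates (endpoint_push \<pi>) ?\<mu> \<kappa>\<^sub>0"
    and \<kappa>1: "disintegrates (distr (endpoint_push \<pi>) borel prod.swap) (return borel x) \<kappa>\<^sub>1"
    and ineq: "\<And>k t. 0 < k \<Longrightarrow> 0 \<le> t \<Longrightarrow> t \<le> 1 \<Longrightarrow>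
      (\<integral>\<^sup>+x. ennreal (excess_fun N k (ac_density m (eval_push t \<pi>) x)) \<partial>m)
         + ennreal (k * measure (singular_part m (eval_push t \<pi>)) UNIV)
      \<le> ennreal (1 - t) * distorted_integral k (1 - t) (ac_density m ?\<mu>) \<kappa>\<^sub>0
        + ennreal t * distorted_integral k t (ac_density m (return borel x)) \<kappa>\<^sub>1
        + ennreal (k * ((1 - t) * measure (singular_part m ?\<mu>) UNIV + t * measure (singular_part m (return borel x)) UNIV))"
    by blast
  note g = GeoOptD[OF \<pi>]
  note gp = geo_probsD[OF g(1)]
  interpret \<pi>: prob_space \<pi> by (rule gp)
  have "AE y in (return borel x :: 'a measure). y = x"
    by (subst AE_return) auto
  then have end1: "AE \<gamma> in \<pi>. apply_bcontfun \<gamma> 1 = x"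
    by (intro AE_eval_push[OF g(1), where t = 1 and P = "\<lambda>y. y = x"]) (simp only: g(3))
  have end0: "AE \<gamma> in \<pi>. apply_bcontfun \<gamma> 0 \<in> A"
    using inA by (intro AE_eval_push[OF g(1), where t = 0 and P = "\<lambda>y. y \<in> A"]) (simp only: g(2))
  have inS: "AE \<gamma> in \<pi>. apply_bcontfun \<gamma> t \<in> S"
    using end0 end1
  proof (rule AE_mp[OF _ AE_mp], intro AE_I2 impI)
    fix \<gamma> assume \<gamma>: "\<gamma> \<in> space \<pi>" "apply_bcontfun \<gamma> 0 \<in> A" "apply_bcontfun \<gamma> 1 = x"
    then have geo: "geodesic_on_unit_interval (apply_bcontfun \<gamma>)" using gp(2) GeoD(1) by blast
    show "apply_bcontfun \<gamma> t \<in> S"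
      using geodesic_dist[OF geo, of 0 t] geodesic_dist[OF geo, of t 1] t \<gamma>(3)
      by (intro AS[OF \<gamma>(2)]) auto
  qed
  let ?\<mu>t = "eval_push t \<pi>"
  have \<mu>t: "?\<mu>t \<in> borel_probs" by (rule eval_push_borel_probs[OF g(1)])
  have \<mu>tS: "emeasure ?\<mu>t (- S) = 0"
  proof -
    have "emeasure ?\<mu>t (- S) = emeasure \<pi> ((\<lambda>\<gamma>. apply_bcontfun \<gamma> t) -` (- S) \<inter> space \<pi>)"
      unfolding eval_push_def using gp(4) S by (subst emeasure_distr) auto
    also have "\<dots> = 0"
      using inS gp(4)[of t] S by (subst (asm) AE_iff_measurable[OF _ refl]) (auto simp: vimage_def Int_def conj_commute)
    finally show ?thesis .
  qed
  obtain \<nu>t where ldt: "lebesgue_decomposition m ?\<mu>t (ac_density m ?\<mu>t) \<nu>t"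
    and sgt: "emeasure (singular_part m ?\<mu>t) UNIV = emeasure \<nu>t UNIV"
    using lebesgue_decomposition_choice[OF decomposition_exists[OF \<mu>t] sets_m] by blast
  obtain \<nu>1 where ld1: "lebesgue_decomposition m (return borel x) (ac_density m (return borel x)) \<nu>1"
    and sg1: "emeasure (singular_part m (return borel x)) UNIV = emeasure \<nu>1 UNIV"
    using lebesgue_decomposition_choice[OF decomposition_exists[OF return_borel_probs] sets_m] by blast
  obtain \<nu>0 where ld0: "lebesgue_decomposition m ?\<mu> (ac_density m ?\<mu>) \<nu>0"
    and sg0: "measure (singular_part m ?\<mu>) UNIV = 0"
    and d0: "AE y in m. ac_density m ?\<mu> y \<le> (if y \<in> A then 1 / measure m A else 0)"
    using ac_density_uniform[OF A(1) A0 Af] by blast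
  have fin: "emeasure \<nu> UNIV \<le> 1" if "lebesgue_decomposition m \<mu>' \<rho> \<nu>" "\<mu>' \<in> borel_probs" for \<mu>' \<rho> \<nu>
  proof -
    have "sets \<mu>' = sets borel" "prob_space \<mu>'" using that(2) by (auto simp: borel_probs_def)
    then have "emeasure \<mu>' UNIV = 1"
      using prob_space.emeasure_space_1[of \<mu>'] sets_eq_imp_space_eq[of \<mu>' borel] by simp
    moreover have "emeasure \<mu>' UNIV = (\<integral>\<^sup>+x. ennreal (\<rho> x) \<partial>m) + emeasure \<nu> UNIV"
      using that(1) by (auto simp: lebesgue_decomposition_def)
    then have "emeasure \<nu> UNIV \<le> emeasure \<mu>' UNIV" by simp
    ultimately show ?thesis by simp
  qed
  have kms: "ennreal (k * measure (singular_part m \<mu>') UNIV) = ennreal k * emeasure \<nu> UNIV"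
    if "lebesgue_decomposition m \<mu>' \<rho> \<nu>" "\<mu>' \<in> borel_probs" "emeasure (singular_part m \<mu>') UNIV = emeasure \<nu> UNIV" for \<mu>' \<rho> \<nu>
  proof -
    have "emeasure \<nu> UNIV = ennreal (measure (singular_part m \<mu>') UNIV)"
      using fin[OF that(1,2)] that(3) by (subst emeasure_eq_ennreal_measure[symmetric]) (auto simp: top_unique)
    then show ?thesis using k by (simp add: ennreal_mult)
  qed
  text \<open>first term vanishes\<close>
  have D0: "distorted_integral k (1 - t) (ac_density m ?\<mu>) \<kappa>\<^sub>0 = 0"
    unfolding kC
  proof (rule distorted_integral_eq_0)
    show "0 \<le> ac_density m ?\<mu> y" for y using ld0 by (simp add: lebesgue_decomposition_def)
    show "0 < 1 / (?b * measure m A)" using b mA by simp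
    have rect: "{(y, z). z \<noteq> x} \<in> sets (borel :: ('a \<times> 'a) measure)"
    proof -
      have "open ((UNIV :: 'a set) \<times> (- {x}))" by (intro open_Times) auto
      moreover have "{(y, z). z \<noteq> x} = (UNIV :: 'a set) \<times> (- {x})" by auto
      ultimately show ?thesis by (metis borel_open)
    qed
    have "emeasure (endpoint_push \<pi>) {(y, z). z \<noteq> x} = 0"
    proof -
      have "emeasure (endpoint_push \<pi>) {(y, z). z \<noteq> x} =
          emeasure \<pi> ((\<lambda>\<gamma>. (apply_bcontfun \<gamma> 0, apply_bcontfun \<gamma> 1)) -` {(y, z). z \<noteq> x} \<inter> space \<pi>)"
        unfolding endpoint_push_def using gp(5) rect by (subst emeasure_distr) auto
      also have "\<dots> = 0"
        using end1 measurable_sets[OF gp(5) rect]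
        by (subst (asm) AE_iff_measurable[OF _ refl]) (auto simp: vimage_def Int_def conj_commute)
      finally show ?thesis .
    qed
    then have "(\<integral>\<^sup>+y. emeasure (\<kappa>\<^sub>0 y) {z. z \<noteq> x} \<partial>?\<mu>) = 0"
      using disintegratesD(3)[OF \<kappa>0 rect] by simp
    moreover have "(\<lambda>y. emeasure (\<kappa>\<^sub>0 y) {z. z \<noteq> x}) \<in> borel_measurable ?\<mu>"
    proof -
      have "{z. z \<noteq> x} \<in> sets borel" by (simp add: Collect_neg_eq)
      then have "(\<lambda>y. emeasure (\<kappa>\<^sub>0 y) {z. z \<noteq> x}) \<in> borel_measurable borel"
        using measurable_compose[OF disintegratesD(4)[OF \<kappa>0] measurable_emeasure_subprob_algebra] by blast
      then show ?thesis by (simp cong: measurable_cong_sets)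
    qed
    ultimately have "AE y in ?\<mu>. emeasure (\<kappa>\<^sub>0 y) {z. z \<noteq> x} = 0"
      by (subst (asm) nn_integral_0_iff_AE) auto
    then have "AE y in m. y \<in> A \<longrightarrow> emeasure (\<kappa>\<^sub>0 y) {z. z \<noteq> x} = 0"
      using A0 Af by (subst (asm) AE_uniform_measure) auto
    with d0 show "AE y in m. 0 < ac_density m ?\<mu> y \<longrightarrow> (AE z in \<kappa>\<^sub>0 y.
        ac_density m ?\<mu> y \<le> 1 / (?b * measure m A) * distortion K N (1 - t) (dist y z))"
    proof eventually_elim
      case (elim y)
      show ?case
      proof
        assume "0 < ac_density m ?\<mu> y"
        then have yA: "y \<in> A" and le: "ac_density m ?\<mu> y \<le> 1 / measure m A" using elim(1) by (auto split: if_splits)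
        have "AE z in \<kappa>\<^sub>0 y. z = x"
          using elim(2) yA disintegratesD(2)[OF \<kappa>0, of y] sets_eq_imp_space_eq[OF disintegratesD(2)[OF \<kappa>0, of y]]
          by (intro AE_I[of _ _ "{z. z \<noteq> x}"]) (auto simp: Collect_neg_eq)
        then show "AE z in \<kappa>\<^sub>0 y. ac_density m ?\<mu> y \<le> 1 / (?b * measure m A) * distortion K N (1 - t) (dist y z)"
        proof eventually_elim
          case (elim z)
          have "dist y x \<le> R" using yA A(2) by (auto simp: subset_eq dist_commute less_imp_le)
          then have "?b \<le> distortion K N (1 - t) (dist y z)" using elim t by (intro distortion_ge) auto
          then have "1 / (?b * measure m A) * ?b \<le> 1 / (?b * measure m A) * distortion K N (1 - t) (dist y z)"
            using b mA by (intro mult_left_mono) auto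
          then show ?case using le b by simp
        qed
      qed
    qed
  qed
  have D1: "distorted_integral k t (ac_density m (return borel x)) \<kappa>\<^sub>1 + ennreal k * emeasure \<nu>1 UNIV \<le> ennreal k"
    using distorted_integral_le[OF ld1 disintegratesD(1)[OF \<kappa>1] k, of t] by simp
  have "ennreal k \<le> (\<integral>\<^sup>+y. ennreal (excess_fun N k (ac_density m ?\<mu>t y)) \<partial>m) + ennreal k * emeasure \<nu>t UNIV
      + ennreal (measure m S powr (1/N))"
    by (rule energy_lower_bound[OF ldt \<mu>t k S \<mu>tS Sf])
  also have "\<dots> \<le> ennreal t * ennreal k + ennreal (measure m S powr (1/N))"
  proof (rule add_right_mono)
    have "(\<integral>\<^sup>+y. ennreal (excess_fun N k (ac_density m ?\<mu>t y)) \<partial>m) + ennreal k * emeasure \<nu>t UNIV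
      \<le> ennreal t * distorted_integral k t (ac_density m (return borel x)) \<kappa>\<^sub>1
        + ennreal (k * (t * measure (singular_part m (return borel x)) UNIV))"
      using ineq[OF k, of t] t D0 sg0 kms[OF ldt \<mu>t sgt] by simp
    also have "ennreal (k * (t * measure (singular_part m (return borel x)) UNIV)) = ennreal t * (ennreal k * emeasure \<nu>1 UNIV)"
    proof -
      have "ennreal (k * (t * measure (singular_part m (return borel x)) UNIV))
          = ennreal (t * (k * measure (singular_part m (return borel x)) UNIV))"
        by (simp add: mult.left_commute)
      also have "\<dots> = ennreal t * ennreal (k * measure (singular_part m (return borel x)) UNIV)"
        using t k by (intro ennreal_mult) auto
      finally show ?thesis unfolding kms[OF ld1 return_borel_probs sg1] .
    qed
    also have "ennreal t * distorted_integral k t (ac_density m (return borel x)) \<kappa>\<^sub>1 + ennreal t * (ennreal k * emeasure \<nu>1 UNIV)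
       \<le> ennreal t * ennreal k"
      unfolding distrib_left[symmetric] by (rule mult_left_mono[OF D1]) simp
    finally show "(\<integral>\<^sup>+y. ennreal (excess_fun N k (ac_density m ?\<mu>t y)) \<partial>m) + ennreal k * emeasure \<nu>t UNIV \<le> ennreal t * ennreal k" .
  qed
  also have "\<dots> = ennreal (t * k + measure m S powr (1/N))" using t k by (simp add: ennreal_mult)
  finally have "k \<le> t * k + measure m S powr (1/N)" using t k by (subst (asm) ennreal_le_iff) auto
  then have "(1 - t) * k \<le> measure m S powr (1/N)" by (simp add: algebra_simps)
  then have "((1 - t) * k) powr N \<le> (measure m S powr (1/N)) powr N"
    using t k N by (intro powr_mono2) auto
  moreover have "((1 - t) * k) powr N = (1 - t) powr N * (?b * measure m A)"
    using t k N b mA by (simp add: powr_mult k_def powr_powr)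
  moreover have "(measure m S powr (1/N)) powr N = measure m S" using N by (simp add: powr_powr)
  ultimately have "(1 - t) powr N * ?b * measure m A \<le> measure m S" by simp
  then have "ennreal ((1 - t) powr N * ?b * measure m A) \<le> ennreal (measure m S)" by (rule ennreal_leI)
  then show ?thesis
    using Af Sf b by (simp add: ennreal_mult emeasure_eq_ennreal_measure less_top)
qed

end

section \<open>Doubling and compactness of balls\<close>

text \<open>An inequality between measures extends to integrals, by induction on the integrand.\<close>

lemma nn_integral_le_of_emeasure_le:
  assumes h: "h \<in> borel_measurable borel" and s: "sets \<mu> = sets borel" "sets \<nu> = sets borel"
    and le: "\<And>S. S \<in> sets borel \<Longrightarrow> emeasure \<mu> S \<le> C * emeasure \<nu> S"
  shows "(\<integral>\<^sup>+x. h x \<partial>\<mu>) \<le> C * (\<integral>\<^sup>+x. h x \<partial>\<nu>)"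
proof -
  have m: "f \<in> borel_measurable \<mu>" "f \<in> borel_measurable \<nu>" if "f \<in> borel_measurable borel" for f :: "_ \<Rightarrow> ennreal"
    using that s by (simp_all cong: measurable_cong_sets)
  show ?thesis using h
  proof (induction rule: borel_measurable_induct)
    case (cong f g)
    then show ?case by (simp cong: nn_integral_cong)
  next
    case (set A)
    then show ?case using le s by simp
  next
    case (mult u c)
    have "c * (\<integral>\<^sup>+x. u x \<partial>\<mu>) \<le> c * (C * (\<integral>\<^sup>+x. u x \<partial>\<nu>))" by (intro mult_left_mono mult) simp
    then show ?case using m[OF mult(2)] by (simp add: nn_integral_cmult mult.left_commute)
  next
    case (add u v)
    have "(\<integral>\<^sup>+x. v x \<partial>\<mu>) + (\<integral>\<^sup>+x. u x \<partial>\<mu>) \<le> C * (\<integral>\<^sup>+x. v x \<partial>\<nu>) + C * (\<integral>\<^sup>+x. u x \<partial>\<nu>)"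
      by (intro add_mono add)
    moreover have u: "u \<in> borel_measurable borel" and v: "v \<in> borel_measurable borel" by (fact add)+
    ultimately show ?case
      by (subst (1 2) nn_integral_add) (rule m[OF u] m[OF v] | simp add: distrib_left)+
  next
    case (seq U)
    have i: "incseq U" by (rule seq)
    have mU: "U i \<in> borel_measurable \<mu>" "U i \<in> borel_measurable \<nu>" for i
      by (rule m, rule seq)+
    have "(\<integral>\<^sup>+x. (SUP i. U i) x \<partial>\<mu>) = (SUP i. \<integral>\<^sup>+x. U i x \<partial>\<mu>)"
      unfolding SUP_apply by (rule nn_integral_monotone_convergence_SUP[OF i mU(1)])
    also have "\<dots> \<le> (SUP i. C * (\<integral>\<^sup>+x. U i x \<partial>\<nu>))" by (rule SUP_mono') (rule seq)
    also have "\<dots> = C * (SUP i. \<integral>\<^sup>+x. U i x \<partial>\<nu>)" by (rule SUP_mult_left_ennreal[symmetric])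
    also have "(SUP i. \<integral>\<^sup>+x. U i x \<partial>\<nu>) = (\<integral>\<^sup>+x. (SUP i. U i) x \<partial>\<nu>)"
      unfolding SUP_apply by (rule nn_integral_monotone_convergence_SUP[OF i mU(2), symmetric])
    finally show ?case .
  qed
qed

context cd_space begin

text \<open>Contracting the ball of radius \<open>2r\<close> by the factor one half.\<close>

lemma measure_ball_double:
  assumes r: "0 < r"
  shows "measure m (ball x (2 * r)) \<le> 2 powr N * cosh (curv * r) powr (N - 1) * measure m (ball x r)"
proof -
  have c: "0 < cosh (curv * r)" by (rule cosh_real_pos)
  have "ennreal ((1 - 1/2) powr N * sinh_ratio (1 - 1/2) (curv * (2 * r)) powr (N - 1)) * emeasure m (ball x (2 * r))
      \<le> emeasure m (ball x r)"
    by (rule brunn_minkowski_point) (auto simp: dist_commute)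
  also have "(1 - 1/2) powr N * sinh_ratio (1 - 1/2) (curv * (2 * r)) powr (N - 1)
      = 1 / (2 powr N * cosh (curv * r) powr (N - 1))"
    using sinh_ratio_half[of "curv * (2 * r)"] curv_nonneg r c by (simp add: powr_divide)
  finally have "ennreal (1 / (2 powr N * cosh (curv * r) powr (N - 1)) * measure m (ball x (2 * r)))
      \<le> ennreal (measure m (ball x r))"
    unfolding emeasure_ball using c by (subst ennreal_mult) auto
  then have "1 / (2 powr N * cosh (curv * r) powr (N - 1)) * measure m (ball x (2 * r)) \<le> measure m (ball x r)"
    by simp
  then show ?thesis using c by (simp add: pos_divide_le_eq mult.commute)
qed

text \<open>The contraction of a fixed large ball towards \<open>y\<close> lies in the small ball around \<open>y\<close>, so its measure is bounded below uniformly.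
  This is the source of all compactness below.\<close>

lemma measure_ball_lower_bound:
  assumes e: "0 < e" and R: "0 < R"
  obtains c where "0 < c" "\<And>y. y \<in> cball x R \<Longrightarrow> c \<le> measure m (ball y e)"
proof -
  define D where "D = 2 * R + 1"
  define s where "s = min (1/2) (e / D)"
  have D: "0 < D" using R by (simp add: D_def)
  have s: "0 < s" "s < 1" "s * D \<le> e"
    using e D by (auto simp: s_def min_def field_simps)
  define b where "b = s powr N * sinh_ratio s (curv * D) powr (N - 1)"
  have b: "0 < b" using s D curv_nonneg sinh_ratio_pos[of s "curv * D"] by (simp add: b_def)
  show ?thesis
  proof (rule that)
    show "0 < b * measure m (ball x (R + 1))" using b measure_ball_pos[of "R + 1" x] R by simp
    fix y assume y: "y \<in> cball x R"
    have "ennreal ((1 - (1 - s)) powr N * sinh_ratio (1 - (1 - s)) (curv * D) powr (N - 1)) * emeasure m (ball x (R + 1))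
        \<le> emeasure m (ball y e)"
    proof (rule brunn_minkowski_point)
      show sub: "ball x (R + 1) \<subseteq> ball y D"
      proof
        fix z assume "z \<in> ball x (R + 1)"
        then show "z \<in> ball y D" using y dist_triangle[of y z x] by (auto simp: D_def dist_commute)
      qed
      fix z p assume z: "z \<in> ball x (R + 1)" and p: "dist p y = (1 - (1 - s)) * dist z y"
      have "dist z y < D" using sub z by (auto simp: dist_commute)
      then have "s * dist z y < s * D" using s by (intro mult_strict_left_mono)
      moreover have "dist p y = s * dist z y" using p by simp
      ultimately have "dist p y < e" using s(3) by linarith
      then show "p \<in> ball y e" by (simp add: dist_commute)
    qed (use s in auto)
    then have "ennreal (b * measure m (ball x (R + 1))) \<le> ennreal (measure m (ball y e))"
      unfolding emeasure_ball using b by (simp add: b_def ennreal_mult)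
    then show "b * measure m (ball x (R + 1)) \<le> measure m (ball y e)" by simp
  qed
qed

lemma finite_net:
  fixes x :: 'a
  assumes e: "0 < e" and R: "0 < R"
  obtains F where "finite F" "cball x R \<subseteq> (\<Union>y\<in>F. ball y e)"
proof -
  obtain c where c: "0 < c" "\<And>y. y \<in> cball x R \<Longrightarrow> c \<le> measure m (ball y (e / 2))"
    using measure_ball_lower_bound[of "e/2" R x] e R by auto
  define P where "P F \<longleftrightarrow> finite F \<and> F \<subseteq> cball x R \<and> (\<forall>y\<in>F. \<forall>z\<in>F. y \<noteq> z \<longrightarrow> e \<le> dist y z)" for F
  define M where "M = measure m (ball x (R + e)) / c"
  have bound: "real (card F) \<le> M" if F: "P F" for F
  proof -
    have disj: "disjoint_family_on (\<lambda>y. ball y (e/2)) F"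
      unfolding disjoint_family_on_def
    proof (intro ballI impI, rule ccontr)
      fix y z assume yz: "y \<in> F" "z \<in> F" "y \<noteq> z" "ball y (e/2) \<inter> ball z (e/2) \<noteq> {}"
      then obtain p where "dist y p < e/2" "dist z p < e/2" by auto
      then have "dist y z < e" using dist_triangle2[of y z p] by linarith
      then show False using F yz by (force simp: P_def)
    qed
    have "real (card F) * c = (\<Sum>y\<in>F. c)" by simp
    also have "\<dots> \<le> (\<Sum>y\<in>F. measure m (ball y (e/2)))"
      using F c by (intro sum_mono) (auto simp: P_def)
    also have "\<dots> = measure m (\<Union>y\<in>F. ball y (e/2))"
      using F disj emeasure_ball_finite by (intro measure_finite_Union[symmetric]) (auto simp: P_def less_top)
    also have "\<dots> \<le> measure m (ball x (R + e))"
    proof (rule measure_mono_fmeasurable)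
      show "(\<Union>y\<in>F. ball y (e/2)) \<subseteq> ball x (R + e)"
      proof
        fix p assume "p \<in> (\<Union>y\<in>F. ball y (e/2))"
        then obtain y where "y \<in> F" "dist y p < e/2" by auto
        then have "dist x y \<le> R" using F by (auto simp: P_def)
        then show "p \<in> ball x (R + e)" using \<open>dist y p < e/2\<close> dist_triangle[of x p y] e by auto
      qed
      show "(\<Union>y\<in>F. ball y (e/2)) \<in> sets m" using F by (auto simp: P_def)
      show "ball x (R + e) \<in> fmeasurable m" using emeasure_ball_finite by (auto simp: fmeasurable_def)
    qed
    finally show ?thesis using c by (simp add: M_def pos_le_divide_eq)
  qed
  have "P {}" by (simp add: P_def)
  have cb: "card F < nat \<lceil>M\<rceil> + 1" if "P F" for F using bound[OF that] by linarith
  obtain F where F: "P F" "\<And>G. P G \<Longrightarrow> card G \<le> card F"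
    using ex_has_greatest_nat[of P "{}" card "nat \<lceil>M\<rceil> + 1"] \<open>P {}\<close> cb by blast
  have "cball x R \<subseteq> (\<Union>y\<in>F. ball y e)"
  proof (rule ccontr)
    assume "\<not> ?thesis"
    then obtain z where z: "z \<in> cball x R" "\<And>y. y \<in> F \<Longrightarrow> e \<le> dist y z" by force
    then have "z \<notin> F" using e by force
    have "P (insert z F)" using F(1) z by (auto simp: P_def dist_commute)
    then have "card (insert z F) \<le> card F" by (rule F(2))
    then show False using \<open>z \<notin> F\<close> F(1) by (simp add: P_def)
  qed
  then show ?thesis using that F(1) by (auto simp: P_def)
qed

lemma compact_cball: "compact (cball x R :: 'a set)"
proof -
  have "\<exists>k. finite k \<and> cball x R \<subseteq> (\<Union>y\<in>k. ball y e)" if "0 < e" for e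
  proof -
    have "cball x R \<subseteq> cball x (max R 1)" by auto
    then show ?thesis using finite_net[of e "max R 1" x] that by (metis less_max_iff_disj order_trans zero_less_one)
  qed
  then show ?thesis by (simp add: compact_eq_totally_bounded complete_eq_closed)
qed

lemma countable_dense: "\<exists>D::'a set. countable D \<and> (\<forall>x. \<forall>e>0. \<exists>d\<in>D. dist d x < e)"
proof -
  obtain x0 :: 'a where True by blast
  have "\<exists>F. finite F \<and> cball x0 (real (Suc n)) \<subseteq> (\<Union>y\<in>F. ball y (1 / real (Suc k)))" for n k
    using finite_net[of "1 / real (Suc k)" "real (Suc n)" x0] by (metis divide_pos_pos of_nat_0_less_iff zero_less_Suc zero_less_one)
  then obtain F where F: "\<And>n k. finite (F n k)" "\<And>n k. cball x0 (real (Suc n)) \<subseteq> (\<Union>y\<in>F n k. ball y (1 / real (Suc k)))"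
    by metis
  show ?thesis
  proof (intro exI[of _ "\<Union>n k. F n k"] conjI allI impI)
    show "countable (\<Union>n k. F n k)" using F(1) by (intro countable_UN) (auto intro: countable_finite)
    fix x :: 'a and e :: real assume "0 < e"
    obtain n where n: "dist x0 x \<le> real (Suc n)"
      using real_arch_simple[of "dist x0 x"] by (metis of_nat_Suc add_increasing zero_le_one order_trans le_add_same_cancel2 of_nat_0_le_iff le_add_same_cancel1 add.commute)
    obtain k where k: "1 / real (Suc k) < e" using \<open>0 < e\<close> nat_approx_posE by blast
    have "x \<in> cball x0 (real (Suc n))" using n by simp
    then obtain d where "d \<in> F n k" "dist d x < 1 / real (Suc k)" using F(2)[of n k] by auto
    then show "\<exists>d\<in>\<Union>n k. F n k. dist d x < e" using k by (auto intro: less_trans)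
  qed
qed

lemma sets_borel_prod: "sets (borel :: ('a \<times> 'a) measure) = sets (borel \<Otimes>\<^sub>M borel)"
proof
  show "sets (borel \<Otimes>\<^sub>M borel) \<subseteq> sets (borel :: ('a \<times> 'a) measure)"
    using sets.sigma_sets_subset[of "{a \<times> b |a b. a \<in> sets borel \<and> b \<in> sets borel}" "borel :: ('a \<times> 'a) measure"]
    by (auto simp: sets_pair_measure intro: borel_Times)
  obtain D :: "'a set" where D: "countable D" "\<And>x e. 0 < e \<Longrightarrow> \<exists>d\<in>D. dist d x < e"
    using countable_dense by blast
  have "U \<in> sets (borel \<Otimes>\<^sub>M borel)" if U: "open U" for U :: "('a \<times> 'a) set"
  proof -
    define I where "I = {(d, d', n::nat). d \<in> D \<and> d' \<in> D \<and> ball d (1 / Suc n) \<times> ball d' (1 / Suc n) \<subseteq> U}"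
    have "countable I"
      by (rule countable_subset[of _ "D \<times> D \<times> UNIV"]) (use D(1) in \<open>auto simp: I_def\<close>)
    moreover have "U = (\<Union>(d, d', n)\<in>I. ball d (1 / Suc n) \<times> ball d' (1 / Suc n))"
    proof (intro equalityI subsetI)
      fix z assume "z \<in> U"
      then obtain A B where AB: "open A" "open B" "z \<in> A \<times> B" "A \<times> B \<subseteq> U" using open_prod_elim[OF U] by blast
      obtain a b where z: "z = (a, b)" by (cases z)
      obtain e1 where e1: "0 < e1" "ball a e1 \<subseteq> A" using AB z by (meson mem_Sigma_iff openE)
      obtain e2 where e2: "0 < e2" "ball b e2 \<subseteq> B" using AB z by (meson mem_Sigma_iff openE)
      obtain n where n: "1 / real (Suc n) < min e1 e2 / 2" using nat_approx_posE[of "min e1 e2 / 2"] e1 e2 by auto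
      obtain d where d: "d \<in> D" "dist d a < 1 / Suc n" using D(2)[of "1 / Suc n" a] by auto
      obtain d' where d': "d' \<in> D" "dist d' b < 1 / Suc n" using D(2)[of "1 / Suc n" b] by auto
      have "ball d (1 / Suc n) \<subseteq> ball a e1"
      proof
        fix p assume "p \<in> ball d (1 / Suc n)"
        then show "p \<in> ball a e1" using d n dist_triangle[of a p d] by (auto simp: dist_commute)
      qed
      moreover have "ball d' (1 / Suc n) \<subseteq> ball b e2"
      proof
        fix p assume "p \<in> ball d' (1 / Suc n)"
        then show "p \<in> ball b e2" using d' n dist_triangle[of b p d'] by (auto simp: dist_commute)
      qed
      ultimately have "(d, d', n) \<in> I" using d d' e1 e2 AB unfolding I_def by blast
      then show "z \<in> (\<Union>(d, d', n)\<in>I. ball d (1 / Suc n) \<times> ball d' (1 / Suc n))"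
        using d d' z by (intro UN_I[of "(d, d', n)"]) auto
    qed (auto simp: I_def)
    moreover have "(\<Union>(d, d', n)\<in>I. ball d (1 / Suc n) \<times> ball d' (1 / Suc n)) \<in> sets (borel \<Otimes>\<^sub>M borel)"
      using \<open>countable I\<close> by (intro sets.countable_UN') auto
    ultimately show ?thesis by simp
  qed
  then have "{U. open U} \<subseteq> sets (borel \<Otimes>\<^sub>M borel :: ('a \<times> 'a) measure)" by auto
  from sets.sigma_sets_subset[OF this] show "sets (borel :: ('a \<times> 'a) measure) \<subseteq> sets (borel \<Otimes>\<^sub>M borel)"
    by (subst borel_def) (simp add: space_pair_measure)
qed

end

section \<open>Optimal plans with bounded intermediate densities\<close>

lemma AE_density_pos:
  assumes ld: "lebesgue_decomposition m \<mu> \<rho> \<nu>" and sm: "sets m = sets borel" "sets \<mu> = sets borel"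
    and AE: "AE y in \<mu>. P y"
  shows "AE y in m. 0 < \<rho> y \<longrightarrow> P y"
proof -
  obtain Z where Z: "{y \<in> space \<mu>. \<not> P y} \<subseteq> Z" "Z \<in> sets \<mu>" "emeasure \<mu> Z = 0"
    using AE by (auto elim!: AE_E)
  have sp: "space \<mu> = UNIV" using sets_eq_imp_space_eq[OF sm(2)] by simp
  have \<rho>: "\<rho> \<in> borel_measurable m"
    using ld sm by (auto simp: lebesgue_decomposition_def cong: measurable_cong_sets)
  have Zb: "Z \<in> sets borel" "Z \<in> sets m" using Z sm by auto
  have "emeasure \<mu> Z = (\<integral>\<^sup>+x\<in>Z. ennreal (\<rho> x) \<partial>m) + emeasure \<nu> Z"
    using ld Zb unfolding lebesgue_decomposition_def by blast
  then have "(\<integral>\<^sup>+x\<in>Z. ennreal (\<rho> x) \<partial>m) = 0" using Z(3) by simp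
  then have "AE x in m. ennreal (\<rho> x) * indicator Z x = 0"
    using \<rho> Zb by (subst (asm) nn_integral_0_iff_AE) auto
  then show ?thesis
  proof (rule AE_mp, intro AE_I2 impI)
    fix x assume h: "ennreal (\<rho> x) * indicator Z x = 0" "0 < \<rho> x"
    then have "x \<notin> Z" by (auto simp: indicator_def ennreal_eq_0_iff split: if_splits)
    then show "P x" using Z(1) sp by blast
  qed
qed

text \<open>Geodesics on \<open>[0,1]\<close> extended by constants, as in \<open>Geo\<close>, but as plain functions.\<close>

definition geod :: "(real \<Rightarrow> 'a::metric_space) \<Rightarrow> bool" where
  "geod \<gamma> \<longleftrightarrow> geodesic_on_unit_interval \<gamma> \<and> (\<forall>t. \<gamma> t = \<gamma> (max 0 (min 1 t)))"

lemma geod_dist: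
  assumes "geod \<gamma>" "s \<in> {0..1}" "t \<in> {0..1}"
  shows "dist (\<gamma> s) (\<gamma> t) = \<bar>s - t\<bar> * dist (\<gamma> 0) (\<gamma> 1)"
  using assms by (intro geodesic_dist) (auto simp: geod_def)

lemma geod_lipschitz:
  assumes "geod \<gamma>" shows "dist (\<gamma> s) (\<gamma> t) \<le> dist (\<gamma> 0) (\<gamma> 1) * \<bar>s - t\<bar>"
proof -
  have c: "\<gamma> u = \<gamma> (max 0 (min 1 u))" for u using assms unfolding geod_def by blast
  have "dist (\<gamma> s) (\<gamma> t) = \<bar>max 0 (min 1 s) - max 0 (min 1 t)\<bar> * dist (\<gamma> 0) (\<gamma> 1)"
    by (subst c[of s], subst c[of t], rule geod_dist[OF assms]) auto
  also have "\<dots> \<le> \<bar>s - t\<bar> * dist (\<gamma> 0) (\<gamma> 1)" by (intro mult_right_mono) auto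
  finally show ?thesis by (simp add: mult.commute)
qed

lemma geod_continuous:
  assumes "geod \<gamma>" shows "continuous_on A \<gamma>"
proof -
  have "(dist (\<gamma> 0) (\<gamma> 1))-lipschitz_on A \<gamma>"
    using geod_lipschitz[OF assms] by (intro lipschitz_onI) (auto simp: dist_real_def)
  then show ?thesis by (rule lipschitz_on_continuous_on)
qed

lemma geod_of_Geo: "\<gamma> \<in> Geo \<Longrightarrow> geod (apply_bcontfun \<gamma>)"
  unfolding geod_def using GeoD by blast

text \<open>The upper gradient inequality for geodesics only. This is all that the transport arguments need, and it is stable
  under truncation of the function.\<close>

definition geo_gradient :: "('a::metric_space \<Rightarrow> ennreal) \<Rightarrow> ('a \<Rightarrow> real) \<Rightarrow> bool" where
  "geo_gradient h v \<longleftrightarrow> h \<in> borel_measurable borel \<and>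
     (\<forall>\<gamma>. geod \<gamma> \<longrightarrow> ennreal \<bar>v (\<gamma> 0) - v (\<gamma> 1)\<bar>
        \<le> ennreal (dist (\<gamma> 0) (\<gamma> 1)) * (\<integral>\<^sup>+t\<in>{0..1}. h (\<gamma> t) \<partial>lborel))"

lemma measurable_eval_joint:
  assumes "\<pi> \<in> geo_probs"
  shows "(\<lambda>(\<gamma>, t). apply_bcontfun \<gamma> t) \<in> \<pi> \<Otimes>\<^sub>M lborel \<rightarrow>\<^sub>M (borel :: 'a::metric_space measure)"
proof (rule borel_measurable_LIMSEQ_metric)
  define a where "a n t = real_of_int \<lfloor>real (Suc n) * t\<rfloor> / real (Suc n)" for n and t :: real
  show "(\<lambda>(\<gamma>, t). apply_bcontfun \<gamma> (a n t)) \<in> \<pi> \<Otimes>\<^sub>M lborel \<rightarrow>\<^sub>M borel" for n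
  proof -
    have "(\<lambda>p. (\<lambda>(i::int) p. apply_bcontfun (fst p) (real_of_int i / real (Suc n))) \<lfloor>real (Suc n) * snd p\<rfloor> p)
        \<in> \<pi> \<Otimes>\<^sub>M lborel \<rightarrow>\<^sub>M borel"
    proof (rule measurable_compose_countable[where f = "\<lambda>(i::int) p. apply_bcontfun (fst p) (real_of_int i / real (Suc n))"])
      show "(\<lambda>p. apply_bcontfun (fst p) (real_of_int i / real (Suc n))) \<in> \<pi> \<Otimes>\<^sub>M lborel \<rightarrow>\<^sub>M borel" for i :: int
        by (rule measurable_compose[OF measurable_fst geo_probsD(4)[OF assms]])
      show "(\<lambda>p. \<lfloor>real (Suc n) * snd p\<rfloor>) \<in> \<pi> \<Otimes>\<^sub>M lborel \<rightarrow>\<^sub>M count_space UNIV" by measurable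
    qed
    then show ?thesis by (simp add: a_def split_beta)
  qed
  fix p :: "(real \<Rightarrow>\<^sub>C 'a) \<times> real"
  obtain \<gamma> t where p: "p = (\<gamma>, t)" by (cases p)
  have "(\<lambda>n. a n t) \<longlonglongrightarrow> t"
  proof (rule LIMSEQ_I)
    fix e :: real assume "0 < e"
    then obtain n0 where n0: "1 / real (Suc n0) < e" using nat_approx_posE by blast
    have "norm (a n t - t) < e" if "n \<ge> n0" for n
    proof -
      have "a n t - t = (real_of_int \<lfloor>real (Suc n) * t\<rfloor> - real (Suc n) * t) / real (Suc n)"
        by (simp add: a_def diff_divide_distrib)
      moreover have "\<bar>real_of_int \<lfloor>real (Suc n) * t\<rfloor> - real (Suc n) * t\<bar> \<le> 1" by linarith
      ultimately have "\<bar>a n t - t\<bar> \<le> 1 / real (Suc n)"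
        by (simp only: abs_divide abs_of_nat) (intro divide_right_mono, auto)
      also have "\<dots> \<le> 1 / real (Suc n0)" using that by (intro divide_left_mono) auto
      finally show ?thesis using n0 by simp
    qed
    then show "\<exists>no. \<forall>n\<ge>no. norm (a n t - t) < e" by blast
  qed
  moreover have "isCont (apply_bcontfun \<gamma>) t"
    using continuous_on_apply_bcontfun[of UNIV \<gamma>] by (simp add: continuous_on_eq_continuous_at del: continuous_on_apply_bcontfun)
  ultimately show "(\<lambda>n. case p of (\<gamma>, t) \<Rightarrow> apply_bcontfun \<gamma> (a n t)) \<longlonglongrightarrow> (case p of (\<gamma>, t) \<Rightarrow> apply_bcontfun \<gamma> t)"
    unfolding p prod.case by (rule isCont_tendsto_compose[rotated])
qed

context cd_space begin

lemma AE_kernel_dist: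
  assumes dis: "disintegrates \<sigma> \<mu> \<kappa>" and s: "sets \<mu> = sets borel"
    and \<sigma>: "emeasure \<sigma> {(y, z). D \<le> dist y z} = 0"
  shows "AE y in \<mu>. AE z in \<kappa> y. dist y (z::'a) < D"
proof -
  have cl: "closed {p :: 'a \<times> 'a. D \<le> dist (fst p) (snd p)}"
    by (intro closed_Collect_le continuous_intros)
  have eq: "{(y, z :: 'a). D \<le> dist y z} = {p. D \<le> dist (fst p) (snd p)}" by auto
  have b: "{(y, z :: 'a). D \<le> dist y z} \<in> sets borel" using cl by (simp add: eq borel_closed)
  have "(\<integral>\<^sup>+y. emeasure (\<kappa> y) {z. D \<le> dist y z} \<partial>\<mu>) = 0"
    using disintegratesD(3)[OF dis b] \<sigma> by simp
  moreover have "(\<lambda>y. emeasure (\<kappa> y) {z. D \<le> dist y z}) \<in> borel_measurable \<mu>"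
  proof -
    have "(SIGMA y:space (borel :: 'a measure). {z. D \<le> dist y z}) \<in> sets (borel \<Otimes>\<^sub>M borel)"
    proof -
      have "(SIGMA y:space (borel :: 'a measure). {z. D \<le> dist y z}) = {(y, z :: 'a). D \<le> dist y z}" by auto
      then show ?thesis using b[unfolded sets_borel_prod] by (simp only:)
    qed
    from emeasure_measurable_subprob_algebra2[OF this disintegratesD(4)[OF dis]]
    show ?thesis using s by (simp cong: measurable_cong_sets)
  qed
  ultimately have "AE y in \<mu>. emeasure (\<kappa> y) {z. D \<le> dist y z} = 0"
    by (subst (asm) nn_integral_0_iff_AE) auto
  then show ?thesis
  proof eventually_elim
    case (elim y)
    note h = elim
    have "closed {z. D \<le> dist y z}" by (intro closed_Collect_le continuous_intros)
    then show ?case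
      using h disintegratesD(2)[OF dis, of y] by (intro AE_I[of _ _ "{z. D \<le> dist y z}"]) auto
  qed
qed

definition contr :: "real \<Rightarrow> real \<Rightarrow> real" where
  "contr D t = sinh_ratio t (curv * D) powr (N - 1)"

lemma contr_pos: "0 < t \<Longrightarrow> 0 \<le> D \<Longrightarrow> 0 < contr D t"
  using sinh_ratio_pos[of t "curv * D"] curv_nonneg by (simp add: contr_def)

lemma W2_finite_bounded:
  fixes x :: 'a
  assumes \<mu>: "\<mu>\<^sub>0 \<in> borel_probs" "\<mu>\<^sub>1 \<in> borel_probs"
    and s: "AE y in \<mu>\<^sub>0. y \<in> ball x R\<^sub>0" "AE y in \<mu>\<^sub>1. y \<in> ball x R\<^sub>1"
  shows "W2 \<mu>\<^sub>0 \<mu>\<^sub>1 < \<infinity>"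
proof -
  have p0: "prob_space \<mu>\<^sub>0" and s0: "sets \<mu>\<^sub>0 = sets borel" and p1: "prob_space \<mu>\<^sub>1" and s1: "sets \<mu>\<^sub>1 = sets borel"
    using \<mu> by (auto simp: borel_probs_def)
  interpret P0: prob_space \<mu>\<^sub>0 by fact
  interpret P1: prob_space \<mu>\<^sub>1 by fact
  interpret pair_prob_space \<mu>\<^sub>0 \<mu>\<^sub>1 ..
  let ?\<sigma> = "\<mu>\<^sub>0 \<Otimes>\<^sub>M \<mu>\<^sub>1"
  have ss: "sets ?\<sigma> = sets borel" using sets_pair_measure_cong[OF s0 s1] sets_borel_prod by simp
  have "distr ?\<sigma> borel fst = distr ?\<sigma> \<mu>\<^sub>0 fst" "distr ?\<sigma> borel snd = distr ?\<sigma> \<mu>\<^sub>1 snd"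
    using s0 s1 by (auto intro!: distr_cong)
  moreover have "distr ?\<sigma> \<mu>\<^sub>0 fst = \<mu>\<^sub>0" by (rule P1.distr_pair_fst)
  moreover have "distr ?\<sigma> \<mu>\<^sub>1 snd = \<mu>\<^sub>1"
  proof (rule measure_eqI)
    fix B assume "B \<in> sets (distr ?\<sigma> \<mu>\<^sub>1 snd)"
    then have B: "B \<in> sets \<mu>\<^sub>1" by simp
    have "emeasure (distr ?\<sigma> \<mu>\<^sub>1 snd) B = emeasure ?\<sigma> (space \<mu>\<^sub>0 \<times> B)"
      using B sets.sets_into_space[OF B]
      by (auto simp: emeasure_distr space_pair_measure intro!: arg_cong2[where f = emeasure])
    also have "\<dots> = emeasure \<mu>\<^sub>1 B"
      using B by (subst P1.emeasure_pair_measure_Times) (auto simp: P0.emeasure_space_1)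
    finally show "emeasure (distr ?\<sigma> \<mu>\<^sub>1 snd) B = emeasure \<mu>\<^sub>1 B" .
  qed simp
  ultimately have c: "?\<sigma> \<in> couplings \<mu>\<^sub>0 \<mu>\<^sub>1"
    using ss prob_space_axioms by (simp add: couplings_def borel_probs_def)
  have dm: "(\<lambda>(y, z). ennreal ((dist y z)\<^sup>2)) \<in> borel_measurable (borel :: ('a \<times> 'a) measure)"
    unfolding split_beta by (intro measurable_compose[OF _ measurable_ennreal] borel_measurable_continuous_onI continuous_intros)
  have dm': "(\<lambda>(y, z). ennreal ((dist y z)\<^sup>2)) \<in> borel_measurable ?\<sigma>"
    by (subst measurable_cong_sets[OF ss refl]) (rule dm)
  have "(\<integral>\<^sup>+p. (\<lambda>(y, z). ennreal ((dist y z)\<^sup>2)) p \<partial>?\<sigma>) = (\<integral>\<^sup>+y. \<integral>\<^sup>+z. ennreal ((dist y z)\<^sup>2) \<partial>\<mu>\<^sub>1 \<partial>\<mu>\<^sub>0)"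
    using P1.nn_integral_fst[OF dm'] by simp
  also have "\<dots> \<le> (\<integral>\<^sup>+y. \<integral>\<^sup>+z. ennreal ((R\<^sub>0 + R\<^sub>1)\<^sup>2) \<partial>\<mu>\<^sub>1 \<partial>\<mu>\<^sub>0)"
  proof (rule nn_integral_mono_AE, rule AE_mp[OF s(1)], intro AE_I2 impI)
    fix y assume y: "y \<in> ball x R\<^sub>0"
    show "(\<integral>\<^sup>+z. ennreal ((dist y z)\<^sup>2) \<partial>\<mu>\<^sub>1) \<le> (\<integral>\<^sup>+z. ennreal ((R\<^sub>0 + R\<^sub>1)\<^sup>2) \<partial>\<mu>\<^sub>1)"
    proof (rule nn_integral_mono_AE, rule AE_mp[OF s(2)], intro AE_I2 impI)
      fix z assume z: "z \<in> ball x R\<^sub>1"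
      then have "dist y z \<le> R\<^sub>0 + R\<^sub>1" using y dist_triangle3[of y z x] by auto
      then show "ennreal ((dist y z)\<^sup>2) \<le> ennreal ((R\<^sub>0 + R\<^sub>1)\<^sup>2)" by (intro ennreal_leI power_mono) auto
    qed
  qed
  also have "\<dots> < \<infinity>" by (simp add: P0.emeasure_space_1 P1.emeasure_space_1)
  finally show ?thesis using W2_finite_of_coupling[OF c] by simp
qed

text \<open>At the threshold \<open>max (A / contr D (1 - t)) (B / contr D t)\<close> the right-hand side of the convexity inequality vanishes.
  Hence so does the excess of the intermediate measure over this threshold, and it has no singular part. The same plan works for all \<open>t\<close>.\<close>

theorem bounded_density_plan:
  fixes x :: 'a
  assumes \<mu>: "\<mu>\<^sub>0 \<in> borel_probs" "\<mu>\<^sub>1 \<in> borel_probs"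
    and s: "AE y in \<mu>\<^sub>0. y \<in> ball x R\<^sub>0" "AE y in \<mu>\<^sub>1. y \<in> ball x R\<^sub>1"
    and A: "0 < A" "\<And>S. S \<in> sets borel \<Longrightarrow> emeasure \<mu>\<^sub>0 S \<le> ennreal A * emeasure m S"
    and B: "0 < B" "\<And>S. S \<in> sets borel \<Longrightarrow> emeasure \<mu>\<^sub>1 S \<le> ennreal B * emeasure m S"
    and D: "0 < R\<^sub>0" "0 < R\<^sub>1" "D = R\<^sub>0 + R\<^sub>1"
  obtains \<pi> where "\<pi> \<in> GeoOpt \<mu>\<^sub>0 \<mu>\<^sub>1"
    "\<And>t S. 0 < t \<Longrightarrow> t < 1 \<Longrightarrow> S \<in> sets borel \<Longrightarrow>
      emeasure (eval_push t \<pi>) S \<le> ennreal (max (A / contr D (1 - t)) (B / contr D t)) * emeasure m S"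
proof -
  from CD_excess[OF \<mu> W2_finite_bounded[OF \<mu> s]]
  obtain \<pi> \<kappa>\<^sub>0 \<kappa>\<^sub>1 where \<pi>: "\<pi> \<in> GeoOpt \<mu>\<^sub>0 \<mu>\<^sub>1"
    and \<kappa>0: "disintegrates (endpoint_push \<pi>) \<mu>\<^sub>0 \<kappa>\<^sub>0"
    and \<kappa>1: "disintegrates (distr (endpoint_push \<pi>) borel prod.swap) \<mu>\<^sub>1 \<kappa>\<^sub>1"
    and ineq: "\<And>k t. 0 < k \<Longrightarrow> 0 \<le> t \<Longrightarrow> t \<le> 1 \<Longrightarrow>
      (\<integral>\<^sup>+x. ennreal (excess_fun N k (ac_density m (eval_push t \<pi>) x)) \<partial>m)
         + ennreal (k * measure (singular_part m (eval_push t \<pi>)) UNIV)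
      \<le> ennreal (1 - t) * distorted_integral k (1 - t) (ac_density m \<mu>\<^sub>0) \<kappa>\<^sub>0
        + ennreal t * distorted_integral k t (ac_density m \<mu>\<^sub>1) \<kappa>\<^sub>1
        + ennreal (k * ((1 - t) * measure (singular_part m \<mu>\<^sub>0) UNIV + t * measure (singular_part m \<mu>\<^sub>1) UNIV))"
    by blast
  note g = GeoOptD[OF \<pi>]
  note gp = geo_probsD[OF g(1)]
  interpret \<pi>: prob_space \<pi> by (rule gp)
  have s0: "sets \<mu>\<^sub>0 = sets borel" and s1: "sets \<mu>\<^sub>1 = sets borel" using \<mu> by (auto simp: borel_probs_def)
  have end0: "AE \<gamma> in \<pi>. apply_bcontfun \<gamma> 0 \<in> ball x R\<^sub>0"
    using s(1) by (intro AE_eval_push[OF g(1), where t = 0 and P = "\<lambda>y. y \<in> ball x R\<^sub>0"]) (simp only: g(2))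
  have end1: "AE \<gamma> in \<pi>. apply_bcontfun \<gamma> 1 \<in> ball x R\<^sub>1"
    using s(2) by (intro AE_eval_push[OF g(1), where t = 1 and P = "\<lambda>y. y \<in> ball x R\<^sub>1"]) (simp only: g(3))
  have dlt: "AE \<gamma> in \<pi>. dist (apply_bcontfun \<gamma> 0) (apply_bcontfun \<gamma> 1) < D"
    using end0 end1
  proof eventually_elim
    case (elim \<gamma>)
    then show ?case using dist_triangle3[of "apply_bcontfun \<gamma> 0" "apply_bcontfun \<gamma> 1" x] D by auto
  qed
  have eq: "{(y, z :: 'a). D \<le> dist y z} = {p. D \<le> dist (fst p) (snd p)}" by auto
  have "closed {p :: 'a \<times> 'a. D \<le> dist (fst p) (snd p)}"
    by (intro closed_Collect_le continuous_intros)
  then have b: "{(y, z :: 'a). D \<le> dist y z} \<in> sets borel" by (simp add: eq borel_closed)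
  have \<sigma>0: "emeasure (endpoint_push \<pi>) {(y, z). D \<le> dist y z} = 0"
  proof -
    have "emeasure (endpoint_push \<pi>) {(y, z). D \<le> dist y z} =
        emeasure \<pi> ((\<lambda>\<gamma>. (apply_bcontfun \<gamma> 0, apply_bcontfun \<gamma> 1)) -` {(y, z). D \<le> dist y z} \<inter> space \<pi>)"
      unfolding endpoint_push_def using gp(5) b by (subst emeasure_distr) auto
    also have "\<dots> = 0"
      using dlt measurable_sets[OF gp(5) b]
      by (subst (asm) AE_iff_measurable[OF _ refl]) (auto simp: vimage_def Int_def conj_commute not_less)
    finally show ?thesis .
  qed
  have \<sigma>1: "emeasure (distr (endpoint_push \<pi>) borel prod.swap) {(y, z). D \<le> dist y z} = 0"
  proof -
    have "prod.swap \<in> (borel :: ('a \<times> 'a) measure) \<rightarrow>\<^sub>M borel"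
      unfolding prod.swap_def by (intro borel_measurable_continuous_onI continuous_intros)
    then have "prod.swap \<in> endpoint_push \<pi> \<rightarrow>\<^sub>M borel" by (simp add: endpoint_push_def)
    then have "emeasure (distr (endpoint_push \<pi>) borel prod.swap) {(y, z). D \<le> dist y z}
        = emeasure (endpoint_push \<pi>) (prod.swap -` {(y, z). D \<le> dist y z} \<inter> space (endpoint_push \<pi>))"
      using b by (rule emeasure_distr)
    also have "prod.swap -` {(y, z). D \<le> dist y z} \<inter> space (endpoint_push \<pi>) = {(y, z). D \<le> dist y z}"
      by (auto simp: endpoint_push_def dist_commute)
    finally show ?thesis using \<sigma>0 by simp
  qed
  obtain \<nu>0 where ld0: "lebesgue_decomposition m \<mu>\<^sub>0 (ac_density m \<mu>\<^sub>0) \<nu>0"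
    and sg0: "emeasure (singular_part m \<mu>\<^sub>0) UNIV = emeasure \<nu>0 UNIV"
    using lebesgue_decomposition_choice[OF decomposition_exists[OF \<mu>(1)] sets_m] by blast
  obtain \<nu>1 where ld1: "lebesgue_decomposition m \<mu>\<^sub>1 (ac_density m \<mu>\<^sub>1) \<nu>1"
    and sg1: "emeasure (singular_part m \<mu>\<^sub>1) UNIV = emeasure \<nu>1 UNIV"
    using lebesgue_decomposition_choice[OF decomposition_exists[OF \<mu>(2)] sets_m] by blast
  note b0 = lebesgue_decomposition_bounded[OF ld0 sets_m sigma_finite_m A(2) less_imp_le[OF A(1)]]
  note b1 = lebesgue_decomposition_bounded[OF ld1 sets_m sigma_finite_m B(2) less_imp_le[OF B(1)]]
  have sing: "measure (singular_part m \<mu>\<^sub>0) UNIV = 0" "measure (singular_part m \<mu>\<^sub>1) UNIV = 0"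
    using sg0 sg1 b0(2) b1(2) by (simp_all add: measure_def)
  have k0: "AE y in m. 0 < ac_density m \<mu>\<^sub>0 y \<longrightarrow> (AE z in \<kappa>\<^sub>0 y. dist y z < D)"
    by (rule AE_density_pos[OF ld0 sets_m s0 AE_kernel_dist[OF \<kappa>0 s0 \<sigma>0]])
  have k1: "AE y in m. 0 < ac_density m \<mu>\<^sub>1 y \<longrightarrow> (AE z in \<kappa>\<^sub>1 y. dist y z < D)"
    by (rule AE_density_pos[OF ld1 sets_m s1 AE_kernel_dist[OF \<kappa>1 s1 \<sigma>1]])
  have "0 < D" using D by simp
  show ?thesis
  proof (rule that[OF \<pi>])
    fix t :: real and S :: "'a set" assume t: "0 < t" "t < 1" and S: "S \<in> sets borel"
    define C where "C = max (A / contr D (1 - t)) (B / contr D t)"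
    have cp: "0 < contr D (1 - t)" "0 < contr D t" using t \<open>0 < D\<close> by (auto intro!: contr_pos)
    have C: "0 < C" using A(1) cp unfolding C_def by (simp add: less_max_iff_disj)
    have CA: "A \<le> C * contr D (1 - t)" and CB: "B \<le> C * contr D t"
      using cp by (simp_all add: C_def flip: pos_divide_le_eq)
    define k where "k = C powr (- (1/N))"
    have k: "0 < k" using C by (simp add: k_def)
    have Z: "distorted_integral k \<tau> \<rho> \<kappa> = 0"
      if \<tau>: "0 < \<tau>" "\<tau> < 1" and ld: "lebesgue_decomposition m \<mu>' \<rho> \<nu>" and le: "AE y in m. \<rho> y \<le> E"
        and E: "E \<le> C * contr D \<tau>" and kd: "AE y in m. 0 < \<rho> y \<longrightarrow> (AE z in \<kappa> y. dist y z < D)" for \<tau> \<mu>' \<rho> \<nu> \<kappa> E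
      unfolding k_def
    proof (rule distorted_integral_eq_0[OF _ C])
      show "0 \<le> \<rho> y" for y using ld by (simp add: lebesgue_decomposition_def)
      show "AE y in m. 0 < \<rho> y \<longrightarrow> (AE z in \<kappa> y. \<rho> y \<le> C * distortion K N \<tau> (dist y z))"
        using le kd
      proof eventually_elim
        case (elim y)
        show ?case
        proof
          assume "0 < \<rho> y"
          with elim have "AE z in \<kappa> y. dist y z < D" by blast
          then show "AE z in \<kappa> y. \<rho> y \<le> C * distortion K N \<tau> (dist y z)"
          proof eventually_elim
            case (elim z)
            then have "contr D \<tau> \<le> distortion K N \<tau> (dist y z)"
              unfolding contr_def using \<tau> by (intro distortion_ge) auto
            then have "C * contr D \<tau> \<le> C * distortion K N \<tau> (dist y z)" using C by (intro mult_left_mono) auto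
            then show ?case using E \<open>\<rho> y \<le> E\<close> by linarith
          qed
        qed
      qed
    qed
    let ?\<mu>t = "eval_push t \<pi>"
    have \<mu>t: "?\<mu>t \<in> borel_probs" by (rule eval_push_borel_probs[OF g(1)])
    obtain \<nu>t where ldt: "lebesgue_decomposition m ?\<mu>t (ac_density m ?\<mu>t) \<nu>t"
      and sgt: "emeasure (singular_part m ?\<mu>t) UNIV = emeasure \<nu>t UNIV"
      using lebesgue_decomposition_choice[OF decomposition_exists[OF \<mu>t] sets_m] by blast
    have \<rho>t: "ac_density m ?\<mu>t \<in> borel_measurable borel" "\<And>y. 0 \<le> ac_density m ?\<mu>t y"
      and eqt: "emeasure ?\<mu>t S = (\<integral>\<^sup>+y\<in>S. ennreal (ac_density m ?\<mu>t y) \<partial>m) + emeasure \<nu>t S"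
      and st: "sets \<nu>t = sets borel" and eqt1: "emeasure ?\<mu>t UNIV = (\<integral>\<^sup>+y. ennreal (ac_density m ?\<mu>t y) \<partial>m) + emeasure \<nu>t UNIV"
      using ldt S by (auto simp: lebesgue_decomposition_def)
    have "(\<integral>\<^sup>+y. ennreal (excess_fun N k (ac_density m ?\<mu>t y)) \<partial>m) + ennreal (k * measure (singular_part m ?\<mu>t) UNIV) \<le> 0"
      using ineq[OF k, of t] t sing Z[of "1 - t", OF _ _ ld0 b0(1) CA k0] Z[of t, OF _ _ ld1 b1(1) CB k1] by simp
    then have e0: "(\<integral>\<^sup>+y. ennreal (excess_fun N k (ac_density m ?\<mu>t y)) \<partial>m) = 0"
      and "ennreal (k * measure (singular_part m ?\<mu>t) UNIV) = 0" by auto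
    then have ms: "measure (singular_part m ?\<mu>t) UNIV = 0" using k by (simp add: ennreal_eq_0_iff mult_le_0_iff measure_le_0_iff)
    have nt: "emeasure \<nu>t UNIV = 0"
    proof -
      have "emeasure \<nu>t UNIV \<le> emeasure ?\<mu>t UNIV" unfolding eqt1 by simp
      also have "\<dots> < \<infinity>"
      proof -
        have "sets ?\<mu>t = sets borel" "prob_space ?\<mu>t" using \<mu>t by (auto simp: borel_probs_def)
        then show ?thesis
          using prob_space.emeasure_space_1[of ?\<mu>t] sets_eq_imp_space_eq[of ?\<mu>t borel] by simp
      qed
      finally show ?thesis using ms sgt by (auto simp: measure_def enn2real_eq_0_iff)
    qed
    have "AE y in m. ennreal (excess_fun N k (ac_density m ?\<mu>t y)) = 0"
      using e0 \<rho>t(1) by (subst (asm) nn_integral_0_iff_AE) (auto simp: excess_fun_def)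
    then have "AE y in m. ac_density m ?\<mu>t y \<le> C"
    proof eventually_elim
      case (elim y)
      then have "excess_fun N k (ac_density m ?\<mu>t y) = 0" using excess_fun_nonneg[of N k] by (simp add: ennreal_eq_0_iff antisym)
      then show ?case using excess_fun_eq_0_iff[OF N \<rho>t(2) C] by (simp add: k_def)
    qed
    then have "(\<integral>\<^sup>+y\<in>S. ennreal (ac_density m ?\<mu>t y) \<partial>m) \<le> (\<integral>\<^sup>+y. ennreal C * indicator S y \<partial>m)"
      by (intro nn_integral_mono_AE) (auto elim!: eventually_mono simp: indicator_def ennreal_leI)
    also have "\<dots> = ennreal C * emeasure m S" using S by (simp add: nn_integral_cmult_indicator)
    finally show "emeasure ?\<mu>t S \<le> ennreal (max (A / contr D (1 - t)) (B / contr D t)) * emeasure m S"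
      using eqt nt emeasure_mono[of S UNIV \<nu>t] st by (simp add: C_def)
  qed
qed

end

section \<open>Transport estimate for gradients along geodesics\<close>

context cd_space begin

text \<open>Integrating the gradient inequality over the geodesics of the plan and exchanging the order of integration leaves, for each time, the integral of
  \<open>h\<close> against a measure of density at most \<open>C t\<close>; all geodesics stay in the ball of radius \<open>2r\<close>.\<close>

theorem transport_gradient_bound:
  fixes x :: 'a
  assumes \<mu>: "\<mu>\<^sub>0 \<in> borel_probs" "\<mu>\<^sub>1 \<in> borel_probs"
    and s: "AE y in \<mu>\<^sub>0. y \<in> ball x R\<^sub>0" "AE y in \<mu>\<^sub>1. y \<in> ball x R\<^sub>1"
    and A: "0 < A" "\<And>S. S \<in> sets borel \<Longrightarrow> emeasure \<mu>\<^sub>0 S \<le> ennreal A * emeasure m S"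
    and B: "0 < B" "\<And>S. S \<in> sets borel \<Longrightarrow> emeasure \<mu>\<^sub>1 S \<le> ennreal B * emeasure m S"
    and D: "0 < R\<^sub>0" "0 < R\<^sub>1" "R\<^sub>0 \<le> r" "R\<^sub>1 \<le> r"
    and hv: "geo_gradient h v" and v: "v \<in> borel_measurable borel" "\<And>y. \<bar>v y\<bar> \<le> 1"
    and C: "C \<in> borel_measurable borel"
      "\<And>t. 0 < t \<Longrightarrow> t < 1 \<Longrightarrow> max (A / contr (R\<^sub>0 + R\<^sub>1) (1 - t)) (B / contr (R\<^sub>0 + R\<^sub>1) t) \<le> C t"
  shows "ennreal ((\<integral>y. v y \<partial>\<mu>\<^sub>0) - (\<integral>y. v y \<partial>\<mu>\<^sub>1))
    \<le> ennreal (R\<^sub>0 + R\<^sub>1) * (\<integral>\<^sup>+t\<in>{0<..<1}. ennreal (C t) \<partial>lborel) * (\<integral>\<^sup>+y\<in>ball x (2 * r). h y \<partial>m)"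
proof -
  obtain \<pi> where \<pi>: "\<pi> \<in> GeoOpt \<mu>\<^sub>0 \<mu>\<^sub>1"
    and dens: "\<And>t S. 0 < t \<Longrightarrow> t < 1 \<Longrightarrow> S \<in> sets borel \<Longrightarrow>
      emeasure (eval_push t \<pi>) S \<le> ennreal (max (A / contr (R\<^sub>0 + R\<^sub>1) (1 - t)) (B / contr (R\<^sub>0 + R\<^sub>1) t)) * emeasure m S"
    using bounded_density_plan[OF \<mu> s A B D(1,2) refl] by blast
  note g = GeoOptD[OF \<pi>]
  note gp = geo_probsD[OF g(1)]
  interpret \<pi>: prob_space \<pi> by (rule gp)
  let ?D = "R\<^sub>0 + R\<^sub>1"
  have end0: "AE \<gamma> in \<pi>. apply_bcontfun \<gamma> 0 \<in> ball x R\<^sub>0"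
    using s(1) by (intro AE_eval_push[OF g(1), where t = 0 and P = "\<lambda>y. y \<in> ball x R\<^sub>0"]) (simp only: g(2))
  have end1: "AE \<gamma> in \<pi>. apply_bcontfun \<gamma> 1 \<in> ball x R\<^sub>1"
    using s(2) by (intro AE_eval_push[OF g(1), where t = 1 and P = "\<lambda>y. y \<in> ball x R\<^sub>1"]) (simp only: g(3))
  have h: "h \<in> borel_measurable borel" using hv by (simp add: geo_gradient_def)
  define H where "H y = h y * indicator (ball x (2 * r)) y" for y
  have H: "H \<in> borel_measurable borel" using h unfolding H_def by (intro borel_measurable_times_ennreal borel_measurable_indicator) auto
  define \<Phi> where "\<Phi> p = H (apply_bcontfun (fst p) (snd p)) * indicator {0<..<1} (snd p)" for p :: "(real \<Rightarrow>\<^sub>C 'a) \<times> real"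
  have \<Phi>: "\<Phi> \<in> borel_measurable (\<pi> \<Otimes>\<^sub>M lborel)"
  proof -
    have "(\<lambda>p. apply_bcontfun (fst p) (snd p)) \<in> \<pi> \<Otimes>\<^sub>M lborel \<rightarrow>\<^sub>M borel"
      using measurable_eval_joint[OF g(1)] by (simp add: split_beta)
    from measurable_compose[OF this H] show ?thesis unfolding \<Phi>_def by measurable
  qed
  have ev: "(\<integral>y. v y \<partial>eval_push t \<pi>) = (\<integral>\<gamma>. v (apply_bcontfun \<gamma> t) \<partial>\<pi>)" for t
    unfolding eval_push_def using gp(4) v(1) by (rule integral_distr)
  have intv: "integrable \<pi> (\<lambda>\<gamma>. v (apply_bcontfun \<gamma> t))" for t
    using v(2) measurable_compose[OF gp(4) v(1)] by (intro \<pi>.integrable_const_bound[of _ 1]) auto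
  have "(\<integral>y. v y \<partial>\<mu>\<^sub>0) - (\<integral>y. v y \<partial>\<mu>\<^sub>1) = (\<integral>\<gamma>. v (apply_bcontfun \<gamma> 0) - v (apply_bcontfun \<gamma> 1) \<partial>\<pi>)"
    using ev[of 0] ev[of 1] g intv by simp
  also have "\<dots> \<le> (\<integral>\<gamma>. \<bar>v (apply_bcontfun \<gamma> 0) - v (apply_bcontfun \<gamma> 1)\<bar> \<partial>\<pi>)"
    using intv by (intro integral_mono) auto
  finally have "ennreal ((\<integral>y. v y \<partial>\<mu>\<^sub>0) - (\<integral>y. v y \<partial>\<mu>\<^sub>1))
      \<le> ennreal (\<integral>\<gamma>. \<bar>v (apply_bcontfun \<gamma> 0) - v (apply_bcontfun \<gamma> 1)\<bar> \<partial>\<pi>)" by (rule ennreal_leI)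
  also have "\<dots> = (\<integral>\<^sup>+\<gamma>. ennreal \<bar>v (apply_bcontfun \<gamma> 0) - v (apply_bcontfun \<gamma> 1)\<bar> \<partial>\<pi>)"
    using intv by (intro nn_integral_eq_integral[symmetric]) auto
  also have "\<dots> \<le> (\<integral>\<^sup>+\<gamma>. ennreal ?D * (\<integral>\<^sup>+t. \<Phi> (\<gamma>, t) \<partial>lborel) \<partial>\<pi>)"
  proof (rule nn_integral_mono_AE)
    show "AE \<gamma> in \<pi>. ennreal \<bar>v (apply_bcontfun \<gamma> 0) - v (apply_bcontfun \<gamma> 1)\<bar> \<le> ennreal ?D * (\<integral>\<^sup>+t. \<Phi> (\<gamma>, t) \<partial>lborel)"
      using end0 end1 AE_space
    proof eventually_elim
      case (elim \<gamma>)
      let ?\<gamma> = "apply_bcontfun \<gamma>"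
      have geo: "geod ?\<gamma>" using elim(3) gp(2) geod_of_Geo by blast
      have d: "dist (?\<gamma> 0) (?\<gamma> 1) < ?D"
        using elim dist_triangle3[of "?\<gamma> 0" "?\<gamma> 1" x] by auto
      have inb: "?\<gamma> t \<in> ball x (2 * r)" if t: "0 < t" "t < 1" for t
      proof (cases "t \<le> 1/2")
        case True
        have "dist (?\<gamma> 0) (?\<gamma> t) = t * dist (?\<gamma> 0) (?\<gamma> 1)" using geod_dist[OF geo, of 0 t] t by simp
        also have "\<dots> \<le> (1/2) * dist (?\<gamma> 0) (?\<gamma> 1)" using True by (intro mult_right_mono) auto
        finally show ?thesis using dist_triangle[of x "?\<gamma> t" "?\<gamma> 0"] elim(1) d D by auto
      next
        case False
        have "dist (?\<gamma> 1) (?\<gamma> t) = (1 - t) * dist (?\<gamma> 0) (?\<gamma> 1)" using geod_dist[OF geo, of 1 t] t by simp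
        also have "\<dots> \<le> (1/2) * dist (?\<gamma> 0) (?\<gamma> 1)" using False by (intro mult_right_mono) auto
        finally show ?thesis using dist_triangle[of x "?\<gamma> t" "?\<gamma> 1"] elim(2) d D by auto
      qed
      have "(\<integral>\<^sup>+t\<in>{0..1}. h (?\<gamma> t) \<partial>lborel) = (\<integral>\<^sup>+t. \<Phi> (\<gamma>, t) \<partial>lborel)"
      proof (rule nn_integral_cong_AE)
        have "AE t in lborel. t \<noteq> (0::real)" "AE t in lborel. t \<noteq> (1::real)" by (auto intro: AE_lborel_singleton)
        then show "AE t in lborel. h (?\<gamma> t) * indicator {0..1} t = \<Phi> (\<gamma>, t)"
        proof eventually_elim
          case (elim t)
          then show ?case using inb[of t] by (auto simp: \<Phi>_def H_def indicator_def)
        qed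
      qed
      then have "ennreal \<bar>v (?\<gamma> 0) - v (?\<gamma> 1)\<bar> \<le> ennreal (dist (?\<gamma> 0) (?\<gamma> 1)) * (\<integral>\<^sup>+t. \<Phi> (\<gamma>, t) \<partial>lborel)"
        using hv geo unfolding geo_gradient_def by metis
      also have "\<dots> \<le> ennreal ?D * (\<integral>\<^sup>+t. \<Phi> (\<gamma>, t) \<partial>lborel)"
        using d by (intro mult_right_mono ennreal_leI) auto
      finally show ?case .
    qed
  qed
  also have "\<dots> = ennreal ?D * (\<integral>\<^sup>+\<gamma>. \<integral>\<^sup>+t. \<Phi> (\<gamma>, t) \<partial>lborel \<partial>\<pi>)"
    using lborel.borel_measurable_nn_integral_fst[OF \<Phi>] by (intro nn_integral_cmult) auto
  also have "(\<integral>\<^sup>+\<gamma>. \<integral>\<^sup>+t. \<Phi> (\<gamma>, t) \<partial>lborel \<partial>\<pi>) = (\<integral>\<^sup>+t. \<integral>\<^sup>+\<gamma>. \<Phi> (\<gamma>, t) \<partial>\<pi> \<partial>lborel)"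
  proof -
    interpret pair_sigma_finite \<pi> lborel ..
    show ?thesis by (rule Fubini'[symmetric]) (simp add: \<Phi> split_beta)
  qed
  also have "\<dots> \<le> (\<integral>\<^sup>+t. (\<integral>\<^sup>+y. H y \<partial>m) * (ennreal (C t) * indicator {0<..<1} t) \<partial>lborel)"
  proof (rule nn_integral_mono)
    fix t :: real
    show "(\<integral>\<^sup>+\<gamma>. \<Phi> (\<gamma>, t) \<partial>\<pi>) \<le> (\<integral>\<^sup>+y. H y \<partial>m) * (ennreal (C t) * indicator {0<..<1} t)"
    proof (cases "t \<in> {0<..<1}")
      case True
      have "(\<integral>\<^sup>+\<gamma>. \<Phi> (\<gamma>, t) \<partial>\<pi>) = (\<integral>\<^sup>+y. H y \<partial>eval_push t \<pi>)"
        unfolding eval_push_def using True gp(4) H by (subst nn_integral_distr) (auto simp: \<Phi>_def)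
      also have "\<dots> \<le> ennreal (C t) * (\<integral>\<^sup>+y. H y \<partial>m)"
      proof (rule nn_integral_le_of_emeasure_le[OF H])
        show "sets (eval_push t \<pi>) = sets borel" by (simp add: eval_push_def)
        fix S :: "'a set" assume S: "S \<in> sets borel"
        show "emeasure (eval_push t \<pi>) S \<le> ennreal (C t) * emeasure m S"
          using dens[of t S] C(2)[of t] True S
          by (meson ennreal_leI greaterThanLessThan_iff mult_right_mono order_trans zero_le)
      qed simp
      finally show ?thesis using True by (simp add: mult.commute)
    qed (simp add: \<Phi>_def)
  qed
  also have "\<dots> = (\<integral>\<^sup>+y. H y \<partial>m) * (\<integral>\<^sup>+t\<in>{0<..<1}. ennreal (C t) \<partial>lborel)"
    using C(1) by (intro nn_integral_cmult) auto
  finally have "ennreal ((\<integral>y. v y \<partial>\<mu>\<^sub>0) - (\<integral>y. v y \<partial>\<mu>\<^sub>1))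
      \<le> ennreal ?D * ((\<integral>\<^sup>+y. H y \<partial>m) * (\<integral>\<^sup>+t\<in>{0<..<1}. ennreal (C t) \<partial>lborel))"
    by (simp only: mult_left_mono zero_le)
  then show ?thesis by (simp add: H_def ac_simps)
qed

end

section \<open>Upper gradients along geodesics and truncation\<close>

lemma curve_length_geod:
  assumes g: "geod \<gamma>" and st: "0 \<le> s" "s \<le> t" "t \<le> 1"
  shows "curve_length \<gamma> s t = ennreal ((t - s) * dist (\<gamma> 0) (\<gamma> 1))"
proof (rule antisym)
  let ?d = "dist (\<gamma> 0) (\<gamma> 1)"
  show "curve_length \<gamma> s t \<le> ennreal ((t - s) * ?d)"
    unfolding curve_length_def
  proof (rule SUP_least, clarify)
    fix n :: nat and \<tau> :: "nat \<Rightarrow> real" assume \<tau>: "mono \<tau>" "range \<tau> \<subseteq> {s..t}"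
    have \<tau>i: "s \<le> \<tau> i" "\<tau> i \<le> t" for i using \<tau>(2) by (simp_all add: image_subset_iff)
    have "(\<Sum>i<n. ennreal (dist (\<gamma> (\<tau> i)) (\<gamma> (\<tau> (Suc i))))) = (\<Sum>i<n. ennreal ((\<tau> (Suc i) - \<tau> i) * ?d))"
    proof (intro sum.cong refl arg_cong[where f = ennreal])
      fix i
      have "\<tau> i \<le> \<tau> (Suc i)" using \<tau>(1) by (simp add: mono_def)
      moreover have "dist (\<gamma> (\<tau> i)) (\<gamma> (\<tau> (Suc i))) = \<bar>\<tau> i - \<tau> (Suc i)\<bar> * ?d"
        using \<tau>i[of i] \<tau>i[of "Suc i"] st by (intro geod_dist[OF g]) auto
      ultimately show "dist (\<gamma> (\<tau> i)) (\<gamma> (\<tau> (Suc i))) = (\<tau> (Suc i) - \<tau> i) * ?d" by simp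
    qed
    also have "\<dots> = ennreal (\<Sum>i<n. (\<tau> (Suc i) - \<tau> i) * ?d)"
      using \<tau>(1) by (intro sum_ennreal) (auto simp: mono_def)
    also have "(\<Sum>i<n. (\<tau> (Suc i) - \<tau> i) * ?d) = (\<tau> n - \<tau> 0) * ?d"
      by (simp only: sum_distrib_right[symmetric] sum_lessThan_telescope)
    also have "\<dots> \<le> (t - s) * ?d" using \<tau>i[of n] \<tau>i[of 0] by (intro mult_right_mono) auto
    finally show "(\<Sum>i<n. ennreal (dist (\<gamma> (\<tau> i)) (\<gamma> (\<tau> (Suc i))))) \<le> ennreal ((t - s) * ?d)"
      by (auto intro: ennreal_leI)
  qed
  define \<tau> where "\<tau> i = (if i = 0 then s else t)" for i :: nat
  have "ennreal ((t - s) * ?d) = (\<Sum>i<1. ennreal (dist (\<gamma> (\<tau> i)) (\<gamma> (\<tau> (Suc i)))))"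
    using geod_dist[OF g, of s t] st by (simp add: \<tau>_def)
  also have "\<dots> \<le> curve_length \<gamma> s t"
    unfolding curve_length_def
    using st by (intro SUP_upper2[of "(1, \<tau>)"]) (auto simp: \<tau>_def mono_def)
  finally show "ennreal ((t - s) * ?d) \<le> curve_length \<gamma> s t" .
qed

lemma upper_gradient_geod:
  assumes ug: "upper_gradient g u" and geo: "geod \<gamma>"
  shows "ennreal \<bar>u (\<gamma> 0) - u (\<gamma> 1)\<bar> \<le> ennreal (dist (\<gamma> 0) (\<gamma> 1)) * (\<integral>\<^sup>+t\<in>{0..1}. g (\<gamma> t) \<partial>lborel)"
proof -
  have l: "curve_length \<gamma> 0 1 = ennreal (dist (\<gamma> 0) (\<gamma> 1))" using curve_length_geod[OF geo, of 0 1] by simp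
  have "constant_speed \<gamma>"
    unfolding constant_speed_def
  proof (intro conjI allI impI)
    show "continuous_on {0..1} \<gamma>" by (rule geod_continuous[OF geo])
    fix s t :: real assume "0 \<le> s \<and> s \<le> t \<and> t \<le> 1"
    then show "curve_length \<gamma> s t = ennreal (t - s) * curve_length \<gamma> 0 1"
      using curve_length_geod[OF geo, of s t] by (simp add: l ennreal_mult)
  qed
  then have "ennreal \<bar>u (\<gamma> 0) - u (\<gamma> 1)\<bar> \<le> curve_length \<gamma> 0 1 * (\<integral>\<^sup>+t\<in>{0..1}. g (\<gamma> t) \<partial>lborel)"
    using ug by (auto simp: upper_gradient_def l)
  then show ?thesis by (simp only: l)
qed

lemma geod_sub:
  assumes geo: "geod \<gamma>" and st: "0 \<le> s" "s \<le> t" "t \<le> 1"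
  shows "geod (\<lambda>\<sigma>. \<gamma> (s + max 0 (min 1 \<sigma>) * (t - s)))"
  unfolding geod_def geodesic_on_unit_interval_def
proof (intro conjI allI ballI)
  fix a b :: real assume ab: "a \<in> {0..1}" "b \<in> {0..1}"
  have in1: "s + c * (t - s) \<in> {0..1}" if "c \<in> {0..1}" for c
  proof -
    have "0 \<le> c * (t - s)" "c * (t - s) \<le> 1 * (t - s)" using that st mult_right_mono[of c 1 "t - s"] by auto
    then show ?thesis using st by auto
  qed
  have "dist (\<gamma> (s + b * (t - s))) (\<gamma> (s + a * (t - s))) = \<bar>(b - a) * (t - s)\<bar> * dist (\<gamma> 0) (\<gamma> 1)"
    by (subst geod_dist[OF geo in1[OF ab(2)] in1[OF ab(1)]]) (simp add: algebra_simps)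
  moreover have "dist (\<gamma> s) (\<gamma> t) = (t - s) * dist (\<gamma> 0) (\<gamma> 1)"
    using geod_dist[OF geo, of s t] st by simp
  ultimately show "dist (\<gamma> (s + max 0 (min 1 b) * (t - s))) (\<gamma> (s + max 0 (min 1 a) * (t - s)))
      = \<bar>b - a\<bar> * dist (\<gamma> (s + max 0 (min 1 0) * (t - s))) (\<gamma> (s + max 0 (min 1 1) * (t - s)))"
    using ab st by (simp add: abs_mult)
qed auto

lemma geod_reverse:
  assumes geo: "geod \<gamma>" shows "geod (\<lambda>t. \<gamma> (1 - t))"
  unfolding geod_def geodesic_on_unit_interval_def
proof (intro conjI allI ballI)
  fix a b :: real assume ab: "a \<in> {0..1}" "b \<in> {0..1}"
  show "dist (\<gamma> (1 - b)) (\<gamma> (1 - a)) = \<bar>b - a\<bar> * dist (\<gamma> (1 - 0)) (\<gamma> (1 - 1))"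
    using geod_dist[OF geo, of "1 - b" "1 - a"] ab by (simp add: dist_commute abs_minus_commute)
next
  fix t :: real
  have "\<gamma> (1 - t) = \<gamma> (max 0 (min 1 (1 - t)))" using geo unfolding geod_def by blast
  also have "max 0 (min 1 (1 - t)) = 1 - max 0 (min 1 t)" by (auto simp: max_def min_def)
  finally show "\<gamma> (1 - t) = \<gamma> (1 - max 0 (min 1 t))" .
qed

lemma geod_integral_reverse:
  assumes geo: "geod \<gamma>" and h: "h \<in> borel_measurable borel"
  shows "(\<integral>\<^sup>+t\<in>{0..1}. h (\<gamma> (1 - t)) \<partial>lborel) = (\<integral>\<^sup>+t\<in>{0..1::real}. h (\<gamma> t) \<partial>lborel)"
proof -
  have m: "(\<lambda>t. h (\<gamma> t) * indicator {0..1} t) \<in> borel_measurable borel"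
    using measurable_compose[OF borel_measurable_continuous_onI[OF geod_continuous[OF geo]] h] by measurable
  have "(\<integral>\<^sup>+t. h (\<gamma> t) * indicator {0..1} t \<partial>lborel)
      = ennreal \<bar>-1\<bar> * (\<integral>\<^sup>+t. h (\<gamma> (1 + -1 * t)) * indicator {0..1} (1 + -1 * t) \<partial>lborel)"
    by (rule nn_integral_real_affine[OF m]) simp
  also have "\<dots> = (\<integral>\<^sup>+t\<in>{0..1}. h (\<gamma> (1 - t)) \<partial>lborel)"
    by (auto intro!: nn_integral_cong simp: indicator_def)
  finally show ?thesis by simp
qed

lemma upper_gradient_sub_geod:
  assumes ug: "upper_gradient g u" and geo: "geod \<gamma>" and st: "0 \<le> s" "s < t" "t \<le> 1"
  shows "ennreal \<bar>u (\<gamma> s) - u (\<gamma> t)\<bar> \<le> ennreal (dist (\<gamma> 0) (\<gamma> 1)) * (\<integral>\<^sup>+\<tau>\<in>{s..t}. g (\<gamma> \<tau>) \<partial>lborel)"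
proof -
  have g: "g \<in> borel_measurable borel" using ug by (simp add: upper_gradient_def)
  have m: "(\<lambda>\<tau>. g (\<gamma> \<tau>) * indicator {s..t} \<tau>) \<in> borel_measurable borel"
    using measurable_compose[OF borel_measurable_continuous_onI[OF geod_continuous[OF geo]] g] by measurable
  let ?\<gamma> = "\<lambda>\<sigma>. \<gamma> (s + max 0 (min 1 \<sigma>) * (t - s))"
  have "ennreal \<bar>u (?\<gamma> 0) - u (?\<gamma> 1)\<bar> \<le> ennreal (dist (?\<gamma> 0) (?\<gamma> 1)) * (\<integral>\<^sup>+\<sigma>\<in>{0..1}. g (?\<gamma> \<sigma>) \<partial>lborel)"
    using st by (intro upper_gradient_geod[OF ug] geod_sub[OF geo]) auto
  moreover have "dist (?\<gamma> 0) (?\<gamma> 1) = (t - s) * dist (\<gamma> 0) (\<gamma> 1)"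
    using geod_dist[OF geo, of s t] st by simp
  moreover have "(\<integral>\<^sup>+\<tau>\<in>{s..t}. g (\<gamma> \<tau>) \<partial>lborel) = ennreal (t - s) * (\<integral>\<^sup>+\<sigma>\<in>{0..1}. g (?\<gamma> \<sigma>) \<partial>lborel)"
  proof -
    have "s \<le> s + (t - s) * \<sigma> \<and> s + (t - s) * \<sigma> \<le> t \<longleftrightarrow> 0 \<le> \<sigma> \<and> \<sigma> \<le> 1" for \<sigma>
      using st by (auto simp: zero_le_mult_iff) (smt (verit) mult_left_le mult_le_cancel_left1 mult_le_cancel_left_pos mult.right_neutral)+
    then have "g (\<gamma> (s + (t - s) * \<sigma>)) * indicator {s..t} (s + (t - s) * \<sigma>) = g (?\<gamma> \<sigma>) * indicator {0..1} \<sigma>" for \<sigma>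
      by (cases "\<sigma> \<in> {0..1}") (auto simp: mult.commute)
    then show ?thesis
      using st by (subst nn_integral_real_affine[OF m, of "t - s" s]) auto
  qed
  ultimately show ?thesis using st by (simp add: ennreal_mult ac_simps)
qed

text \<open>The last time below the lower level before the first time at the upper level: in between the function stays strictly inside the strip.\<close>

lemma crossing_interval:
  fixes f :: "real \<Rightarrow> real"
  assumes f: "continuous_on {0..1} f" and lo: "f 0 \<le> lo" "lo < hi" "hi \<le> f 1"
  obtains s t where "0 \<le> s" "s < t" "t \<le> 1" "f s \<le> lo" "hi \<le> f t" "\<And>\<sigma>. s < \<sigma> \<Longrightarrow> \<sigma> < t \<Longrightarrow> lo < f \<sigma> \<and> f \<sigma> < hi"
proof -
  have "closed {\<sigma>\<in>{0..1}. hi \<le> f \<sigma>}"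
    using f by (intro continuous_on_closed_Collect_le) (auto intro: continuous_intros)
  then have "compact ({0..1} \<inter> {\<sigma>\<in>{0..1}. hi \<le> f \<sigma>})" by (intro compact_Int_closed) auto
  then obtain t where t: "t \<in> {0..1}" "hi \<le> f t" "\<And>\<sigma>. \<sigma> \<in> {0..1} \<Longrightarrow> hi \<le> f \<sigma> \<Longrightarrow> t \<le> \<sigma>"
  proof -
    have "1 \<in> {0..1} \<inter> {\<sigma>\<in>{0..1}. hi \<le> f \<sigma>}" using lo by simp
    then show ?thesis
      using compact_attains_inf[OF \<open>compact ({0..1} \<inter> {\<sigma>\<in>{0..1}. hi \<le> f \<sigma>})\<close>] that by blast
  qed
  have "closed {\<sigma>\<in>{0..t}. f \<sigma> \<le> lo}"
    using f t by (intro continuous_on_closed_Collect_le) (auto intro: continuous_intros continuous_on_subset)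
  then have "compact ({0..t} \<inter> {\<sigma>\<in>{0..t}. f \<sigma> \<le> lo})" by (intro compact_Int_closed) auto
  then obtain s where s: "s \<in> {0..t}" "f s \<le> lo" "\<And>\<sigma>. \<sigma> \<in> {0..t} \<Longrightarrow> f \<sigma> \<le> lo \<Longrightarrow> \<sigma> \<le> s"
  proof -
    have "0 \<in> {0..t} \<inter> {\<sigma>\<in>{0..t}. f \<sigma> \<le> lo}" using lo t by simp
    then show ?thesis
      using compact_attains_sup[OF \<open>compact ({0..t} \<inter> {\<sigma>\<in>{0..t}. f \<sigma> \<le> lo})\<close>] that by blast
  qed
  have "s \<noteq> t" using s t lo by auto
  show ?thesis
  proof (rule that)
    fix \<sigma> assume "s < \<sigma>" "\<sigma> < t"
    then show "lo < f \<sigma> \<and> f \<sigma> < hi" using s t by (smt (verit) atLeastAtMost_iff)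
  qed (use s t \<open>s \<noteq> t\<close> in auto)
qed

text \<open>A truncation of \<open>u\<close> changes only while \<open>u\<close> crosses the strip between the two levels. On a crossing interval the upper gradient of \<open>u\<close> may be
  restricted to the open strip. Such pieces for different strips do not overlap, which is what makes the later integration over all levels free of losses.\<close>

theorem truncation_gradient:
  fixes u :: "'a::metric_space \<Rightarrow> real"
  assumes ug: "upper_gradient g u" and u: "continuous_on UNIV u" and e: "0 < e"
  shows "geo_gradient (\<lambda>y. g y * ennreal (1 / e) * indicator {y. l < u y \<and> u y < l + e} y)
      (\<lambda>y. min 1 (max 0 ((u y - l) / e)))"
    (is "geo_gradient ?h ?v")
proof -
  have g: "g \<in> borel_measurable borel" using ug by (simp add: upper_gradient_def)
  have um: "u \<in> borel_measurable borel" using u by (rule borel_measurable_continuous_onI)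
  have h: "?h \<in> borel_measurable borel"
    using g um by (intro borel_measurable_times_ennreal borel_measurable_indicator) auto
  have main: "ennreal (?v (\<gamma> 1) - ?v (\<gamma> 0)) \<le> ennreal (dist (\<gamma> 0) (\<gamma> 1)) * (\<integral>\<^sup>+t\<in>{0..1}. ?h (\<gamma> t) \<partial>lborel)"
    if geo: "geod \<gamma>" for \<gamma> :: "real \<Rightarrow> 'a"
  proof (cases "?v (\<gamma> 0) < ?v (\<gamma> 1)")
    case False
    then have "?v (\<gamma> 1) - ?v (\<gamma> 0) \<le> 0" by (simp only: not_less diff_le_0_iff_le)
    then show ?thesis by (simp only: ennreal_neg zero_le)
  next
    case True
    define f where "f = u \<circ> \<gamma>"
    define lo where "lo = max l (f 0)"
    define hi where "hi = min (l + e) (f 1)"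
    have vv: "?v (\<gamma> 1) - ?v (\<gamma> 0) = (hi - lo) / e" and lohi: "lo < hi"
      using True e by (auto simp: lo_def hi_def f_def min_def max_def field_simps split: if_splits)
    have "continuous_on {0..1} f"
      unfolding f_def by (intro continuous_on_compose geod_continuous[OF geo] continuous_on_subset[OF u]) auto
    then obtain s t where st: "0 \<le> s" "s < t" "t \<le> 1" "f s \<le> lo" "hi \<le> f t"
        "\<And>\<sigma>. s < \<sigma> \<Longrightarrow> \<sigma> < t \<Longrightarrow> lo < f \<sigma> \<and> f \<sigma> < hi"
      using lohi by (elim crossing_interval[of f lo hi]) (auto simp: lo_def hi_def)
    have "ennreal (?v (\<gamma> 1) - ?v (\<gamma> 0)) \<le> ennreal (\<bar>u (\<gamma> s) - u (\<gamma> t)\<bar> * (1 / e))"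
      unfolding vv using st(4,5) e by (intro ennreal_leI) (auto simp: f_def divide_right_mono)
    also have "\<dots> = ennreal \<bar>u (\<gamma> s) - u (\<gamma> t)\<bar> * ennreal (1 / e)" using e by (intro ennreal_mult) auto
    also have "\<dots> \<le> ennreal (dist (\<gamma> 0) (\<gamma> 1)) * (\<integral>\<^sup>+\<tau>\<in>{s..t}. g (\<gamma> \<tau>) \<partial>lborel) * ennreal (1 / e)"
      by (intro mult_right_mono upper_gradient_sub_geod[OF ug geo st(1-3)]) simp
    also have "\<dots> = ennreal (dist (\<gamma> 0) (\<gamma> 1)) * (\<integral>\<^sup>+\<tau>. (g (\<gamma> \<tau>) * indicator {s..t} \<tau>) * ennreal (1 / e) \<partial>lborel)"
      using measurable_compose[OF borel_measurable_continuous_onI[OF geod_continuous[OF geo]] g]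
      by (subst nn_integral_multc) (auto simp: ac_simps)
    also have "\<dots> \<le> ennreal (dist (\<gamma> 0) (\<gamma> 1)) * (\<integral>\<^sup>+t\<in>{0..1}. ?h (\<gamma> t) \<partial>lborel)"
    proof (intro mult_left_mono nn_integral_mono_AE)
      have "AE \<tau> in lborel. \<tau> \<noteq> s" "AE \<tau> in lborel. \<tau> \<noteq> t" by (auto intro: AE_lborel_singleton)
      then show "AE \<tau> in lborel. (g (\<gamma> \<tau>) * indicator {s..t} \<tau>) * ennreal (1 / e) \<le> ?h (\<gamma> \<tau>) * indicator {0..1} \<tau>"
      proof eventually_elim
        case (elim \<tau>)
        show ?case
        proof (cases "\<tau> \<in> {s..t}")
          case True
          then have "lo < f \<tau> \<and> f \<tau> < hi" using elim st(6) by auto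
          then have "l < u (\<gamma> \<tau>) \<and> u (\<gamma> \<tau>) < l + e" by (auto simp: lo_def hi_def f_def)
          then show ?thesis using True st by simp
        qed simp
      qed
    qed simp
    finally show ?thesis .
  qed
  show ?thesis
    unfolding geo_gradient_def
  proof (intro conjI allI impI h)
    fix \<gamma> :: "real \<Rightarrow> 'a" assume geo: "geod \<gamma>"
    show "ennreal \<bar>?v (\<gamma> 0) - ?v (\<gamma> 1)\<bar> \<le> ennreal (dist (\<gamma> 0) (\<gamma> 1)) * (\<integral>\<^sup>+t\<in>{0..1}. ?h (\<gamma> t) \<partial>lborel)"
    proof (cases "?v (\<gamma> 0) \<le> ?v (\<gamma> 1)")
      case True
      then show ?thesis using main[OF geo] by (simp add: abs_minus_commute)
    next
      case False
      have "ennreal (?v (\<gamma> 0) - ?v (\<gamma> 1)) \<le> ennreal (dist (\<gamma> 1) (\<gamma> 0)) * (\<integral>\<^sup>+t\<in>{0..1}. ?h (\<gamma> (1 - t)) \<partial>lborel)"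
        using main[OF geod_reverse[OF geo]] by (simp only: diff_self diff_zero)
      moreover have "ennreal \<bar>?v (\<gamma> 0) - ?v (\<gamma> 1)\<bar> = ennreal (?v (\<gamma> 0) - ?v (\<gamma> 1))"
        using False by (simp only: not_le abs_of_pos diff_gt_0_iff_gt)
      ultimately show ?thesis using geod_integral_reverse[OF geo h] by (simp only: dist_commute[of "\<gamma> 1"])
    qed
  qed
qed

section \<open>Approximation of gradients by continuous functions\<close>

lemma open_continuous_approx:
  fixes U :: "'a::metric_space set"
  assumes U: "open U"
  obtains f :: "nat \<Rightarrow> 'a \<Rightarrow> real" where "\<And>n. continuous_on UNIV (f n)" "\<And>n y. 0 \<le> f n y" "\<And>n y. f n y \<le> 1"
    "\<And>y. incseq (\<lambda>n. f n y)" "\<And>n y. y \<notin> U \<Longrightarrow> f n y = 0" "\<And>y. y \<in> U \<Longrightarrow> \<exists>n. f n y = 1"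
proof (cases "U = UNIV")
  case True
  show ?thesis by (rule that[of "\<lambda>_ _. 1"]) (auto simp: True incseq_def)
next
  case False
  define f where "f n y = min 1 (real n * infdist y (- U))" for n y
  show ?thesis
  proof (rule that[of f])
    show "continuous_on UNIV (f n)" for n unfolding f_def by (intro continuous_intros)
    show "incseq (\<lambda>n. f n y)" for y
      unfolding f_def incseq_def by (auto intro!: min.coboundedI2 mult_right_mono infdist_nonneg)
    fix y assume "y \<in> U"
    moreover have "closed (- U)" "- U \<noteq> {}" using U False by auto
    ultimately have "infdist y (- U) > 0"
      using in_closed_iff_infdist_zero[of "- U" y] infdist_nonneg[of y "- U"] by auto
    then obtain n where "1 \<le> real n * infdist y (- U)"
      using reals_Archimedean3[of "infdist y (- U)"] by (metis less_imp_le)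
    then show "\<exists>n. f n y = 1" by (intro exI[of _ n]) (simp add: f_def)
  qed (auto simp: f_def infdist_nonneg)
qed

text \<open>Sets that are approximable from outside by open and from inside by closed sets form a sigma-algebra that contains the open sets.\<close>

lemma outer_regular_finite_measure:
  fixes \<mu> :: "'a::metric_space measure"
  assumes fin: "finite_measure \<mu>" and s: "sets \<mu> = sets borel" and A: "A \<in> sets borel" and e: "0 < (e::real)"
  obtains U where "open U" "A \<subseteq> U" "measure \<mu> U < measure \<mu> A + e"
proof -
  interpret finite_measure \<mu> by fact
  have sp: "space \<mu> = UNIV" using sets_eq_imp_space_eq[OF s] by simp
  define P where "P A \<longleftrightarrow> (\<forall>e>0. \<exists>U C. open U \<and> closed C \<and> C \<subseteq> A \<and> A \<subseteq> U \<and> measure \<mu> (U - C) < e)" for A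
  have meas: "open U \<Longrightarrow> U \<in> sets \<mu>" "closed C \<Longrightarrow> C \<in> sets \<mu>" for U C using s by auto
  have "P A"
  proof -
    have "A \<in> sigma_sets UNIV {U. open U}" using A by (simp add: borel_def)
    then show ?thesis
    proof (induction rule: sigma_sets.induct)
      case (Basic U)
      then have U: "open U" by simp
      obtain f :: "nat \<Rightarrow> 'a \<Rightarrow> real" where f: "\<And>n. continuous_on UNIV (f n)" "\<And>y. incseq (\<lambda>n. f n y)"
        "\<And>n y. y \<notin> U \<Longrightarrow> f n y = 0" "\<And>y. y \<in> U \<Longrightarrow> \<exists>n. f n y = 1" "\<And>n y. f n y \<le> 1"
        using open_continuous_approx[OF U] by metis
      define C where "C n = {y. 1 \<le> f n y}" for n
      have C: "closed (C n)" for n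
        unfolding C_def using f(1)[of n] by (intro closed_Collect_le) (auto simp: continuous_on_eq_continuous_at intro!: continuous_intros)
      have CU: "C n \<subseteq> U" for n using f(3) by (force simp: C_def)
      have "(\<lambda>n. measure \<mu> (C n)) \<longlonglongrightarrow> measure \<mu> (\<Union>n. C n)"
      proof (rule finite_Lim_measure_incseq)
        show "range C \<subseteq> sets \<mu>" using C meas by auto
        show "incseq C" unfolding incseq_def C_def using f(2) by (auto simp: incseq_def intro: order_trans)
      qed
      moreover have "(\<Union>n. C n) = U"
      proof (intro equalityI subsetI)
        fix y assume "y \<in> U"
        then obtain n where "f n y = 1" using f(4) by blast
        then show "y \<in> (\<Union>n. C n)" by (intro UN_I[of n]) (simp_all add: C_def)
      qed (use CU in blast)
      ultimately have lim: "(\<lambda>n. measure \<mu> (C n)) \<longlonglongrightarrow> measure \<mu> U" by simp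
      show ?case unfolding P_def
      proof (intro allI impI)
        fix e :: real assume "0 < e"
        then have "\<forall>\<^sub>F n in sequentially. measure \<mu> U - e < measure \<mu> (C n)"
          by (intro order_tendstoD(1)[OF lim]) simp
        then obtain n where "measure \<mu> U - e < measure \<mu> (C n)" by (auto simp: eventually_sequentially)
        moreover have "measure \<mu> (U - C n) = measure \<mu> U - measure \<mu> (C n)"
          using U C CU meas by (intro finite_measure_Diff) auto
        ultimately show "\<exists>V C. open V \<and> closed C \<and> C \<subseteq> U \<and> U \<subseteq> V \<and> measure \<mu> (V - C) < e"
          using U C[of n] CU[of n] by (intro exI[of _ U] exI[of _ "C n"]) auto
      qed
    next
      case Empty
      show ?case unfolding P_def by (intro allI impI exI[of _ "{}"]) simp
    next
      case (Compl A)
      show ?case unfolding P_def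
      proof (intro allI impI)
        fix e :: real assume "0 < e"
        then obtain U C where "open U" "closed C" "C \<subseteq> A" "A \<subseteq> U" "measure \<mu> (U - C) < e"
          using Compl(2)[unfolded P_def, rule_format, OF \<open>0 < e\<close>] by (elim exE conjE)
        moreover have "(- C) - (- U) = U - C" by auto
        ultimately show "\<exists>U' C'. open U' \<and> closed C' \<and> C' \<subseteq> UNIV - A \<and> UNIV - A \<subseteq> U' \<and> measure \<mu> (U' - C') < e"
          by (intro exI[of _ "- C"] exI[of _ "- U"]) auto
      qed
    next
      case (Union A)
      show ?case unfolding P_def
      proof (intro allI impI)
        fix e :: real assume e: "0 < e"
        have "\<exists>U C. open U \<and> closed C \<and> C \<subseteq> A i \<and> A i \<subseteq> U \<and> measure \<mu> (U - C) < e / 4 * (1/2)^i" for i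
          using e by (intro Union(2)[unfolded P_def, rule_format]) simp
        then obtain U C where UC: "\<And>i. open (U i)" "\<And>i. closed (C i)" "\<And>i. C i \<subseteq> A i" "\<And>i. A i \<subseteq> U i"
          "\<And>i. measure \<mu> (U i - C i) < e / 4 * (1/2)^i" by metis
        have "(\<lambda>n. measure \<mu> (\<Union>i<n. C i)) \<longlonglongrightarrow> measure \<mu> (\<Union>n. \<Union>i<n. C i)"
        proof (rule finite_Lim_measure_incseq)
          show "range (\<lambda>n. \<Union>i<n. C i) \<subseteq> sets \<mu>" using UC(2) meas by (auto intro!: sets.countable_UN')
          show "incseq (\<lambda>n. \<Union>i<n. C i)" unfolding incseq_def by (intro allI impI UN_mono) auto
        qed
        moreover have "(\<Union>n. \<Union>i<n. C i) = (\<Union>i. C i)"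
        proof (intro equalityI subsetI)
          fix y assume "y \<in> (\<Union>i. C i)"
          then obtain i where "y \<in> C i" by blast
          then show "y \<in> (\<Union>n. \<Union>i<n. C i)" by (intro UN_I[of "Suc i"] UN_I[of i]) simp_all
        qed blast
        ultimately have lim: "(\<lambda>n. measure \<mu> (\<Union>i<n. C i)) \<longlonglongrightarrow> measure \<mu> (\<Union>i. C i)" by simp
        then have "\<forall>\<^sub>F n in sequentially. measure \<mu> (\<Union>i. C i) - e / 4 < measure \<mu> (\<Union>i<n. C i)"
          using e by (intro order_tendstoD(1)[OF lim]) simp
        then obtain n where n: "measure \<mu> (\<Union>i. C i) - e / 4 < measure \<mu> (\<Union>i<n. C i)" by (auto simp: eventually_sequentially)
        have mC: "(\<Union>i. C i) \<in> sets \<mu>" "(\<Union>i<n. C i) \<in> sets \<mu>" "\<And>i. U i - C i \<in> sets \<mu>" "(\<Union>i. U i) \<in> sets \<mu>"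
          using UC(1,2) meas by (auto intro!: sets.countable_UN')
        have summ: "summable (\<lambda>i. e / 4 * (1/2)^i)" by (intro summable_mult summable_geometric) auto
        have sume: "(\<Sum>i. e / 4 * (1/2)^i) = e / 2"
          by (subst suminf_mult) (auto simp: suminf_geometric intro!: summable_geometric)
        have summ2: "summable (\<lambda>i. measure \<mu> (U i - C i))"
          by (rule summable_comparison_test'[OF summ]) (use UC(5) in \<open>auto intro: less_imp_le\<close>)
        have "measure \<mu> (\<Union>i. U i - C i) \<le> (\<Sum>i. measure \<mu> (U i - C i))"
          using mC by (intro finite_measure_subadditive_countably summ2) auto
        also have "\<dots> \<le> e / 2"
          unfolding sume[symmetric] by (intro suminf_le summ summ2) (use UC(5) in \<open>auto intro: less_imp_le\<close>)
        finally have le1: "measure \<mu> (\<Union>i. U i - C i) \<le> e / 2" .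
        have "measure \<mu> ((\<Union>i. U i) - (\<Union>i<n. C i)) \<le> measure \<mu> ((\<Union>i. U i - C i) \<union> ((\<Union>i. C i) - (\<Union>i<n. C i)))"
          using mC by (intro finite_measure_mono) auto
        also have "\<dots> \<le> measure \<mu> (\<Union>i. U i - C i) + measure \<mu> ((\<Union>i. C i) - (\<Union>i<n. C i))"
          using mC by (intro measure_Un_le) auto
        also have "measure \<mu> ((\<Union>i. C i) - (\<Union>i<n. C i)) = measure \<mu> (\<Union>i. C i) - measure \<mu> (\<Union>i<n. C i)"
          using mC by (intro finite_measure_Diff) auto
        finally have "measure \<mu> ((\<Union>i. U i) - (\<Union>i<n. C i)) < e" using le1 n e by linarith
        moreover have "open (\<Union>i. U i)" by (intro open_UN ballI UC(1))
        moreover have "closed (\<Union>i<n. C i)" by (intro closed_UN ballI UC(2)) simp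
        moreover have "(\<Union>i<n. C i) \<subseteq> (\<Union>i. A i)" by (intro UN_mono UC(3)) simp
        moreover have "(\<Union>i. A i) \<subseteq> (\<Union>i. U i)" by (intro UN_mono UC(4)) simp
        ultimately show "\<exists>U C. open U \<and> closed C \<and> C \<subseteq> (\<Union>i. A i) \<and> (\<Union>i. A i) \<subseteq> U \<and> measure \<mu> (U - C) < e"
          by (intro exI[of _ "\<Union>i. U i"] exI[of _ "\<Union>i<n. C i"] conjI)
      qed
    qed
  qed
  then obtain U C where UC: "open U" "closed C" "C \<subseteq> A" "A \<subseteq> U" "measure \<mu> (U - C) < e"
    using e unfolding P_def by (elim allE[of _ e] impE exE conjE) simp_all
  have "measure \<mu> U = measure \<mu> C + measure \<mu> (U - C)"
    using UC meas by (subst finite_measure_Diff) auto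
  also have "measure \<mu> C \<le> measure \<mu> A" using UC A s by (intro finite_measure_mono) auto
  finally show ?thesis using that[OF UC(1,4)] UC(5) by linarith
qed

lemma layer_sum_bounds:
  fixes z :: ennreal and d :: real assumes d: "0 < d"
  defines "S \<equiv> \<lambda>n. \<Sum>k<n. (if ennreal (real k * d) < z then ennreal d else 0)"
  shows "S n \<le> z + ennreal d" "z \<le> (SUP n. S n)"
proof -
  have le: "S n \<le> ennreal (real n * d)" for n
  proof (induction n)
    case (Suc n)
    have "S (Suc n) \<le> ennreal (real n * d) + ennreal d"
      unfolding S_def sum.lessThan_Suc by (intro add_mono) (use Suc in \<open>auto simp: S_def\<close>)
    then show ?case using d by (simp add: distrib_right add.commute flip: ennreal_plus)
  qed (simp add: S_def)
  show "S n \<le> z + ennreal d"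
  proof (induction n)
    case (Suc n)
    show ?case
    proof (cases "ennreal (real n * d) < z")
      case True
      have "S (Suc n) \<le> ennreal (real n * d) + ennreal d"
        using le[of n] True by (simp add: S_def)
      also have "\<dots> \<le> z + ennreal d" using True by (intro add_right_mono) auto
      finally show ?thesis .
    qed (use Suc in \<open>simp add: S_def\<close>)
  qed (simp add: S_def)
  show "z \<le> (SUP n. S n)"
  proof (rule dense_le)
    fix c assume c: "c < z"
    then have "c < \<top>" by (rule less_le_trans) simp
    then obtain c' where c': "c = ennreal c'" "0 \<le> c'" by (metis ennreal_cases less_irrefl)
    define k where "k = nat \<lfloor>c' / d\<rfloor>"
    have k: "real k * d \<le> c'" "c' \<le> real (Suc k) * d"
    proof -
      have "real k = of_int \<lfloor>c' / d\<rfloor>" using c' d by (simp add: k_def)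
      then have "real k \<le> c' / d" "c' / d \<le> real k + 1" by linarith+
      then show "real k * d \<le> c'" "c' \<le> real (Suc k) * d" using d by (auto simp: field_simps)
    qed
    have "S (Suc k) = (\<Sum>j<Suc k. ennreal d)"
      unfolding S_def
    proof (intro sum.cong refl if_P)
      fix j assume "j \<in> {..<Suc k}"
      then have "real j * d \<le> real k * d" using d by (intro mult_right_mono) auto
      then show "ennreal (real j * d) < z" using k(1) c c' by (metis ennreal_leI le_less_trans order_trans)
    qed
    also have "\<dots> = ennreal (real (Suc k) * d)" using d by (simp add: ennreal_mult ennreal_of_nat_eq_real_of_nat)
    finally have "c \<le> S (Suc k)" using k c' by (simp add: ennreal_leI)
    then show "c \<le> (SUP n. S n)" by (rule SUP_upper2[rotated]) simp
  qed
qed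

text \<open>A Vitali-Caratheodory type statement: up to a small constant, \<open>h\<close> is a countable sum of multiples of indicators of its superlevel sets; cover each of them by an open
  set of slightly larger measure, and approximate the indicators of open sets from below by continuous functions. So \<open>h\<close> is dominated by a lower semicontinuous
  function with almost the same integral, and that function is an increasing limit of continuous ones.\<close>

lemma (in mm_space) continuous_minorants:
  assumes h: "h \<in> borel_measurable borel" and fin: "(\<integral>\<^sup>+y\<in>ball x R. h y \<partial>m) < \<infinity>" and e: "0 < (e::real)"
  obtains w :: "nat \<Rightarrow> 'a \<Rightarrow> real" where "\<And>j. continuous_on UNIV (w j)" "\<And>j y. 0 \<le> w j y"
    "\<And>y. incseq (\<lambda>j. w j y)" "\<And>y. y \<in> ball x R \<Longrightarrow> h y \<le> (SUP j. ennreal (w j y))"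
    "\<And>j. (\<integral>\<^sup>+y\<in>ball x R. ennreal (w j y) \<partial>m) \<le> (\<integral>\<^sup>+y\<in>ball x R. h y \<partial>m) + ennreal e"
proof -
  define B where "B = ball x R"
  have B: "B \<in> sets borel" by (simp add: B_def)
  define \<mu> where "\<mu> = density m (indicator B)"
  have em: "emeasure \<mu> S = emeasure m (B \<inter> S)" if "S \<in> sets borel" for S
    using that B unfolding \<mu>_def by (subst emeasure_density) (auto simp: nn_integral_indicator[symmetric] indicator_inter_arith simp del: nn_integral_indicator)
  have s\<mu>: "sets \<mu> = sets borel" by (simp add: \<mu>_def)
  have finB: "emeasure m B < \<infinity>" unfolding B_def by (rule emeasure_ball_finite)
  have fin\<mu>: "finite_measure \<mu>"
    using em[of UNIV] finB by (intro finite_measureI) (auto simp: \<mu>_def less_top)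
  interpret \<mu>: finite_measure \<mu> by fact
  have mB: "0 \<le> measure m B" by simp
  define d where "d = min 1 (e / (2 * measure m B + 2))"
  have p0: "0 < 2 * measure m B + 2" using mB by linarith
  then have "0 < e / (2 * measure m B + 2)" using e by (intro divide_pos_pos)
  then have d: "0 < d" "d \<le> 1"
    by (simp_all only: d_def min_less_iff_conj zero_less_one simp_thms min.cobounded1)
  have dB: "d * measure m B + d \<le> e / 2"
  proof -
    have "d \<le> e / (2 * measure m B + 2)" by (simp only: d_def min.cobounded2)
    then have "d * (2 * measure m B + 2) \<le> e" using p0 by (simp only: pos_le_divide_eq)
    then show ?thesis by (simp add: algebra_simps)
  qed
  define A where "A k = {y. ennreal (real k * d) < h y}" for k
  have A: "A k \<in> sets borel" for k unfolding A_def using h by measurable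
  have "\<exists>U. open U \<and> A k \<subseteq> U \<and> measure \<mu> U < measure \<mu> (A k) + (1/2)^Suc k" for k
    using outer_regular_finite_measure[OF fin\<mu> s\<mu> A, of "(1/2)^Suc k"] by (metis half_gt_zero_iff zero_less_one zero_less_power)
  then obtain U where U: "\<And>k. open (U k)" "\<And>k. A k \<subseteq> U k" "\<And>k. measure \<mu> (U k) < measure \<mu> (A k) + (1/2)^Suc k"
    by metis
  have "\<exists>f :: nat \<Rightarrow> 'a \<Rightarrow> real. (\<forall>n. continuous_on UNIV (f n)) \<and> (\<forall>n y. 0 \<le> f n y) \<and> (\<forall>n y. f n y \<le> 1) \<and>
    (\<forall>y. incseq (\<lambda>n. f n y)) \<and> (\<forall>n y. y \<notin> U k \<longrightarrow> f n y = 0) \<and> (\<forall>y. y \<in> U k \<longrightarrow> (\<exists>n. f n y = 1))" for k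
    using open_continuous_approx[OF U(1)[of k]] by metis
  then obtain f :: "nat \<Rightarrow> nat \<Rightarrow> 'a \<Rightarrow> real" where f: "\<And>k n. continuous_on UNIV (f k n)" "\<And>k n y. 0 \<le> f k n y" "\<And>k n y. f k n y \<le> 1"
    "\<And>k y. incseq (\<lambda>n. f k n y)" "\<And>k n y. y \<notin> U k \<Longrightarrow> f k n y = 0" "\<And>k y. y \<in> U k \<Longrightarrow> \<exists>n. f k n y = 1"
    by metis
  define w where "w j y = (\<Sum>k<j. d * f k j y)" for j y
  show ?thesis
  proof (rule that[of w])
    show "continuous_on UNIV (w j)" for j unfolding w_def using f(1) by (intro continuous_intros)
    show "0 \<le> w j y" for j y unfolding w_def using f(2) d by (intro sum_nonneg mult_nonneg_nonneg) auto
    show inc: "incseq (\<lambda>j. w j y)" for y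
    proof (rule incseq_SucI)
      fix j
      have "w j y \<le> (\<Sum>k<j. d * f k (Suc j) y)"
        unfolding w_def using f(4) d by (intro sum_mono mult_left_mono) (auto simp: incseq_Suc_iff)
      also have "\<dots> \<le> w (Suc j) y" unfolding w_def using f(2) d by simp
      finally show "w j y \<le> w (Suc j) y" .
    qed
    show "h y \<le> (SUP j. ennreal (w j y))" for y
    proof -
      have "h y \<le> (SUP n. \<Sum>k<n. (if ennreal (real k * d) < h y then ennreal d else 0))"
        by (rule layer_sum_bounds(2)[OF d(1)])
      also have "\<dots> \<le> (SUP j. ennreal (w j y))"
      proof (rule SUP_least)
        fix n :: nat
        have "\<exists>i. \<forall>k<n. ennreal (real k * d) < h y \<longrightarrow> f k i y = 1"
        proof (induction n)
          case (Suc n)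
          then obtain i where i: "\<forall>k<n. ennreal (real k * d) < h y \<longrightarrow> f k i y = 1" by blast
          obtain i' where i': "ennreal (real n * d) < h y \<longrightarrow> f n i' y = 1"
            using f(6)[of y n] U(2)[of n] by (auto simp: A_def)
          have up: "f k (max i i') y = 1" if "f k a y = 1" "a \<le> max i i'" for k a
            using f(3)[of k "max i i'" y] incseqD[OF f(4)[of k y] that(2)] that(1) by linarith
          have "\<forall>k<Suc n. ennreal (real k * d) < h y \<longrightarrow> f k (max i i') y = 1"
            using i i' up[of _ i] up[of n i'] by (auto simp: less_Suc_eq)
          then show ?case by blast
        qed simp
        then obtain i where i: "\<forall>k<n. ennreal (real k * d) < h y \<longrightarrow> f k i y = 1" by blast
        define j where "j = max i n"
        have "(\<Sum>k<n. (if ennreal (real k * d) < h y then ennreal d else 0)) \<le> (\<Sum>k<n. ennreal (d * f k j y))"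
        proof (rule sum_mono)
          fix k assume k: "k \<in> {..<n}"
          show "(if ennreal (real k * d) < h y then ennreal d else 0) \<le> ennreal (d * f k j y)"
          proof (cases "ennreal (real k * d) < h y")
            case True
            then have "f k i y = 1" using i k by simp
            then have "1 \<le> f k j y" using incseqD[OF f(4)[of k y], of i j] by (simp add: j_def)
            then show ?thesis using True d by (simp add: ennreal_leI)
          qed simp
        qed
        also have "\<dots> = ennreal (\<Sum>k<n. d * f k j y)" using f(2) d by (intro sum_ennreal) auto
        also have "\<dots> \<le> ennreal (w j y)"
          unfolding w_def using f(2) d by (intro ennreal_leI sum_mono2) (auto simp: j_def)
        also have "\<dots> \<le> (SUP j. ennreal (w j y))" by (rule SUP_upper) simp
        finally show "(\<Sum>k<n. (if ennreal (real k * d) < h y then ennreal d else 0)) \<le> (SUP j. ennreal (w j y))" .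
      qed
      finally show ?thesis .
    qed
    show "(\<integral>\<^sup>+y\<in>ball x R. ennreal (w j y) \<partial>m) \<le> (\<integral>\<^sup>+y\<in>ball x R. h y \<partial>m) + ennreal e" for j
    proof -
      have nn: "(\<integral>\<^sup>+y. p y * indicator B y \<partial>m) = (\<integral>\<^sup>+y. p y \<partial>\<mu>)" if "p \<in> borel_measurable borel" for p :: "'a \<Rightarrow> ennreal"
        unfolding \<mu>_def using that B by (subst nn_integral_density) (auto simp: mult.commute cong: measurable_cong_sets)
      have mU: "U k \<in> sets \<mu>" "A k \<in> sets \<mu>" for k using U(1) A s\<mu> by auto
      have wm: "(\<lambda>y. ennreal (w j y)) \<in> borel_measurable borel"
        unfolding w_def using f(1) by (intro measurable_compose[OF _ measurable_ennreal] borel_measurable_continuous_onI continuous_intros)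
      have "(\<integral>\<^sup>+y. ennreal (w j y) \<partial>\<mu>) \<le> (\<integral>\<^sup>+y. (\<Sum>k<j. ennreal d * indicator (U k) y) \<partial>\<mu>)"
      proof (rule nn_integral_mono)
        fix y
        have "ennreal (w j y) = (\<Sum>k<j. ennreal (d * f k j y))"
          unfolding w_def using f(2) d by (intro sum_ennreal[symmetric]) auto
        also have "\<dots> \<le> (\<Sum>k<j. ennreal d * indicator (U k) y)"
          using f(3,5) d by (intro sum_mono) (auto simp: indicator_def intro!: ennreal_leI mult_left_le)
        finally show "ennreal (w j y) \<le> (\<Sum>k<j. ennreal d * indicator (U k) y)" .
      qed
      also have "\<dots> = (\<Sum>k<j. ennreal d * emeasure \<mu> (U k))"
        using mU by (subst nn_integral_sum) (auto simp: nn_integral_cmult_indicator)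
      also have "\<dots> \<le> (\<Sum>k<j. ennreal d * (emeasure \<mu> (A k) + ennreal ((1/2)^Suc k)))"
      proof (intro sum_mono mult_left_mono)
        fix k
        have "ennreal (measure \<mu> (U k)) \<le> ennreal (measure \<mu> (A k) + (1/2)^Suc k)"
          using U(3)[of k] by (intro ennreal_leI) auto
        then show "emeasure \<mu> (U k) \<le> emeasure \<mu> (A k) + ennreal ((1/2)^Suc k)"
          by (simp add: \<mu>.emeasure_eq_measure)
      qed simp
      also have "\<dots> = (\<Sum>k<j. ennreal d * emeasure \<mu> (A k)) + (\<Sum>k<j. ennreal d * ennreal ((1/2)^Suc k))"
        by (simp only: distrib_left sum.distrib)
      also have "(\<Sum>k<j. ennreal d * emeasure \<mu> (A k)) = (\<integral>\<^sup>+y. (\<Sum>k<j. ennreal d * indicator (A k) y) \<partial>\<mu>)"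
        using mU by (subst nn_integral_sum) (auto simp: nn_integral_cmult_indicator)
      also have "\<dots> \<le> (\<integral>\<^sup>+y. h y + ennreal d \<partial>\<mu>)"
      proof (rule nn_integral_mono)
        fix y
        have "(\<Sum>k<j. ennreal d * indicator (A k) y) = (\<Sum>k<j. (if ennreal (real k * d) < h y then ennreal d else 0))"
          by (intro sum.cong) (auto simp: A_def)
        then show "(\<Sum>k<j. ennreal d * indicator (A k) y) \<le> h y + ennreal d"
          using layer_sum_bounds(1)[OF d(1), where z = "h y" and n = j] by simp
      qed
      also have "\<dots> = (\<integral>\<^sup>+y. h y \<partial>\<mu>) + ennreal d * emeasure \<mu> UNIV"
        using h s\<mu> sets_eq_imp_space_eq[OF s\<mu>] by (subst nn_integral_add) (auto cong: measurable_cong_sets)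
      also have "ennreal d * emeasure \<mu> UNIV = ennreal (d * measure m B)"
        using em[of UNIV] finB d by (simp add: ennreal_mult emeasure_eq_ennreal_measure less_top)
      also have "(\<Sum>k<j. ennreal d * ennreal ((1/2)^Suc k)) \<le> ennreal d"
      proof -
        have "(\<Sum>k<j. ennreal d * ennreal ((1/2)^Suc k)) = ennreal (\<Sum>k<j. d * (1/2)^Suc k)"
        proof -
          have "(\<Sum>k<j. ennreal d * ennreal ((1/2)^Suc k)) = (\<Sum>k<j. ennreal (d * (1/2)^Suc k))"
            using d by (intro sum.cong refl ennreal_mult[symmetric]) auto
          also have "\<dots> = ennreal (\<Sum>k<j. d * (1/2)^Suc k)" using d by (intro sum_ennreal) auto
          finally show ?thesis .
        qed
        also have "(\<Sum>k<j. d * (1/2)^Suc k) = d * (1 - (1/2)^j)"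
        proof (induction j)
          case (Suc j)
          show ?case unfolding sum.lessThan_Suc Suc by (simp add: algebra_simps)
        qed simp
        also have "\<dots> \<le> d" using d by (simp add: algebra_simps)
        finally show ?thesis by (simp add: ennreal_leI)
      qed
      finally have "(\<integral>\<^sup>+y. ennreal (w j y) \<partial>\<mu>) \<le> (\<integral>\<^sup>+y. h y \<partial>\<mu>) + ennreal (d * measure m B) + ennreal d"
        by (simp add: add_left_mono)
      also have "\<dots> = (\<integral>\<^sup>+y. h y \<partial>\<mu>) + ennreal (d * measure m B + d)"
        using d by (simp add: add.assoc)
      also have "\<dots> \<le> (\<integral>\<^sup>+y. h y \<partial>\<mu>) + ennreal e"
        using dB e by (intro add_left_mono ennreal_leI) linarith
      finally show ?thesis using nn[OF wm] nn[OF h] by (simp add: B_def)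
    qed
  qed
qed

section \<open>Compactness of geodesics\<close>

text \<open>Closed balls are compact and geodesics in a ball are equi-Lipschitz, so a diagonal sequence over the rationals
  converges pointwise.\<close>

lemma (in cd_space) geodesics_compact:
  assumes geo: "\<And>n. geod (\<gamma> n)" and R: "\<And>n t. \<gamma> n t \<in> cball (x::'a) R"
  obtains \<sigma> \<gamma>' where "strict_mono (\<sigma> :: nat \<Rightarrow> nat)" "geod \<gamma>'" "\<And>t. (\<lambda>n. \<gamma> (\<sigma> n) t) \<longlonglongrightarrow> \<gamma>' t"
proof -
  define q :: "nat \<Rightarrow> rat" where "q = from_nat"
  interpret subseqs "\<lambda>n s. convergent (\<lambda>i. \<gamma> (s i) (of_rat (q n)))"
  proof
    fix n and s :: "nat \<Rightarrow> nat" assume "strict_mono s"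
    have "seq_compact (cball x R)" using compact_cball by (rule compact_imp_seq_compact)
    then obtain l r where "strict_mono r" "((\<lambda>i. \<gamma> (s i) (of_rat (q n))) \<circ> r) \<longlonglongrightarrow> l"
      using R unfolding seq_compact_def by meson
    then show "\<exists>r'. strict_mono r' \<and> convergent (\<lambda>i. \<gamma> ((s \<circ> r') i) (of_rat (q n)))"
      by (auto simp: convergent_def comp_def)
  qed
  define \<sigma> where "\<sigma> = diagseq"
  have \<sigma>: "strict_mono \<sigma>" unfolding \<sigma>_def by (rule subseq_diagseq)
  have convq: "convergent (\<lambda>i. \<gamma> (\<sigma> i) (of_rat p))" for p
  proof -
    obtain n where n: "q n = p" unfolding q_def by (metis from_nat_to_nat)
    have "convergent (\<lambda>i. \<gamma> ((diagseq \<circ> (+) (Suc n)) i) (of_rat (q n)))"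
    proof (rule diagseq_holds)
      fix r s :: "nat \<Rightarrow> nat" and k assume "strict_mono r" "convergent (\<lambda>i. \<gamma> (s i) (of_rat (q k)))"
      then show "convergent (\<lambda>i. \<gamma> ((s \<circ> r) i) (of_rat (q k)))"
        using convergent_subseq_convergent[of "\<lambda>i. \<gamma> (s i) (of_rat (q k))" r] by (simp add: comp_def)
    qed
    then have "convergent (\<lambda>i. \<gamma> (\<sigma> (i + Suc n)) (of_rat p))" by (simp add: \<sigma>_def n add.commute)
    then show ?thesis using convergent_ignore_initial_segment[of "\<lambda>i. \<gamma> (\<sigma> i) (of_rat p)" "Suc n"] by simp
  qed
  have dlt: "dist (\<gamma> n s) (\<gamma> n t) \<le> 2 * \<bar>R\<bar> * \<bar>s - t\<bar>" for n s t
  proof -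
    have "dist (\<gamma> n 0) (\<gamma> n 1) \<le> 2 * \<bar>R\<bar>"
      using R[of n 0] R[of n 1] dist_triangle3[of "\<gamma> n 0" "\<gamma> n 1" x] by auto
    then have "dist (\<gamma> n 0) (\<gamma> n 1) * \<bar>s - t\<bar> \<le> 2 * \<bar>R\<bar> * \<bar>s - t\<bar>" by (intro mult_right_mono) auto
    then show ?thesis using geod_lipschitz[OF geo[of n], of s t] by linarith
  qed
  have "convergent (\<lambda>i. \<gamma> (\<sigma> i) t)" for t
  proof (rule Cauchy_convergent, rule metric_CauchyI)
    fix e :: real assume e: "0 < e"
    define \<delta> where "\<delta> = e / (6 * \<bar>R\<bar> + 6)"
    have \<delta>: "0 < \<delta>" using e by (simp add: \<delta>_def)
    obtain p where p: "t < of_rat p" "of_rat p < t + \<delta>" using of_rat_dense[of t "t + \<delta>"] \<delta> by auto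
    have R\<delta>: "2 * \<bar>R\<bar> * \<bar>of_rat p - t\<bar> < e / 3"
    proof -
      have "2 * \<bar>R\<bar> * \<bar>of_rat p - t\<bar> \<le> 2 * \<bar>R\<bar> * \<delta>" using p by (intro mult_left_mono) auto
      also have "\<dots> < (2 * \<bar>R\<bar> + 2) * \<delta>" using \<delta> by (simp add: algebra_simps)
      also have "\<dots> = e / 3" by (simp add: \<delta>_def field_simps)
      finally show ?thesis .
    qed
    have "Cauchy (\<lambda>i. \<gamma> (\<sigma> i) (of_rat p))" using convq by (rule convergent_Cauchy)
    then obtain M where M: "\<And>i j. M \<le> i \<Longrightarrow> M \<le> j \<Longrightarrow> dist (\<gamma> (\<sigma> i) (of_rat p)) (\<gamma> (\<sigma> j) (of_rat p)) < e / 3"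
      using e unfolding Cauchy_def by (metis divide_pos_pos zero_less_numeral)
    show "\<exists>M. \<forall>i\<ge>M. \<forall>j\<ge>M. dist (\<gamma> (\<sigma> i) t) (\<gamma> (\<sigma> j) t) < e"
    proof (intro exI allI impI)
      fix i j assume ij: "M \<le> i" "M \<le> j"
      have "dist (\<gamma> (\<sigma> i) t) (\<gamma> (\<sigma> j) t) \<le> dist (\<gamma> (\<sigma> i) t) (\<gamma> (\<sigma> i) (of_rat p))
          + (dist (\<gamma> (\<sigma> i) (of_rat p)) (\<gamma> (\<sigma> j) (of_rat p)) + dist (\<gamma> (\<sigma> j) (of_rat p)) (\<gamma> (\<sigma> j) t))"
        by (intro order_trans[OF dist_triangle add_left_mono] dist_triangle)
      also have "\<dots> < e"
        using M[OF ij] dlt[of "\<sigma> i" t "of_rat p"] dlt[of "\<sigma> j" "of_rat p" t] R\<delta> by (simp add: abs_minus_commute)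
      finally show "dist (\<gamma> (\<sigma> i) t) (\<gamma> (\<sigma> j) t) < e" .
    qed
  qed
  then obtain \<gamma>' where lim: "\<And>t. (\<lambda>i. \<gamma> (\<sigma> i) t) \<longlonglongrightarrow> \<gamma>' t" unfolding convergent_def by metis
  have "geod \<gamma>'"
    unfolding geod_def geodesic_on_unit_interval_def
  proof (intro conjI ballI allI)
    fix s t :: real assume st: "s \<in> {0..1}" "t \<in> {0..1}"
    have "(\<lambda>i. dist (\<gamma> (\<sigma> i) t) (\<gamma> (\<sigma> i) s)) \<longlonglongrightarrow> dist (\<gamma>' t) (\<gamma>' s)" by (intro tendsto_dist lim)
    moreover have "(\<lambda>i. dist (\<gamma> (\<sigma> i) t) (\<gamma> (\<sigma> i) s)) = (\<lambda>i. \<bar>t - s\<bar> * dist (\<gamma> (\<sigma> i) 0) (\<gamma> (\<sigma> i) 1))"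
      using geod_dist[OF geo st(2,1)] by (intro ext)
    moreover have "(\<lambda>i. \<bar>t - s\<bar> * dist (\<gamma> (\<sigma> i) 0) (\<gamma> (\<sigma> i) 1)) \<longlonglongrightarrow> \<bar>t - s\<bar> * dist (\<gamma>' 0) (\<gamma>' 1)"
      by (intro tendsto_intros lim)
    ultimately show "dist (\<gamma>' t) (\<gamma>' s) = \<bar>t - s\<bar> * dist (\<gamma>' 0) (\<gamma>' 1)" by (metis LIMSEQ_unique)
  next
    fix t :: real
    have "(\<lambda>i. \<gamma> (\<sigma> i) t) = (\<lambda>i. \<gamma> (\<sigma> i) (max 0 (min 1 t)))"
      using geo by (intro ext) (simp only: geod_def)
    then show "\<gamma>' t = \<gamma>' (max 0 (min 1 t))" using lim[of t] lim[of "max 0 (min 1 t)"] by (metis LIMSEQ_unique)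
  qed
  then show ?thesis using that \<sigma> lim by blast
qed

section \<open>Radial stopping costs\<close>

text \<open>Part of a geodesic from \<open>y\<close> to \<open>x\<close>, expressed by equality in the triangle inequality.\<close>

definition radial :: "'a::metric_space \<Rightarrow> 'a \<Rightarrow> (real \<Rightarrow> 'a) \<Rightarrow> bool" where
  "radial x y \<gamma> \<longleftrightarrow> geod \<gamma> \<and> \<gamma> 0 = y \<and> dist y (\<gamma> 1) + dist (\<gamma> 1) x = dist y x"

definition path_cost :: "('a::metric_space \<Rightarrow> real) \<Rightarrow> ('a \<Rightarrow> real) \<Rightarrow> (real \<Rightarrow> 'a) \<Rightarrow> ennreal" where
  "path_cost v w \<gamma> = ennreal (v (\<gamma> 1)) + ennreal (dist (\<gamma> 0) (\<gamma> 1)) * (\<integral>\<^sup>+t\<in>{0..1}. ennreal (w (\<gamma> t)) \<partial>lborel)"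

text \<open>The cheapest way to move from \<open>y\<close> inwards and to stop, paying \<open>v\<close> at the end and \<open>w\<close> along the way. It plays the role of a function
  transported by the contraction, in a space where the contraction is not given by a map.\<close>

definition stop_cost :: "'a::metric_space \<Rightarrow> ('a \<Rightarrow> real) \<Rightarrow> ('a \<Rightarrow> real) \<Rightarrow> 'a \<Rightarrow> ennreal" where
  "stop_cost x v w y = (INF \<gamma>\<in>{\<gamma>. radial x y \<gamma>}. path_cost v w \<gamma>)"

lemma radial_dist_le:
  assumes "radial x y \<gamma>" shows "dist (\<gamma> t) x \<le> dist y x"
proof -
  have g: "geod \<gamma>" "\<gamma> 0 = y" "dist y (\<gamma> 1) + dist (\<gamma> 1) x = dist y x" using assms by (auto simp: radial_def)
  define s where "s = max 0 (min 1 t)"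
  have s: "s \<in> {0..1}" by (simp add: s_def)
  have "\<gamma> t = \<gamma> s" using g(1) unfolding geod_def s_def by blast
  moreover have "dist (\<gamma> s) (\<gamma> 1) \<le> dist y (\<gamma> 1)"
    using geod_dist[OF g(1) s, of 1] s g(2) by (simp add: mult_left_le_one_le)
  ultimately show ?thesis using dist_triangle[of "\<gamma> s" x "\<gamma> 1"] g(3) by simp
qed

lemma radial_const: "radial x y (\<lambda>_. y)"
  by (simp add: radial_def geod_def geodesic_on_unit_interval_def)

lemma stop_cost_le: "stop_cost x v w y \<le> ennreal (v y)"
proof -
  have "stop_cost x v w y \<le> path_cost v w (\<lambda>_. y)"
    unfolding stop_cost_def by (rule INF_lower) (simp add: radial_const)
  then show ?thesis by (simp add: path_cost_def)
qed

lemma geod_nn_measurable: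
  fixes w :: "'a::metric_space \<Rightarrow> real"
  assumes "geod \<gamma>" "continuous_on UNIV w"
  shows "(\<lambda>t. ennreal (w (\<gamma> t))) \<in> borel_measurable borel"
  using borel_measurable_continuous_onI[OF continuous_on_compose2[OF assms(2) geod_continuous[OF assms(1), of UNIV]]]
  by simp

lemma geod_concat:
  fixes \<gamma> \<gamma>1 \<gamma>2 :: "real \<Rightarrow> 'a::metric_space"
  assumes g1: "geod \<gamma>1" and g2: "geod \<gamma>2" and j: "\<gamma>1 1 = \<gamma>2 0"
    and add: "dist (\<gamma>1 0) (\<gamma>2 1) = dist (\<gamma>1 0) (\<gamma>1 1) + dist (\<gamma>2 0) (\<gamma>2 1)"
    and pos: "0 < dist (\<gamma>1 0) (\<gamma>1 1)" "0 < dist (\<gamma>2 0) (\<gamma>2 1)"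
    and a_def: "a = dist (\<gamma>1 0) (\<gamma>1 1) / (dist (\<gamma>1 0) (\<gamma>1 1) + dist (\<gamma>2 0) (\<gamma>2 1))"
    and \<gamma>_def: "\<And>t. \<gamma> t = (if t \<le> a then \<gamma>1 (t / a) else \<gamma>2 ((t - a) / (1 - a)))"
  shows "geod \<gamma>" "\<gamma> 0 = \<gamma>1 0" "\<gamma> 1 = \<gamma>2 1" "0 < a" "a < 1"
    "a * dist (\<gamma> 0) (\<gamma> 1) = dist (\<gamma>1 0) (\<gamma>1 1)" "(1 - a) * dist (\<gamma> 0) (\<gamma> 1) = dist (\<gamma>2 0) (\<gamma>2 1)"
proof -
  let ?d1 = "dist (\<gamma>1 0) (\<gamma>1 1)" and ?d2 = "dist (\<gamma>2 0) (\<gamma>2 1)"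
  have pp: "0 < ?d1 + ?d2" using pos by linarith
  show a: "0 < a" unfolding a_def by (rule divide_pos_pos[OF pos(1) pp])
  have "?d1 < 1 * (?d1 + ?d2)" using pos by simp
  then show a1: "a < 1" unfolding a_def using pp by (simp only: pos_divide_less_eq)
  note a = a a1
  show e0: "\<gamma> 0 = \<gamma>1 0" and e1: "\<gamma> 1 = \<gamma>2 1" using a by (auto simp: \<gamma>_def)
  have d: "dist (\<gamma> 0) (\<gamma> 1) = ?d1 + ?d2" using add e0 e1 by simp
  show ad: "a * dist (\<gamma> 0) (\<gamma> 1) = ?d1" unfolding d a_def using less_imp_neq[OF pp, symmetric]
    by (simp only: times_divide_eq_left nonzero_mult_div_cancel_right not_False_eq_True)
  then show ad2: "(1 - a) * dist (\<gamma> 0) (\<gamma> 1) = ?d2" using d by (simp add: algebra_simps)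
  have canc: "b / c * (c * z) = b * z" if "c \<noteq> 0" for b c z :: real using that by simp
  have upper: "dist (\<gamma> s) (\<gamma> t) \<le> (t - s) * (?d1 + ?d2)" if st: "0 \<le> s" "s \<le> t" "t \<le> 1" for s t
  proof -
    have A: "dist (\<gamma>1 (s / a)) (\<gamma>1 (t / a)) = (t - s) * (?d1 + ?d2)" if "0 \<le> s" "s \<le> t" "t \<le> a" for s t
    proof -
      have "dist (\<gamma>1 (s / a)) (\<gamma>1 (t / a)) = \<bar>s / a - t / a\<bar> * ?d1"
        using that a by (intro geod_dist[OF g1]) (auto simp: divide_le_eq_1)
      also have "\<bar>s / a - t / a\<bar> = (t - s) / a" using that a by (simp add: diff_divide_distrib[symmetric])
      also have "(t - s) / a * ?d1 = (t - s) / a * (a * (?d1 + ?d2))" by (simp only: ad[unfolded d])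
      also have "\<dots> = (t - s) * (?d1 + ?d2)" using a by (intro canc) simp
      finally show ?thesis .
    qed
    have B: "dist (\<gamma>2 ((s - a) / (1 - a))) (\<gamma>2 ((t - a) / (1 - a))) = (t - s) * (?d1 + ?d2)" if "a \<le> s" "s \<le> t" "t \<le> 1" for s t
    proof -
      have "dist (\<gamma>2 ((s - a) / (1 - a))) (\<gamma>2 ((t - a) / (1 - a))) = \<bar>(s - a) / (1 - a) - (t - a) / (1 - a)\<bar> * ?d2"
        using that a by (intro geod_dist[OF g2]) (auto simp: divide_le_eq_1)
      also have "\<bar>(s - a) / (1 - a) - (t - a) / (1 - a)\<bar> = (t - s) / (1 - a)"
        using that a by (simp add: diff_divide_distrib[symmetric])
      also have "(t - s) / (1 - a) * ?d2 = (t - s) / (1 - a) * ((1 - a) * (?d1 + ?d2))" by (simp only: ad2[unfolded d])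
      also have "\<dots> = (t - s) * (?d1 + ?d2)" using a by (intro canc) simp
      finally show ?thesis .
    qed
    show ?thesis
    proof (cases "t \<le> a")
      case True
      then show ?thesis using A[of s t] st by (simp add: \<gamma>_def)
    next
      case False
      show ?thesis
      proof (cases "s \<le> a")
        case True
        have "dist (\<gamma> s) (\<gamma> t) \<le> dist (\<gamma>1 (s / a)) (\<gamma>1 (a / a)) + dist (\<gamma>2 ((a - a) / (1 - a))) (\<gamma>2 ((t - a) / (1 - a)))"
          using True False a j dist_triangle[of "\<gamma>1 (s/a)" "\<gamma>2 ((t - a) / (1 - a))" "\<gamma>1 1"] by (simp add: \<gamma>_def)
        also have "\<dots> = (a - s) * (?d1 + ?d2) + (t - a) * (?d1 + ?d2)"
          using A[of s a] B[of a t] st True False by simp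
        finally show ?thesis by (simp add: algebra_simps)
      next
        case False
        then show ?thesis using B[of s t] st \<open>\<not> t \<le> a\<close> by (simp add: \<gamma>_def)
      qed
    qed
  qed
  have eq: "dist (\<gamma> s) (\<gamma> t) = (t - s) * (?d1 + ?d2)" if st: "0 \<le> s" "s \<le> t" "t \<le> 1" for s t
  proof (rule antisym[OF upper[OF st]])
    have "?d1 + ?d2 \<le> dist (\<gamma> 0) (\<gamma> s) + dist (\<gamma> s) (\<gamma> t) + dist (\<gamma> t) (\<gamma> 1)"
      using d dist_triangle[of "\<gamma> 0" "\<gamma> 1" "\<gamma> s"] dist_triangle[of "\<gamma> s" "\<gamma> 1" "\<gamma> t"] by linarith
    also have "\<dots> \<le> s * (?d1 + ?d2) + dist (\<gamma> s) (\<gamma> t) + (1 - t) * (?d1 + ?d2)"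
      using upper[of 0 s] upper[of t 1] st by simp
    finally show "(t - s) * (?d1 + ?d2) \<le> dist (\<gamma> s) (\<gamma> t)" by (simp add: algebra_simps)
  qed
  have c1: "\<gamma>1 u = \<gamma>1 (max 0 (min 1 u))" and c2: "\<gamma>2 u = \<gamma>2 (max 0 (min 1 u))" for u
    using g1 g2 unfolding geod_def by blast+
  show "geod \<gamma>"
    unfolding geod_def geodesic_on_unit_interval_def
  proof (intro conjI ballI allI)
    fix s t :: real assume st: "s \<in> {0..1}" "t \<in> {0..1}"
    show "dist (\<gamma> t) (\<gamma> s) = \<bar>t - s\<bar> * dist (\<gamma> 0) (\<gamma> 1)"
      using eq[of s t] eq[of t s] st d by (cases "s \<le> t") (auto simp: dist_commute)
  next
    fix t :: real
    consider "t < 0" | "0 \<le> t" "t \<le> 1" | "1 < t" by linarith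
    then show "\<gamma> t = \<gamma> (max 0 (min 1 t))"
    proof cases
      case 1
      then have "max 0 (min 1 (t / a)) = 0" "max 0 (min 1 t) = 0" using a divide_neg_pos[of t a] by (auto simp: max_def min_def)
      note m = this
      have "\<gamma>1 (t / a) = \<gamma>1 0" using c1[of "t / a"] unfolding m(1) .
      then show ?thesis using 1 m(2) a e0 by (simp only: \<gamma>_def) simp
    next
      case 3
      then have "max 0 (min 1 ((t - a) / (1 - a))) = 1" "max 0 (min 1 t) = 1" using a by (auto simp: max_def min_def)
      note m = this
      have "\<gamma>2 ((t - a) / (1 - a)) = \<gamma>2 1" using c2[of "(t - a) / (1 - a)"] unfolding m(1) .
      then show ?thesis using 3 m(2) a e1 by (simp only: \<gamma>_def) simp
    next
      case 2
      then have "max 0 (min 1 t) = t" by simp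
      then show ?thesis by (simp only:)
    qed
  qed
qed

lemma geod_concat_integral:
  fixes F :: "real \<Rightarrow> ennreal" and F1 F2 :: "real \<Rightarrow> ennreal"
  assumes a: "0 < a" "a < 1" and m: "F1 \<in> borel_measurable borel" "F2 \<in> borel_measurable borel"
    and F: "\<And>t. t \<le> a \<Longrightarrow> F t = F1 (t / a)" "\<And>t. a < t \<Longrightarrow> F t = F2 ((t - a) / (1 - a))"
  shows "(\<integral>\<^sup>+t\<in>{0..1}. F t \<partial>lborel) = ennreal a * (\<integral>\<^sup>+t\<in>{0..1}. F1 t \<partial>lborel) + ennreal (1 - a) * (\<integral>\<^sup>+t\<in>{0..1}. F2 t \<partial>lborel)"
proof -
  let ?G1 = "\<lambda>t. F1 (t / a) * indicator {0..a} t" and ?G2 = "\<lambda>t. F2 ((t - a) / (1 - a)) * indicator {a<..1} t"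
  have mG: "?G1 \<in> borel_measurable borel" "?G2 \<in> borel_measurable borel"
    using m by measurable
  have "(\<integral>\<^sup>+t\<in>{0..1}. F t \<partial>lborel) = (\<integral>\<^sup>+t. ?G1 t + ?G2 t \<partial>lborel)"
  proof (rule nn_integral_cong)
    fix t show "F t * indicator {0..1} t = ?G1 t + ?G2 t"
      using a F(1)[of t] F(2)[of t] by (cases "t \<le> a"; cases "0 \<le> t"; cases "t \<le> 1") auto
  qed
  also have "\<dots> = (\<integral>\<^sup>+t. ?G1 t \<partial>lborel) + (\<integral>\<^sup>+t. ?G2 t \<partial>lborel)"
    using mG by (intro nn_integral_add) auto
  also have "(\<integral>\<^sup>+t. ?G1 t \<partial>lborel) = ennreal \<bar>a\<bar> * (\<integral>\<^sup>+t. ?G1 (0 + a * t) \<partial>lborel)"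
    using a by (intro nn_integral_real_affine mG) auto
  also have "(\<integral>\<^sup>+t. ?G1 (0 + a * t) \<partial>lborel) = (\<integral>\<^sup>+t\<in>{0..1}. F1 t \<partial>lborel)"
    using a by (intro nn_integral_cong) (auto simp: indicator_def zero_le_mult_iff)
  also have "(\<integral>\<^sup>+t. ?G2 t \<partial>lborel) = ennreal \<bar>1 - a\<bar> * (\<integral>\<^sup>+t. ?G2 (a + (1 - a) * t) \<partial>lborel)"
    using a by (intro nn_integral_real_affine mG) auto
  also have "(\<integral>\<^sup>+t. ?G2 (a + (1 - a) * t) \<partial>lborel) = (\<integral>\<^sup>+t\<in>{0..1}. F2 t \<partial>lborel)"
  proof (rule nn_integral_cong_AE)
    have "AE t in lborel. t \<noteq> (0::real)" by (rule AE_lborel_singleton)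
    then show "AE t in lborel. ?G2 (a + (1 - a) * t) = F2 t * indicator {0..1} t"
    proof eventually_elim
      case (elim t)
      have "a + (1 - a) * t \<in> {a<..1} \<longleftrightarrow> t \<in> {0<..1}"
      proof -
        have "a < a + (1 - a) * t \<longleftrightarrow> 0 < t" using a by (simp add: zero_less_mult_iff)
        moreover have "a + (1 - a) * t \<le> 1 \<longleftrightarrow> (1 - a) * t \<le> (1 - a) * 1" by auto
        moreover have "\<dots> \<longleftrightarrow> t \<le> 1" using a by (subst mult_le_cancel_left_pos) auto
        ultimately show ?thesis by auto
      qed
      then show ?case using a elim by (auto simp: indicator_def)
    qed
  qed
  finally show ?thesis using a by simp
qed

context cd_space begin

lemma geod_exists: "\<exists>\<gamma>. geod \<gamma> \<and> \<gamma> 0 = (y::'a) \<and> \<gamma> 1 = z"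
proof -
  obtain \<gamma> where g: "geodesic_on_unit_interval \<gamma>" "\<gamma> 0 = y" "\<gamma> 1 = z" using geodesic_space by blast
  have "geod (\<lambda>t. \<gamma> (max 0 (min 1 t)))"
    unfolding geod_def geodesic_on_unit_interval_def
  proof (intro conjI ballI allI)
    fix s t :: real assume st: "s \<in> {0..1}" "t \<in> {0..1}"
    then have "max 0 (min 1 s) = s" "max 0 (min 1 t) = t" by auto
    then show "dist (\<gamma> (max 0 (min 1 t))) (\<gamma> (max 0 (min 1 s))) = \<bar>t - s\<bar> * dist (\<gamma> (max 0 (min 1 0))) (\<gamma> (max 0 (min 1 1)))"
      using geodesic_dist[OF g(1) st(2,1)] by simp
  qed auto
  then show ?thesis using g(2,3) by (intro exI[of _ "\<lambda>t. \<gamma> (max 0 (min 1 t))"]) simp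
qed

text \<open>The dynamic programming inequality: prepend a short radial piece to a path that starts at \<open>p\<close>. The value \<open>b\<close> bounds \<open>w\<close> on that piece.\<close>

lemma stop_cost_step:
  fixes x y p :: 'a
  assumes w: "continuous_on UNIV w" "\<And>z. 0 \<le> w z"
    and p: "dist y p + dist p x = dist y x"
    and osc: "\<And>z. dist z p \<le> dist y p \<Longrightarrow> dist z x \<le> dist y x \<Longrightarrow> w z \<le> b"
  shows "stop_cost x v w y \<le> ennreal (dist y p * b) + stop_cost x v w p"
proof (cases "y = p")
  case True then show ?thesis by simp
next
  case False
  then have d1: "0 < dist y p" by simp
  obtain \<gamma>1 where g1: "geod \<gamma>1" "\<gamma>1 0 = y" "\<gamma>1 1 = p" using geod_exists by blast
  have w1: "w (\<gamma>1 t) \<le> b" if "t \<in> {0..1}" for t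
  proof -
    have dp: "dist (\<gamma>1 t) p \<le> dist y p"
      using geod_dist[OF g1(1) that, of 1] that g1 by (simp add: mult_left_le_one_le)
    then show ?thesis using p dist_triangle[of "\<gamma>1 t" x p] by (intro osc) auto
  qed
  have I1: "(\<integral>\<^sup>+t\<in>{0..1}. ennreal (w (\<gamma>1 t)) \<partial>lborel) \<le> ennreal b"
  proof -
    have "(\<integral>\<^sup>+t\<in>{0..1}. ennreal (w (\<gamma>1 t)) \<partial>lborel) \<le> (\<integral>\<^sup>+t. ennreal b * indicator {0..1::real} t \<partial>lborel)"
      using w1 by (intro nn_integral_mono) (auto simp: indicator_def intro: ennreal_leI)
    also have "\<dots> = ennreal b" by (simp add: nn_integral_cmult_indicator)
    finally show ?thesis .
  qed
  have b0: "0 \<le> b" using w(2)[of p] osc[of p] p by (smt (verit) dist_self zero_le_dist)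
  show ?thesis
    unfolding stop_cost_def[of x v w p]
  proof -
    have main: "stop_cost x v w y \<le> ennreal (dist y p * b) + path_cost v w \<gamma>2" if "\<gamma>2 \<in> {\<gamma>. radial x p \<gamma>}" for \<gamma>2
    proof -
    have r2: "geod \<gamma>2" "\<gamma>2 0 = p" "dist p (\<gamma>2 1) + dist (\<gamma>2 1) x = dist p x" using that by (auto simp: radial_def)
    let ?z = "\<gamma>2 1"
    have dz: "dist y ?z = dist y p + dist p ?z" and rz: "dist y ?z + dist ?z x = dist y x"
      using dist_triangle[of y ?z p] dist_triangle[of y x ?z] p r2 by linarith+
    let ?I = "\<lambda>\<gamma>. \<integral>\<^sup>+t\<in>{0..1}. ennreal (w (\<gamma> t)) \<partial>lborel"
    show "stop_cost x v w y \<le> ennreal (dist y p * b) + path_cost v w \<gamma>2"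
    proof (cases "p = ?z")
      case True
      have "radial x y \<gamma>1" using g1 p by (simp add: radial_def)
      then have "stop_cost x v w y \<le> path_cost v w \<gamma>1"
        unfolding stop_cost_def by (intro INF_lower) simp
      also have "\<dots> = ennreal (dist y p) * ?I \<gamma>1 + ennreal (v ?z)"
        using g1 True by (simp add: path_cost_def add.commute)
      also have "\<dots> \<le> ennreal (dist y p) * ennreal b + path_cost v w \<gamma>2"
        by (intro add_mono mult_left_mono I1) (auto simp: path_cost_def)
      also have "\<dots> = ennreal (dist y p * b) + path_cost v w \<gamma>2" using b0 by (simp add: ennreal_mult)
      finally show ?thesis .
    next
      case False
      then have d2: "0 < dist p ?z" by simp
      define a where "a = dist y p / (dist y p + dist p ?z)"
      define \<gamma> where "\<gamma> t = (if t \<le> a then \<gamma>1 (t / a) else \<gamma>2 ((t - a) / (1 - a)))" for t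
      have "\<gamma>1 1 = \<gamma>2 0" "dist (\<gamma>1 0) (\<gamma>2 1) = dist (\<gamma>1 0) (\<gamma>1 1) + dist (\<gamma>2 0) (\<gamma>2 1)"
        "0 < dist (\<gamma>1 0) (\<gamma>1 1)" "0 < dist (\<gamma>2 0) (\<gamma>2 1)" using g1 r2 dz d1 d2 by auto
      note c = geod_concat[OF g1(1) r2(1) this]
      have G: "geod \<gamma>" "\<gamma> 0 = y" "\<gamma> 1 = ?z" "0 < a" "a < 1" "a * dist y ?z = dist y p" "(1 - a) * dist y ?z = dist p ?z"
      proof -
        have "a = dist (\<gamma>1 0) (\<gamma>1 1) / (dist (\<gamma>1 0) (\<gamma>1 1) + dist (\<gamma>2 0) (\<gamma>2 1))"
          by (simp add: a_def g1 r2)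
        note c' = c[OF this \<gamma>_def]
        show "geod \<gamma>" "0 < a" "a < 1" by (rule c')+
        show "\<gamma> 0 = y" by (rule trans[OF c'(2) g1(2)])
        show "\<gamma> 1 = ?z" by (rule c'(3))
        show "a * dist y ?z = dist y p" "(1 - a) * dist y ?z = dist p ?z"
          using c'(6,7) unfolding c'(2,3) g1(2,3) r2(2) .
      qed
      have "radial x y \<gamma>" using G rz by (simp add: radial_def)
      then have "stop_cost x v w y \<le> path_cost v w \<gamma>"
        unfolding stop_cost_def by (intro INF_lower) simp
      also have "\<dots> = ennreal (v ?z) + ennreal (dist y ?z) * (ennreal a * ?I \<gamma>1 + ennreal (1 - a) * ?I \<gamma>2)"
        unfolding path_cost_def G(2,3)
        by (subst geod_concat_integral[OF G(4,5) geod_nn_measurable[OF g1(1) w(1)] geod_nn_measurable[OF r2(1) w(1)]])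
           (auto simp: \<gamma>_def)
      also have "ennreal (dist y ?z) * (ennreal a * ?I \<gamma>1 + ennreal (1 - a) * ?I \<gamma>2)
          = ennreal (dist y p) * ?I \<gamma>1 + ennreal (dist p ?z) * ?I \<gamma>2"
      proof -
        have "ennreal (dist y ?z) * ennreal a = ennreal (dist y p)"
          using G by (subst ennreal_mult[symmetric]) (auto simp: mult.commute)
        moreover have "ennreal (dist y ?z) * ennreal (1 - a) = ennreal (dist p ?z)"
          using G by (subst ennreal_mult[symmetric]) (auto simp: mult.commute)
        ultimately show ?thesis by (simp only: distrib_left mult.assoc[symmetric])
      qed
      also have "ennreal (v ?z) + (ennreal (dist y p) * ?I \<gamma>1 + ennreal (dist p ?z) * ?I \<gamma>2)
          = ennreal (dist y p) * ?I \<gamma>1 + path_cost v w \<gamma>2"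
        using r2 by (simp add: path_cost_def ac_simps)
      also have "\<dots> \<le> ennreal (dist y p) * ennreal b + path_cost v w \<gamma>2"
        by (intro add_mono mult_left_mono I1) auto
      also have "\<dots> = ennreal (dist y p * b) + path_cost v w \<gamma>2" using b0 by (simp add: ennreal_mult)
      finally show ?thesis .
    qed
    qed
    have nt: "stop_cost x v w y \<noteq> \<top>" using stop_cost_le[of x v w y] by (auto simp: top_unique)
    have "stop_cost x v w y - ennreal (dist y p * b) \<le> (INF \<gamma>\<in>{\<gamma>. radial x p \<gamma>}. path_cost v w \<gamma>)"
      using main by (intro INF_greatest) (simp add: ennreal_minus_le_iff)
    then show "stop_cost x v w y \<le> ennreal (dist y p * b) + (INF \<gamma>\<in>{\<gamma>. radial x p \<gamma>}. path_cost v w \<gamma>)"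
      by (simp add: ennreal_minus_le_iff)
  qed
qed

lemma path_cost_tendsto:
  fixes x :: 'a
  assumes geo: "\<And>n. geod (\<gamma> n)" "geod \<gamma>'" and lim: "\<And>t. (\<lambda>n. \<gamma> n t) \<longlonglongrightarrow> \<gamma>' t"
    and R: "\<And>n t. \<gamma> n t \<in> cball x R" and v: "continuous_on UNIV v" and w: "continuous_on UNIV w"
  shows "(\<lambda>n. path_cost v w (\<gamma> n)) \<longlonglongrightarrow> path_cost v w \<gamma>'"
proof -
  have "compact (w ` cball x R)"
    using compact_cball by (intro compact_continuous_image continuous_on_subset[OF w]) auto
  then obtain M where M: "\<And>y. y \<in> cball x R \<Longrightarrow> \<bar>w y\<bar> \<le> M"
  proof -
    obtain M where "\<forall>z\<in>w ` cball x R. norm z \<le> M"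
      using compact_imp_bounded[OF \<open>compact (w ` cball x R)\<close>] unfolding bounded_iff by blast
    then show ?thesis using that[of M] by simp
  qed
  have cont: "(\<lambda>n. f (\<gamma> n t)) \<longlonglongrightarrow> f (\<gamma>' t)" if "continuous_on UNIV f" for f :: "'a \<Rightarrow> real" and t
    using that lim[of t] by (metis UNIV_I continuous_on_eq_continuous_at isCont_tendsto_compose open_UNIV)
  have "(\<lambda>n. \<integral>\<^sup>+t\<in>{0..1}. ennreal (w (\<gamma> n t)) \<partial>lborel) \<longlonglongrightarrow> (\<integral>\<^sup>+t\<in>{0..1}. ennreal (w (\<gamma>' t)) \<partial>lborel)"
  proof (rule nn_integral_dominated_convergence[where w = "\<lambda>t. ennreal M * indicator {0..1} t"])
    show "(\<lambda>t. ennreal (w (\<gamma> n t)) * indicator {0..1} t) \<in> borel_measurable lborel" for n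
      using geod_nn_measurable[OF geo(1) w] by simp
    show "(\<lambda>t. ennreal (w (\<gamma>' t)) * indicator {0..1} t) \<in> borel_measurable lborel"
      using geod_nn_measurable[OF geo(2) w] by simp
    show "AE t in lborel. ennreal (w (\<gamma> n t)) * indicator {0..1} t \<le> ennreal M * indicator {0..1} t" for n
    proof (rule AE_I2)
      fix t
      have "w (\<gamma> n t) \<le> M" using M[OF R[of n t]] by linarith
      then show "ennreal (w (\<gamma> n t)) * indicator {0..1} t \<le> ennreal M * indicator {0..1} t"
        by (intro mult_right_mono ennreal_leI) auto
    qed
    show "(\<integral>\<^sup>+t. ennreal M * indicator {0..1::real} t \<partial>lborel) < \<infinity>" by (simp add: nn_integral_cmult_indicator)
    show "AE t in lborel. (\<lambda>n. ennreal (w (\<gamma> n t)) * indicator {0..1} t) \<longlonglongrightarrow> ennreal (w (\<gamma>' t)) * indicator {0..1} t"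
    proof (rule AE_I2)
      fix t :: real
      show "(\<lambda>n. ennreal (w (\<gamma> n t)) * indicator {0..1} t) \<longlonglongrightarrow> ennreal (w (\<gamma>' t)) * indicator {0..1} t"
        using cont[OF w, of t] by (cases "t \<in> {0..1}") (auto intro: tendsto_ennrealI)
    qed
  qed auto
  moreover have "(\<integral>\<^sup>+t\<in>{0..1}. ennreal (w (\<gamma>' t)) \<partial>lborel) \<le> ennreal M"
  proof -
    have "(\<integral>\<^sup>+t\<in>{0..1}. ennreal (w (\<gamma>' t)) \<partial>lborel) \<le> (\<integral>\<^sup>+t. ennreal M * indicator {0..1::real} t \<partial>lborel)"
    proof (rule nn_integral_mono)
      fix t :: real
      have "w (\<gamma> n t) \<le> M" for n using M[OF R[of n t]] by linarith
      then have "w (\<gamma>' t) \<le> M"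
        by (intro LIMSEQ_le_const2[OF cont[OF w, of t]] exI[of _ 0] allI impI)
      then show "ennreal (w (\<gamma>' t)) * indicator {0..1} t \<le> ennreal M * indicator {0..1} t"
        by (intro mult_right_mono ennreal_leI) auto
    qed
    then show ?thesis by (simp add: nn_integral_cmult_indicator)
  qed
  moreover have "(\<lambda>n. ennreal (dist (\<gamma> n 0) (\<gamma> n 1))) \<longlonglongrightarrow> ennreal (dist (\<gamma>' 0) (\<gamma>' 1))"
    by (rule tendsto_ennrealI[OF tendsto_dist[OF lim lim]])
  ultimately have "(\<lambda>n. ennreal (dist (\<gamma> n 0) (\<gamma> n 1)) * (\<integral>\<^sup>+t\<in>{0..1}. ennreal (w (\<gamma> n t)) \<partial>lborel))
      \<longlonglongrightarrow> ennreal (dist (\<gamma>' 0) (\<gamma>' 1)) * (\<integral>\<^sup>+t\<in>{0..1}. ennreal (w (\<gamma>' t)) \<partial>lborel)"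
    by (intro tendsto_mult_ennreal) (auto simp: top_unique)
  then show ?thesis
    unfolding path_cost_def by (rule tendsto_add[OF tendsto_ennrealI[OF cont[OF v]]])
qed

text \<open>Lower semicontinuity, from compactness of radial geodesics and continuity of the cost; it provides measurability.\<close>

lemma stop_cost_lower_closed:
  fixes x :: 'a
  assumes v: "continuous_on UNIV v" and w: "continuous_on UNIV w"
  shows "closed {y\<in>cball x R. stop_cost x v w y \<le> l}"
proof (cases "l = \<infinity>")
  case True
  then have "{y\<in>cball x R. stop_cost x v w y \<le> l} = cball x R" by auto
  then show ?thesis using closed_cball by (simp only:)
next
  case False
  show ?thesis
    unfolding closed_sequential_limits
  proof (intro allI impI, elim conjE)
    fix ys :: "nat \<Rightarrow> 'a" and y assume ys: "\<forall>n. ys n \<in> {y\<in>cball x R. stop_cost x v w y \<le> l}" and lim: "ys \<longlonglongrightarrow> y"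
    have "\<exists>\<gamma>. radial x (ys n) \<gamma> \<and> path_cost v w \<gamma> < l + ennreal (1 / Suc n)" for n
    proof -
      have "l < l + ennreal (1 / Suc n)"
        using False by (cases l) (auto simp flip: ennreal_plus simp: ennreal_less_iff)
      then have "stop_cost x v w (ys n) < l + ennreal (1 / Suc n)"
        using ys by (metis (mono_tags, lifting) le_less_trans mem_Collect_eq)
      then show ?thesis unfolding stop_cost_def INF_less_iff by auto
    qed
    then obtain \<gamma> where \<gamma>: "\<And>n. radial x (ys n) (\<gamma> n)" "\<And>n. path_cost v w (\<gamma> n) < l + ennreal (1 / Suc n)" by metis
    have geo: "geod (\<gamma> n)" for n using \<gamma>(1) by (simp add: radial_def)
    have inR: "\<gamma> n t \<in> cball x R" for n t
    proof -
      have "dist x (ys n) \<le> R" using ys by simp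
      then show ?thesis using radial_dist_le[OF \<gamma>(1), of n t] by (simp add: dist_commute)
    qed
    obtain \<sigma> \<gamma>' where \<sigma>: "strict_mono \<sigma>" "geod \<gamma>'" "\<And>t. (\<lambda>n. \<gamma> (\<sigma> n) t) \<longlonglongrightarrow> \<gamma>' t"
      using geodesics_compact[where \<gamma> = \<gamma>, OF geo inR] by metis
    have "(\<lambda>n. \<gamma> (\<sigma> n) 0) = ys \<circ> \<sigma>" using \<gamma>(1) by (auto simp: radial_def)
    then have y0: "\<gamma>' 0 = y"
      using \<sigma>(3)[of 0] LIMSEQ_subseq_LIMSEQ[OF lim \<sigma>(1)] by (metis LIMSEQ_unique)
    have "(\<lambda>n. dist (\<gamma> (\<sigma> n) 0) (\<gamma> (\<sigma> n) 1) + dist (\<gamma> (\<sigma> n) 1) x) \<longlonglongrightarrow> dist (\<gamma>' 0) (\<gamma>' 1) + dist (\<gamma>' 1) x"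
      by (intro tendsto_intros \<sigma>(3))
    moreover have "(\<lambda>n. dist (\<gamma> (\<sigma> n) 0) (\<gamma> (\<sigma> n) 1) + dist (\<gamma> (\<sigma> n) 1) x) = (\<lambda>n. dist (\<gamma> (\<sigma> n) 0) x)"
      using \<gamma>(1) by (auto simp: radial_def)
    moreover have "(\<lambda>n. dist (\<gamma> (\<sigma> n) 0) x) \<longlonglongrightarrow> dist (\<gamma>' 0) x" by (intro tendsto_intros \<sigma>(3))
    ultimately have "dist (\<gamma>' 0) (\<gamma>' 1) + dist (\<gamma>' 1) x = dist (\<gamma>' 0) x" by (metis LIMSEQ_unique)
    then have rad: "radial x y \<gamma>'" using y0 \<sigma>(2) by (simp add: radial_def)
    have "(\<lambda>n. path_cost v w (\<gamma> (\<sigma> n))) \<longlonglongrightarrow> path_cost v w \<gamma>'"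
      by (rule path_cost_tendsto[OF _ \<sigma>(2,3) _ v w]) (use geo inR in auto)
    moreover have "(\<lambda>n. l + ennreal (1 / Suc (\<sigma> n))) \<longlonglongrightarrow> l + ennreal 0"
    proof (intro tendsto_add tendsto_const tendsto_ennrealI)
      have "(\<lambda>n. 1 / real (Suc n)) \<longlonglongrightarrow> 0" by (rule LIMSEQ_Suc[OF lim_1_over_n])
      from LIMSEQ_subseq_LIMSEQ[OF this \<sigma>(1)] show "(\<lambda>n. 1 / real (Suc (\<sigma> n))) \<longlonglongrightarrow> 0" by (simp add: comp_def)
    qed
    ultimately have "path_cost v w \<gamma>' \<le> l + ennreal 0"
      by (rule LIMSEQ_le) (use \<gamma>(2) in \<open>auto intro!: exI[of _ 0] less_imp_le\<close>)
    moreover have "stop_cost x v w y \<le> path_cost v w \<gamma>'"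
      unfolding stop_cost_def using rad by (intro INF_lower) simp
    moreover have "y \<in> cball x R"
      by (rule closed_sequentially[OF closed_cball _ lim]) (use ys in auto)
    ultimately show "y \<in> {y\<in>cball x R. stop_cost x v w y \<le> l}" by auto
  qed
qed

text \<open>If the cost were too small for every \<open>j\<close>, a limit of almost optimal paths would violate the gradient inequality, since the increasing
  limit of the \<open>w j\<close> dominates \<open>h\<close>.\<close>

lemma stop_cost_approx:
  fixes x :: 'a
  assumes hv: "geo_gradient h v" and v: "continuous_on UNIV v" "\<And>y. 0 \<le> v y"
    and w: "\<And>j. continuous_on UNIV (w j)" "\<And>j y. 0 \<le> w j y" "\<And>y. incseq (\<lambda>j. w j y)"
      "\<And>y. y \<in> cball x R \<Longrightarrow> h y \<le> (SUP j. ennreal (w j y))"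
    and e: "0 < (e::real)"
  obtains j where "\<And>y. y \<in> cball x R \<Longrightarrow> ennreal (v y) \<le> stop_cost x v (w j) y + ennreal e"
proof (rule ccontr)
  assume "\<not> thesis"
  then have "\<forall>j. \<exists>y\<in>cball x R. stop_cost x v (w j) y + ennreal e < ennreal (v y)"
    using that by (metis not_le)
  then obtain ys where ys: "\<And>j. ys j \<in> cball x R" "\<And>j. stop_cost x v (w j) (ys j) + ennreal e < ennreal (v (ys j))" by metis
  have "\<exists>\<gamma>. radial x (ys j) \<gamma> \<and> path_cost v (w j) \<gamma> + ennreal e < ennreal (v (ys j))" for j
  proof -
    have "v (ys j) > e"
      using ys(2)[of j] e v(2) by (metis add.commute ennreal_less_iff le_add_same_cancel1 le_less_trans less_imp_le zero_le add_increasing2 order_refl)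
    then have "stop_cost x v (w j) (ys j) < ennreal (v (ys j)) - ennreal e"
      using ys(2)[of j] by (subst less_diff_eq_ennreal) auto
    then obtain \<gamma> where "radial x (ys j) \<gamma>" "path_cost v (w j) \<gamma> < ennreal (v (ys j)) - ennreal e"
      unfolding stop_cost_def INF_less_iff by auto
    then show ?thesis by (intro exI[of _ \<gamma>]) (simp add: less_diff_eq_ennreal)
  qed
  then obtain \<gamma> where \<gamma>: "\<And>j. radial x (ys j) (\<gamma> j)" "\<And>j. path_cost v (w j) (\<gamma> j) + ennreal e < ennreal (v (ys j))" by metis
  have geo: "geod (\<gamma> n)" for n using \<gamma>(1) by (simp add: radial_def)
  have inR: "\<gamma> n t \<in> cball x R" for n t
  proof -
    have "dist x (ys n) \<le> R" using ys(1)[of n] by simp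
    then show ?thesis using radial_dist_le[OF \<gamma>(1), of n t] by (simp add: dist_commute)
  qed
  obtain \<sigma> \<gamma>' where \<sigma>: "strict_mono \<sigma>" "geod \<gamma>'" "\<And>t. (\<lambda>n. \<gamma> (\<sigma> n) t) \<longlonglongrightarrow> \<gamma>' t"
    using geodesics_compact[where \<gamma> = \<gamma>, OF geo inR] by metis
  have inR': "\<gamma>' t \<in> cball x R" for t
    by (rule closed_sequentially[OF closed_cball inR \<sigma>(3)])
  have vlim: "(\<lambda>n. v (\<gamma> (\<sigma> n) 0)) \<longlonglongrightarrow> v (\<gamma>' 0)"
    using v(1) \<sigma>(3)[of 0] by (metis UNIV_I continuous_on_eq_continuous_at isCont_tendsto_compose open_UNIV)
  have ubd: "path_cost v (w i) \<gamma>' + ennreal e \<le> ennreal (v (\<gamma>' 0))" for i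
  proof (rule LIMSEQ_le)
    have "(\<lambda>n. path_cost v (w i) (\<gamma> (\<sigma> n))) \<longlonglongrightarrow> path_cost v (w i) \<gamma>'"
      by (rule path_cost_tendsto[OF _ \<sigma>(2,3) _ v(1) w(1)]) (use geo inR in auto)
    then show "(\<lambda>n. path_cost v (w i) (\<gamma> (\<sigma> n)) + ennreal e) \<longlonglongrightarrow> path_cost v (w i) \<gamma>' + ennreal e"
      by (rule tendsto_add[OF _ tendsto_const])
    show "(\<lambda>n. ennreal (v (\<gamma> (\<sigma> n) 0))) \<longlonglongrightarrow> ennreal (v (\<gamma>' 0))" by (intro tendsto_ennrealI vlim)
    have "path_cost v (w i) (\<gamma> (\<sigma> n)) + ennreal e \<le> ennreal (v (\<gamma> (\<sigma> n) 0))" if "i \<le> n" for n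
    proof -
      have "i \<le> \<sigma> n" using that seq_suble[OF \<sigma>(1), of n] by linarith
      then have "path_cost v (w i) (\<gamma> (\<sigma> n)) \<le> path_cost v (w (\<sigma> n)) (\<gamma> (\<sigma> n))"
        unfolding path_cost_def
        by (intro add_left_mono mult_left_mono nn_integral_mono mult_right_mono ennreal_leI incseqD[OF w(3)]) auto
      then have "path_cost v (w i) (\<gamma> (\<sigma> n)) + ennreal e \<le> path_cost v (w (\<sigma> n)) (\<gamma> (\<sigma> n)) + ennreal e"
        by (rule add_right_mono)
      also have "\<dots> \<le> ennreal (v (\<gamma> (\<sigma> n) 0))" using \<gamma>[of "\<sigma> n"] by (simp add: radial_def less_imp_le)
      finally show ?thesis .
    qed
    then show "\<exists>N. \<forall>n\<ge>N. path_cost v (w i) (\<gamma> (\<sigma> n)) + ennreal e \<le> ennreal (v (\<gamma> (\<sigma> n) 0))" by blast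
  qed
  let ?d = "dist (\<gamma>' 0) (\<gamma>' 1)"
  have "(SUP i. path_cost v (w i) \<gamma>') = ennreal (v (\<gamma>' 1)) + ennreal ?d * (SUP i. \<integral>\<^sup>+t\<in>{0..1}. ennreal (w i (\<gamma>' t)) \<partial>lborel)"
    unfolding path_cost_def by (simp add: ennreal_SUP_add_right SUP_mult_left_ennreal)
  also have "(SUP i. \<integral>\<^sup>+t\<in>{0..1}. ennreal (w i (\<gamma>' t)) \<partial>lborel) = (\<integral>\<^sup>+t. (SUP i. ennreal (w i (\<gamma>' t)) * indicator {0..1} t) \<partial>lborel)"
  proof (rule nn_integral_monotone_convergence_SUP[symmetric])
    show "incseq (\<lambda>i t. ennreal (w i (\<gamma>' t)) * indicator {0..1} t)"
      using w(3) by (auto simp: incseq_def le_fun_def intro!: mult_right_mono ennreal_leI)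
    show "(\<lambda>t. ennreal (w i (\<gamma>' t)) * indicator {0..1} t) \<in> borel_measurable lborel" for i
      using geod_nn_measurable[OF \<sigma>(2) w(1)] by simp
  qed
  finally have sup: "(SUP i. path_cost v (w i) \<gamma>') = ennreal (v (\<gamma>' 1)) + ennreal ?d * (\<integral>\<^sup>+t. (SUP i. ennreal (w i (\<gamma>' t)) * indicator {0..1} t) \<partial>lborel)" .
  have "ennreal (v (\<gamma>' 0)) \<le> ennreal (v (\<gamma>' 1) + \<bar>v (\<gamma>' 0) - v (\<gamma>' 1)\<bar>)" by (intro ennreal_leI) linarith
  also have "\<dots> = ennreal (v (\<gamma>' 1)) + ennreal \<bar>v (\<gamma>' 0) - v (\<gamma>' 1)\<bar>" using v(2) by (intro ennreal_plus) auto
  also have "\<dots> \<le> ennreal (v (\<gamma>' 1)) + ennreal ?d * (\<integral>\<^sup>+t\<in>{0..1}. h (\<gamma>' t) \<partial>lborel)"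
    using hv \<sigma>(2) by (intro add_left_mono) (auto simp: geo_gradient_def)
  also have "\<dots> \<le> ennreal (v (\<gamma>' 1)) + ennreal ?d * (\<integral>\<^sup>+t. (SUP i. ennreal (w i (\<gamma>' t)) * indicator {0..1} t) \<partial>lborel)"
  proof (intro add_left_mono mult_left_mono nn_integral_mono)
    fix t :: real
    show "h (\<gamma>' t) * indicator {0..1} t \<le> (SUP i. ennreal (w i (\<gamma>' t)) * indicator {0..1} t)"
      using w(4)[OF inR'[of t]] by (cases "t \<in> {0..1}") auto
  qed simp
  also have "\<dots> = (SUP i. path_cost v (w i) \<gamma>')" by (rule sup[symmetric])
  finally have le: "ennreal (v (\<gamma>' 0)) \<le> (SUP i. path_cost v (w i) \<gamma>')" .
  have "(SUP i. path_cost v (w i) \<gamma>') + ennreal e = (SUP i. path_cost v (w i) \<gamma>' + ennreal e)"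
    by (simp add: ennreal_SUP_add_left)
  also have "\<dots> \<le> ennreal (v (\<gamma>' 0))" by (intro SUP_least ubd)
  finally have "ennreal (v (\<gamma>' 0)) + ennreal e \<le> ennreal (v (\<gamma>' 0))" using le by (meson add_right_mono order_trans)
  then show False using e v(2)[of "\<gamma>' 0"] by (simp flip: ennreal_plus)
qed

end

section \<open>Contracting functions to a smaller ball\<close>

context mm_space begin

text \<open>The layer cake formula.\<close>

lemma nn_integral_superlevels:
  fixes F :: "'a \<Rightarrow> real"
  assumes F: "F \<in> borel_measurable borel" and B: "B \<in> sets borel"
  shows "(\<integral>\<^sup>+y\<in>B. ennreal (F y) \<partial>m) = (\<integral>\<^sup>+l. emeasure m {y\<in>B. l < F y} * indicator {0..} l \<partial>lborel)" (is ?eq)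
    and "(\<lambda>l. emeasure m {y\<in>B. l < F y} * indicator {0..} l) \<in> borel_measurable lborel" (is ?meas)
proof -
  interpret m: sigma_finite_measure m by (rule sigma_finite_m)
  interpret pair_sigma_finite m lborel by standard
  have Fm [measurable]: "F \<in> borel_measurable m" using F by (simp add: measurable_cong_sets[OF sets_m refl])
  have Bm [measurable]: "B \<in> sets m" using B by (simp add: sets_m)
  define f where "f = (\<lambda>(y, l). if y \<in> B \<and> 0 \<le> l \<and> l < F y then 1 else (0::ennreal))"
  have fm [measurable]: "f \<in> borel_measurable (m \<Otimes>\<^sub>M lborel)" unfolding f_def by measurable
  have 1: "(\<integral>\<^sup>+l. f (y, l) \<partial>lborel) = ennreal (F y) * indicator B y" for y
  proof -
    have "(\<integral>\<^sup>+l. f (y, l) \<partial>lborel) = (\<integral>\<^sup>+l. indicator B y * indicator {0..<F y} l \<partial>lborel)"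
      by (intro nn_integral_cong) (auto simp: f_def indicator_def)
    also have "\<dots> = ennreal (F y) * indicator B y"
      by (subst nn_integral_cmult_indicator) (cases "0 \<le> F y"; auto simp: indicator_def ennreal_neg)+
    finally show ?thesis .
  qed
  have 2: "(\<integral>\<^sup>+y. f (y, l) \<partial>m) = emeasure m {y\<in>B. l < F y} * indicator {0..} l" for l
  proof -
    have s: "{y\<in>B. l < F y} \<in> sets m" using Bm Fm by measurable
    have "(\<integral>\<^sup>+y. f (y, l) \<partial>m) = (\<integral>\<^sup>+y. indicator {0..} l * indicator {y\<in>B. l < F y} y \<partial>m)"
      by (intro nn_integral_cong) (auto simp: f_def indicator_def)
    also have "\<dots> = emeasure m {y\<in>B. l < F y} * indicator {0..} l"
      using s by (subst nn_integral_cmult_indicator) (auto simp: mult.commute)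
    finally show ?thesis .
  qed
  have "(\<integral>\<^sup>+y. (\<integral>\<^sup>+l. f (y, l) \<partial>lborel) \<partial>m) = (\<integral>\<^sup>+l. (\<integral>\<^sup>+y. f (y, l) \<partial>m) \<partial>lborel)"
    by (rule Fubini'[symmetric]) simp
  then show ?eq unfolding 1 2 .
  have "(\<lambda>l. \<integral>\<^sup>+y. f (y, l) \<partial>m) \<in> borel_measurable lborel" by measurable
  then show ?meas unfolding 2 .
qed

lemma nn_integral_le_of_superlevels:
  fixes F G :: "'a \<Rightarrow> real"
  assumes F: "F \<in> borel_measurable borel" "A \<in> sets borel" and G: "G \<in> borel_measurable borel" "B \<in> sets borel"
    and le: "\<And>l. 0 \<le> l \<Longrightarrow> c * emeasure m {y\<in>A. l < F y} \<le> emeasure m {y\<in>B. l < G y}"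
  shows "c * (\<integral>\<^sup>+y\<in>A. ennreal (F y) \<partial>m) \<le> (\<integral>\<^sup>+y\<in>B. ennreal (G y) \<partial>m)"
proof -
  have "c * (\<integral>\<^sup>+y\<in>A. ennreal (F y) \<partial>m) = (\<integral>\<^sup>+l. c * (emeasure m {y\<in>A. l < F y} * indicator {0..} l) \<partial>lborel)"
    unfolding nn_integral_superlevels(1)[OF F]
    by (rule nn_integral_cmult[symmetric]) (use nn_integral_superlevels(2)[OF F] in simp)
  also have "\<dots> \<le> (\<integral>\<^sup>+l. emeasure m {y\<in>B. l < G y} * indicator {0..} l \<partial>lborel)"
    using le by (intro nn_integral_mono) (auto simp: indicator_def)
  also have "\<dots> = (\<integral>\<^sup>+y\<in>B. ennreal (G y) \<partial>m)" by (rule nn_integral_superlevels(1)[OF G, symmetric])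
  finally show ?thesis .
qed

end

context cd_space begin

definition excess_cost :: "'a \<Rightarrow> ('a \<Rightarrow> real) \<Rightarrow> ('a \<Rightarrow> real) \<Rightarrow> real \<Rightarrow> 'a \<Rightarrow> real" where
  "excess_cost x v w c y = max 0 (enn2real (stop_cost x v w y) - c)"

lemma excess_cost_measurable:
  assumes "continuous_on UNIV v" "continuous_on UNIV w" "0 \<le> c"
  shows "(\<lambda>y. excess_cost x v w c y * indicator (cball x R) y) \<in> borel_measurable borel"
proof (subst borel_measurable_iff_le, intro allI)
  fix l
  let ?S = "{y \<in> space borel. excess_cost x v w c y * indicator (cball x R) y \<le> l}"
  show "?S \<in> sets borel"
  proof (cases "l < 0")
    case True
    then have "?S = {}" by (auto simp: excess_cost_def indicator_def not_le)
    then show ?thesis by simp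
  next
    case False
    have fin: "stop_cost x v w y < \<top>" for y
      using stop_cost_le[of x v w y] by (simp add: le_less_trans)
    have "?S = - cball x R \<union> {y\<in>cball x R. stop_cost x v w y \<le> ennreal (l + c)}"
    proof -
      have eq: "excess_cost x v w c y \<le> l \<longleftrightarrow> stop_cost x v w y \<le> ennreal (l + c)" for y
        using fin[of y] False assms(3)
        by (cases "stop_cost x v w y") (auto simp: excess_cost_def ennreal_le_iff simp del: ennreal_plus)
      have "excess_cost x v w c y * indicator (cball x R) y \<le> l \<longleftrightarrow> y \<notin> cball x R \<or> stop_cost x v w y \<le> ennreal (l + c)" for y
      proof (cases "y \<in> cball x R")
        case True
        then show ?thesis using eq[of y] by (simp only: indicator_simps mult_1_right) simp
      next
        case False
        then show ?thesis using \<open>\<not> l < 0\<close> by simp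
      qed
      then show ?thesis unfolding space_borel by (simp only:) blast
    qed
    then show ?thesis
      using borel_closed[OF stop_cost_lower_closed[OF assms(1,2), of x R "ennreal (l + c)"]] by simp
  qed
qed

text \<open>If the cost at \<open>y\<close> exceeds a level then, up to the price of the short piece, so does the cost at every point \<open>p\<close> at the fraction \<open>q\<close> of
  the distance to \<open>x\<close>. So the contraction of a superlevel set lies in a superlevel set on the smaller ball, and the layer cake formula turns the
  Brunn-Minkowski inequality into one between integrals.\<close>

lemma contraction_step:
  fixes x :: 'a
  assumes v: "continuous_on UNIV v" and w: "continuous_on UNIV w" "\<And>y. 0 \<le> w y" and c: "0 \<le> c"
    and q: "0 < q" "q < 1" and R: "0 < R" and \<eta>: "0 \<le> \<eta>"
    and osc: "\<And>z p. dist z x \<le> R \<Longrightarrow> dist p x \<le> R \<Longrightarrow> dist z p \<le> (1 - q) * R \<Longrightarrow> w z \<le> w p + \<eta>"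
  shows "ennreal (q powr N * sinh_ratio q (curv * R) powr (N - 1)) * (\<integral>\<^sup>+y\<in>ball x R. ennreal (excess_cost x v w c y) \<partial>m)
    \<le> (\<integral>\<^sup>+y\<in>ball x (q * R). ennreal (excess_cost x v w c y) \<partial>m)
      + ennreal ((1 - q) * R) * (\<integral>\<^sup>+y\<in>ball x (q * R). ennreal (w y + \<eta>) \<partial>m)"
proof -
  define F where "F y = excess_cost x v w c y * indicator (cball x R) y" for y
  define G where "G y = F y + (1 - q) * R * (w y + \<eta>)" for y
  have Fm [measurable]: "F \<in> borel_measurable borel" unfolding F_def by (rule excess_cost_measurable[OF v w(1) c])
  have wm [measurable]: "w \<in> borel_measurable borel" by (rule borel_measurable_continuous_onI[OF w(1)])
  have Gm: "G \<in> borel_measurable borel" unfolding G_def by measurable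
  have F0: "0 \<le> F y" for y by (simp add: F_def excess_cost_def)
  have qR: "q * R \<le> R" using q R by simp
  have FR: "F y = excess_cost x v w c y" if "y \<in> ball x R" for y using that by (simp add: F_def)
  have "ennreal (q powr N * sinh_ratio q (curv * R) powr (N - 1)) * (\<integral>\<^sup>+y\<in>ball x R. ennreal (F y) \<partial>m)
      \<le> (\<integral>\<^sup>+y\<in>ball x (q * R). ennreal (G y) \<partial>m)"
  proof (rule nn_integral_le_of_superlevels[OF Fm _ Gm])
    fix l :: real assume l: "0 \<le> l"
    have A: "{y\<in>ball x R. l < F y} \<in> sets borel" and S: "{y\<in>ball x (q * R). l < G y} \<in> sets borel"
      using Gm by measurable
    have "ennreal ((1 - (1 - q)) powr N * sinh_ratio (1 - (1 - q)) (curv * R) powr (N - 1)) * emeasure m {y\<in>ball x R. l < F y}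
        \<le> emeasure m {y\<in>ball x (q * R). l < G y}"
    proof (rule brunn_minkowski_point[OF A _ S])
      fix y p :: 'a
      assume y: "y \<in> {y\<in>ball x R. l < F y}" and p: "dist y p = (1 - q) * dist y x" "dist p x = (1 - (1 - q)) * dist y x"
      have yR: "dist y x < R" using y by (simp add: dist_commute)
      have px: "dist p x = q * dist y x" using p by simp
      have pR: "dist p x < q * R" unfolding px using yR q by simp
      have b: "dist y p \<le> (1 - q) * R" using p(1) yR q by simp
      have "stop_cost x v w y \<le> ennreal (dist y p * (w p + \<eta>)) + stop_cost x v w p"
      proof (rule stop_cost_step[OF w])
        show "dist y p + dist p x = dist y x" using p(1) px by (simp add: algebra_simps)
        fix z assume "dist z p \<le> dist y p" "dist z x \<le> dist y x"
        then show "w z \<le> w p + \<eta>" using yR pR qR b by (intro osc) linarith+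
      qed
      also have "\<dots> \<le> ennreal ((1 - q) * R * (w p + \<eta>)) + stop_cost x v w p"
        using b w(2)[of p] \<eta> by (intro add_right_mono ennreal_leI mult_right_mono) auto
      finally have le: "stop_cost x v w y \<le> ennreal ((1 - q) * R * (w p + \<eta>)) + stop_cost x v w p" .
      have pos: "0 \<le> (1 - q) * R * (w p + \<eta>)" using q R w(2)[of p] \<eta> by simp
      have fin: "stop_cost x v w p < \<top>" using stop_cost_le[of x v w p] by (simp add: le_less_trans)
      have "enn2real (stop_cost x v w y) \<le> enn2real (ennreal ((1 - q) * R * (w p + \<eta>)) + stop_cost x v w p)"
        using fin by (intro enn2real_mono le) (simp add: ennreal_add_less_top)
      also have "\<dots> = (1 - q) * R * (w p + \<eta>) + enn2real (stop_cost x v w p)"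
        using fin pos by (subst enn2real_plus) auto
      finally have "excess_cost x v w c y \<le> excess_cost x v w c p + (1 - q) * R * (w p + \<eta>)"
        using pos by (simp add: excess_cost_def)
      moreover have "F y = excess_cost x v w c y" "F p = excess_cost x v w c p"
        using yR pR qR by (auto intro!: FR simp: dist_commute)
      ultimately have "l < G p" using y by (simp add: G_def)
      then show "p \<in> {y\<in>ball x (q * R). l < G y}" using pR by (simp add: dist_commute)
    qed (use q R in auto)
    then show "ennreal (q powr N * sinh_ratio q (curv * R) powr (N - 1)) * emeasure m {y\<in>ball x R. l < F y}
        \<le> emeasure m {y\<in>ball x (q * R). l < G y}" by simp
  qed auto
  also have "(\<integral>\<^sup>+y\<in>ball x (q * R). ennreal (G y) \<partial>m)
      = (\<integral>\<^sup>+y. ennreal (F y) * indicator (ball x (q * R)) y + ennreal ((1 - q) * R) * (ennreal (w y + \<eta>) * indicator (ball x (q * R)) y) \<partial>m)"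
  proof (rule nn_integral_cong)
    fix y
    have "ennreal (G y) = ennreal (F y) + ennreal ((1 - q) * R) * ennreal (w y + \<eta>)"
      unfolding G_def using F0[of y] q R w(2)[of y] \<eta> by (simp add: ennreal_mult)
    then show "ennreal (G y) * indicator (ball x (q * R)) y = ennreal (F y) * indicator (ball x (q * R)) y + ennreal ((1 - q) * R) * (ennreal (w y + \<eta>) * indicator (ball x (q * R)) y)"
      by (simp add: indicator_def)
  qed
  also have "\<dots> = (\<integral>\<^sup>+y\<in>ball x (q * R). ennreal (F y) \<partial>m) + ennreal ((1 - q) * R) * (\<integral>\<^sup>+y\<in>ball x (q * R). ennreal (w y + \<eta>) \<partial>m)"
  proof -
    have [measurable]: "F \<in> borel_measurable m" "w \<in> borel_measurable m" "ball x (q * R) \<in> sets m"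
      using Fm wm by (simp_all add: measurable_cong_sets[OF sets_m refl] sets_m)
    show ?thesis by (subst nn_integral_add) (auto simp: nn_integral_cmult)
  qed
  also have "(\<integral>\<^sup>+y\<in>ball x (q * R). ennreal (F y) \<partial>m) = (\<integral>\<^sup>+y\<in>ball x (q * R). ennreal (excess_cost x v w c y) \<partial>m)"
    using FR qR by (intro nn_integral_cong) (auto simp: indicator_def)
  also have "(\<integral>\<^sup>+y\<in>ball x R. ennreal (F y) \<partial>m) = (\<integral>\<^sup>+y\<in>ball x R. ennreal (excess_cost x v w c y) \<partial>m)"
    using FR by (intro nn_integral_cong) (auto simp: indicator_def)
  finally show ?thesis .
qed

text \<open>The factor by which the measure of sets may shrink under contraction by \<open>t\<close> of the ball of radius \<open>r\<close>.\<close>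

definition ball_profile :: "real \<Rightarrow> real \<Rightarrow> real" where
  "ball_profile r t = t powr N * sinh_ratio t (curv * r) powr (N - 1)"

lemma ball_profile_pos: "0 < t \<Longrightarrow> 0 \<le> r \<Longrightarrow> 0 < ball_profile r t"
  using sinh_ratio_pos[of t "curv * r"] curv_nonneg by (simp add: ball_profile_def)

lemma ball_profile_1: "0 \<le> r \<Longrightarrow> ball_profile r 1 = 1"
  using curv_nonneg by (simp add: ball_profile_def sinh_ratio_def)

text \<open>Successive contractions lose nothing: the factors of the single steps, taken at the actual radii, multiply to the factor of the total contraction.\<close>

lemma ball_profile_mult:
  assumes "0 < q" "0 < s" "0 \<le> r"
  shows "ball_profile r (q * s) = ball_profile r s * ball_profile (s * r) q"
proof -
  have "sinh_ratio (q * s) (curv * r) = sinh_ratio q (curv * (s * r)) * sinh_ratio s (curv * r)"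
  proof (cases "curv * r = 0")
    case True
    then show ?thesis by (auto simp: sinh_ratio_def)
  next
    case False
    then have pos: "0 < curv * (s * r)" using assms curv_nonneg by (auto simp: less_le)
    have e: "q * s * (curv * r) = q * (curv * (s * r))" "s * (curv * r) = curv * (s * r)" by simp_all
    have "0 < sinh (curv * (s * r))" unfolding sinh_real_pos_iff by (rule pos)
    then show ?thesis using False pos assms unfolding sinh_ratio_def e by simp
  qed
  moreover have "0 \<le> sinh_ratio q (curv * (s * r))" "0 \<le> sinh_ratio s (curv * r)"
    using sinh_ratio_pos[of q "curv * (s * r)"] sinh_ratio_pos[of s "curv * r"] assms curv_nonneg by auto
  ultimately show ?thesis using assms by (simp add: ball_profile_def powr_mult)
qed

text \<open>The price of the steps adds up to a Riemann sum for the integral of \<open>1 / ball_profile r\<close>.\<close>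

lemma contraction_iterated:
  fixes x :: 'a
  assumes v: "continuous_on UNIV v" and w: "continuous_on UNIV w" "\<And>y. 0 \<le> w y" and c: "0 \<le> c"
    and q: "0 < q" "q < 1" and r: "0 < r" and \<eta>: "0 \<le> \<eta>"
    and osc: "\<And>z p. dist z x \<le> r \<Longrightarrow> dist p x \<le> r \<Longrightarrow> dist z p \<le> (1 - q) * r \<Longrightarrow> w z \<le> w p + \<eta>"
  shows "(\<integral>\<^sup>+y\<in>ball x r. ennreal (excess_cost x v w c y) \<partial>m)
    \<le> ennreal (1 / ball_profile r (q ^ k)) * (\<integral>\<^sup>+y\<in>ball x (q ^ k * r). ennreal (excess_cost x v w c y) \<partial>m)
      + ennreal (r * (\<Sum>i<k. (q ^ i - q ^ Suc i) / ball_profile r (q ^ Suc i))) * (\<integral>\<^sup>+y\<in>ball x r. ennreal (w y + \<eta>) \<partial>m)"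
proof (induction k)
  case 0
  then show ?case using r by (simp add: ball_profile_1)
next
  case (Suc k)
  let ?I = "\<lambda>R. \<integral>\<^sup>+y\<in>ball x R. ennreal (excess_cost x v w c y) \<partial>m"
  let ?W = "\<integral>\<^sup>+y\<in>ball x r. ennreal (w y + \<eta>) \<partial>m"
  let ?S = "\<lambda>k. \<Sum>i<k. (q ^ i - q ^ Suc i) / ball_profile r (q ^ Suc i)"
  define s where "s = q ^ k"
  have s: "0 < s" "s \<le> 1" using q by (auto simp: s_def power_le_one)
  have sr: "0 < s * r" "s * r \<le> r" using s r by (auto simp: mult_left_le_one_le)
  have \<phi>: "0 < ball_profile (s * r) q" using q sr by (intro ball_profile_pos) auto
  have gs: "0 < ball_profile r s" using s r by (intro ball_profile_pos) auto
  have gq: "ball_profile r (q * s) = ball_profile r s * ball_profile (s * r) q"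
    using q s r by (intro ball_profile_mult) auto
  have step: "ennreal (ball_profile (s * r) q) * ?I (s * r)
      \<le> ?I (q * (s * r)) + ennreal ((1 - q) * (s * r)) * (\<integral>\<^sup>+y\<in>ball x (q * (s * r)). ennreal (w y + \<eta>) \<partial>m)"
    unfolding ball_profile_def
  proof (rule contraction_step[OF v w c q sr(1) \<eta>])
    fix z p assume "dist z x \<le> s * r" "dist p x \<le> s * r" "dist z p \<le> (1 - q) * (s * r)"
    moreover have "(1 - q) * (s * r) \<le> (1 - q) * r" using sr(2) q by (intro mult_left_mono) auto
    ultimately show "w z \<le> w p + \<eta>" using sr(2) by (intro osc) linarith+
  qed
  have W: "(\<integral>\<^sup>+y\<in>ball x (q * (s * r)). ennreal (w y + \<eta>) \<partial>m) \<le> ?W"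
  proof (intro nn_integral_mono mult_left_mono)
    have "q * (s * r) \<le> 1 * r" using q sr by (intro mult_mono) auto
    then have "ball x (q * (s * r)) \<subseteq> ball x r" by (intro subset_ball) simp
    then show "indicator (ball x (q * (s * r))) y \<le> (indicator (ball x r) y :: ennreal)" for y by (auto simp: indicator_def)
  qed simp
  have "?I (s * r) = ennreal (1 / ball_profile (s * r) q) * (ennreal (ball_profile (s * r) q) * ?I (s * r))"
    using \<phi> by (simp add: mult.assoc[symmetric] ennreal_mult[symmetric])
  also have "\<dots> \<le> ennreal (1 / ball_profile (s * r) q) * (?I (q * (s * r)) + ennreal ((1 - q) * (s * r)) * ?W)"
    by (intro mult_left_mono order_trans[OF step] add_left_mono mult_left_mono W) auto
  finally have "ennreal (1 / ball_profile r s) * ?I (s * r)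
      \<le> ennreal (1 / ball_profile r s) * (ennreal (1 / ball_profile (s * r) q) * (?I (q * (s * r)) + ennreal ((1 - q) * (s * r)) * ?W))"
    by (rule mult_left_mono) simp
  also have "\<dots> = ennreal (1 / ball_profile r (q * s)) * (?I (q * (s * r)) + ennreal ((1 - q) * (s * r)) * ?W)"
    using \<phi> gs by (simp add: gq mult.assoc[symmetric] ennreal_mult[symmetric])
  also have "\<dots> = ennreal (1 / ball_profile r (q * s)) * ?I (q * (s * r)) + ennreal (r * ((s - q * s) / ball_profile r (q * s))) * ?W"
  proof -
    have "ennreal (1 / ball_profile r (q * s)) * ennreal ((1 - q) * (s * r)) = ennreal (r * ((s - q * s) / ball_profile r (q * s)))"
      using q s r by (subst ennreal_mult''[symmetric]) (auto simp: field_simps)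
    then show ?thesis by (simp only: distrib_left mult.assoc[symmetric])
  qed
  finally have A: "ennreal (1 / ball_profile r s) * ?I (s * r)
      \<le> ennreal (1 / ball_profile r (q * s)) * ?I (q * (s * r)) + ennreal (r * ((s - q * s) / ball_profile r (q * s))) * ?W" .
  have S0: "0 \<le> ?S j" for j
    using q r by (intro sum_nonneg divide_nonneg_pos ball_profile_pos) (auto simp: mult_left_le_one_le)
  have t0: "0 \<le> (s - q * s) / ball_profile r (q * s)"
    using q s r by (intro divide_nonneg_pos ball_profile_pos) (auto simp: mult_left_le_one_le)
  have "?I r \<le> ennreal (1 / ball_profile r s) * ?I (s * r) + ennreal (r * ?S k) * ?W"
    using Suc by (simp add: s_def)
  also have "\<dots> \<le> (ennreal (1 / ball_profile r (q * s)) * ?I (q * (s * r)) + ennreal (r * ((s - q * s) / ball_profile r (q * s))) * ?W) + ennreal (r * ?S k) * ?W"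
    by (rule add_right_mono[OF A])
  also have "\<dots> = ennreal (1 / ball_profile r (q * s)) * ?I (q * (s * r)) + (ennreal (r * ((s - q * s) / ball_profile r (q * s))) + ennreal (r * ?S k)) * ?W"
    by (simp only: distrib_right add.assoc)
  also have "ennreal (r * ((s - q * s) / ball_profile r (q * s))) + ennreal (r * ?S k) = ennreal (r * ?S (Suc k))"
  proof -
    have "r * ((s - q * s) / ball_profile r (q * s)) + r * ?S k = r * ?S (Suc k)"
      by (simp add: s_def algebra_simps)
    then show ?thesis
      using ennreal_plus[of "r * ((s - q * s) / ball_profile r (q * s))" "r * ?S k"] S0[of k] t0 r
      by (metis mult_nonneg_nonneg less_imp_le)
  qed
  finally show ?case by (simp only: s_def mult.assoc power_Suc)
qed

text \<open>The Riemann sum takes the decreasing function \<open>1 / ball_profile r\<close> at the left end points. Replacing them by the right end points costs at most the factor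
  in front, which tends to \<open>1\<close> with \<open>q\<close>; then the sum telescopes.\<close>

lemma profile_sum_le:
  assumes r: "0 < r" and q: "0 < q" "q < 1"
    and \<Phi>: "\<And>s s'. q ^ k \<le> s \<Longrightarrow> s \<le> s' \<Longrightarrow> s' \<le> 1 \<Longrightarrow> (s' - s) / ball_profile r s' \<le> \<Phi> s - \<Phi> s'"
  shows "(\<Sum>i<k. (q ^ i - q ^ Suc i) / ball_profile r (q ^ Suc i))
    \<le> q powr (- N) * exp ((1 - q) * (curv * r) * (N - 1)) * (\<Phi> (q ^ k) - \<Phi> 1)"
proof -
  define M where "M = q powr (- N) * exp ((1 - q) * (curv * r) * (N - 1))"
  have "(\<Sum>i<k. (q ^ i - q ^ Suc i) / ball_profile r (q ^ Suc i)) \<le> (\<Sum>i<k. M * (\<Phi> (q ^ Suc i) - \<Phi> (q ^ i)))"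
  proof (rule sum_mono)
    fix i assume "i \<in> {..<k}"
    then have i: "Suc i \<le> k" by simp
    define s where "s = q ^ i"
    have s: "0 < s" "s \<le> 1" using q by (auto simp: s_def power_le_one)
    have qs: "q ^ k \<le> q * s" using power_decreasing[OF i, of q] q by (simp add: s_def)
    have pos: "0 < ball_profile (s * r) q" "0 < ball_profile r s" using q s r by (auto intro!: ball_profile_pos)
    have "1 / ball_profile (s * r) q \<le> M"
    proof -
      have n: "0 \<le> N - 1" using N by simp
      have a0: "0 \<le> curv * r" using curv_nonneg r by simp
      have "exp (- ((1 - q) * (curv * r))) \<le> exp (- ((1 - q) * (curv * (s * r))))"
        using q s a0 by (auto intro!: mult_left_mono simp: mult_left_le_one_le mult.left_commute)
      also have "\<dots> \<le> sinh_ratio q (curv * (s * r))"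
        using q s r curv_nonneg by (intro sinh_ratio_ge_exp) auto
      finally have "exp (- ((1 - q) * (curv * r))) powr (N - 1) \<le> sinh_ratio q (curv * (s * r)) powr (N - 1)"
        using n by (intro powr_mono2) auto
      then have "q powr N * exp (- ((1 - q) * (curv * r) * (N - 1))) \<le> ball_profile (s * r) q"
        unfolding ball_profile_def by (intro mult_left_mono) (auto simp: exp_powr_real)
      also have "q powr N * exp (- ((1 - q) * (curv * r) * (N - 1))) = 1 / M"
        using q by (simp add: M_def powr_minus exp_minus divide_inverse)
      finally have "1 / M \<le> ball_profile (s * r) q" .
      moreover have "0 < M" using q by (simp add: M_def)
      ultimately show ?thesis using pos(1) by (simp only: pos_divide_le_eq mult.commute)
    qed
    have "(s - q * s) / ball_profile r (q * s) = 1 / ball_profile (s * r) q * ((s - q * s) / ball_profile r s)"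
      using ball_profile_mult[of q s r] q s r by simp
    also have "\<dots> \<le> M * (\<Phi> (q * s) - \<Phi> s)"
    proof (intro mult_mono)
      show "1 / ball_profile (s * r) q \<le> M" by fact
      show "(s - q * s) / ball_profile r s \<le> \<Phi> (q * s) - \<Phi> s" using qs s q by (intro \<Phi>) (auto simp: mult_left_le_one_le)
    qed (use pos s q in \<open>auto simp: M_def mult_left_le_one_le\<close>)
    finally show "(q ^ i - q ^ Suc i) / ball_profile r (q ^ Suc i) \<le> M * (\<Phi> (q ^ Suc i) - \<Phi> (q ^ i))"
      by (simp add: s_def)
  qed
  also have "\<dots> = M * (\<Phi> (q ^ k) - \<Phi> (q ^ 0))"
    by (simp only: sum_distrib_left[symmetric] sum_lessThan_telescope[of "\<lambda>i. \<Phi> (q ^ i)"])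
  finally show ?thesis by (simp add: M_def)
qed

text \<open>The limit of small steps. The function \<open>\<Phi>\<close> stands for a primitive of \<open>- 1 / ball_profile r\<close>, in a form that needs no derivative. The threshold \<open>c\<close> stays
  fixed throughout and is only chosen afterwards.\<close>

lemma contraction:
  fixes x :: 'a
  assumes h: "h \<in> borel_measurable borel" "(\<integral>\<^sup>+y\<in>ball x (2 * r). h y \<partial>m) < \<infinity>" and hv: "geo_gradient h v"
    and v: "continuous_on UNIV v" "\<And>y. 0 \<le> v y" and r: "0 < r" and t0: "0 < t0" "t0 \<le> 1" and c: "0 \<le> c"
    and \<Phi>: "\<And>s s'. t0 \<le> s \<Longrightarrow> s \<le> s' \<Longrightarrow> s' \<le> 1 \<Longrightarrow> (s' - s) / ball_profile r s' \<le> \<Phi> s - \<Phi> s'"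
  shows "(\<integral>\<^sup>+y\<in>ball x r. ennreal (v y - c) \<partial>m)
    \<le> ennreal (1 / ball_profile r t0) * (\<integral>\<^sup>+y\<in>ball x (t0 * r). ennreal (v y - c) \<partial>m)
      + ennreal (r * (\<Phi> t0 - \<Phi> 1)) * (\<integral>\<^sup>+y\<in>ball x (2 * r). h y \<partial>m)"
proof (cases "t0 = 1")
  case True
  then show ?thesis using r by (simp add: ball_profile_1)
next
  case False
  with t0 have t1: "t0 < 1" by simp
  define H where "H = enn2real (\<integral>\<^sup>+y\<in>ball x (2 * r). h y \<partial>m)"
  have H: "(\<integral>\<^sup>+y\<in>ball x (2 * r). h y \<partial>m) = ennreal H" "0 \<le> H" using h(2) by (auto simp: H_def)
  define b where "b = measure m (ball x r)"
  have b: "emeasure m (ball x r) = ennreal b" "0 \<le> b" by (auto simp: b_def emeasure_ball)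
  let ?X = "\<integral>\<^sup>+y\<in>ball x (t0 * r). ennreal (v y - c) \<partial>m"
  have d\<Phi>: "0 \<le> \<Phi> t0 - \<Phi> 1"
  proof -
    have "0 \<le> (1 - t0) / ball_profile r 1" using t1 r by (simp add: ball_profile_1)
    also have "\<dots> \<le> \<Phi> t0 - \<Phi> 1" using t0 by (intro \<Phi>) auto
    finally show ?thesis .
  qed
  have key: "(\<integral>\<^sup>+y\<in>ball x r. ennreal (v y - c) \<partial>m)
      \<le> ennreal (1 / ball_profile r t0) * ?X + ennreal (r * ((1 + e) * (\<Phi> t0 - \<Phi> 1)) * (H + e + e * b) + e * b)"
    if e: "0 < e" for e
  proof -
    obtain w :: "nat \<Rightarrow> 'a \<Rightarrow> real" where w: "\<And>j. continuous_on UNIV (w j)" "\<And>j y. 0 \<le> w j y"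
      "\<And>y. incseq (\<lambda>j. w j y)" "\<And>y. y \<in> ball x (2 * r) \<Longrightarrow> h y \<le> (SUP j. ennreal (w j y))"
      "\<And>j. (\<integral>\<^sup>+y\<in>ball x (2 * r). ennreal (w j y) \<partial>m) \<le> (\<integral>\<^sup>+y\<in>ball x (2 * r). h y \<partial>m) + ennreal e"
      by (rule continuous_minorants[OF h e], rule that)
    have hw: "h y \<le> (SUP j. ennreal (w j y))" if "y \<in> cball x r" for y
      using that r by (intro w(4)) simp
    obtain j where j: "\<And>y. y \<in> cball x r \<Longrightarrow> ennreal (v y) \<le> stop_cost x v (w j) y + ennreal e"
    proof (rule stop_cost_approx[where w = w and h = h and x = x and R = r and e = e and v = v])
      fix j assume "\<And>y. y \<in> cball x r \<Longrightarrow> ennreal (v y) \<le> stop_cost x v (w j) y + ennreal e"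
      then show thesis by (rule that)
    qed (rule hv v w(1,2,3) hw e | assumption)+
    have "uniformly_continuous_on (cball x r) (w j)"
      using continuous_on_subset[OF w(1)] compact_cball by (intro compact_uniformly_continuous) auto
    then obtain \<delta> where \<delta>: "0 < \<delta>" "\<And>z p. z \<in> cball x r \<Longrightarrow> p \<in> cball x r \<Longrightarrow> dist p z < \<delta> \<Longrightarrow> dist (w j p) (w j z) < e"
      using e unfolding uniformly_continuous_on_def by metis
    define M where "M q = q powr (- N) * exp ((1 - q) * (curv * r) * (N - 1))" for q
    have qlim: "(\<lambda>k. t0 powr (1 / real k)) \<longlonglongrightarrow> 1"
    proof -
      have "(\<lambda>k. t0 powr (1 / real k)) \<longlonglongrightarrow> t0 powr 0"
        using t0 by (intro tendsto_powr tendsto_const lim_1_over_n) auto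
      then show ?thesis using t0 by simp
    qed
    have "(\<lambda>k. M (t0 powr (1 / real k))) \<longlonglongrightarrow> 1 powr (- N) * exp ((1 - 1) * (curv * r) * (N - 1))"
      unfolding M_def by (intro tendsto_intros qlim) auto
    then have "\<forall>\<^sub>F k in sequentially. M (t0 powr (1 / real k)) < 1 + e"
      using e by (intro order_tendstoD(2)) auto
    moreover have "\<forall>\<^sub>F k in sequentially. 1 - \<delta> / r < t0 powr (1 / real k)"
      using qlim \<delta>(1) r by (intro order_tendstoD(1)) auto
    moreover have "\<forall>\<^sub>F k in sequentially. 0 < k" by (rule eventually_gt_at_top)
    ultimately have "\<forall>\<^sub>F k in sequentially. M (t0 powr (1 / real k)) < 1 + e \<and> 1 - \<delta> / r < t0 powr (1 / real k) \<and> 0 < k"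
      by eventually_elim auto
    then obtain k where k: "M (t0 powr (1 / real k)) < 1 + e" "1 - \<delta> / r < t0 powr (1 / real k)" "0 < k"
      using eventually_happens'[OF sequentially_bot] by blast
    \<comment> \<open>\<open>k\<close> equal steps lead from the radius \<open>r\<close> to \<open>t0 * r\<close>.\<close>
    define q where "q = t0 powr (1 / real k)"
    have q0: "0 < q" using t0 by (simp add: q_def)
    have "t0 powr (1 / real k) < t0 powr 0" using t0 t1 k(3) by (intro powr_less_mono') auto
    then have q1: "q < 1" using t0 by (simp add: q_def)
    have qk: "q ^ k = t0"
      using t0 k(3) by (simp add: q_def powr_realpow[symmetric] powr_powr)
    have q\<delta>: "(1 - q) * r < \<delta>" using k(2) r by (simp add: q_def[symmetric] field_simps)
    have osc: "w j z \<le> w j p + e" if "dist z x \<le> r" "dist p x \<le> r" "dist z p \<le> (1 - q) * r" for z p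
    proof -
      have "dist (w j z) (w j p) < e"
        using that q\<delta> by (intro \<delta>(2)) (auto simp: dist_commute)
      then show ?thesis by (simp add: dist_real_def)
    qed
    let ?E = "excess_cost x v (w j) c"
    have iter: "(\<integral>\<^sup>+y\<in>ball x r. ennreal (?E y) \<partial>m)
        \<le> ennreal (1 / ball_profile r t0) * (\<integral>\<^sup>+y\<in>ball x (t0 * r). ennreal (?E y) \<partial>m)
        + ennreal (r * (\<Sum>i<k. (q ^ i - q ^ Suc i) / ball_profile r (q ^ Suc i))) * (\<integral>\<^sup>+y\<in>ball x r. ennreal (w j y + e) \<partial>m)"
      using contraction_iterated[where k = k, OF v(1) w(1,2) c q0 q1 r less_imp_le[OF e] osc] unfolding qk by simp
    have E1: "(\<integral>\<^sup>+y\<in>ball x (t0 * r). ennreal (?E y) \<partial>m) \<le> ?X"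
    proof (intro nn_integral_mono mult_right_mono)
      fix y
      have "enn2real (stop_cost x v (w j) y) \<le> v y"
        using enn2real_mono[OF stop_cost_le[of x v "w j" y]] v(2)[of y] by simp
      then have "?E y \<le> max 0 (v y - c)" by (simp add: excess_cost_def)
      then show "ennreal (?E y) \<le> ennreal (v y - c)"
        by (metis ennreal_leI ennreal_max_0)
    qed simp
    have sum: "(\<Sum>i<k. (q ^ i - q ^ Suc i) / ball_profile r (q ^ Suc i)) \<le> (1 + e) * (\<Phi> t0 - \<Phi> 1)"
    proof -
      have "(\<Sum>i<k. (q ^ i - q ^ Suc i) / ball_profile r (q ^ Suc i)) \<le> M q * (\<Phi> t0 - \<Phi> 1)"
        unfolding M_def using profile_sum_le[OF r q0 q1, of k \<Phi>, unfolded qk, OF \<Phi>] by simp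
      also have "\<dots> \<le> (1 + e) * (\<Phi> t0 - \<Phi> 1)" using k(1) d\<Phi> by (intro mult_right_mono) (auto simp: q_def)
      finally show ?thesis .
    qed
    have bm [measurable]: "ball x r \<in> sets m" "w j \<in> borel_measurable m" "v \<in> borel_measurable m"
      using borel_measurable_continuous_onI[OF w(1)[of j]] borel_measurable_continuous_onI[OF v(1)]
      by (simp_all add: measurable_cong_sets[OF sets_m refl] sets_m)
    have W: "(\<integral>\<^sup>+y\<in>ball x r. ennreal (w j y + e) \<partial>m) \<le> ennreal (H + e + e * b)"
    proof -
      have "(\<integral>\<^sup>+y\<in>ball x r. ennreal (w j y + e) \<partial>m) = (\<integral>\<^sup>+y. ennreal (w j y) * indicator (ball x r) y + ennreal e * indicator (ball x r) y \<partial>m)"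
        using w(2) e by (intro nn_integral_cong) (auto simp: indicator_def)
      also have "\<dots> = (\<integral>\<^sup>+y\<in>ball x r. ennreal (w j y) \<partial>m) + ennreal e * ennreal b"
        by (subst nn_integral_add) (auto simp: nn_integral_cmult_indicator b sets_m)
      also have "\<dots> \<le> (ennreal H + ennreal e) + ennreal e * ennreal b"
      proof (intro add_right_mono)
        have "(\<integral>\<^sup>+y\<in>ball x r. ennreal (w j y) \<partial>m) \<le> (\<integral>\<^sup>+y\<in>ball x (2 * r). ennreal (w j y) \<partial>m)"
          using r by (intro nn_integral_mono) (auto simp: indicator_def)
        then show "(\<integral>\<^sup>+y\<in>ball x r. ennreal (w j y) \<partial>m) \<le> ennreal H + ennreal e" using w(5)[of j] H(1) by simp
      qed
      also have "\<dots> = ennreal (H + e + e * b)" using H e b by (simp add: ennreal_mult)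
      finally show ?thesis .
    qed
    have "(\<integral>\<^sup>+y\<in>ball x r. ennreal (v y - c) \<partial>m) \<le> (\<integral>\<^sup>+y. (ennreal (?E y) + ennreal e) * indicator (ball x r) y \<partial>m)"
    proof (rule nn_integral_mono)
      fix y
      show "ennreal (v y - c) * indicator (ball x r) y \<le> (ennreal (?E y) + ennreal e) * indicator (ball x r) y"
      proof (cases "y \<in> ball x r")
        case True
        then have le: "ennreal (v y) \<le> stop_cost x v (w j) y + ennreal e" by (intro j) simp
        have fin: "stop_cost x v (w j) y < \<top>" using stop_cost_le[of x v "w j" y] by (simp add: le_less_trans)
        have "v y = enn2real (ennreal (v y))" using v(2) by simp
        also have "\<dots> \<le> enn2real (stop_cost x v (w j) y + ennreal e)"
          using fin by (intro enn2real_mono le) (simp add: ennreal_add_less_top)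
        also have "\<dots> = enn2real (stop_cost x v (w j) y) + e" using fin e by (subst enn2real_plus) auto
        finally have "v y - c \<le> ?E y + e" using e by (simp add: excess_cost_def)
        then have "ennreal (v y - c) \<le> ennreal (?E y + e)" by (rule ennreal_leI)
        also have "\<dots> = ennreal (?E y) + ennreal e"
          using e by (intro ennreal_plus) (auto simp only: excess_cost_def max.cobounded1 less_imp_le)
        finally show ?thesis using True by simp
      qed simp
    qed
    also have "\<dots> = (\<integral>\<^sup>+y. ennreal (?E y * indicator (cball x r) y) * indicator (ball x r) y + ennreal e * indicator (ball x r) y \<partial>m)"
      by (intro nn_integral_cong) (auto simp: indicator_def)
    also have "\<dots> = (\<integral>\<^sup>+y\<in>ball x r. ennreal (?E y * indicator (cball x r) y) \<partial>m) + ennreal e * ennreal b"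
    proof -
      have [measurable]: "(\<lambda>y. ?E y * indicator (cball x r) y) \<in> borel_measurable m"
        using excess_cost_measurable[OF v(1) w(1) c, of x j r] by (simp add: measurable_cong_sets[OF sets_m refl])
      show ?thesis by (subst nn_integral_add) (auto simp: nn_integral_cmult_indicator b sets_m)
    qed
    also have "(\<integral>\<^sup>+y\<in>ball x r. ennreal (?E y * indicator (cball x r) y) \<partial>m) = (\<integral>\<^sup>+y\<in>ball x r. ennreal (?E y) \<partial>m)"
      by (intro nn_integral_cong) (auto simp: indicator_def)
    also have "\<dots> \<le> ennreal (1 / ball_profile r t0) * ?X + ennreal (r * ((1 + e) * (\<Phi> t0 - \<Phi> 1))) * ennreal (H + e + e * b)"
      using r by (intro order_trans[OF iter] add_mono mult_mono E1 W ennreal_leI mult_left_mono sum) auto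
    also have "ennreal (1 / ball_profile r t0) * ?X + ennreal (r * ((1 + e) * (\<Phi> t0 - \<Phi> 1))) * ennreal (H + e + e * b) + ennreal e * ennreal b
        = ennreal (1 / ball_profile r t0) * ?X + ennreal (r * ((1 + e) * (\<Phi> t0 - \<Phi> 1)) * (H + e + e * b) + e * b)"
    proof -
      have "0 \<le> r * ((1 + e) * (\<Phi> t0 - \<Phi> 1))" "0 \<le> H + e + e * b" "0 \<le> e * b" using r e d\<Phi> H(2) b(2) by auto
      then have "ennreal (r * ((1 + e) * (\<Phi> t0 - \<Phi> 1)) * (H + e + e * b) + e * b)
          = ennreal (r * ((1 + e) * (\<Phi> t0 - \<Phi> 1))) * ennreal (H + e + e * b) + ennreal e * ennreal b"
        using e b(2) by (subst ennreal_plus) (auto simp: ennreal_mult)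
      then show ?thesis by (simp only: add.assoc)
    qed
    finally show ?thesis by (simp add: add_right_mono)
  qed
  have "(\<lambda>i. ennreal (1 / ball_profile r t0) * ?X + ennreal (r * ((1 + 1 / real (Suc i)) * (\<Phi> t0 - \<Phi> 1)) * (H + 1 / real (Suc i) + 1 / real (Suc i) * b) + 1 / real (Suc i) * b))
      \<longlonglongrightarrow> ennreal (1 / ball_profile r t0) * ?X + ennreal (r * ((1 + 0) * (\<Phi> t0 - \<Phi> 1)) * (H + 0 + 0 * b) + 0 * b)"
    by (intro tendsto_intros tendsto_ennrealI LIMSEQ_Suc[OF lim_1_over_n])
  then have "(\<integral>\<^sup>+y\<in>ball x r. ennreal (v y - c) \<partial>m)
      \<le> ennreal (1 / ball_profile r t0) * ?X + ennreal (r * ((1 + 0) * (\<Phi> t0 - \<Phi> 1)) * (H + 0 + 0 * b) + 0 * b)"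
    by (rule LIMSEQ_le_const) (intro exI[of _ 0] allI impI key, simp)
  also have "\<dots> = ennreal (1 / ball_profile r t0) * ?X + ennreal (r * (\<Phi> t0 - \<Phi> 1)) * (\<integral>\<^sup>+y\<in>ball x (2 * r). h y \<partial>m)"
    using H(2) by (simp add: H(1) ennreal_mult'')
  finally show ?thesis .
qed

end

section \<open>Contracted measures of bounded density\<close>

lemma (in mm_space) quantile_exists:
  fixes v :: "'a \<Rightarrow> real"
  assumes B: "B \<in> sets borel" "emeasure m B < \<infinity>" and v: "v \<in> borel_measurable borel" "\<And>y. 0 \<le> v y" "\<And>y. v y \<le> 1"
    and \<theta>: "0 < \<theta>" "\<theta> \<le> measure m B"
  obtains c where "0 \<le> c" "measure m {y\<in>B. c < v y} \<le> \<theta>" "\<theta> \<le> measure m {y\<in>B. c \<le> v y}"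
proof -
  have meas: "{y\<in>B. l < v y} \<in> sets m" "{y\<in>B. l \<le> v y} \<in> sets m" for l
    unfolding sets_m using B(1) v(1) by measurable
  have fin: "emeasure m S \<noteq> \<infinity>" if "S \<subseteq> B" for S
    using emeasure_mono[OF that, of m] B by (auto simp: sets_m top_unique)
  have Bf: "B \<in> fmeasurable m" using B by (auto simp: fmeasurable_def sets_m)
  define L where "L = {l. 0 \<le> l \<and> measure m {y\<in>B. l < v y} \<le> \<theta>}"
  have e1: "{y\<in>B. 1 < v y} = {}" using v(3) by (auto simp: not_less)
  have L1: "1 \<in> L" unfolding L_def mem_Collect_eq e1 using \<theta> by simp
  have bdd: "bdd_below L" by (auto simp: L_def bdd_below_def)
  define c where "c = Inf L"
  have c0: "0 \<le> c" unfolding c_def 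
  proof (rule cInf_greatest)
    show "L \<noteq> {}" using L1 by blast
  qed (simp add: L_def)
  have mono: "measure m {y\<in>B. l < v y} \<le> measure m {y\<in>B. l' < v y}" if "l' \<le> l" for l l'
    using that fin[of "{y\<in>B. l' < v y}"] meas
    by (intro measure_mono_fmeasurable) (auto simp: fmeasurable_def less_top)
  have above: "measure m {y\<in>B. l < v y} \<le> \<theta>" if "c < l" for l
  proof -
    have "L \<noteq> {}" using L1 by blast
    from cInf_lessD[OF this that[unfolded c_def]] obtain l' where l': "l' \<in> L" "l' < l" by metis
    have "measure m {y\<in>B. l' < v y} \<le> \<theta>" using l'(1) by (simp add: L_def)
    then show ?thesis by (rule order_trans[OF mono[OF less_imp_le[OF l'(2)]]])
  qed
  have below: "\<theta> < measure m {y\<in>B. l < v y}" if "0 \<le> l" "l < c" for l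
  proof (rule ccontr)
    assume "\<not> ?thesis"
    then have "l \<in> L" using that by (simp add: L_def)
    then show False using cInf_lower[OF _ bdd, of l] that by (simp add: c_def)
  qed
  have "measure m {y\<in>B. c < v y} \<le> \<theta>"
  proof -
    define P where "P n = {y\<in>B. c + 1 / real (Suc n) < v y}" for n
    have "incseq P"
      unfolding incseq_def P_def
    proof (intro allI impI subsetI, elim CollectE conjE, intro CollectI conjI)
      fix i j y assume ij: "i \<le> (j::nat)" and y: "y \<in> B" "c + 1 / real (Suc i) < v y"
      have "1 / real (Suc j) \<le> 1 / real (Suc i)" using ij by (simp add: frac_le)
      then show "c + 1 / real (Suc j) < v y" using y by linarith
    qed
    moreover have "(\<Union>n. P n) = {y\<in>B. c < v y}"
    proof (intro set_eqI iffI)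
      fix y assume y: "y \<in> {y\<in>B. c < v y}"
      then obtain n where "1 / real (Suc n) < v y - c" using reals_Archimedean[of "v y - c"] by (auto simp: inverse_eq_divide)
      then have "y \<in> P n" using y by (auto simp: P_def)
      then show "y \<in> (\<Union>n. P n)" by blast
    next
      fix y assume "y \<in> (\<Union>n. P n)"
      then obtain n where "y \<in> B" "c + 1 / real (Suc n) < v y" by (auto simp: P_def)
      moreover have "0 < 1 / real (Suc n)" by simp
      ultimately have "c < v y" by linarith
      then show "y \<in> {y\<in>B. c < v y}" using \<open>y \<in> B\<close> by simp
    qed
    moreover have "range P \<subseteq> sets m" using meas by (auto simp: P_def)
    ultimately have "(\<lambda>n. measure m (P n)) \<longlonglongrightarrow> measure m {y\<in>B. c < v y}"
      using Lim_measure_incseq[of P m] fin[of "{y\<in>B. c < v y}"] by auto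
    moreover have "measure m (P n) \<le> \<theta>" for n unfolding P_def by (rule above) simp
    ultimately show ?thesis by (intro LIMSEQ_le_const2) auto
  qed
  moreover have "\<theta> \<le> measure m {y\<in>B. c \<le> v y}"
  proof (cases "c = 0")
    case True
    then have "{y\<in>B. c \<le> v y} = B" using v(2) by auto
    then show ?thesis using \<theta> by simp
  next
    case False
    with c0 have cp: "0 < c" by simp
    define P where "P n = {y\<in>B. c - c / real (Suc n) < v y}" for n
    have "decseq P"
      unfolding decseq_def P_def
    proof (intro allI impI subsetI, elim CollectE conjE, intro CollectI conjI)
      fix i j y assume ij: "i \<le> (j::nat)" and y: "y \<in> B" "c - c / real (Suc j) < v y"
      have "c / real (Suc j) \<le> c / real (Suc i)" using ij cp by (simp add: frac_le)
      then show "c - c / real (Suc i) < v y" using y by linarith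
    qed
    moreover have "(\<Inter>n. P n) = {y\<in>B. c \<le> v y}"
    proof (intro set_eqI iffI)
      fix y assume "y \<in> (\<Inter>n. P n)"
      then have y: "y \<in> B" "\<And>n. c - c / real (Suc n) < v y" by (auto simp: P_def)
      have "(\<lambda>n. c - c * (1 / real (Suc n))) \<longlonglongrightarrow> c - c * 0" by (intro tendsto_intros LIMSEQ_Suc[OF lim_1_over_n])
      then have "c - c * 0 \<le> v y" using y(2) by (intro LIMSEQ_le_const2) (auto intro!: exI[of _ 0] less_imp_le)
      then show "y \<in> {y\<in>B. c \<le> v y}" using y(1) by simp
    next
      fix y assume y: "y \<in> {y\<in>B. c \<le> v y}"
      have "0 < c / real (Suc n)" for n using cp by simp
      then show "y \<in> (\<Inter>n. P n)" using y by (auto simp: P_def intro: less_le_trans[of _ c])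
    qed
    moreover have "range P \<subseteq> sets m" using meas by (auto simp: P_def)
    ultimately have "(\<lambda>n. measure m (P n)) \<longlonglongrightarrow> measure m {y\<in>B. c \<le> v y}"
      using Lim_measure_decseq[of P m] fin by (auto simp: P_def)
    moreover have "\<theta> \<le> measure m (P n)" for n
      unfolding P_def using cp by (intro less_imp_le[OF below]) (auto simp: field_simps)
    ultimately show ?thesis by (intro LIMSEQ_le_const) auto
  qed
  ultimately show thesis using c0 that by blast
qed

text \<open>Filling the set \<open>B\<close> with density \<open>C\<close> from the highest values of \<open>v\<close> downwards until the mass is one. The level \<open>c\<close> reached is a quantile, and on the level set itself
  a smaller constant density completes the mass.\<close>

lemma (in mm_space) bathtub:
  fixes v :: "'a \<Rightarrow> real"
  assumes B: "B \<in> sets borel" "emeasure m B < \<infinity>" and v: "v \<in> borel_measurable borel" "\<And>y. 0 \<le> v y" "\<And>y. v y \<le> 1"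
    and C: "0 < C" "1 \<le> C * measure m B"
  obtains c \<nu> where "0 \<le> c" "\<nu> \<in> borel_probs" "AE y in \<nu>. y \<in> B"
    "\<And>S. S \<in> sets borel \<Longrightarrow> emeasure \<nu> S \<le> ennreal C * emeasure m S"
    "(\<integral>\<^sup>+y. ennreal (v y) \<partial>\<nu>) = ennreal c + ennreal C * (\<integral>\<^sup>+y\<in>B. ennreal (v y - c) \<partial>m)"
proof -
  obtain c where c: "0 \<le> c" "measure m {y\<in>B. c < v y} \<le> 1 / C" "1 / C \<le> measure m {y\<in>B. c \<le> v y}"
    using quantile_exists[OF B v, of "1 / C"] C by (auto simp: field_simps)
  define P where "P = {y\<in>B. c < v y}"
  define Q where "Q = {y\<in>B. c = v y}"
  have PQ: "P \<in> sets m" "Q \<in> sets m" unfolding P_def Q_def sets_m using B(1) v(1) by measurable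
  have sub: "P \<subseteq> B" "Q \<subseteq> B" "P \<inter> Q = {}" by (auto simp: P_def Q_def)
  have fin: "emeasure m S \<noteq> \<infinity>" if "S \<subseteq> B" for S
    using emeasure_mono[OF that, of m] B by (auto simp: sets_m top_unique)
  have em: "emeasure m P = ennreal (measure m P)" "emeasure m Q = ennreal (measure m Q)"
    using fin sub by (auto intro!: emeasure_eq_ennreal_measure)
  have un: "{y\<in>B. c \<le> v y} = P \<union> Q" by (auto simp: P_def Q_def)
  have mPQ: "measure m (P \<union> Q) = measure m P + measure m Q"
    using PQ sub fin by (intro measure_Union) auto
  have le: "C * measure m P \<le> 1" "1 \<le> C * measure m P + C * measure m Q"
    using c(2,3) C unfolding un mPQ P_def[symmetric] by (auto simp: field_simps)
  \<comment> \<open>the density on the critical level set\<close>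
  define s where "s = (if measure m Q = 0 then 0 else (1 - C * measure m P) / measure m Q)"
  have s: "0 \<le> s" "s \<le> C" "C * measure m P + s * measure m Q = 1"
    using le C(1) by (auto simp: s_def field_simps zero_less_measure_iff)
  define d where "d y = C * indicator P y + s * indicator Q y" for y
  have d: "0 \<le> d y" "d y \<le> C" "d y = d y * indicator B y" for y
    using s(1,2) C(1) sub by (auto simp: d_def indicator_def)
  have [measurable]: "P \<in> sets m" "Q \<in> sets m" "B \<in> sets m" "v \<in> borel_measurable m"
    using PQ B(1) v(1) by (simp_all add: sets_m measurable_cong_sets[OF sets_m refl])
  have dm [measurable]: "d \<in> borel_measurable m" unfolding d_def by measurable
  define \<nu> where "\<nu> = density m (\<lambda>y. ennreal (d y))"
  have tot: "(\<integral>\<^sup>+y. ennreal (d y) \<partial>m) = 1"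
  proof -
    have "(\<integral>\<^sup>+y. ennreal (d y) \<partial>m) = (\<integral>\<^sup>+y. ennreal C * indicator P y + ennreal s * indicator Q y \<partial>m)"
      using s C sub by (intro nn_integral_cong) (auto simp: d_def indicator_def)
    also have "\<dots> = ennreal C * emeasure m P + ennreal s * emeasure m Q"
      using PQ by (subst nn_integral_add) (auto simp: nn_integral_cmult_indicator)
    also have "\<dots> = ennreal (C * measure m P + s * measure m Q)"
      unfolding em using s(1) C(1) by (simp only: ennreal_mult[OF less_imp_le[OF C(1)] measure_nonneg, symmetric]
        ennreal_mult[OF s(1) measure_nonneg, symmetric]) (simp add: ennreal_plus[symmetric] del: ennreal_plus)
    finally show ?thesis by (simp add: s(3))
  qed
  have sets\<nu>: "sets \<nu> = sets borel" by (simp add: \<nu>_def sets_m)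
  have "emeasure \<nu> (space \<nu>) = 1"
  proof -
    have "emeasure \<nu> (space \<nu>) = (\<integral>\<^sup>+y\<in>space m. ennreal (d y) \<partial>m)"
      unfolding \<nu>_def by (subst emeasure_density) auto
    also have "\<dots> = (\<integral>\<^sup>+y. ennreal (d y) \<partial>m)" by (intro nn_integral_cong) simp
    finally show ?thesis unfolding tot .
  qed
  then have 1: "\<nu> \<in> borel_probs" using sets\<nu> by (auto simp: borel_probs_def intro: prob_spaceI)
  have 2: "AE y in \<nu>. y \<in> B"
  proof -
    have "y \<in> B" if "0 < ennreal (d y)" for y using that d(3)[of y] by (cases "y \<in> B") auto
    then show ?thesis unfolding \<nu>_def by (subst AE_density) auto
  qed
  have 3: "emeasure \<nu> S \<le> ennreal C * emeasure m S" if S: "S \<in> sets borel" for S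
  proof -
    have "emeasure \<nu> S = (\<integral>\<^sup>+y\<in>S. ennreal (d y) \<partial>m)"
      unfolding \<nu>_def using S by (intro emeasure_density) (auto simp: sets_m)
    also have "\<dots> \<le> (\<integral>\<^sup>+y. ennreal C * indicator S y \<partial>m)"
      using d by (intro nn_integral_mono mult_right_mono ennreal_leI) auto
    also have "\<dots> = ennreal C * emeasure m S" using S by (simp add: nn_integral_cmult_indicator sets_m)
    finally show ?thesis .
  qed
  have 4: "(\<integral>\<^sup>+y. ennreal (v y) \<partial>\<nu>) = ennreal c + ennreal C * (\<integral>\<^sup>+y\<in>B. ennreal (v y - c) \<partial>m)"
  proof -
    have "(\<integral>\<^sup>+y. ennreal (v y) \<partial>\<nu>) = (\<integral>\<^sup>+y. ennreal (d y) * ennreal (v y) \<partial>m)"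
      unfolding \<nu>_def by (subst nn_integral_density) auto
    also have "\<dots> = (\<integral>\<^sup>+y. ennreal c * ennreal (d y) + ennreal C * (ennreal (v y - c) * indicator B y) \<partial>m)"
    proof (rule nn_integral_cong)
      fix y
      consider "y \<in> P" | "y \<in> Q" | "y \<notin> P" "y \<notin> Q" by blast
      then show "ennreal (d y) * ennreal (v y) = ennreal c * ennreal (d y) + ennreal C * (ennreal (v y - c) * indicator B y)"
      proof cases
        case 1
        then have y: "d y = C" "y \<in> B" "c < v y" using sub by (auto simp: d_def P_def Q_def)
        have "C * v y = c * C + C * (v y - c)" by (simp add: algebra_simps)
        then have "ennreal (C * v y) = ennreal (c * C) + ennreal (C * (v y - c))"
          using y C c by (simp add: ennreal_plus[symmetric] del: ennreal_plus)
        then show ?thesis using y C c v(2)[of y] by (simp add: ennreal_mult)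
      next
        case 2
        then have y: "d y = s" "y \<in> B" "v y = c" using sub by (auto simp: d_def P_def Q_def)
        then show ?thesis by (simp add: mult.commute)
      next
        case 3
        then have y: "d y = 0" by (simp add: d_def)
        have "ennreal (v y - c) * indicator B y = 0"
        proof (cases "y \<in> B")
          case True
          then have "v y \<le> c" using 3 by (auto simp: P_def)
          then show ?thesis by (simp add: ennreal_neg)
        qed simp
        then show ?thesis using y by simp
      qed
    qed
    also have "\<dots> = ennreal c * (\<integral>\<^sup>+y. ennreal (d y) \<partial>m) + ennreal C * (\<integral>\<^sup>+y\<in>B. ennreal (v y - c) \<partial>m)"
      by (subst nn_integral_add) (auto simp: nn_integral_cmult)
    finally show ?thesis by (simp add: tot)
  qed
  show thesis by (rule that[OF c(1) 1 2 3 4])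
qed

context cd_space begin

lemma ball_profile_le:
  assumes t: "0 < t" "t \<le> 1" and r: "0 < r"
  shows "ball_profile r t * measure m (ball x r) \<le> measure m (ball (x::'a) (t * r))"
proof (cases "t = 1")
  case True
  then show ?thesis using r by (simp add: ball_profile_1)
next
  case False
  have "ennreal ((1 - (1 - t)) powr N * sinh_ratio (1 - (1 - t)) (curv * r) powr (N - 1)) * emeasure m (ball x r) \<le> emeasure m (ball x (t * r))"
  proof (rule brunn_minkowski_point[where x = x])
    fix y p :: 'a assume "y \<in> ball x r" "dist p x = (1 - (1 - t)) * dist y x"
    then show "p \<in> ball x (t * r)" using t by (simp add: dist_commute)
  qed (use t False r in auto)
  then have "ennreal (ball_profile r t * measure m (ball x r)) \<le> ennreal (measure m (ball x (t * r)))"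
    using ball_profile_pos[of t r] t r by (simp add: emeasure_ball ball_profile_def ennreal_mult)
  then show ?thesis by simp
qed

text \<open>The contraction estimate for the threshold that the bathtub measure on the small ball provides: then the truncated integral on the small ball is exactly the
  integral of \<open>v\<close> against that measure.\<close>

lemma contracted_measure:
  fixes x :: 'a
  assumes h: "h \<in> borel_measurable borel" "(\<integral>\<^sup>+y\<in>ball x (2 * r). h y \<partial>m) = ennreal H" "0 \<le> H" and hv: "geo_gradient h v"
    and v: "continuous_on UNIV v" "\<And>y. 0 \<le> v y" "\<And>y. v y \<le> 1" and r: "0 < r" and t0: "0 < t0" "t0 \<le> 1"
    and \<Phi>: "\<And>s s'. t0 \<le> s \<Longrightarrow> s \<le> s' \<Longrightarrow> s' \<le> 1 \<Longrightarrow> (s' - s) / ball_profile r s' \<le> \<Phi> s - \<Phi> s'"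
    and I: "\<Phi> t0 - \<Phi> 1 \<le> I"
    and E: "E \<in> sets borel" "E \<subseteq> ball x r" "0 < measure m E" "\<And>y. y \<in> E \<Longrightarrow> v y = 1"
  obtains \<nu> where "\<nu> \<in> borel_probs" "AE y in \<nu>. y \<in> ball x (t0 * r)"
    "\<And>S. S \<in> sets borel \<Longrightarrow> emeasure \<nu> S \<le> ennreal (1 / (ball_profile r t0 * measure m E)) * emeasure m S"
    "1 \<le> (\<integral>y. v y \<partial>\<nu>) + r * I / measure m E * H"
proof -
  define C where "C = 1 / (ball_profile r t0 * measure m E)"
  have g: "0 < ball_profile r t0" using t0 r by (intro ball_profile_pos) auto
  have C: "0 < C" using g E(3) by (simp add: C_def)
  have Ef: "emeasure m E = ennreal (measure m E)"
    using emeasure_finite_of_subset_ball[OF E(2)] by (intro emeasure_eq_ennreal_measure) auto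
  have vm: "v \<in> borel_measurable borel" by (rule borel_measurable_continuous_onI[OF v(1)])
  have "1 \<le> C * measure m (ball x (t0 * r))"
  proof -
    have "measure m E \<le> measure m (ball x r)"
      using E emeasure_ball_finite[of x r] by (intro measure_mono_fmeasurable) (auto simp: fmeasurable_def sets_m)
    then have "ball_profile r t0 * measure m E \<le> measure m (ball x (t0 * r))"
      using ball_profile_le[OF t0 r, of x] g by (meson mult_left_mono less_imp_le order_trans)
    then show ?thesis using g E(3) by (simp add: C_def)
  qed
  from bathtub[OF _ emeasure_ball_finite vm v(2,3) C this]
  obtain c \<nu> where c: "0 \<le> c" and \<nu>: "\<nu> \<in> borel_probs" "AE y in \<nu>. y \<in> ball x (t0 * r)"
      "\<And>S. S \<in> sets borel \<Longrightarrow> emeasure \<nu> S \<le> ennreal C * emeasure m S"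
      "(\<integral>\<^sup>+y. ennreal (v y) \<partial>\<nu>) = ennreal c + ennreal C * (\<integral>\<^sup>+y\<in>ball x (t0 * r). ennreal (v y - c) \<partial>m)"
    by auto
  interpret \<nu>: prob_space \<nu> using \<nu>(1) by (simp add: borel_probs_def)
  have v\<nu>: "v \<in> borel_measurable \<nu>" using vm \<nu>(1) by (simp add: borel_probs_def cong: measurable_cong_sets)
  have int: "integrable \<nu> v" using v v\<nu> by (intro \<nu>.integrable_const_bound[of _ 1]) auto
  have V: "(\<integral>\<^sup>+y. ennreal (v y) \<partial>\<nu>) = ennreal (\<integral>y. v y \<partial>\<nu>)"
    using v(2) int by (intro nn_integral_eq_integral) auto
  have "ennreal (1 - c) * ennreal (measure m E) = (\<integral>\<^sup>+y. ennreal (1 - c) * indicator E y \<partial>m)"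
    using E by (subst nn_integral_cmult_indicator) (auto simp: Ef sets_m)
  also have "\<dots> \<le> (\<integral>\<^sup>+y\<in>ball x r. ennreal (v y - c) \<partial>m)"
    using E by (intro nn_integral_mono) (auto simp: indicator_def)
  also have "\<dots> \<le> ennreal (1 / ball_profile r t0) * (\<integral>\<^sup>+y\<in>ball x (t0 * r). ennreal (v y - c) \<partial>m)
      + ennreal (r * (\<Phi> t0 - \<Phi> 1)) * (\<integral>\<^sup>+y\<in>ball x (2 * r). h y \<partial>m)"
    by (rule contraction[OF h(1) _ hv v(1,2) r t0 c \<Phi>]) (use h(2) in simp)
  also have "\<dots> \<le> ennreal (1 / ball_profile r t0) * (\<integral>\<^sup>+y\<in>ball x (t0 * r). ennreal (v y - c) \<partial>m) + ennreal (r * I) * ennreal H"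
    unfolding h(2) using r I by (intro add_left_mono mult_right_mono ennreal_leI) auto
  finally have main: "ennreal (1 - c) * ennreal (measure m E)
    \<le> ennreal (1 / ball_profile r t0) * (\<integral>\<^sup>+y\<in>ball x (t0 * r). ennreal (v y - c) \<partial>m) + ennreal (r * I) * ennreal H" .
  have d\<Phi>: "0 \<le> I"
  proof -
    have "0 \<le> (1 - t0) / ball_profile r 1" using t0 r by (simp add: ball_profile_1)
    also have "\<dots> \<le> \<Phi> t0 - \<Phi> 1" using t0 by (intro \<Phi>) auto
    finally show ?thesis using I by simp
  qed
  have iE: "ennreal (1 / measure m E) * ennreal (measure m E) = 1"
    using E(3) by (simp add: ennreal_mult[symmetric])
  have "ennreal 1 \<le> ennreal c + ennreal (1 - c) * 1"
    using c by (cases "c \<le> 1") (auto simp: ennreal_plus[symmetric] ennreal_neg simp del: ennreal_plus)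
  also have "\<dots> = ennreal c + ennreal (1 / measure m E) * (ennreal (1 - c) * ennreal (measure m E))"
    by (simp only: iE[symmetric] ac_simps)
  also have "\<dots> \<le> ennreal c + ennreal (1 / measure m E) * (ennreal (1 / ball_profile r t0) * (\<integral>\<^sup>+y\<in>ball x (t0 * r). ennreal (v y - c) \<partial>m) + ennreal (r * I) * ennreal H)"
    by (intro add_left_mono mult_left_mono main) simp
  also have "\<dots> = ennreal (\<integral>y. v y \<partial>\<nu>) + ennreal (r * I / measure m E * H)"
  proof -
    have "ennreal (1 / measure m E) * ennreal (1 / ball_profile r t0) = ennreal C"
      using E(3) g by (simp add: C_def ennreal_mult[symmetric] mult.commute)
    moreover have "ennreal (1 / measure m E) * (ennreal (r * I) * ennreal H) = ennreal (r * I / measure m E * H)"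
      using E(3) r d\<Phi> h(3) by (simp add: ennreal_mult[symmetric])
    ultimately show ?thesis unfolding V[symmetric] \<nu>(4) by (simp only: distrib_left mult.assoc[symmetric] add.assoc)
  qed
  also have "\<dots> = ennreal ((\<integral>y. v y \<partial>\<nu>) + r * I / measure m E * H)"
    using E(3) r d\<Phi> h(3) v(2) by (intro ennreal_plus[symmetric]) (auto intro!: integral_nonneg_AE)
  finally have "1 \<le> (\<integral>y. v y \<partial>\<nu>) + r * I / measure m E * H"
    by (rule ennreal_le_iff[THEN iffD1, rotated]) (use E(3) r d\<Phi> h(3) v(2) in \<open>auto intro!: integral_nonneg_AE add_nonneg_nonneg\<close>)
  then show thesis using that[OF \<nu>(1,2)] \<nu>(3) unfolding C_def by blast
qed

text \<open>Three terms: the price of contracting \<open>E\<close>, that of contracting \<open>F\<close> (apply the same to \<open>1 - v\<close>), and the transport between the contracted measures.\<close>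

lemma level_bound:
  fixes x :: 'a
  assumes h: "h \<in> borel_measurable borel" "(\<integral>\<^sup>+y\<in>ball x (2 * r). h y \<partial>m) = ennreal H" "0 \<le> H" and hv: "geo_gradient h v"
    and v: "continuous_on UNIV v" "\<And>y. 0 \<le> v y" "\<And>y. v y \<le> 1" and r: "0 < r"
    and t0: "0 < t0" "t0 \<le> 1" and t1: "0 < t1" "t1 \<le> 1"
    and \<Phi>0: "\<And>s s'. t0 \<le> s \<Longrightarrow> s \<le> s' \<Longrightarrow> s' \<le> 1 \<Longrightarrow> (s' - s) / ball_profile r s' \<le> \<Phi>0 s - \<Phi>0 s'"
    and \<Phi>1: "\<And>s s'. t1 \<le> s \<Longrightarrow> s \<le> s' \<Longrightarrow> s' \<le> 1 \<Longrightarrow> (s' - s) / ball_profile r s' \<le> \<Phi>1 s - \<Phi>1 s'"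
    and I: "\<Phi>0 t0 - \<Phi>0 1 \<le> I0" "\<Phi>1 t1 - \<Phi>1 1 \<le> I1"
    and E: "E \<in> sets borel" "E \<subseteq> ball x r" "0 < measure m E" "\<And>y. y \<in> E \<Longrightarrow> v y = 1"
    and F: "F \<in> sets borel" "F \<subseteq> ball x r" "0 < measure m F" "\<And>y. y \<in> F \<Longrightarrow> v y = 0"
    and C: "C \<in> borel_measurable borel" "(\<integral>\<^sup>+t\<in>{0<..<1}. ennreal (C t) \<partial>lborel) \<le> ennreal J" "0 \<le> J"
      "\<And>t. 0 < t \<Longrightarrow> t < 1 \<Longrightarrow> measure m F / (ball_profile r t0 * contr ((t0 + t1) * r) (1 - t)) \<le> C t"
      "\<And>t. 0 < t \<Longrightarrow> t < 1 \<Longrightarrow> measure m E / (ball_profile r t1 * contr ((t0 + t1) * r) t) \<le> C t"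
  shows "measure m E * measure m F \<le> r * (measure m F * I0 + measure m E * I1 + (t0 + t1) * J) * H"
proof -
  obtain \<mu> where \<mu>: "\<mu> \<in> borel_probs" "AE y in \<mu>. y \<in> ball x (t0 * r)"
    "\<And>S. S \<in> sets borel \<Longrightarrow> emeasure \<mu> S \<le> ennreal (1 / (ball_profile r t0 * measure m E)) * emeasure m S"
    "1 \<le> (\<integral>y. v y \<partial>\<mu>) + r * I0 / measure m E * H"
    by (rule contracted_measure[OF h hv v r t0 \<Phi>0 I(1) E], assumption+, rule that)
  have hv': "geo_gradient h (\<lambda>y. 1 - v y)" using hv by (simp add: geo_gradient_def abs_minus_commute)
  obtain \<nu> where \<nu>: "\<nu> \<in> borel_probs" "AE y in \<nu>. y \<in> ball x (t1 * r)"
    "\<And>S. S \<in> sets borel \<Longrightarrow> emeasure \<nu> S \<le> ennreal (1 / (ball_profile r t1 * measure m F)) * emeasure m S"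
    "1 \<le> (\<integral>y. 1 - v y \<partial>\<nu>) + r * I1 / measure m F * H"
  proof (rule contracted_measure[OF h hv' _ _ _ r t1 \<Phi>1 I(2) F(1-3)])
    show "continuous_on UNIV (\<lambda>y. 1 - v y)" by (intro continuous_intros v(1))
  qed (use v F(4) that in auto)
  interpret \<nu>: prob_space \<nu> using \<nu>(1) by (simp add: borel_probs_def)
  have vm: "v \<in> borel_measurable borel" by (rule borel_measurable_continuous_onI[OF v(1)])
  have v\<nu>: "v \<in> borel_measurable \<nu>" using vm \<nu>(1) by (simp add: borel_probs_def cong: measurable_cong_sets)
  have int: "integrable \<nu> v" using v v\<nu> by (intro \<nu>.integrable_const_bound[of _ 1]) auto
  have \<nu>4: "(\<integral>y. v y \<partial>\<nu>) \<le> r * I1 / measure m F * H"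
    using \<nu>(4) int by (simp add: \<nu>.prob_space)
  define P where "P = measure m E * measure m F"
  have P: "0 < P" using E(3) F(3) by (simp add: P_def)
  define D where "D = (t0 + t1) * r"
  have D: "0 < D" using t0 t1 r by (simp add: D_def)
  have g: "0 < ball_profile r t0" "0 < ball_profile r t1" using t0 t1 r by (auto intro!: ball_profile_pos)
  have "ennreal ((\<integral>y. v y \<partial>\<mu>) - (\<integral>y. v y \<partial>\<nu>))
      \<le> ennreal (t0 * r + t1 * r) * (\<integral>\<^sup>+t\<in>{0<..<1}. ennreal (C t / P) \<partial>lborel) * (\<integral>\<^sup>+y\<in>ball x (2 * r). h y \<partial>m)"
  proof (rule transport_gradient_bound[OF \<mu>(1) \<nu>(1) \<mu>(2) \<nu>(2) _ \<mu>(3) _ \<nu>(3) _ _ _ _ hv vm])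
    show "(\<lambda>t. C t / P) \<in> borel_measurable borel" using C(1) by measurable
    fix t :: real assume t: "0 < t" "t < 1"
    have cp: "0 < contr D (1 - t)" "0 < contr D t" using t D by (auto intro!: contr_pos)
    have "1 / (ball_profile r t0 * measure m E) / contr D (1 - t) = (measure m F / (ball_profile r t0 * contr D (1 - t))) / P"
      using cp g E(3) F(3) by (simp add: P_def)
    moreover have "1 / (ball_profile r t1 * measure m F) / contr D t = (measure m E / (ball_profile r t1 * contr D t)) / P"
      using cp g E(3) F(3) by (simp add: P_def)
    moreover have "(measure m F / (ball_profile r t0 * contr D (1 - t))) / P \<le> C t / P"
      "(measure m E / (ball_profile r t1 * contr D t)) / P \<le> C t / P"
      by (rule divide_right_mono[OF C(4)[OF t, folded D_def] less_imp_le[OF P]]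
          divide_right_mono[OF C(5)[OF t, folded D_def] less_imp_le[OF P]])+
    ultimately have "max (1 / (ball_profile r t0 * measure m E) / contr D (1 - t)) (1 / (ball_profile r t1 * measure m F) / contr D t) \<le> C t / P"
      by (simp only: max.bounded_iff)
    then show "max (1 / (ball_profile r t0 * measure m E) / contr (t0 * r + t1 * r) (1 - t)) (1 / (ball_profile r t1 * measure m F) / contr (t0 * r + t1 * r) t) \<le> C t / P"
      by (simp only: D_def distrib_right)
  next
    show "\<bar>v y\<bar> \<le> 1" for y using v(2,3)[of y] by simp
  qed (use g E(3) F(3) t0 t1 r in \<open>simp_all add: mult_left_le_one_le\<close>)
  also have "(\<integral>\<^sup>+t\<in>{0<..<1}. ennreal (C t / P) \<partial>lborel) = ennreal (1 / P) * (\<integral>\<^sup>+t\<in>{0<..<1}. ennreal (C t) \<partial>lborel)"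
  proof -
    have "(\<integral>\<^sup>+t\<in>{0<..<1}. ennreal (C t / P) \<partial>lborel) = (\<integral>\<^sup>+t. ennreal (1 / P) * (ennreal (C t) * indicator {0<..<1} t) \<partial>lborel)"
      using P by (intro nn_integral_cong) (auto simp: indicator_def ennreal_mult'[symmetric])
    also have "\<dots> = ennreal (1 / P) * (\<integral>\<^sup>+t\<in>{0<..<1}. ennreal (C t) \<partial>lborel)"
      using C(1) by (intro nn_integral_cmult) simp
    finally show ?thesis .
  qed
  also have "ennreal (t0 * r + t1 * r) * (ennreal (1 / P) * (\<integral>\<^sup>+t\<in>{0<..<1}. ennreal (C t) \<partial>lborel)) * (\<integral>\<^sup>+y\<in>ball x (2 * r). h y \<partial>m)
      \<le> ennreal (t0 * r + t1 * r) * (ennreal (1 / P) * ennreal J) * ennreal H"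
    unfolding h(2) by (intro mult_right_mono mult_left_mono C(2)) auto
  also have "\<dots> = ennreal (D / P * J * H)"
  proof -
    have "t0 * r + t1 * r = D" by (simp add: D_def distrib_right)
    then show ?thesis using P D C(3) h(3) by (simp only:) (simp add: ennreal_mult[symmetric])
  qed
  finally have "(\<integral>y. v y \<partial>\<mu>) - (\<integral>y. v y \<partial>\<nu>) \<le> D / P * J * H"
    using P D C(3) h(3) by (subst (asm) ennreal_le_iff) auto
  then have "1 \<le> r * I0 / measure m E * H + r * I1 / measure m F * H + D / P * J * H"
    using \<mu>(4) \<nu>4 by linarith
  then have "P * 1 \<le> P * (r * I0 / measure m E * H + r * I1 / measure m F * H + D / P * J * H)"
    using P by (intro mult_left_mono) auto
  also have "\<dots> = r * (measure m F * I0 + measure m E * I1 + (t0 + t1) * J) * H"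
    using E(3) F(3) by (simp add: P_def D_def field_simps)
  finally show ?thesis by (simp add: P_def)
qed

end

section \<open>Integrals and bounds of exponentials\<close>

lemma exp_le_taylor:
  assumes "0 \<le> x" "x \<le> (1::real)"
  shows "exp x \<le> (\<Sum>i<n. x ^ i / fact i) + 3 * x ^ n / fact n"
proof -
  obtain t where t: "\<bar>t\<bar> \<le> \<bar>x\<bar>" "exp x = (\<Sum>i<n. x ^ i / fact i) + exp t / fact n * x ^ n"
    using Maclaurin_exp_le[of x n] by blast
  have "exp t \<le> exp 1" using t(1) assms by simp
  then have "exp t \<le> 3" using exp_le by linarith
  then have "exp t / fact n * x ^ n \<le> 3 / fact n * x ^ n" using assms by (intro mult_right_mono divide_right_mono) auto
  then show ?thesis using t(2) by simp
qed

lemma exp_ge_taylor: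
  assumes "0 \<le> (x::real)"
  shows "(\<Sum>i<n. x ^ i / fact i) \<le> exp x"
proof -
  obtain t where "exp x = (\<Sum>i<n. x ^ i / fact i) + exp t / fact n * x ^ n"
    using Maclaurin_exp_le[of x n] by blast
  then show ?thesis using assms by simp
qed

text \<open>The points \<open>4/5\<close> and \<open>8/15\<close> are the contraction parameters of the last cases.\<close>

lemma exp_numeric_bounds:
  "exp (4/5) \<le> (2226/1000::real)" "exp (8/15) \<le> (1705/1000::real)" "449/1000 \<le> exp (- (4/5::real))" "exp (- (4/5::real)) \<le> 45/100"
  "ln (3/2) \<le> (41/100::real)"
proof -
  show 1: "exp (4/5) \<le> (2226/1000::real)"
    using exp_le_taylor[of "4/5" 7] by (simp add: eval_nat_numeral)
  show "exp (8/15) \<le> (1705/1000::real)"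
    using exp_le_taylor[of "8/15" 6] by (simp add: eval_nat_numeral)
  have 2: "2223/1000 \<le> exp (4/5::real)"
    using exp_ge_taylor[of "4/5" 6] by (simp add: eval_nat_numeral)
  have "inverse (2226/1000) \<le> inverse (exp (4/5::real))" by (rule le_imp_inverse_le[OF 1]) simp
  then show "449/1000 \<le> exp (- (4/5::real))" by (simp add: exp_minus)
  have "inverse (exp (4/5::real)) \<le> inverse (2223/1000)" by (rule le_imp_inverse_le[OF 2]) simp
  then show "exp (- (4/5::real)) \<le> 45/100" by (simp add: exp_minus)
  have "3/2 \<le> exp (41/100::real)"
    using exp_ge_taylor[of "41/100" 4] by (simp add: eval_nat_numeral)
  then have "ln (3/2) \<le> ln (exp (41/100::real))" by (intro ln_mono) auto
  then show "ln (3/2) \<le> (41/100::real)" by simp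
qed

lemma exp_integral:
  assumes T: "T \<noteq> 0" and c: "0 \<le> c" and ab: "a \<le> (b::real)"
  shows "(\<integral>\<^sup>+y\<in>{a..b}. ennreal (c * exp (T * y)) \<partial>lborel) = ennreal (c * (exp (T * b) - exp (T * a)) / T)"
proof -
  have "(\<integral>\<^sup>+y. ennreal (c * exp (T * y)) * indicator {a..b} y \<partial>lborel) = ennreal (c * exp (T * b) / T - c * exp (T * a) / T)"
  proof (rule nn_integral_FTC_Icc)
    show "((\<lambda>y. c * exp (T * y) / T) has_real_derivative c * exp (T * y)) (at y)" for y
      using T by (auto intro!: derivative_eq_intros)
  qed (use c ab in auto)
  then show ?thesis by (simp add: right_diff_distrib diff_divide_distrib)
qed

text \<open>Split the interval where the increasing and the decreasing exponential cross, or at an end point if they do not cross. The arithmetic-geometric mean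
  inequality makes the resulting bound independent of the splitting point.\<close>

lemma max_exp_integral:
  assumes T: "0 < T" and ab: "0 < \<alpha>" "0 < \<beta>"
  shows "(\<integral>\<^sup>+y\<in>{0<..<1}. ennreal (max (\<alpha> * exp (T * y)) (\<beta> * exp (- T * y))) \<partial>lborel)
    \<le> ennreal ((\<alpha> * exp T + \<beta> - 2 * sqrt (\<alpha> * \<beta>)) / T)"
proof -
  \<comment> \<open>the crossing point of the two exponentials\<close>
  define y0 where "y0 = ln (\<beta> / \<alpha>) / (2 * T)"
  define z where "z = max 0 (min 1 y0)"
  have z: "0 \<le> z" "z \<le> 1" by (auto simp: z_def)
  have e0: "\<beta> = \<alpha> * exp (2 * T * y0)" using T ab by (simp add: y0_def)
  have fac: "\<beta> * exp (- T * y) = \<alpha> * exp (T * y) * exp (2 * T * (y0 - y))" for y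
    unfolding e0 by (simp add: exp_add[symmetric] algebra_simps)
  have left: "\<alpha> * exp (T * y) \<le> \<beta> * exp (- T * y)" if "y \<le> y0" for y
    unfolding fac using mult_left_mono[of 1 "exp (2 * T * (y0 - y))" "\<alpha> * exp (T * y)"] that T ab by simp
  have right: "\<beta> * exp (- T * y) \<le> \<alpha> * exp (T * y)" if "y0 \<le> y" for y
    unfolding fac using that T ab by (simp add: mult_le_0_iff)
  have "(\<integral>\<^sup>+y\<in>{0<..<1}. ennreal (max (\<alpha> * exp (T * y)) (\<beta> * exp (- T * y))) \<partial>lborel)
      \<le> (\<integral>\<^sup>+y. ennreal (\<beta> * exp (- T * y)) * indicator {0..z} y + ennreal (\<alpha> * exp (T * y)) * indicator {z..1} y \<partial>lborel)"
  proof (rule nn_integral_mono)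
    fix y :: real
    consider "y \<notin> {0<..<1}" | "y \<in> {0<..<1}" "y \<le> z" | "y \<in> {0<..<1}" "z < y" by linarith
    then show "ennreal (max (\<alpha> * exp (T * y)) (\<beta> * exp (- T * y))) * indicator {0<..<1} y
        \<le> ennreal (\<beta> * exp (- T * y)) * indicator {0..z} y + ennreal (\<alpha> * exp (T * y)) * indicator {z..1} y"
    proof cases
      case 2
      then have "y \<le> y0" by (auto simp: z_def)
      then have "max (\<alpha> * exp (T * y)) (\<beta> * exp (- T * y)) = \<beta> * exp (- T * y)" by (intro max_absorb2 left)
      then show ?thesis using 2 by (simp only:) (simp add: add_increasing2)
    next
      case 3
      then have "y0 \<le> y" by (auto simp: z_def)
      then have "max (\<alpha> * exp (T * y)) (\<beta> * exp (- T * y)) = \<alpha> * exp (T * y)" by (intro max_absorb1 right)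
      then show ?thesis using 3 by (simp only:) simp
    qed simp
  qed
  also have "\<dots> = ennreal (\<beta> * (exp (- T * z) - exp (- T * 0)) / - T) + ennreal (\<alpha> * (exp (T * 1) - exp (T * z)) / T)"
    using T ab z by (subst nn_integral_add) (auto simp: exp_integral[of T \<alpha> z 1] exp_integral[of "- T" \<beta> 0 z, simplified])
  also have "\<dots> = ennreal (\<beta> * (1 - exp (- T * z)) / T + \<alpha> * (exp T - exp (T * z)) / T)"
  proof -
    have "\<beta> * (exp (- T * z) - exp (- T * 0)) / - T = \<beta> * (1 - exp (- T * z)) / T" using T by (simp add: field_simps)
    moreover have "0 \<le> \<beta> * (1 - exp (- T * z)) / T" "0 \<le> \<alpha> * (exp T - exp (T * z)) / T"
      using T ab z by (auto intro!: divide_nonneg_pos mult_nonneg_nonneg)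
    ultimately show ?thesis by (simp add: ennreal_plus[symmetric] del: ennreal_plus)
  qed
  also have "\<dots> \<le> ennreal ((\<alpha> * exp T + \<beta> - 2 * sqrt (\<alpha> * \<beta>)) / T)"
  proof (rule ennreal_leI)
    have "2 * sqrt (\<alpha> * \<beta>) \<le> \<alpha> * exp (T * z) + \<beta> * exp (- T * z)"
    proof -
      have "sqrt ((\<alpha> * exp (T * z)) * (\<beta> * exp (- T * z))) \<le> (\<alpha> * exp (T * z) + \<beta> * exp (- T * z)) / 2"
        using ab by (intro arith_geo_mean_sqrt) auto
      moreover have "(\<alpha> * exp (T * z)) * (\<beta> * exp (- T * z)) = \<alpha> * \<beta>" by (simp add: exp_minus)
      ultimately show ?thesis by (simp only: le_divide_eq_numeral1 mult.commute[of "sqrt _"])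
    qed
    then show "\<beta> * (1 - exp (- T * z)) / T + \<alpha> * (exp T - exp (T * z)) / T \<le> (\<alpha> * exp T + \<beta> - 2 * sqrt (\<alpha> * \<beta>)) / T"
      using T by (simp add: add_divide_distrib[symmetric] divide_right_mono algebra_simps)
  qed
  finally show ?thesis .
qed

lemma exp_sum_integral:
  assumes T: "0 < T" and c: "0 \<le> \<gamma>" "0 \<le> \<delta>" "0 < \<alpha> \<and> 0 < \<beta> \<or> \<alpha> = 0 \<and> \<beta> = 0"
  shows "(\<integral>\<^sup>+y\<in>{0<..<1}. ennreal (\<gamma> * exp (T * y) + \<delta> * exp (- T * y) + max (\<alpha> * exp (T * y)) (\<beta> * exp (- T * y))) \<partial>lborel)
    \<le> ennreal ((\<gamma> * (exp T - 1) + \<delta> * (1 - exp (- T)) + (\<alpha> * exp T + \<beta> - 2 * sqrt (\<alpha> * \<beta>))) / T)"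
    and "0 \<le> \<gamma> * (exp T - 1) + \<delta> * (1 - exp (- T)) + (\<alpha> * exp T + \<beta> - 2 * sqrt (\<alpha> * \<beta>))"
proof -
  let ?M = "\<lambda>y. max (\<alpha> * exp (T * y)) (\<beta> * exp (- T * y))"
  have M: "0 \<le> ?M y" for y using c(3) by (auto simp: le_max_iff_disj)
  have m3: "(\<integral>\<^sup>+y\<in>{0<..<1}. ennreal (?M y) \<partial>lborel) \<le> ennreal ((\<alpha> * exp T + \<beta> - 2 * sqrt (\<alpha> * \<beta>)) / T)"
    using c(3) max_exp_integral[OF T] by auto
  have n3: "0 \<le> \<alpha> * exp T + \<beta> - 2 * sqrt (\<alpha> * \<beta>)"
  proof -
    have "sqrt (\<alpha> * \<beta>) \<le> (\<alpha> + \<beta>) / 2" using c(3) by (intro arith_geo_mean_sqrt) auto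
    then have "2 * sqrt (\<alpha> * \<beta>) \<le> \<alpha> + \<beta>" by simp
    also have "\<alpha> * 1 \<le> \<alpha> * exp T" using T c(3) by (intro mult_left_mono) auto
    then have "\<alpha> + \<beta> \<le> \<alpha> * exp T + \<beta>" by simp
    finally show ?thesis by simp
  qed
  have n1: "0 \<le> \<gamma> * (exp T - 1)" "0 \<le> \<delta> * (1 - exp (- T))" using T c by auto
  show "0 \<le> \<gamma> * (exp T - 1) + \<delta> * (1 - exp (- T)) + (\<alpha> * exp T + \<beta> - 2 * sqrt (\<alpha> * \<beta>))" using n1 n3 by linarith
  have "(\<integral>\<^sup>+y\<in>{0<..<1}. ennreal (\<gamma> * exp (T * y) + \<delta> * exp (- T * y) + ?M y) \<partial>lborel)
      \<le> (\<integral>\<^sup>+y. (ennreal (\<gamma> * exp (T * y)) * indicator {0..1} y + ennreal (\<delta> * exp (- T * y)) * indicator {0..1} y) + ennreal (?M y) * indicator {0<..<1} y \<partial>lborel)"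
  proof (rule nn_integral_mono)
    fix y
    have "ennreal (\<gamma> * exp (T * y) + \<delta> * exp (- T * y) + ?M y) = ennreal (\<gamma> * exp (T * y)) + ennreal (\<delta> * exp (- T * y)) + ennreal (?M y)"
      using c M[of y] by (simp add: ennreal_plus del: max.bounded_iff)
    then show "ennreal (\<gamma> * exp (T * y) + \<delta> * exp (- T * y) + ?M y) * indicator {0<..<1} y
      \<le> (ennreal (\<gamma> * exp (T * y)) * indicator {0..1} y + ennreal (\<delta> * exp (- T * y)) * indicator {0..1} y) + ennreal (?M y) * indicator {0<..<1} y"
      by (cases "y \<in> {0<..<1}") simp_all
  qed
  also have "\<dots> = ((\<integral>\<^sup>+y\<in>{0..1}. ennreal (\<gamma> * exp (T * y)) \<partial>lborel) + (\<integral>\<^sup>+y\<in>{0..1}. ennreal (\<delta> * exp (- T * y)) \<partial>lborel))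
      + (\<integral>\<^sup>+y\<in>{0<..<1}. ennreal (?M y) \<partial>lborel)"
    by (subst nn_integral_add, simp, simp, subst nn_integral_add) simp_all
  also have "\<dots> \<le> (ennreal (\<gamma> * (exp T - 1) / T) + ennreal (\<delta> * (1 - exp (- T)) / T)) + ennreal ((\<alpha> * exp T + \<beta> - 2 * sqrt (\<alpha> * \<beta>)) / T)"
  proof (intro add_mono m3)
    show "(\<integral>\<^sup>+y\<in>{0..1}. ennreal (\<gamma> * exp (T * y)) \<partial>lborel) \<le> ennreal (\<gamma> * (exp T - 1) / T)"
      using exp_integral[of T \<gamma> 0 1] T c by simp
    have "\<delta> * (exp (- T) - 1) / - T = \<delta> * (1 - exp (- T)) / T" using T by (simp add: field_simps)
    then show "(\<integral>\<^sup>+y\<in>{0..1}. ennreal (\<delta> * exp (- T * y)) \<partial>lborel) \<le> ennreal (\<delta> * (1 - exp (- T)) / T)"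
      using exp_integral[of "- T" \<delta> 0 1] T c by simp
  qed
  also have "\<dots> = ennreal (\<gamma> * (exp T - 1) / T + \<delta> * (1 - exp (- T)) / T + (\<alpha> * exp T + \<beta> - 2 * sqrt (\<alpha> * \<beta>)) / T)"
    using n1 n3 T by (simp add: ennreal_plus)
  also have "\<dots> = ennreal ((\<gamma> * (exp T - 1) + \<delta> * (1 - exp (- T)) + (\<alpha> * exp T + \<beta> - 2 * sqrt (\<alpha> * \<beta>))) / T)"
    by (simp only: add_divide_distrib)
  finally show "(\<integral>\<^sup>+y\<in>{0<..<1}. ennreal (\<gamma> * exp (T * y) + \<delta> * exp (- T * y) + ?M y) \<partial>lborel)
    \<le> ennreal ((\<gamma> * (exp T - 1) + \<delta> * (1 - exp (- T)) + (\<alpha> * exp T + \<beta> - 2 * sqrt (\<alpha> * \<beta>))) / T)" .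
qed

lemma four_sinh_ge_exp:
  assumes "1/2 \<le> (v::real)" shows "exp v \<le> 4 * sinh v"
proof -
  have "2 \<le> exp (2 * v)" using exp_ge_add_one_self[of "2 * v"] assms by linarith
  then have "2 * exp (- v) \<le> exp (2 * v) * exp (- v)" by (intro mult_right_mono) auto
  also have "\<dots> = exp v" by (simp add: exp_add[symmetric])
  finally show ?thesis by (simp add: sinh_field_def exp_minus field_simps)
qed

lemma four_sinh_le: "4 * sinh a \<le> exp (2 * a) / cosh (a::real)"
proof -
  have "4 * sinh a * cosh a = exp (2 * a) - exp (- (2 * a))"
  proof -
    have "exp (2 * a) = exp a * exp a" "exp (- (2 * a)) = exp (- a) * exp (- a)" by (simp_all flip: exp_add)
    moreover have "4 * ((p - q) / 2) * ((p + q) / 2) = p * p - q * q" for p q :: real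
    proof -
      have "4 * ((p - q) / 2) * ((p + q) / 2) = (p - q) * (p + q)" by simp
      then show ?thesis by (simp add: algebra_simps)
    qed
    ultimately show ?thesis by (simp only: sinh_field_def cosh_field_def)
  qed
  then have "4 * sinh a * cosh a \<le> exp (2 * a)" by simp
  then show ?thesis using cosh_real_pos[of a] by (simp add: field_simps)
qed

text \<open>The function \<open>e\<^bsup>-u\<^esup> ln (1 + 1/u)\<close> is an elementary upper bound for the exponential integral; its derivative is at most \<open>- e\<^bsup>-u\<^esup> / u\<close>
  because \<open>ln (1 + 1/u) \<ge> 1 / (1 + u)\<close>.\<close>

lemma exp_log_primitive:
  assumes "0 < u" "u \<le> (u'::real)"
  shows "(u' - u) * exp (- u') / u' \<le> exp (- u) * ln (1 + 1 / u) - exp (- u') * ln (1 + 1 / u')"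
proof -
  define d where "d = u' - u"
  have d: "0 \<le> d" and u': "0 < u'" using assms by (auto simp: d_def)
  have L: "1 - 1 / x \<le> ln x" if "0 < x" for x :: real
    using ln_le_minus_one[of "1 / x"] that by (simp add: ln_div)
  have L1: "1 / (1 + u') \<le> ln (1 + 1 / u)"
  proof -
    have "1 / (1 + u') \<le> 1 / (1 + u)" using assms by (intro divide_left_mono) auto
    also have "\<dots> = 1 - 1 / (1 + 1 / u)" using assms(1) by (simp add: field_simps)
    also have "\<dots> \<le> ln (1 + 1 / u)" using assms(1) by (intro L) (simp add: add_pos_pos)
    finally show ?thesis .
  qed
  have L2: "d / (u' * (1 + u')) \<le> ln (1 + 1 / u) - ln (1 + 1 / u')"
  proof -
    have p: "0 < 1 + 1 / u" "0 < 1 + 1 / u'" using assms(1) u' by (simp_all add: add_pos_pos)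
    have "d / (u' * (1 + u')) \<le> d / (u' * (1 + u))"
      using assms u' d by (intro divide_left_mono mult_left_mono) auto
    also have "\<dots> = 1 - 1 / ((1 + 1 / u) / (1 + 1 / u'))"
    proof -
      have "1 / ((1 + 1 / u) / (1 + 1 / u')) = u * (1 + u') / (u' * (1 + u))"
      proof -
        have "1 + 1 / u = (1 + u) / u" "1 + 1 / u' = (1 + u') / u'" using assms u' by (simp_all add: field_simps)
        then show ?thesis by (simp add: ac_simps)
      qed
      moreover have "d = u' * (1 + u) - u * (1 + u')" by (simp add: d_def algebra_simps)
      moreover have "u' * (1 + u) / (u' * (1 + u)) = 1" using assms u' by simp
      ultimately show ?thesis by (simp only: diff_divide_distrib)
    qed
    also have "\<dots> \<le> ln ((1 + 1 / u) / (1 + 1 / u'))" using p by (intro L) simp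
    also have "\<dots> = ln (1 + 1 / u) - ln (1 + 1 / u')" using p by (simp add: ln_div)
    finally show ?thesis .
  qed
  have "d / u' = d * (1 / (1 + u')) + d / (u' * (1 + u'))"
  proof -
    have "d / u' = d * (1 + u') / (u' * (1 + u'))" using u' by simp
    also have "\<dots> = d * u' / (u' * (1 + u')) + d / (u' * (1 + u'))"
      by (simp only: distrib_left add_divide_distrib mult_1_right add.commute)
    also have "d * u' / (u' * (1 + u')) = d * (1 / (1 + u'))" using u' by simp
    finally show ?thesis .
  qed
  also have "\<dots> \<le> d * ln (1 + 1 / u) + (ln (1 + 1 / u) - ln (1 + 1 / u'))"
    using L1 L2 d by (intro add_mono mult_left_mono)
  also have "\<dots> = (1 + d) * ln (1 + 1 / u) - ln (1 + 1 / u')" by (simp add: algebra_simps)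
  also have "\<dots> \<le> exp d * ln (1 + 1 / u) - ln (1 + 1 / u')"
    using exp_ge_add_one_self[of d] assms(1) by (intro diff_right_mono mult_right_mono) (auto intro!: ln_ge_zero)
  finally have "exp (- u') * (d / u') \<le> exp (- u') * (exp d * ln (1 + 1 / u) - ln (1 + 1 / u'))"
    by (intro mult_left_mono) auto
  also have "\<dots> = exp (- u) * ln (1 + 1 / u) - exp (- u') * ln (1 + 1 / u')"
    by (simp add: d_def right_diff_distrib mult.assoc[symmetric] exp_add[symmetric])
  finally show ?thesis by (simp add: d_def mult.commute)
qed

section \<open>Separation of two sets\<close>

lemma sinh_le_mult_cosh:
  assumes "0 \<le> a" shows "sinh a \<le> a * cosh (a::real)"
proof -
  have "0 \<le> a * cosh a - sinh a"
    by (rule DERIV_pos_imp_ge_0[where g' = "\<lambda>a. a * sinh a" and g = "\<lambda>a. a * cosh a - sinh a"])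
       (use assms in \<open>auto intro!: derivative_eq_intros\<close>)
  then show ?thesis by simp
qed

lemma exp_chord:
  assumes "0 \<le> s" "s \<le> c" "0 < (c::real)"
  shows "exp s \<le> 1 + s * ((exp c - 1) / c)"
proof -
  have "exp ((1 - s / c) *\<^sub>R 0 + (s / c) *\<^sub>R c) \<le> (1 - s / c) * exp 0 + (s / c) * exp c"
    using assms by (intro convex_onD[OF exp_convex]) auto
  also have "(1 - s / c) *\<^sub>R 0 + (s / c) *\<^sub>R c = s" using assms by simp
  finally show ?thesis by (simp add: algebra_simps diff_divide_distrib)
qed

text \<open>Combine \<open>sinh a \<le> a cosh a\<close> with \<open>cosh a \<le> 1 + 2a/3 \<le> e\<^bsup>2a/3\<^esup>\<close>, where convexity gives the linear bound.\<close>

lemma sinh_double_bound: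
  assumes a: "0 \<le> a" "a \<le> (1::real)"
  shows "sinh (2 * a) * cosh a \<le> 2 * a * exp (2 * a)"
proof -
  have "exp 1 \<le> (28/10::real)" using exp_le_taylor[of 1 6] by (simp add: eval_nat_numeral)
  have "exp a \<le> 1 + a * (18/10)"
    using exp_chord[of a 1] a mult_left_mono[OF \<open>exp 1 \<le> (28/10::real)\<close> a(1)] by (simp add: algebra_simps)
  moreover have "exp (- a) \<le> 1 - a * (1/2)"
  proof -
    have "exp ((1 - a) *\<^sub>R 0 + a *\<^sub>R (- 1)) \<le> (1 - a) * exp 0 + a * exp (- 1 :: real)"
      using a by (intro convex_onD[OF exp_convex]) auto
    moreover have "exp (- 1 :: real) \<le> 1/2"
      using exp_ge_add_one_self[of "1::real"] by (simp add: exp_minus field_simps)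
    ultimately show ?thesis using mult_left_mono[of "exp (- 1)" "1/2" a] a by (simp add: algebra_simps)
  qed
  ultimately have "cosh a \<le> 1 + 2 / 3 * a" using a by (simp add: cosh_field_def)
  also have "\<dots> \<le> exp (2 / 3 * a)" by (rule exp_ge_add_one_self)
  finally have c: "cosh a \<le> exp (2 / 3 * a)" .
  have c0: "0 < cosh a" by (rule cosh_real_pos)
  have "sinh (2 * a) * cosh a = 2 * (sinh a * cosh a ^ 2)" by (simp add: sinh_double power2_eq_square)
  also have "\<dots> \<le> 2 * (a * cosh a * cosh a ^ 2)"
    using sinh_le_mult_cosh[OF a(1)] by (intro mult_left_mono mult_right_mono) auto
  also have "\<dots> = 2 * a * cosh a ^ 3" by (simp add: eval_nat_numeral)
  also have "\<dots> \<le> 2 * a * exp (2 / 3 * a) ^ 3" using a c c0 by (intro mult_left_mono power_mono) auto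
  also have "exp (2 / 3 * a) ^ 3 = exp (2 * a)" by (simp add: exp_of_nat_mult[symmetric])
  finally show ?thesis .
qed

context cd_space begin

text \<open>The loss that the final constant leaves for the transport after the doubling estimate has used up \<open>cosh(a)\<^bsup>n\<^esup>\<close>.\<close>

definition spread :: "real \<Rightarrow> real" where
  "spread r = (exp (2 * (curv * r)) / cosh (curv * r)) powr (N - 1)"

lemma spread_pos: "0 < spread r"
  using cosh_real_pos[of "curv * r"] by (simp add: spread_def)

text \<open>For large radii all estimates are made relative to the slightly smaller constant \<open>(4 sinh a)\<^bsup>n\<^esup>\<close>, whose base is comparable to the numerator in
  \<open>ball_profile\<close>.\<close>

lemma spread_ge: "0 \<le> r \<Longrightarrow> (4 * sinh (curv * r)) powr (N - 1) \<le> spread r"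
  unfolding spread_def using N curv_nonneg by (intro powr_mono2 four_sinh_le) auto

lemma ball_profile_eq:
  assumes "0 < t" "0 < curv * r"
  shows "ball_profile r t = t * (sinh (t * (curv * r)) / sinh (curv * r)) powr (N - 1)"
proof -
  have sr: "0 < sinh_ratio t (curv * r)" using assms by (intro sinh_ratio_pos) auto
  have "t powr N = t powr (1 + (N - 1))" by simp
  also have "\<dots> = t * t powr (N - 1)" using assms(1) by (subst powr_add) simp
  finally have "ball_profile r t = t * (t powr (N - 1) * sinh_ratio t (curv * r) powr (N - 1))" by (simp add: ball_profile_def)
  also have "t powr (N - 1) * sinh_ratio t (curv * r) powr (N - 1) = (t * sinh_ratio t (curv * r)) powr (N - 1)"
    using assms sr by (simp add: powr_mult)
  also have "t * sinh_ratio t (curv * r) = sinh (t * (curv * r)) / sinh (curv * r)"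
    using assms by (auto simp: sinh_ratio_def)
  finally show ?thesis .
qed

lemma contr_spread:
  assumes t: "0 < t" "t \<le> 1" and r: "0 < r" and a: "curv * r \<le> 1"
  shows "1 \<le> spread r * contr (2 * r) t"
proof -
  let ?a = "curv * r"
  have a0: "0 \<le> ?a" using curv_nonneg r by simp
  have sr: "0 < sinh_ratio t (2 * ?a)" using t a0 by (intro sinh_ratio_pos) auto
  have c: "0 < cosh ?a" by (rule cosh_real_pos)
  have "1 \<le> exp (2 * ?a) / cosh ?a * sinh_ratio t (2 * ?a)"
  proof (cases "?a = 0")
    case True
    show ?thesis unfolding True by (simp add: sinh_ratio_def)
  next
    case False
    have "0 < ?a" by (rule le_neq_trans[OF a0 False[symmetric]])
    then have ap: "0 < 2 * ?a" by linarith
    then have s: "0 < sinh (2 * ?a)" by (simp only: sinh_real_pos_iff)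
    have "sinh (2 * ?a) * cosh ?a \<le> 2 * ?a * exp (2 * ?a)" by (rule sinh_double_bound[OF a0 a])
    then have "1 \<le> (2 * ?a * exp (2 * ?a)) / (sinh (2 * ?a) * cosh ?a)"
      using s c by (subst le_divide_eq_1_pos) auto
    also have "\<dots> = exp (2 * ?a) / cosh ?a * (2 * ?a / sinh (2 * ?a))" by (simp only: times_divide_times_eq mult.commute)
    also have "\<dots> \<le> exp (2 * ?a) / cosh ?a * sinh_ratio t (2 * ?a)"
      using t ap c by (intro mult_left_mono sinh_ratio_ge_inverse) auto
    finally show ?thesis .
  qed
  then have "1 \<le> (exp (2 * ?a) / cosh ?a * sinh_ratio t (2 * ?a)) powr (N - 1)"
    using N by (intro ge_one_powr_ge_zero) auto
  also have "\<dots> = (exp (2 * ?a) / cosh ?a) powr (N - 1) * sinh_ratio t (2 * ?a) powr (N - 1)"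
    using c sr by (subst powr_mult) auto
  also have "\<dots> = spread r * contr (2 * r) t"
    by (simp add: spread_def contr_def mult.left_commute)
  finally show ?thesis .
qed

end

text \<open>The smaller set is called \<open>E\<close>; the roles can be exchanged by passing from \<open>v\<close> to \<open>1 - v\<close>.\<close>

locale separated_sets = cd_space m K N for m :: "'a::complete_space measure" and K N +
  fixes x :: 'a and r H :: real and h :: "'a \<Rightarrow> ennreal" and v :: "'a \<Rightarrow> real" and E F :: "'a set"
  assumes h: "h \<in> borel_measurable borel" "(\<integral>\<^sup>+y\<in>ball x (2 * r). h y \<partial>m) = ennreal H" "0 \<le> H" and hv: "geo_gradient h v"
    and v: "continuous_on UNIV v" "\<And>y. 0 \<le> v y" "\<And>y. v y \<le> 1" and r: "0 < r"
    and E: "E \<in> sets borel" "E \<subseteq> ball x r" "0 < measure m E" "\<And>y. y \<in> E \<Longrightarrow> v y = 1"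
    and F: "F \<in> sets borel" "F \<subseteq> ball x r" "0 < measure m F" "\<And>y. y \<in> F \<Longrightarrow> v y = 0"
    and EF: "measure m E \<le> measure m F"
begin

abbreviation "eE \<equiv> measure m E"
abbreviation "fF \<equiv> measure m F"
definition a :: real where "a = curv * r"

lemma ball_profile_a: "0 < t \<Longrightarrow> 0 < a \<Longrightarrow> ball_profile r t = t * (sinh (t * a) / sinh a) powr (N - 1)"
  unfolding a_def by (rule ball_profile_eq)

lemma spread_ge_a: "(4 * sinh a) powr (N - 1) \<le> spread r"
  unfolding a_def using r by (intro spread_ge) simp

text \<open>Transport without contraction. The densities are bounded by \<open>spread r\<close> by \<open>sinh_double_bound\<close>.\<close>

lemma separation_small_radius:
  assumes a: "a \<le> 1"
  shows "eE * fF \<le> r * (2 * (eE + fF) * spread r) * H"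
proof -
  have b: "p / (ball_profile r 1 * contr ((1 + 1) * r) t) \<le> (eE + fF) * spread r"
    if "0 < t" "t < 1" "p \<le> eE + fF" "0 \<le> p" for t p
  proof -
    have c: "0 < contr (2 * r) t" using that r by (intro contr_pos) auto
    have "p * 1 \<le> (eE + fF) * (spread r * contr (2 * r) t)"
      using that E(3) F(3) a r by (intro mult_mono contr_spread) (auto simp: a_def)
    then show ?thesis using c r by (simp add: ball_profile_1 pos_divide_le_eq mult.assoc)
  qed
  have "eE * fF \<le> r * (fF * 0 + eE * 0 + (1 + 1) * ((eE + fF) * spread r)) * H"
  proof (rule level_bound[OF h hv v r _ _ _ _ _ _ _ _ E F, where ?\<Phi>0.0 = "\<lambda>_. 0" and ?\<Phi>1.0 = "\<lambda>_. 0" and C = "\<lambda>_. (eE + fF) * spread r"])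
    fix s s' :: real assume "1 \<le> s" "s \<le> s'" "s' \<le> 1"
    then have "s' - s = 0" by linarith
    then show "(s' - s) / ball_profile r s' \<le> 0 - 0" by (simp only: div_0 diff_self order_refl)
  next
    fix s s' :: real assume "1 \<le> s" "s \<le> s'" "s' \<le> 1"
    then have "s' - s = 0" by linarith
    then show "(s' - s) / ball_profile r s' \<le> 0 - 0" by (simp only: div_0 diff_self order_refl)
  next
    show "(\<integral>\<^sup>+t\<in>{0<..<1::real}. ennreal ((eE + fF) * spread r) \<partial>lborel) \<le> ennreal ((eE + fF) * spread r)"
      by (subst nn_integral_cmult_indicator) auto
  next
    fix t :: real assume t: "0 < t" "t < 1"
    show "fF / (ball_profile r 1 * contr ((1 + 1) * r) (1 - t)) \<le> (eE + fF) * spread r"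
      using t E(3) F(3) by (intro b) auto
    show "eE / (ball_profile r 1 * contr ((1 + 1) * r) t) \<le> (eE + fF) * spread r"
      using t E(3) F(3) by (intro b) auto
  qed (use spread_pos[of r] E(3) F(3) in auto)
  then show ?thesis by (simp add: algebra_simps)
qed

text \<open>Contract both sets to the radius \<open>1 / curv\<close>. There \<open>sinh\<close> is still comparable to its argument, and the exponent is large enough that
  the cost of the contraction is integrable without using exponential decay.\<close>

lemma separation_large_dimension:
  assumes a: "1 < a" and n: "1 \<le> N - 1"
  shows "eE * fF \<le> r * (2 * (eE + fF) * spread r) * H"
proof -
  let ?n = "N - 1"
  define X where "X = sinh a powr ?n"
  have s1: "0 < sinh (1::real)" by simp
  have sa: "0 < sinh a" unfolding sinh_real_pos_iff by (rule less_trans[OF zero_less_one a])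
  have c1: "0 < cosh (1::real)" by (rule cosh_real_pos)
  have X: "0 < X" using sa by (simp add: X_def)
  have g: "s * (s * a) / X \<le> ball_profile r s" if s: "1 / a \<le> s" "s \<le> 1" for s
  proof -
    have s0: "0 < s" "1 \<le> s * a" using s a by (auto simp: divide_le_eq intro: less_le_trans[of _ "1 / a"])
    have "s * a \<le> (s * a) powr ?n" using powr_mono[of 1 ?n "s * a"] n s0 by simp
    also have "\<dots> \<le> sinh (s * a) powr ?n" using s0 n by (intro powr_mono2 sinh_ge_self) auto
    finally have "s * (s * a) / X \<le> s * (sinh (s * a) powr ?n) / X" using s0 X by (intro divide_right_mono mult_left_mono) auto
    also have "\<dots> = ball_profile r s"
      using s0 a sa by (subst ball_profile_a) (auto simp: X_def powr_divide)
    finally show ?thesis .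
  qed
  have \<Phi>: "(s' - s) / ball_profile r s' \<le> X / (a * s) - X / (a * s')" if s: "1 / a \<le> s" "s \<le> s'" "s' \<le> 1" for s s'
  proof -
    have "0 < 1 / a" using a by simp
    then have s0: "0 < s" "0 < s'" using s by linarith+
    have "(s' - s) / ball_profile r s' \<le> (s' - s) / (s' * (s' * a) / X)"
    proof (rule divide_left_mono)
      have "0 < s' * (s' * a) / X" using s0 a X by simp
      then show "0 < ball_profile r s' * (s' * (s' * a) / X)" using g[of s'] s by (intro mult_pos_pos) linarith+
    qed (use g[of s'] s in auto)
    also have "\<dots> = X / a * ((s' - s) / (s' * s'))" using X by (simp add: ac_simps)
    also have "\<dots> \<le> X / a * ((s' - s) / (s * s'))"
      using X a s s0 by (intro mult_left_mono divide_left_mono mult_right_mono) auto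
    also have "(s' - s) / (s * s') = 1 / s - 1 / s'" using s0 by (simp add: field_simps)
    also have "X / a * (1 / s - 1 / s') = X / (a * s) - X / (a * s')" by (simp add: right_diff_distrib)
    finally show ?thesis .
  qed
  define c where "c = fF * (a * (X * cosh 1 powr ?n))"
  have b: "p / (ball_profile r (1 / a) * contr ((1 / a + 1 / a) * r) t) \<le> c" if t: "0 < t" "t < 1" and p: "p \<le> fF" "0 \<le> p" for t p
  proof -
    have e2: "curv * ((1 / a + 1 / a) * r) = 2" using a by (auto simp: a_def add_divide_distrib[symmetric])
    have "2 / sinh 2 \<le> sinh_ratio t 2" using t by (intro sinh_ratio_ge_inverse) auto
    moreover have "sinh (2::real) = 2 * sinh 1 * cosh 1" using sinh_double[of "1::real"] by simp
    ultimately have "1 / (sinh 1 * cosh 1) \<le> sinh_ratio t 2" by simp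
    then have "(1 / (sinh 1 * cosh 1)) powr ?n \<le> sinh_ratio t 2 powr ?n" using s1 c1 n by (intro powr_mono2) auto
    then have "1 / (sinh 1 powr ?n * cosh 1 powr ?n) \<le> contr ((1 / a + 1 / a) * r) t"
      unfolding contr_def e2 using s1 c1 by (simp add: powr_divide powr_mult)
    moreover have "ball_profile r (1 / a) = 1 / a * (sinh 1 powr ?n / X)"
      using a sa s1 by (subst ball_profile_a) (auto simp: X_def powr_divide)
    ultimately have "1 / a * (sinh 1 powr ?n / X) * (1 / (sinh 1 powr ?n * cosh 1 powr ?n)) \<le> ball_profile r (1 / a) * contr ((1 / a + 1 / a) * r) t"
      using a X by (simp only:) (intro mult_left_mono, auto)
    moreover have "1 / a * (sinh 1 powr ?n / X) * (1 / (sinh 1 powr ?n * cosh 1 powr ?n)) = 1 / (a * (X * cosh 1 powr ?n))"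
      using s1 by simp
    ultimately have le: "1 / (a * (X * cosh 1 powr ?n)) \<le> ball_profile r (1 / a) * contr ((1 / a + 1 / a) * r) t" by simp
    have pos: "0 < a * (X * cosh 1 powr ?n)" using a X c1 by simp
    have "p / (ball_profile r (1 / a) * contr ((1 / a + 1 / a) * r) t) \<le> p / (1 / (a * (X * cosh 1 powr ?n)))"
    proof (rule divide_left_mono[OF le p(2)])
      have q: "0 < 1 / (a * (X * cosh 1 powr ?n))" using pos by simp
      show "0 < ball_profile r (1 / a) * contr ((1 / a + 1 / a) * r) t * (1 / (a * (X * cosh 1 powr ?n)))"
        by (rule mult_pos_pos[OF less_le_trans[OF q le] q])
    qed
    also have "\<dots> = p * (a * (X * cosh 1 powr ?n))" by simp
    also have "\<dots> \<le> c" unfolding c_def using p(1) pos by (intro mult_right_mono) auto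
    finally show ?thesis .
  qed
  have c0: "0 \<le> c" using F(3) a X by (simp add: c_def)
  have "eE * fF \<le> r * (fF * X + eE * X + (1 / a + 1 / a) * c) * H"
  proof (rule level_bound[OF h hv v r _ _ _ _ _ _ _ _ E F, where ?\<Phi>0.0 = "\<lambda>t. X / (a * t)" and ?\<Phi>1.0 = "\<lambda>t. X / (a * t)" and C = "\<lambda>_. c"])
    show "(\<integral>\<^sup>+t\<in>{0<..<1::real}. ennreal c \<partial>lborel) \<le> ennreal c"
      by (subst nn_integral_cmult_indicator) auto
  next
    fix t :: real assume t: "0 < t" "t < 1"
    show "fF / (ball_profile r (1 / a) * contr ((1 / a + 1 / a) * r) (1 - t)) \<le> c" using t F(3) by (intro b) auto
    show "eE / (ball_profile r (1 / a) * contr ((1 / a + 1 / a) * r) t) \<le> c" using t E(3) EF by (intro b) auto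
  qed (use a X c0 \<Phi> in auto)
  also have "\<dots> \<le> r * (2 * (eE + fF) * spread r) * H"
  proof (intro mult_right_mono mult_left_mono)
    have half: "(p + q) / 2 \<le> 2" if "p \<le> 3" "q \<le> 1" for p q :: real using that by simp
    have "exp (- 1 :: real) \<le> 1" by simp
    then have "cosh (1::real) \<le> 2" unfolding cosh_field_def by (rule half[OF exp_le])
    then have c2: "cosh 1 powr ?n \<le> 2 powr ?n" using c1 n by (intro powr_mono2) auto
    have two: "2 \<le> (2::real) powr ?n" using powr_mono[of 1 ?n 2] n by simp
    have "(4::real) powr ?n = 2 powr ?n * 2 powr ?n" using powr_mult[of 2 2 ?n] by simp
    moreover have "2 * 2 powr ?n \<le> (2::real) powr ?n * 2 powr ?n" using two by (intro mult_right_mono) auto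
    ultimately have k: "1 + 2 * cosh 1 powr ?n \<le> 2 * (4::real) powr ?n" using c2 two by linarith
    have ac: "(1 / a + 1 / a) * c = 2 * fF * X * cosh 1 powr ?n"
      using a by (simp add: c_def add_divide_distrib[symmetric])
    have "fF * X + eE * X + (1 / a + 1 / a) * c \<le> (eE + fF) * X * (1 + 2 * cosh 1 powr ?n)"
    proof -
      have "0 \<le> eE * X * cosh 1 powr ?n" using E(3) X by simp
      then show ?thesis unfolding ac by (simp add: algebra_simps)
    qed
    also have "\<dots> \<le> (eE + fF) * X * (2 * 4 powr ?n)" using k E(3) F(3) X by (intro mult_left_mono) auto
    also have "\<dots> = 2 * (eE + fF) * (4 * sinh a) powr ?n" using sa by (simp add: X_def powr_mult)
    also have "\<dots> \<le> 2 * (eE + fF) * spread r" using spread_ge_a E(3) F(3) by (intro mult_left_mono) auto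
    finally show "fF * X + eE * X + (1 / a + 1 / a) * c \<le> 2 * (eE + fF) * spread r" .
  qed (use r h in auto)
  finally show ?thesis .
qed

text \<open>For small dimension all quantities relative to \<open>(4 sinh a)\<^bsup>n\<^esup>\<close> are bounded by exponentials in the variable \<open>S t\<close>. The four coefficients describe an upper bound for
  the maximum of the two densities along the transport, in a form whose integral is explicit.\<close>

lemma separation_exponential:
  assumes a: "1 < a" and n: "0 < N - 1" and S: "S = (N - 1) * a"
    and t0: "t0 \<le> 1" "1 / 2 \<le> t0 * a" and t1: "t1 \<le> 1" "1 / 2 \<le> t1 * a"
    and \<phi>0: "\<And>s s'. t0 \<le> s \<Longrightarrow> s \<le> s' \<Longrightarrow> s' \<le> 1 \<Longrightarrow> (s' - s) * exp (- (S * s')) / s' \<le> \<phi>0 s - \<phi>0 s'"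
    and \<phi>1: "\<And>s s'. t1 \<le> s \<Longrightarrow> s \<le> s' \<Longrightarrow> s' \<le> 1 \<Longrightarrow> (s' - s) * exp (- (S * s')) / s' \<le> \<phi>1 s - \<phi>1 s'"
    and I: "\<phi>0 t0 - \<phi>0 1 \<le> I0" "\<phi>1 t1 - \<phi>1 1 \<le> I1"
    and \<kappa>: "\<kappa>0 = S * t0" "\<kappa>1 = S * t1"
    and c: "0 \<le> \<gamma>" "0 \<le> \<delta>" "0 < \<alpha> \<and> 0 < \<beta> \<or> \<alpha> = 0 \<and> \<beta> = 0"
    and U0: "\<And>y. 0 < y \<Longrightarrow> y < 1 \<Longrightarrow> fF * exp (- \<kappa>0) / \<kappa>0 * exp ((\<kappa>0 + \<kappa>1) * y)
      \<le> \<gamma> * exp ((\<kappa>0 + \<kappa>1) * y) + \<delta> * exp (- (\<kappa>0 + \<kappa>1) * y) + max (\<alpha> * exp ((\<kappa>0 + \<kappa>1) * y)) (\<beta> * exp (- (\<kappa>0 + \<kappa>1) * y))"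
    and U1: "\<And>y. 0 < y \<Longrightarrow> y < 1 \<Longrightarrow> eE * exp \<kappa>0 / \<kappa>1 * exp (- (\<kappa>0 + \<kappa>1) * y)
      \<le> \<gamma> * exp ((\<kappa>0 + \<kappa>1) * y) + \<delta> * exp (- (\<kappa>0 + \<kappa>1) * y) + max (\<alpha> * exp ((\<kappa>0 + \<kappa>1) * y)) (\<beta> * exp (- (\<kappa>0 + \<kappa>1) * y))"
    and le: "fF * I0 + eE * I1 + (\<gamma> * (exp (\<kappa>0 + \<kappa>1) - 1) + \<delta> * (1 - exp (- (\<kappa>0 + \<kappa>1)))
      + (\<alpha> * exp (\<kappa>0 + \<kappa>1) + \<beta> - 2 * sqrt (\<alpha> * \<beta>))) \<le> 2 * (eE + fF)"
  shows "eE * fF \<le> r * (2 * (eE + fF) * spread r) * H"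
proof -
  let ?n = "N - 1"
  define T where "T = \<kappa>0 + \<kappa>1"
  define Z where "Z = (4 * sinh a) powr ?n"
  define W where "W = \<gamma> * (exp T - 1) + \<delta> * (1 - exp (- T)) + (\<alpha> * exp T + \<beta> - 2 * sqrt (\<alpha> * \<beta>))"
  define U where "U y = \<gamma> * exp (T * y) + \<delta> * exp (- T * y) + max (\<alpha> * exp (T * y)) (\<beta> * exp (- T * y))" for y
  have sa: "0 < sinh a" unfolding sinh_real_pos_iff by (rule less_trans[OF zero_less_one a])
  have Z: "0 < Z" using sa by (simp add: Z_def)
  have S0: "0 < S" unfolding S by (rule mult_pos_pos[OF n]) (use a in linarith)
  have tp: "0 < t" if "1 / 2 \<le> t * a" for t
  proof (rule ccontr)
    assume "\<not> 0 < t" then have "t * a \<le> 0" using a by (intro mult_nonpos_nonneg) auto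
    then show False using that by linarith
  qed
  have t0p: "0 < t0" and t1p: "0 < t1" using tp t0 t1 by auto
  have \<kappa>p: "0 < \<kappa>0" "0 < \<kappa>1" using t0p t1p S0 by (auto simp: \<kappa>)
  then have T: "0 < T" by (simp add: T_def)
  have ST: "(t0 + t1) = T / S" using S0 by (simp add: T_def \<kappa> distrib_left[symmetric])
  have W: "0 \<le> W" and intU: "(\<integral>\<^sup>+y\<in>{0<..<1}. ennreal (U y) \<partial>lborel) \<le> ennreal (W / T)"
    using exp_sum_integral[OF T c] by (simp_all add: W_def U_def)
  have g: "t * exp (S * t) / Z \<le> ball_profile r t" if t: "1 / 2 \<le> t * a" for t
  proof -
    have t': "0 < t" by (rule tp[OF t])
    have "exp (S * t) = exp (t * a) powr ?n" by (simp add: S exp_powr_real ac_simps)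
    also have "\<dots> \<le> (4 * sinh (t * a)) powr ?n" using n t by (intro powr_mono2 four_sinh_ge_exp) auto
    finally have "t * exp (S * t) / Z \<le> t * ((4 * sinh (t * a)) powr ?n) / Z"
      using t' Z by (intro divide_right_mono mult_left_mono) auto
    also have "\<dots> = t * ((4 * sinh (t * a)) / (4 * sinh a)) powr ?n"
      using t' t sa by (subst powr_divide) (auto simp: Z_def)
    also have "\<dots> = ball_profile r t" using t' a by (subst ball_profile_a) auto
    finally show ?thesis .
  qed
  have ginv: "1 / ball_profile r t \<le> Z * exp (- (S * t)) / t" if t: "1 / 2 \<le> t * a" for t
  proof -
    have p: "0 < t * exp (S * t) / Z" using tp[OF t] Z by simp
    have "1 / ball_profile r t \<le> 1 / (t * exp (S * t) / Z)"
      using g[OF t] p by (intro divide_left_mono mult_pos_pos) linarith+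
    also have "\<dots> = Z * exp (- (S * t)) / t" by (simp add: exp_minus divide_inverse)
    finally show ?thesis .
  qed
  have mono: "1 / 2 \<le> s * a" if "1 / 2 \<le> t * a" "t \<le> s" for s t
    using that mult_right_mono[of t s a] a by linarith
  have \<Phi>: "(s' - s) / ball_profile r s' \<le> Z * \<phi> s - Z * \<phi> s'"
    if "1 / 2 \<le> s' * a" "s \<le> s'" "(s' - s) * exp (- (S * s')) / s' \<le> \<phi> s - \<phi> s'" for s s' and \<phi> :: "real \<Rightarrow> real"
  proof -
    have "(s' - s) * (1 / ball_profile r s') \<le> (s' - s) * (Z * exp (- (S * s')) / s')"
      using that by (intro mult_left_mono ginv) auto
    also have "\<dots> = Z * ((s' - s) * exp (- (S * s')) / s')" by simp
    also have "\<dots> \<le> Z * (\<phi> s - \<phi> s')" using that(3) Z by (intro mult_left_mono) auto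
    finally show ?thesis by (simp add: right_diff_distrib)
  qed
  have cD: "exp (- (T * (1 - y))) \<le> contr ((t0 + t1) * r) y" if y: "0 < y" "y < 1" for y
  proof -
    have "0 \<le> (t0 + t1) * a" using t0p t1p a by simp
    then have "exp (- ((1 - y) * ((t0 + t1) * a))) \<le> sinh_ratio y ((t0 + t1) * a)"
      using y by (intro sinh_ratio_ge_exp) auto
    then have "exp (- ((1 - y) * ((t0 + t1) * a))) powr ?n \<le> sinh_ratio y ((t0 + t1) * a) powr ?n"
      using n by (intro powr_mono2) auto
    moreover have "exp (- ((1 - y) * ((t0 + t1) * a))) powr ?n = exp (- (T * (1 - y)))"
      by (simp add: exp_powr_real T_def \<kappa> S algebra_simps)
    ultimately show ?thesis by (simp add: contr_def mult.left_commute a_def)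
  qed
  have b: "p / (ball_profile r t * contr ((t0 + t1) * r) y) \<le> Z * S * (p * exp (- (S * t)) / (S * t) * exp (T * (1 - y)))"
    if y: "0 < y" "y < 1" and p: "0 \<le> p" and t: "1 / 2 \<le> t * a" for p t y
  proof -
    have "1 / contr ((t0 + t1) * r) y \<le> 1 / exp (- (T * (1 - y)))"
      using cD[OF y] by (intro divide_left_mono mult_pos_pos) (auto intro: less_le_trans[OF exp_gt_zero])
    also have "\<dots> = exp (T * (1 - y))" by (simp add: exp_minus inverse_eq_divide)
    finally have ci: "1 / contr ((t0 + t1) * r) y \<le> exp (T * (1 - y))" .
    have cp: "0 < contr ((t0 + t1) * r) y" using y t0p t1p r by (intro contr_pos) auto
    have "p * (1 / ball_profile r t * (1 / contr ((t0 + t1) * r) y)) \<le> p * (Z * exp (- (S * t)) / t * exp (T * (1 - y)))"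
      using p ginv[OF t] ci cp tp[OF t] Z by (intro mult_left_mono mult_mono) auto
    also have "\<dots> = Z * S * (p * exp (- (S * t)) / (S * t) * exp (T * (1 - y)))" using S0 by simp
    finally show ?thesis by simp
  qed
  have "eE * fF \<le> r * (fF * (Z * I0) + eE * (Z * I1) + (t0 + t1) * (Z * S * (W / T))) * H"
  proof (rule level_bound[OF h hv v r t0p t0(1) t1p t1(1) _ _ _ _ E F,
        where ?\<Phi>0.0 = "\<lambda>t. Z * \<phi>0 t" and ?\<Phi>1.0 = "\<lambda>t. Z * \<phi>1 t" and C = "\<lambda>y. Z * S * U y"])
    fix s s' assume "t0 \<le> s" "s \<le> s'" "s' \<le> 1"
    then show "(s' - s) / ball_profile r s' \<le> Z * \<phi>0 s - Z * \<phi>0 s'"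
      using mono[OF t0(2), of s'] by (intro \<Phi> \<phi>0) auto
  next
    fix s s' assume "t1 \<le> s" "s \<le> s'" "s' \<le> 1"
    then show "(s' - s) / ball_profile r s' \<le> Z * \<phi>1 s - Z * \<phi>1 s'"
      using mono[OF t1(2), of s'] by (intro \<Phi> \<phi>1) auto
  next
    show "Z * \<phi>0 t0 - Z * \<phi>0 1 \<le> Z * I0" using I(1) Z by (simp add: right_diff_distrib[symmetric])
    show "Z * \<phi>1 t1 - Z * \<phi>1 1 \<le> Z * I1" using I(2) Z by (simp add: right_diff_distrib[symmetric])
    show "(\<lambda>y. Z * S * U y) \<in> borel_measurable borel" unfolding U_def by measurable
    show "(\<integral>\<^sup>+y\<in>{0<..<1}. ennreal (Z * S * U y) \<partial>lborel) \<le> ennreal (Z * S * (W / T))"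
    proof -
      have "(\<integral>\<^sup>+y\<in>{0<..<1}. ennreal (Z * S * U y) \<partial>lborel) = (\<integral>\<^sup>+y. ennreal (Z * S) * (ennreal (U y) * indicator {0<..<1} y) \<partial>lborel)"
        using Z S0 by (intro nn_integral_cong) (simp add: ennreal_mult' mult.assoc)
      also have "\<dots> = ennreal (Z * S) * (\<integral>\<^sup>+y\<in>{0<..<1}. ennreal (U y) \<partial>lborel)"
        unfolding U_def by (intro nn_integral_cmult) measurable
      also have "\<dots> \<le> ennreal (Z * S) * ennreal (W / T)" by (intro mult_left_mono intU) auto
      also have "\<dots> = ennreal (Z * S * (W / T))" using Z S0 W T by (simp add: ennreal_mult[symmetric])
      finally show ?thesis .
    qed
    show "0 \<le> Z * S * (W / T)" using Z S0 W T by simp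
  next
    fix y :: real assume y: "0 < y" "y < 1"
    have "fF / (ball_profile r t0 * contr ((t0 + t1) * r) (1 - y)) \<le> Z * S * (fF * exp (- (S * t0)) / (S * t0) * exp (T * (1 - (1 - y))))"
      using y F(3) t0(2) by (intro b) auto
    also have "\<dots> \<le> Z * S * U y"
      using U0[OF y] Z S0 by (intro mult_left_mono) (auto simp: U_def T_def \<kappa>)
    finally show "fF / (ball_profile r t0 * contr ((t0 + t1) * r) (1 - y)) \<le> Z * S * U y" .
    have "eE / (ball_profile r t1 * contr ((t0 + t1) * r) y) \<le> Z * S * (eE * exp (- (S * t1)) / (S * t1) * exp (T * (1 - y)))"
      using y E(3) t1(2) by (intro b) auto
    also have "eE * exp (- (S * t1)) / (S * t1) * exp (T * (1 - y)) = eE * exp \<kappa>0 / \<kappa>1 * exp (- (\<kappa>0 + \<kappa>1) * y)"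
    proof -
      have "exp (- (S * t1)) * exp (T * (1 - y)) = exp \<kappa>0 * exp (- (\<kappa>0 + \<kappa>1) * y)"
        by (simp add: exp_add[symmetric] T_def \<kappa> algebra_simps)
      then have "eE * (exp (- (S * t1)) * exp (T * (1 - y))) / \<kappa>1 = eE * (exp \<kappa>0 * exp (- (\<kappa>0 + \<kappa>1) * y)) / \<kappa>1" by (simp only:)
      then show ?thesis by (simp only: \<kappa>(2)[symmetric] mult.assoc times_divide_eq_left)
    qed
    also have "Z * S * (eE * exp \<kappa>0 / \<kappa>1 * exp (- (\<kappa>0 + \<kappa>1) * y)) \<le> Z * S * U y"
      using U1[OF y] Z S0 by (intro mult_left_mono) (auto simp: U_def T_def)
    finally show "eE / (ball_profile r t1 * contr ((t0 + t1) * r) y) \<le> Z * S * U y" .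
  qed
  also have "(t0 + t1) * (Z * S * (W / T)) = Z * W" using S0 T by (simp add: ST)
  also have "r * (fF * (Z * I0) + eE * (Z * I1) + Z * W) * H = r * (Z * (fF * I0 + eE * I1 + W)) * H"
    by (simp add: algebra_simps)
  also have "\<dots> \<le> r * (2 * (eE + fF) * spread r) * H"
  proof (intro mult_right_mono mult_left_mono)
    have "Z * (fF * I0 + eE * I1 + W) \<le> Z * (2 * (eE + fF))" using le Z by (intro mult_left_mono) (auto simp: W_def T_def)
    also have "\<dots> \<le> spread r * (2 * (eE + fF))" unfolding Z_def using spread_ge_a E(3) F(3) by (intro mult_right_mono) auto
    finally show "Z * (fF * I0 + eE * I1 + W) \<le> 2 * (eE + fF) * spread r" by (simp only: mult.commute)
  qed (use r h in auto)
  finally show ?thesis .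
qed

end

section \<open>The case of small dimension and large radius\<close>

definition log_primitive :: "real \<Rightarrow> real" where
  "log_primitive u = exp (- u) * ln (1 + 1 / u)"

lemma log_primitive_nonneg: "0 < u \<Longrightarrow> 0 \<le> log_primitive u"
  by (simp add: log_primitive_def)

lemma log_primitive_scaled:
  assumes "0 < S" "0 < s" "s \<le> s'"
  shows "(s' - s) * exp (- (S * s')) / s' \<le> log_primitive (S * s) - log_primitive (S * s')"
proof -
  have "(S * s' - S * s) * exp (- (S * s')) / (S * s') = (s' - s) * exp (- (S * s')) / s'"
  proof -
    have "S * s' - S * s = S * (s' - s)" by (simp add: right_diff_distrib)
    then show ?thesis using assms by simp
  qed
  then show ?thesis using exp_log_primitive[of "S * s" "S * s'"] assms by (simp add: log_primitive_def)
qed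

lemma log_primitive_bounds: "log_primitive (4/5) \<le> 37/100" "log_primitive (8/15) \<le> 1"
proof -
  have "ln (9/4) = 2 * ln (3/2::real)"
    using ln_realpow[of "3/2" 2] by (simp add: power2_eq_square)
  then have "ln (9/4) \<le> (82/100::real)" using exp_numeric_bounds(5) by simp
  then have "exp (- (4/5)) * ln (9/4) \<le> 45/100 * (82/100::real)"
    using exp_numeric_bounds(4) by (intro mult_mono) auto
  then show "log_primitive (4/5) \<le> 37/100" by (simp add: log_primitive_def)
  have "23/8 \<le> exp (3/2::real)" using exp_ge_taylor[of "3/2" 3] by (simp add: eval_nat_numeral)
  then have "ln (23/8) \<le> ln (exp (3/2::real))" by (intro ln_mono) auto
  then have l: "ln (23/8) \<le> (3/2::real)" by simp
  have "23/15 \<le> exp (8/15::real)" using exp_ge_add_one_self[of "8/15::real"] by simp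
  then have "inverse (exp (8/15::real)) \<le> inverse (23/15)" by (rule le_imp_inverse_le) simp
  then have "exp (- (8/15)) \<le> (15/23::real)" by (simp add: exp_minus)
  then have "exp (- (8/15)) * ln (23/8) \<le> 15/23 * (3/2::real)" using l by (intro mult_mono) auto
  then show "log_primitive (8/15) \<le> 1" by (simp add: log_primitive_def)
qed

context separated_sets begin

lemma e0: "0 < eE" and f0: "0 < fF" and ef: "eE \<le> fF" using E(3) F(3) EF by auto

lemma large_scale_premises:
  assumes n: "0 < N - 1" "N - 1 < 1" and a: "1 < a" and S: "S = (N - 1) * a" "4/5 \<le> S" and k: "1/2 \<le> k" "k \<le> 4/5"
  shows "0 < S" "0 < k / S" "k / S \<le> 1" "1/2 \<le> k / S * a" "k = S * (k / S)"
proof -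
  show S0: "0 < S" using S by linarith
  show "0 < k / S" "k / S \<le> 1" "k = S * (k / S)" using S0 S k by auto
  have "k / S * a = k / (N - 1)" using a n by (simp add: S)
  moreover have "k \<le> k / (N - 1)" using n k by (simp add: le_divide_eq mult_left_le)
  ultimately show "1/2 \<le> k / S * a" using k by linarith
qed

text \<open>Both sets are contracted to \<open>S t = 4/5\<close>. The geometric mean of the two measures is used through the factor \<open>0.47\<close>, available since the measures differ
  at most by a factor of two.\<close>

lemma separation_balanced:
  assumes n: "0 < N - 1" "N - 1 < 1" and a: "1 < a" and S: "S = (N - 1) * a" "4/5 \<le> S" and bal: "fF \<le> 2 * eE"
  shows "eE * fF \<le> r * (2 * (eE + fF) * spread r) * H"
proof -
  let ?t = "4/5 / S"
  have k: "1/2 \<le> (4/5::real)" "4/5 \<le> (4/5::real)" by simp_all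
  note p = large_scale_premises[OF n a S k]
  let ?\<alpha> = "fF * exp (- (4/5)) / (4/5)" and ?\<beta> = "eE * exp (4/5) / (4/5)"
  have ab: "0 < ?\<alpha>" "0 < ?\<beta>" using e0 f0 by simp_all
  have sq: "47/100 * (eE + fF) \<le> sqrt (eE * fF)"
  proof (rule real_le_rsqrt)
    have "0 \<le> (2 * eE - fF) * (2 * fF - eE)" using bal ef e0 by (intro mult_nonneg_nonneg) auto
    then have nine: "2 * (eE + fF)\<^sup>2 \<le> 9 * (eE * fF)" by (simp add: power2_eq_square algebra_simps)
    have "(47/100 * s)\<^sup>2 = 2209/10000 * s\<^sup>2" for s :: real by (simp add: power2_eq_square)
    note this[of "eE + fF"]
    moreover have "0 \<le> (eE + fF)\<^sup>2" by simp
    ultimately show "(47/100 * (eE + fF))\<^sup>2 \<le> eE * fF" using nine by linarith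
  qed
  have A: "?\<alpha> * exp (4/5 + 4/5) = 5/4 * (fF * exp (4/5))"
  proof -
    have "exp (- (4/5)) * exp (4/5 + 4/5) = exp (4/5::real)" by (simp add: exp_add[symmetric])
    then have "fF * (exp (- (4/5)) * exp (4/5 + 4/5)) / (4/5) = fF * exp (4/5) / (4/5)" by (simp only:)
    then show ?thesis by ((simp only: mult.assoc times_divide_eq_left)?, simp?)
  qed
  have R: "sqrt (?\<alpha> * ?\<beta>) = 5/4 * sqrt (eE * fF)"
  proof -
    have "exp (- (4/5)) * exp (4/5) = (1::real)" by (simp add: exp_minus)
    then have "?\<alpha> * ?\<beta> = (5/4)\<^sup>2 * (eE * fF)" by (simp add: power2_eq_square field_simps)
    then show ?thesis by ((simp only: real_sqrt_mult real_sqrt_abs)?, simp?)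
  qed
  have x: "exp (4/5) \<le> (2226/1000::real)" by (rule exp_numeric_bounds)
  show ?thesis
  proof (rule separation_exponential[OF a n(1) S(1), where ?t0.0 = ?t and ?t1.0 = ?t and ?\<kappa>0.0 = "4/5" and ?\<kappa>1.0 = "4/5"
        and ?\<phi>0.0 = "\<lambda>t. log_primitive (S * t)" and ?\<phi>1.0 = "\<lambda>t. log_primitive (S * t)"
        and ?I0.0 = "37/100" and ?I1.0 = "37/100" and \<gamma> = 0 and \<delta> = 0 and \<alpha> = ?\<alpha> and \<beta> = ?\<beta>])
    fix s s' assume s: "?t \<le> s" "s \<le> s'" "s' \<le> 1"
    show "(s' - s) * exp (- (S * s')) / s' \<le> log_primitive (S * s) - log_primitive (S * s')"
      by (rule log_primitive_scaled[OF p(1) less_le_trans[OF p(2) s(1)] s(2)])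
    then show "(s' - s) * exp (- (S * s')) / s' \<le> log_primitive (S * s) - log_primitive (S * s')" .
  next
    have "0 \<le> log_primitive (S * 1)" using p by (intro log_primitive_nonneg) simp
    then show i: "log_primitive (S * ?t) - log_primitive (S * 1) \<le> 37/100"
      using log_primitive_bounds(1) p(1) by simp
    then show "log_primitive (S * ?t) - log_primitive (S * 1) \<le> 37/100" .
  next
    have x1: "fF * exp (4/5) \<le> fF * (2226/1000)" "eE * exp (4/5) \<le> eE * (2226/1000)" using x e0 f0 by (auto intro!: mult_left_mono)
    have b1: "?\<beta> = 5/4 * (eE * exp (4/5))" by simp
    have gen: "d * (37/100) + c * (37/100) + (0 + 0 + (5/4 * X + B - 2 * (5/4 * R))) \<le> 2 * (c + d)"
      if "X \<le> d * (2226/1000)" "Y \<le> c * (2226/1000)" "B = 5/4 * Y" "47/100 * (c + d) \<le> R" "0 < c" "0 < d"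
      for X Y B R c d :: real
      using that unfolding distrib_left by linarith
    show "fF * (37/100) + eE * (37/100) + (0 * (exp (4/5 + 4/5) - 1) + 0 * (1 - exp (- (4/5 + 4/5)))
        + (?\<alpha> * exp (4/5 + 4/5) + ?\<beta> - 2 * sqrt (?\<alpha> * ?\<beta>))) \<le> 2 * (eE + fF)"
      unfolding A R by (simp only: mult_zero_left) (rule gen[OF x1 b1 sq e0 f0])
  qed (use p ab in auto)
qed

text \<open>The larger set is contracted further, to \<open>S t = 8/15\<close>. The maximum of the two densities is convex in the weights, so it is
  estimated by interpolation between the case of a vanishing \<open>E\<close>, where the first density alone counts, and the ratio two.\<close>

lemma separation_unbalanced:
  assumes n: "0 < N - 1" "N - 1 < 1" and a: "1 < a" and S: "S = (N - 1) * a" "4/5 \<le> S" and bal: "2 * eE \<le> fF"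
  shows "eE * fF \<le> r * (2 * (eE + fF) * spread r) * H"
proof -
  let ?t = "4/5 / S" and ?t' = "8/15 / S"
  have k: "1/2 \<le> (4/5::real)" "4/5 \<le> (4/5::real)" "1/2 \<le> (8/15::real)" "8/15 \<le> (4/5::real)" by simp_all
  note p = large_scale_premises[OF n a S k(1,2)] and p' = large_scale_premises[OF n a S k(3,4)]
  let ?\<gamma> = "(fF - 2 * eE) * exp (- (4/5)) / (4/5)"
  let ?\<alpha> = "2 * eE * exp (- (4/5)) / (4/5)" and ?\<beta> = "eE * exp (4/5) / (8/15)"
  have ab: "0 < ?\<alpha>" "0 < ?\<beta>" and g0: "0 \<le> ?\<gamma>" using e0 f0 bal by simp_all
  have ex: "exp (- (4/5)) * exp (4/5 + 8/15) = exp (8/15::real)" by (simp add: exp_add[symmetric])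
  have G: "?\<gamma> * (exp (4/5 + 8/15) - 1) = 5/4 * ((fF - 2 * eE) * (exp (8/15) - exp (- (4/5))))"
  proof -
    have "c * q / (4/5) * (w - 1) = 5/4 * (c * (q * w - q))" for c q w :: real by (simp add: algebra_simps)
    from this[of "fF - 2 * eE" "exp (- (4/5))" "exp (4/5 + 8/15)"] show ?thesis unfolding ex .
  qed
  have A: "?\<alpha> * exp (4/5 + 8/15) = 5/2 * (eE * exp (8/15))"
  proof -
    have "?\<alpha> * exp (4/5 + 8/15) = 5/2 * (eE * (exp (- (4/5)) * exp (4/5 + 8/15)))" by simp
    then show ?thesis unfolding ex .
  qed
  have R: "216/100 * eE \<le> sqrt (?\<alpha> * ?\<beta>)"
  proof (rule real_le_rsqrt)
    have "exp (- (4/5)) * exp (4/5) = (1::real)" by (simp add: exp_minus)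
    then have ab2: "?\<alpha> * ?\<beta> = 75/16 * (eE * eE)" by (simp add: field_simps)
    have "(216/100 * eE)\<^sup>2 = 46656/10000 * (eE * eE)" by (simp add: power2_eq_square)
    moreover have "0 \<le> eE * eE" by simp
    ultimately show "(216/100 * eE)\<^sup>2 \<le> ?\<alpha> * ?\<beta>" unfolding ab2 by linarith
  qed
  note num = exp_numeric_bounds
  show ?thesis
  proof (rule separation_exponential[OF a n(1) S(1), where ?t0.0 = ?t and ?t1.0 = ?t' and ?\<kappa>0.0 = "4/5" and ?\<kappa>1.0 = "8/15"
        and ?\<phi>0.0 = "\<lambda>t. log_primitive (S * t)" and ?\<phi>1.0 = "\<lambda>t. log_primitive (S * t)"
        and ?I0.0 = "37/100" and ?I1.0 = 1 and \<gamma> = ?\<gamma> and \<delta> = 0 and \<alpha> = ?\<alpha> and \<beta> = ?\<beta>])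
    fix s s' assume s: "?t \<le> s" "s \<le> s'" "s' \<le> 1"
    show "(s' - s) * exp (- (S * s')) / s' \<le> log_primitive (S * s) - log_primitive (S * s')"
      by (rule log_primitive_scaled[OF p(1) less_le_trans[OF p(2) s(1)] s(2)])
  next
    fix s s' assume s: "?t' \<le> s" "s \<le> s'" "s' \<le> 1"
    show "(s' - s) * exp (- (S * s')) / s' \<le> log_primitive (S * s) - log_primitive (S * s')"
      by (rule log_primitive_scaled[OF p'(1) less_le_trans[OF p'(2) s(1)] s(2)])
  next
    have i: "0 \<le> log_primitive (S * 1)" using p by (intro log_primitive_nonneg) simp
    then show "log_primitive (S * ?t) - log_primitive (S * 1) \<le> 37/100"
      using log_primitive_bounds(1) p(1) by simp
    show "log_primitive (S * ?t') - log_primitive (S * 1) \<le> 1"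
      using i log_primitive_bounds(2) p(1) by simp
  next
    fix y :: real
    have "fF * exp (- (4/5)) / (4/5) * exp ((4/5 + 8/15) * y) = ?\<gamma> * exp ((4/5 + 8/15) * y) + ?\<alpha> * exp ((4/5 + 8/15) * y)"
      by (simp add: field_simps)
    also have "\<dots> \<le> ?\<gamma> * exp ((4/5 + 8/15) * y) + 0 * exp (- (4/5 + 8/15) * y) + max (?\<alpha> * exp ((4/5 + 8/15) * y)) (?\<beta> * exp (- (4/5 + 8/15) * y))"
      by (simp only: mult_zero_left add_0_right add_left_mono max.cobounded1)
    finally show "fF * exp (- (4/5)) / (4/5) * exp ((4/5 + 8/15) * y) \<le> ?\<gamma> * exp ((4/5 + 8/15) * y) + 0 * exp (- (4/5 + 8/15) * y) + max (?\<alpha> * exp ((4/5 + 8/15) * y)) (?\<beta> * exp (- (4/5 + 8/15) * y))" .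
    have "0 \<le> ?\<gamma> * exp ((4/5 + 8/15) * y)" by (intro mult_nonneg_nonneg g0) simp
    then show "eE * exp (4/5) / (8/15) * exp (- (4/5 + 8/15) * y) \<le> ?\<gamma> * exp ((4/5 + 8/15) * y) + 0 * exp (- (4/5 + 8/15) * y) + max (?\<alpha> * exp ((4/5 + 8/15) * y)) (?\<beta> * exp (- (4/5 + 8/15) * y))"
      by (intro add_increasing max.cobounded2) auto
  next
    have g1: "(fF - 2 * eE) * (exp (8/15) - exp (- (4/5))) \<le> (fF - 2 * eE) * (1256/1000)"
      using num(2,3) bal by (intro mult_left_mono) linarith+
    have x1: "eE * exp (8/15) \<le> eE * (1705/1000)" "eE * exp (4/5) \<le> eE * (2226/1000)"
      using num(1,2) e0 by (auto intro!: mult_left_mono)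
    have b1: "?\<beta> = 15/8 * (eE * exp (4/5))" by simp
    have gen: "d * (37/100) + c * 1 + (5/4 * P + 0 + (5/2 * X + B - 2 * R)) \<le> 2 * (c + d)"
      if "P \<le> (d - 2 * c) * (1256/1000)" "X \<le> c * (1705/1000)" "Y \<le> c * (2226/1000)" "B = 15/8 * Y" "216/100 * c \<le> R" "2 * c \<le> d" "0 < c"
      for P X Y B R c d :: real
      using that unfolding distrib_left left_diff_distrib by linarith
    show "fF * (37/100) + eE * 1 + (?\<gamma> * (exp (4/5 + 8/15) - 1) + 0 * (1 - exp (- (4/5 + 8/15)))
        + (?\<alpha> * exp (4/5 + 8/15) + ?\<beta> - 2 * sqrt (?\<alpha> * ?\<beta>))) \<le> 2 * (eE + fF)"
      unfolding G A by (simp only: mult_zero_left) (rule gen[OF g1 x1 b1 R bal e0])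
  qed (use p p' ab g0 in auto)
qed

text \<open>Transport without contraction, again by interpolation: the part of \<open>F\<close> in excess of \<open>E\<close> contributes only one exponential.\<close>

lemma separation_moderate_balanced:
  assumes n: "0 < N - 1" and a: "1 < a" and S: "S = (N - 1) * a" "S \<le> 4/5" and bal: "fF \<le> 26/5 * eE"
  shows "eE * fF \<le> r * (2 * (eE + fF) * spread r) * H"
proof -
  have S0: "0 < S" unfolding S by (rule mult_pos_pos[OF n]) (use a in linarith)
  let ?\<gamma> = "(fF - eE) * exp (- S) / S" and ?\<alpha> = "eE * exp (- S) / S" and ?\<beta> = "eE * exp S / S"
  have ab: "0 < ?\<alpha>" "0 < ?\<beta>" and g0: "0 \<le> ?\<gamma>" using e0 ef S0 by simp_all
  have ex: "exp (- S) * exp (S + S) = exp S" by (simp add: exp_add[symmetric])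
  have G: "?\<gamma> * (exp (S + S) - 1) = (fF - eE) * ((exp S - exp (- S)) / S)"
  proof -
    have "?\<gamma> * (exp (S + S) - 1) = (fF - eE) * ((exp (- S) * exp (S + S) - exp (- S)) / S)" by (simp add: algebra_simps)
    then show ?thesis unfolding ex .
  qed
  have A: "?\<alpha> * exp (S + S) = eE * (exp S / S)"
  proof -
    have "?\<alpha> * exp (S + S) = eE * (exp (- S) * exp (S + S) / S)" by simp
    then show ?thesis unfolding ex .
  qed
  have R: "sqrt (?\<alpha> * ?\<beta>) = eE / S"
  proof -
    have "exp (- S) * exp S = 1" by (simp add: exp_minus)
    then have "?\<alpha> * ?\<beta> = (eE / S)\<^sup>2" by (simp add: power2_eq_square field_simps)
    then show ?thesis using e0 S0 by (simp only: real_sqrt_abs) simp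
  qed
  note num = exp_numeric_bounds
  have q: "(exp S - 1) / S \<le> 15325/10000"
  proof -
    have "exp S - 1 \<le> S * ((exp (4/5) - 1) / (4/5))" using exp_chord[of S "4/5"] S0 S by simp
    also have "\<dots> \<le> S * (15325/10000)" using num(1) S0 by (intro mult_left_mono) auto
    finally show ?thesis using S0 by (simp add: pos_divide_le_eq mult.commute)
  qed
  have p: "(exp S - exp (- S)) / S \<le> 222125/100000"
  proof -
    have "sinh (S / (4/5) * (4/5)) \<le> S / (4/5) * sinh (4/5)" using S0 S by (intro sinh_scaled_le) auto
    then have *: "sinh S \<le> S / (4/5) * sinh (4/5)" using S0 by simp
    have "p \<le> S * (5/4 * q)" if "p / 2 \<le> S / (4/5) * (q / 2)" for p q using that by simp
    from this[OF *[unfolded sinh_field_def]] have "exp S - exp (- S) \<le> S * (5/4 * (exp (4/5) - exp (- (4/5))))" .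
    also have "\<dots> \<le> S * (222125/100000)" using num(1,3) S0 by (intro mult_left_mono) auto
    finally show ?thesis using S0 by (simp add: pos_divide_le_eq mult.commute)
  qed
  show ?thesis
  proof (rule separation_exponential[OF a n S(1), where ?t0.0 = 1 and ?t1.0 = 1 and ?\<kappa>0.0 = S and ?\<kappa>1.0 = S
        and ?\<phi>0.0 = "\<lambda>t. 0" and ?\<phi>1.0 = "\<lambda>t. 0"
        and ?I0.0 = 0 and ?I1.0 = 0 and \<gamma> = ?\<gamma> and \<delta> = 0 and \<alpha> = ?\<alpha> and \<beta> = ?\<beta>])
    fix s s' :: real assume "1 \<le> s" "s \<le> s'" "s' \<le> 1"
    then have "s' - s = 0" by linarith
    then show z: "(s' - s) * exp (- (S * s')) / s' \<le> 0 - 0" by simp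
    then show "(s' - s) * exp (- (S * s')) / s' \<le> 0 - 0" .
  next
    fix y :: real
    have "fF * exp (- S) / S * exp ((S + S) * y) = ?\<gamma> * exp ((S + S) * y) + ?\<alpha> * exp ((S + S) * y)"
      using S0 by (simp add: field_simps)
    also have "\<dots> \<le> ?\<gamma> * exp ((S + S) * y) + 0 * exp (- (S + S) * y) + max (?\<alpha> * exp ((S + S) * y)) (?\<beta> * exp (- (S + S) * y))"
      by (simp only: mult_zero_left add_0_right add_left_mono max.cobounded1)
    finally show "fF * exp (- S) / S * exp ((S + S) * y) \<le> ?\<gamma> * exp ((S + S) * y) + 0 * exp (- (S + S) * y) + max (?\<alpha> * exp ((S + S) * y)) (?\<beta> * exp (- (S + S) * y))" .
    have "0 \<le> ?\<gamma> * exp ((S + S) * y)" by (intro mult_nonneg_nonneg g0) simp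
    then show "eE * exp S / S * exp (- (S + S) * y) \<le> ?\<gamma> * exp ((S + S) * y) + 0 * exp (- (S + S) * y) + max (?\<alpha> * exp ((S + S) * y)) (?\<beta> * exp (- (S + S) * y))"
      by (intro add_increasing max.cobounded2) auto
  next
    have p1: "(fF - eE) * ((exp S - exp (- S)) / S) \<le> (fF - eE) * (222125/100000)" using p ef by (intro mult_left_mono) auto
    have q1: "2 * (eE * ((exp S - 1) / S)) \<le> 2 * (eE * (15325/10000))" using q e0 by (intro mult_left_mono) auto
    have gen: "0 + 0 + (P + 0 + Q) \<le> 2 * (c + d)"
      if "P \<le> (d - c) * (222125/100000)" "Q \<le> 2 * (c * (15325/10000))" "d \<le> 26/5 * c" "0 < c" for P Q c d :: real
      using that unfolding distrib_left left_diff_distrib by linarith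
    have "eE * (exp S / S) + ?\<beta> - 2 * (eE / S) = 2 * (eE * ((exp S - 1) / S))"
      by (simp add: diff_divide_distrib right_diff_distrib)
    then show "fF * 0 + eE * 0 + (?\<gamma> * (exp (S + S) - 1) + 0 * (1 - exp (- (S + S)))
        + (?\<alpha> * exp (S + S) + ?\<beta> - 2 * sqrt (?\<alpha> * ?\<beta>))) \<le> 2 * (eE + fF)"
      unfolding G A R by (simp only: mult_zero_left mult_zero_right) (rule gen[OF p1 q1 bal e0])
  qed (use a ab g0 in auto)
qed

text \<open>Only the larger set is contracted, to \<open>t = 2/3\<close>. The maximum of the two densities may be replaced by their sum because \<open>E\<close> is small.\<close>

lemma separation_moderate_unbalanced:
  assumes n: "0 < N - 1" and a: "1 < a" and S: "S = (N - 1) * a" "S \<le> 4/5" and bal: "26/5 * eE \<le> fF"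
  shows "eE * fF \<le> r * (2 * (eE + fF) * spread r) * H"
proof -
  have S0: "0 < S" unfolding S by (rule mult_pos_pos[OF n]) (use a in linarith)
  define y1 where "y1 = S * (2/3)"
  have y1: "0 < y1" "y1 \<le> 8/15" using S0 S by (auto simp: y1_def)
  let ?\<gamma> = "fF * exp (- S) / S" and ?\<delta> = "eE * exp S / y1"
  have g0: "0 \<le> ?\<gamma>" "0 \<le> ?\<delta>" using e0 f0 S0 y1 by simp_all
  have G: "?\<gamma> * (exp (S + y1) - 1) = fF * ((exp y1 - exp (- S)) / S)"
  proof -
    have "?\<gamma> * (exp (S + y1) - 1) = fF * ((exp (- S) * exp (S + y1) - exp (- S)) / S)" by (simp add: algebra_simps)
    moreover have "exp (- S) * exp (S + y1) = exp y1" by (simp add: exp_add[symmetric])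
    ultimately show ?thesis by (simp only:)
  qed
  have D: "?\<delta> * (1 - exp (- (S + y1))) = 3/2 * (eE * ((exp S - exp (- y1)) / S))"
  proof -
    have "c * p / z * (1 - q) = c * ((p - p * q) / z)" for c p q z :: real by (simp add: algebra_simps diff_divide_distrib)
    moreover have "exp S * exp (- (S + y1)) = exp (- y1)" by (simp add: exp_add[symmetric])
    ultimately have "?\<delta> * (1 - exp (- (S + y1))) = eE * ((exp S - exp (- y1)) / y1)" by (simp only:)
    also have "\<dots> = 3/2 * (eE * ((exp S - exp (- y1)) / S))"
    proof -
      have "c * (p / y1) = 3/2 * (c * (p / S))" for c p by (simp add: y1_def)
      then show ?thesis .
    qed
    finally show ?thesis .
  qed
  note num = exp_numeric_bounds
  have q: "(exp S - exp (- y1)) / S \<le> 22/10"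
  proof -
    have "exp S \<le> 1 + S * ((exp (4/5) - 1) / (4/5))" using exp_chord[of S "4/5"] S0 S by simp
    moreover have "S * ((exp (4/5) - 1) / (4/5)) \<le> S * (15325/10000)" using num(1) S0 by (intro mult_left_mono) auto
    moreover have "1 - y1 \<le> exp (- y1)" using exp_ge_add_one_self[of "- y1"] by simp
    ultimately have "exp S - exp (- y1) \<le> 22/10 * S" using S0 unfolding y1_def by linarith
    then show ?thesis using S0 by (simp add: pos_divide_le_eq)
  qed
  have p: "(exp y1 - exp (- S)) / S \<le> 5/3"
  proof -
    have 1: "exp y1 \<le> 1 + y1 + y1\<^sup>2 / 2 + y1 ^ 3 / 2"
      using exp_le_taylor[of y1 3] y1 by (simp add: eval_nat_numeral)
    obtain t where "exp (- S) = (\<Sum>i<4. (- S) ^ i / fact i) + exp t / fact 4 * (- S) ^ 4"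
      using Maclaurin_exp_le[of "- S" 4] by blast
    moreover have "0 \<le> exp t / fact 4 * (- S) ^ 4" by simp
    moreover have "(\<Sum>i<4. (- S) ^ i / fact i) = 1 - S + S\<^sup>2 / 2 - S ^ 3 / 6" by (simp add: eval_nat_numeral)
    ultimately have 2: "1 - S + S\<^sup>2 / 2 - S ^ 3 / 6 \<le> exp (- S)" by linarith
    have "S * S\<^sup>2 \<le> 4/5 * S\<^sup>2" by (intro mult_right_mono S(2)) simp
    then have "S ^ 3 \<le> 4/5 * S\<^sup>2" by (simp only: power3_eq_cube power2_eq_square mult.assoc)
    moreover have "y1\<^sup>2 = 4/9 * S\<^sup>2" "y1 ^ 3 = 8/27 * S ^ 3" by (simp_all add: y1_def power_mult_distrib eval_nat_numeral)
    moreover have "0 \<le> S\<^sup>2" by simp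
    moreover have "y1 = 2/3 * S" by (simp add: y1_def)
    ultimately have "exp y1 - exp (- S) \<le> 5/3 * S" using 1 2 by linarith
    then show ?thesis using S0 by (simp add: pos_divide_le_eq)
  qed
  show ?thesis
  proof (rule separation_exponential[OF a n S(1), where ?t0.0 = 1 and ?t1.0 = "2/3" and ?\<kappa>0.0 = S and ?\<kappa>1.0 = y1
        and ?\<phi>0.0 = "\<lambda>t. 0" and ?\<phi>1.0 = "\<lambda>t. - ln t"
        and ?I0.0 = 0 and ?I1.0 = "41/100" and \<gamma> = ?\<gamma> and \<delta> = ?\<delta> and \<alpha> = 0 and \<beta> = 0])
    fix s s' :: real assume "1 \<le> s" "s \<le> s'" "s' \<le> 1"
    then have "s' - s = 0" by linarith
    then show z: "(s' - s) * exp (- (S * s')) / s' \<le> 0 - 0" by simp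
  next
    fix s s' :: real assume s: "2/3 \<le> s" "s \<le> s'" "s' \<le> 1"
    have "(s' - s) * exp (- (S * s')) / s' \<le> (s' - s) * 1 / s'" using s S0 by (intro divide_right_mono mult_left_mono) auto
    also have "\<dots> = 1 - s / s'" using s by (simp add: diff_divide_distrib)
    also have "\<dots> \<le> - ln (s / s')" using ln_le_minus_one[of "s / s'"] s by simp
    also have "\<dots> = - ln s - - ln s'" using s by (simp add: ln_div)
    finally show "(s' - s) * exp (- (S * s')) / s' \<le> - ln s - - ln s'" .
  next
    have "- ln (2/3::real) = ln (3/2)" using ln_inverse[of "2/3::real"] by simp
    then show "- ln (2/3) - - ln 1 \<le> (41/100::real)" using num(5) by simp
  next
    have p1: "fF * ((exp y1 - exp (- S)) / S) \<le> fF * (5/3)" using p f0 by (intro mult_left_mono) auto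
    have q1: "eE * ((exp S - exp (- y1)) / S) \<le> eE * (22/10)" using q e0 by (intro mult_left_mono) auto
    have gen: "0 + c * (41/100) + (P + 3/2 * Q + (0 + 0 - 0)) \<le> 2 * (c + d)"
      if "P \<le> d * (5/3)" "Q \<le> c * (22/10)" "26/5 * c \<le> d" "0 < c" for P Q c d :: real
      using that unfolding distrib_left left_diff_distrib by linarith
    show "fF * 0 + eE * (41/100) + (?\<gamma> * (exp (S + y1) - 1) + ?\<delta> * (1 - exp (- (S + y1)))
        + (0 * exp (S + y1) + 0 - 2 * sqrt (0 * 0))) \<le> 2 * (eE + fF)"
      unfolding G D by (simp only: mult_zero_left mult_zero_right real_sqrt_zero) (rule gen[OF p1 q1 bal e0])
  next
    fix y :: real
    have "0 \<le> ?\<delta> * exp (- (S + y1) * y)" "0 \<le> ?\<gamma> * exp ((S + y1) * y)" by (intro mult_nonneg_nonneg g0; simp)+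
    then show "fF * exp (- S) / S * exp ((S + y1) * y) \<le> ?\<gamma> * exp ((S + y1) * y) + ?\<delta> * exp (- (S + y1) * y) + max (0 * exp ((S + y1) * y)) (0 * exp (- (S + y1) * y))"
      "eE * exp S / y1 * exp (- (S + y1) * y) \<le> ?\<gamma> * exp ((S + y1) * y) + ?\<delta> * exp (- (S + y1) * y) + max (0 * exp ((S + y1) * y)) (0 * exp (- (S + y1) * y))"
      by (simp_all only: mult_zero_left max.idem add_0_right)
  qed (use a g0 in \<open>auto simp: y1_def\<close>)
qed

lemma separation: "eE * fF \<le> r * (2 * (eE + fF) * spread r) * H"
proof (cases "a \<le> 1")
  case True
  then show ?thesis by (rule separation_small_radius)
next
  case False
  then have a: "1 < a" by simp
  have "N \<noteq> 1"
  proof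
    assume "N = 1"
    then have "curv = 0" unfolding curv_def by simp
    then have "a = 0" unfolding a_def by simp
    then show False using a by simp
  qed
  then have n: "0 < N - 1" using N by simp
  show ?thesis
  proof (cases "1 \<le> N - 1")
    case True
    then show ?thesis by (rule separation_large_dimension[OF a])
  next
    case False
    then have n1: "N - 1 < 1" by simp
    show ?thesis
    proof (cases "4/5 \<le> (N - 1) * a")
      case True
      show ?thesis
        using separation_balanced[OF n n1 a refl True] separation_unbalanced[OF n n1 a refl True] by linarith
    next
      case False
      then have "(N - 1) * a \<le> 4/5" by simp
      then show ?thesis
        using separation_moderate_balanced[OF n a refl] separation_moderate_unbalanced[OF n a refl] by linarith
    qed
  qed
qed

end

text \<open>By symmetry the smaller set may be called \<open>E\<close>.\<close>

lemma (in cd_space) level_sets_separated: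
  fixes x :: 'a
  assumes h: "h \<in> borel_measurable borel" "(\<integral>\<^sup>+y\<in>ball x (2 * r). h y \<partial>m) = ennreal H" "0 \<le> H" and hv: "geo_gradient h v"
    and v: "continuous_on UNIV v" "\<And>y. 0 \<le> v y" "\<And>y. v y \<le> 1" and r: "0 < r"
    and E: "E \<in> sets borel" "E \<subseteq> ball x r" "0 < measure m E" "\<And>y. y \<in> E \<Longrightarrow> v y = 1"
    and F: "F \<in> sets borel" "F \<subseteq> ball x r" "0 < measure m F" "\<And>y. y \<in> F \<Longrightarrow> v y = 0"
  shows "measure m E * measure m F \<le> r * (2 * (measure m E + measure m F) * spread r) * H"
proof (cases "measure m E \<le> measure m F")
  case True
  interpret separated_sets m K N x r H h v E F by unfold_locales (use assms True in auto)
  show ?thesis by (rule separation)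
next
  case False
  have hv': "geo_gradient h (\<lambda>y. 1 - v y)" using hv by (simp add: geo_gradient_def abs_minus_commute)
  have cv': "continuous_on UNIV (\<lambda>y. 1 - v y)" by (intro continuous_intros v(1))
  interpret separated_sets m K N x r H h "\<lambda>y. 1 - v y" F E
    by unfold_locales (use assms False hv' cv' in auto)
  show ?thesis using separation by (simp add: ac_simps)
qed

section \<open>From level sets to the Poincare inequality\<close>

context cd_space begin

lemma level_set_product:
  fixes x :: 'a and u :: "'a \<Rightarrow> real"
  assumes u: "continuous_on UNIV u" and g: "upper_gradient g u" and r: "0 < r" and e: "0 < e"
    and fin: "(\<integral>\<^sup>+y\<in>ball x (2 * r). g y \<partial>m) < \<infinity>"
  shows "emeasure m {y\<in>ball x r. l + e \<le> u y} * emeasure m {y\<in>ball x r. u y \<le> l}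
    \<le> ennreal (2 * r * measure m (ball x r) * spread r)
      * (\<integral>\<^sup>+y\<in>ball x (2 * r). g y * ennreal (1 / e) * indicator {y. l < u y \<and> u y < l + e} y \<partial>m)"
proof -
  let ?E = "{y\<in>ball x r. l + e \<le> u y}" and ?F = "{y\<in>ball x r. u y \<le> l}"
  define h where "h = (\<lambda>y. g y * ennreal (1 / e) * indicator {y. l < u y \<and> u y < l + e} y)"
  define v where "v = (\<lambda>y. min 1 (max 0 ((u y - l) / e)))"
  have hv: "geo_gradient h v" unfolding h_def v_def by (rule truncation_gradient[OF g u e])
  then have hm: "h \<in> borel_measurable borel" by (simp add: geo_gradient_def)
  have gm: "g \<in> borel_measurable borel" using g by (simp add: upper_gradient_def)
  have um: "u \<in> borel_measurable borel" by (rule borel_measurable_continuous_onI[OF u])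
  have meas: "?E \<in> sets borel" "?F \<in> sets borel" using um by measurable
  have em: "emeasure m S = ennreal (measure m S)" if "S \<subseteq> ball x r" for S
    using emeasure_finite_of_subset_ball[OF that] by (intro emeasure_eq_ennreal_measure) auto
  have "(\<integral>\<^sup>+y\<in>ball x (2 * r). h y \<partial>m) \<le> (\<integral>\<^sup>+y. ennreal (1 / e) * (g y * indicator (ball x (2 * r)) y) \<partial>m)"
    unfolding h_def by (intro nn_integral_mono) (auto simp: indicator_def ac_simps)
  also have "\<dots> = ennreal (1 / e) * (\<integral>\<^sup>+y\<in>ball x (2 * r). g y \<partial>m)"
  proof (rule nn_integral_cmult)
    have "(\<lambda>y. g y * indicator (ball x (2 * r)) y) \<in> borel_measurable borel" using gm by (intro borel_measurable_times_ennreal borel_measurable_indicator) auto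
    then show "(\<lambda>y. g y * indicator (ball x (2 * r)) y) \<in> borel_measurable m" by (simp only: measurable_cong_sets[OF sets_m refl])
  qed
  also have "\<dots> < \<infinity>" using fin by (simp add: ennreal_mult_less_top)
  finally have hfin: "(\<integral>\<^sup>+y\<in>ball x (2 * r). h y \<partial>m) < \<infinity>" .
  define H where "H = enn2real (\<integral>\<^sup>+y\<in>ball x (2 * r). h y \<partial>m)"
  have H: "(\<integral>\<^sup>+y\<in>ball x (2 * r). h y \<partial>m) = ennreal H" "0 \<le> H" using hfin by (auto simp: H_def)
  have "measure m ?E * measure m ?F \<le> 2 * r * measure m (ball x r) * spread r * H"
  proof (cases "measure m ?E = 0 \<or> measure m ?F = 0")
    case True
    have "0 \<le> 2 * r * measure m (ball x r) * spread r * H"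
      using r H(2) spread_pos[of r] by (intro mult_nonneg_nonneg) auto
    then show ?thesis using True by auto
  next
    case False
    then have pos: "0 < measure m ?E" "0 < measure m ?F" by (simp_all add: zero_less_measure_iff)
    have "measure m ?E * measure m ?F \<le> r * (2 * (measure m ?E + measure m ?F) * spread r) * H"
    proof (rule level_sets_separated[OF hm H hv _ _ _ r meas(1) _ pos(1) _ meas(2) _ pos(2)])
      show "continuous_on UNIV v" unfolding v_def using e by (intro continuous_intros u) auto
      show "v y = 0" if "y \<in> ?F" for y
      proof -
        have "(u y - l) / e \<le> 0" using that e by (simp add: divide_nonpos_pos)
        then show ?thesis by (simp add: v_def max_absorb1)
      qed
    qed (use e in \<open>auto simp: v_def\<close>)
    also have "\<dots> \<le> r * (2 * measure m (ball x r) * spread r) * H"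
    proof (intro mult_right_mono mult_left_mono)
      have "measure m ?E + measure m ?F = measure m (?E \<union> ?F)"
      proof (rule measure_Union[symmetric])
        show "emeasure m ?E \<noteq> \<infinity>" "emeasure m ?F \<noteq> \<infinity>" by (subst em; force)+
        show "?E \<inter> ?F = {}" using e by auto
      qed (use meas in \<open>simp_all only: sets_m\<close>)
      also have "\<dots> \<le> measure m (ball x r)"
        using emeasure_ball_finite[of x r] meas by (intro measure_mono_fmeasurable) (auto simp: fmeasurable_def sets_m)
      finally show "measure m ?E + measure m ?F \<le> measure m (ball x r)" .
    qed (use r H(2) spread_pos[of r] in auto)
    finally show ?thesis by (simp add: ac_simps)
  qed
  then have "ennreal (measure m ?E * measure m ?F) \<le> ennreal (2 * r * measure m (ball x r) * spread r * H)" by (rule ennreal_leI)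
  moreover have "ennreal (measure m ?E * measure m ?F) = emeasure m ?E * emeasure m ?F"
    by (subst (1 2) em) (auto simp: ennreal_mult)
  moreover have "ennreal (2 * r * measure m (ball x r) * spread r * H) = ennreal (2 * r * measure m (ball x r) * spread r) * ennreal H"
    using r H(2) spread_pos[of r] by (intro ennreal_mult) auto
  ultimately show ?thesis unfolding H(1)[symmetric] h_def by simp
qed

text \<open>The indicator is written as a real number so that both integration rules for densities apply.\<close>

definition ball_measure :: "'a \<Rightarrow> real \<Rightarrow> 'a measure" where
  "ball_measure x r = density m (\<lambda>y. ennreal (indicator (ball x r) y))"

lemma sets_ball_measure [measurable_cong]: "sets (ball_measure x r) = sets borel"
  by (simp add: ball_measure_def sets_m)

lemma space_ball_measure: "space (ball_measure x r) = UNIV"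
  by (simp add: ball_measure_def space_m)

lemma nn_integral_ball_measure:
  assumes "f \<in> borel_measurable borel"
  shows "(\<integral>\<^sup>+y. f y \<partial>ball_measure x r) = (\<integral>\<^sup>+y\<in>ball x r. f y \<partial>m)"
proof -
  have [measurable]: "f \<in> borel_measurable m" "ball x r \<in> sets m"
    using assms by (simp_all add: measurable_cong_sets[OF sets_m refl] sets_m)
  have "(\<integral>\<^sup>+y. f y \<partial>ball_measure x r) = (\<integral>\<^sup>+y. ennreal (indicator (ball x r) y) * f y \<partial>m)"
    unfolding ball_measure_def by (rule nn_integral_density) measurable
  also have "\<dots> = (\<integral>\<^sup>+y\<in>ball x r. f y \<partial>m)" by (intro nn_integral_cong) (auto simp: indicator_def)
  finally show ?thesis .
qed

lemma emeasure_ball_measure: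
  assumes "S \<in> sets borel"
  shows "emeasure (ball_measure x r) S = emeasure m (ball x r \<inter> S)"
proof -
  have "emeasure (ball_measure x r) S = (\<integral>\<^sup>+y. indicator S y \<partial>ball_measure x r)"
    using assms by (simp add: sets_ball_measure)
  also have "\<dots> = (\<integral>\<^sup>+y\<in>ball x r. indicator S y \<partial>m)"
    using assms by (intro nn_integral_ball_measure) simp
  also have "\<dots> = (\<integral>\<^sup>+y. indicator (ball x r \<inter> S) y \<partial>m)"
    by (intro nn_integral_cong) (simp split: split_indicator)
  also have "\<dots> = emeasure m (ball x r \<inter> S)"
    using assms by (intro nn_integral_indicator) (simp add: sets_m)
  finally show ?thesis .
qed

lemma finite_ball_measure: "finite_measure (ball_measure x r)"
proof
  show "emeasure (ball_measure x r) (space (ball_measure x r)) \<noteq> \<infinity>"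
    using emeasure_ball_measure[of UNIV x r] emeasure_ball_finite[of x r]
    by (simp add: space_ball_measure less_top)
qed

text \<open>For fixed \<open>y\<close> and \<open>z\<close> the levels \<open>l\<close> with \<open>u z \<le> l\<close> and \<open>l + e \<le> u y\<close> form an interval of length \<open>u y - u z - e\<close>, and for fixed \<open>y\<close> the levels
  with \<open>l < u y < l + e\<close> form one of length \<open>e\<close>. So integrating \<open>level_set_product\<close> over \<open>l\<close> gives the claim on both sides.\<close>

lemma pair_energy_below:
  fixes x :: 'a and u :: "'a \<Rightarrow> real"
  assumes u: "continuous_on UNIV u" and g: "upper_gradient g u" and r: "0 < r" and e: "0 < e"
    and fin: "(\<integral>\<^sup>+y\<in>ball x (2 * r). g y \<partial>m) < \<infinity>"
  shows "(\<integral>\<^sup>+y. (\<integral>\<^sup>+z. ennreal (u y - u z - e) \<partial>ball_measure x r) \<partial>ball_measure x r)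
    \<le> ennreal (2 * r * measure m (ball x r) * spread r) * (\<integral>\<^sup>+y\<in>ball x (2 * r). g y \<partial>m)"
proof -
  let ?M = "ball_measure x r" and ?c = "ennreal (2 * r * measure m (ball x r) * spread r)"
  interpret M: finite_measure ?M by (rule finite_ball_measure)
  interpret m: sigma_finite_measure m by (rule sigma_finite_m)
  interpret Ml: pair_sigma_finite ?M lborel by standard
  interpret ml: pair_sigma_finite m lborel by standard
  have um [measurable]: "u \<in> borel_measurable borel" by (rule borel_measurable_continuous_onI[OF u])
  have gm: "g \<in> borel_measurable borel" using g by (simp add: upper_gradient_def)
  have [measurable]: "g \<in> borel_measurable m" "u \<in> borel_measurable m" "ball x (2 * r) \<in> sets m"
    using gm um by (simp_all add: measurable_cong_sets[OF sets_m refl] sets_m)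
  have uM [measurable]: "u \<in> borel_measurable ?M" using um by (simp add: measurable_cong_sets[OF sets_ball_measure refl])
  have 1: "ennreal (u y - u z - e) = (\<integral>\<^sup>+l. (if l + e \<le> u y \<and> u z \<le> l then 1 else 0) \<partial>lborel)" for y z
  proof -
    have "(\<integral>\<^sup>+l. (if l + e \<le> u y \<and> u z \<le> l then 1 else 0) \<partial>lborel) = (\<integral>\<^sup>+l. indicator {u z..u y - e} l \<partial>lborel)"
      by (intro nn_integral_cong) (auto simp: indicator_def)
    also have "\<dots> = emeasure lborel {u z..u y - e}" by simp
    also have "\<dots> = ennreal (u y - u z - e)"
    proof (cases "u z \<le> u y - e")
      case True
      then show ?thesis by (simp add: algebra_simps)
    next
      case False
      then have "{u z..u y - e} = {}" "u y - u z - e \<le> 0" by auto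
      then show ?thesis by (simp add: ennreal_neg)
    qed
    finally show ?thesis by simp
  qed
  have "(\<integral>\<^sup>+y. (\<integral>\<^sup>+z. ennreal (u y - u z - e) \<partial>?M) \<partial>?M)
      = (\<integral>\<^sup>+y. (\<integral>\<^sup>+z. (\<integral>\<^sup>+l. (if l + e \<le> u y \<and> u z \<le> l then 1 else 0) \<partial>lborel) \<partial>?M) \<partial>?M)"
    by (simp only: 1)
  also have "\<dots> = (\<integral>\<^sup>+y. (\<integral>\<^sup>+l. (\<integral>\<^sup>+z. (if l + e \<le> u y \<and> u z \<le> l then 1 else 0) \<partial>?M) \<partial>lborel) \<partial>?M)"
  proof (rule nn_integral_cong)
    fix y
    have "(\<lambda>(z, l). (if l + e \<le> u y \<and> u z \<le> l then 1 else 0) :: ennreal) \<in> borel_measurable (?M \<Otimes>\<^sub>M lborel)" by measurable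
    from Ml.Fubini'[OF this]
    show "(\<integral>\<^sup>+z. (\<integral>\<^sup>+l. (if l + e \<le> u y \<and> u z \<le> l then 1 else 0) \<partial>lborel) \<partial>?M)
      = (\<integral>\<^sup>+l. (\<integral>\<^sup>+z. (if l + e \<le> u y \<and> u z \<le> l then 1 else 0) \<partial>?M) \<partial>lborel)" by simp
  qed
  also have "\<dots> = (\<integral>\<^sup>+y. (\<integral>\<^sup>+l. (if l + e \<le> u y then 1 else 0) * emeasure ?M {z. u z \<le> l} \<partial>lborel) \<partial>?M)"
  proof (intro nn_integral_cong)
    fix y l
    have "(\<integral>\<^sup>+z. (if l + e \<le> u y \<and> u z \<le> l then 1 else 0) \<partial>?M) = (\<integral>\<^sup>+z. (if l + e \<le> u y then 1 else 0) * indicator {z. u z \<le> l} z \<partial>?M)"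
      by (intro nn_integral_cong) (auto simp: indicator_def)
    also have "\<dots> = (if l + e \<le> u y then 1 else 0) * emeasure ?M {z. u z \<le> l}"
      using um by (intro nn_integral_cmult_indicator) (simp add: sets_ball_measure)
    finally show "(\<integral>\<^sup>+z. (if l + e \<le> u y \<and> u z \<le> l then 1 else 0) \<partial>?M) = (if l + e \<le> u y then 1 else 0) * emeasure ?M {z. u z \<le> l}" .
  qed
  also have "\<dots> = (\<integral>\<^sup>+l. (\<integral>\<^sup>+y. (if l + e \<le> u y then 1 else 0) * emeasure ?M {z. u z \<le> l} \<partial>?M) \<partial>lborel)"
  proof -
    have "(\<lambda>l. \<integral>\<^sup>+z. (if u z \<le> l then 1 else 0) \<partial>?M) \<in> borel_measurable borel" by measurable
    moreover have "(\<integral>\<^sup>+z. (if u z \<le> l then 1 else 0) \<partial>?M) = emeasure ?M {z. u z \<le> l}" for l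
    proof -
      have "(\<integral>\<^sup>+z. (if u z \<le> l then 1 else 0) \<partial>?M) = (\<integral>\<^sup>+z. indicator {z. u z \<le> l} z \<partial>?M)"
        by (intro nn_integral_cong) (simp split: split_indicator)
      also have "\<dots> = emeasure ?M {z. u z \<le> l}"
        using um by (intro nn_integral_indicator) (simp add: sets_ball_measure)
      finally show ?thesis .
    qed
    ultimately have [measurable]: "(\<lambda>l. emeasure ?M {z. u z \<le> l}) \<in> borel_measurable borel" by (simp only:)
    have "(\<lambda>(y, l). (if l + e \<le> u y then 1 else 0) * emeasure ?M {z. u z \<le> l}) \<in> borel_measurable (?M \<Otimes>\<^sub>M lborel)" by measurable
    from Ml.Fubini'[OF this] show ?thesis by simp
  qed
  also have "\<dots> = (\<integral>\<^sup>+l. emeasure ?M {y. l + e \<le> u y} * emeasure ?M {z. u z \<le> l} \<partial>lborel)"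
  proof (rule nn_integral_cong)
    fix l
    have "(\<integral>\<^sup>+y. (if l + e \<le> u y then 1 else 0) * emeasure ?M {z. u z \<le> l} \<partial>?M) = (\<integral>\<^sup>+y. emeasure ?M {z. u z \<le> l} * indicator {y. l + e \<le> u y} y \<partial>?M)"
      by (intro nn_integral_cong) (auto simp: indicator_def)
    also have "\<dots> = emeasure ?M {z. u z \<le> l} * emeasure ?M {y. l + e \<le> u y}"
      using um by (intro nn_integral_cmult_indicator) (simp add: sets_ball_measure)
    finally show "(\<integral>\<^sup>+y. (if l + e \<le> u y then 1 else 0) * emeasure ?M {z. u z \<le> l} \<partial>?M) = emeasure ?M {y. l + e \<le> u y} * emeasure ?M {z. u z \<le> l}"
      by (simp only: mult.commute)
  qed
  also have "\<dots> \<le> (\<integral>\<^sup>+l. ?c * (\<integral>\<^sup>+y\<in>ball x (2 * r). g y * ennreal (1 / e) * indicator {y. l < u y \<and> u y < l + e} y \<partial>m) \<partial>lborel)"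
  proof (rule nn_integral_mono)
    fix l
    have "emeasure ?M {y. l + e \<le> u y} = emeasure m {y\<in>ball x r. l + e \<le> u y}"
      using um by (subst emeasure_ball_measure) (auto intro!: arg_cong[where f = "emeasure m"])
    moreover have "emeasure ?M {y. u y \<le> l} = emeasure m {y\<in>ball x r. u y \<le> l}"
      using um by (subst emeasure_ball_measure) (auto intro!: arg_cong[where f = "emeasure m"])
    ultimately show "emeasure ?M {y. l + e \<le> u y} * emeasure ?M {z. u z \<le> l}
      \<le> ?c * (\<integral>\<^sup>+y\<in>ball x (2 * r). g y * ennreal (1 / e) * indicator {y. l < u y \<and> u y < l + e} y \<partial>m)"
      using level_set_product[OF u g r e fin, of l] by simp
  qed
  also have "\<dots> = (\<integral>\<^sup>+l. ?c * (\<integral>\<^sup>+y. (if l < u y \<and> u y < l + e then g y * ennreal (1 / e) * indicator (ball x (2 * r)) y else 0) \<partial>m) \<partial>lborel)"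
    by (intro nn_integral_cong arg_cong[where f = "\<lambda>z. ?c * z"]) (auto simp: indicator_def)
  also have "\<dots> = ?c * (\<integral>\<^sup>+l. (\<integral>\<^sup>+y. (if l < u y \<and> u y < l + e then g y * ennreal (1 / e) * indicator (ball x (2 * r)) y else 0) \<partial>m) \<partial>lborel)"
    by (rule nn_integral_cmult) measurable
  also have "(\<integral>\<^sup>+l. (\<integral>\<^sup>+y. (if l < u y \<and> u y < l + e then g y * ennreal (1 / e) * indicator (ball x (2 * r)) y else 0) \<partial>m) \<partial>lborel)
      = (\<integral>\<^sup>+y. (\<integral>\<^sup>+l. (if l < u y \<and> u y < l + e then g y * ennreal (1 / e) * indicator (ball x (2 * r)) y else 0) \<partial>lborel) \<partial>m)"
  proof -
    have "(\<lambda>(y, l). (if l < u y \<and> u y < l + e then g y * ennreal (1 / e) * indicator (ball x (2 * r)) y else 0)) \<in> borel_measurable (m \<Otimes>\<^sub>M lborel)" by measurable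
    from ml.Fubini'[OF this] show ?thesis by simp
  qed
  also have "\<dots> = (\<integral>\<^sup>+y\<in>ball x (2 * r). g y \<partial>m)"
  proof (rule nn_integral_cong)
    fix y
    have "(\<integral>\<^sup>+l. (if l < u y \<and> u y < l + e then g y * ennreal (1 / e) * indicator (ball x (2 * r)) y else 0) \<partial>lborel)
        = (\<integral>\<^sup>+l. (g y * ennreal (1 / e) * indicator (ball x (2 * r)) y) * indicator {u y - e<..<u y} l \<partial>lborel)"
      by (intro nn_integral_cong) (auto simp: indicator_def)
    also have "\<dots> = (g y * ennreal (1 / e) * indicator (ball x (2 * r)) y) * ennreal e"
      using e by (subst nn_integral_cmult_indicator) auto
    also have "\<dots> = g y * indicator (ball x (2 * r)) y * (ennreal (1 / e) * ennreal e)" by (simp only: ac_simps)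
    also have "ennreal (1 / e) * ennreal e = 1" using e by (simp add: ennreal_mult[symmetric])
    finally show "(\<integral>\<^sup>+l. (if l < u y \<and> u y < l + e then g y * ennreal (1 / e) * indicator (ball x (2 * r)) y else 0) \<partial>lborel) = g y * indicator (ball x (2 * r)) y"
      by simp
  qed
  finally show ?thesis .
qed

lemma pair_energy:
  fixes x :: 'a and u :: "'a \<Rightarrow> real"
  assumes u: "continuous_on UNIV u" and g: "upper_gradient g u" and r: "0 < r"
    and fin: "(\<integral>\<^sup>+y\<in>ball x (2 * r). g y \<partial>m) < \<infinity>"
  shows "(\<integral>\<^sup>+y. (\<integral>\<^sup>+z. ennreal \<bar>u y - u z\<bar> \<partial>ball_measure x r) \<partial>ball_measure x r)
    \<le> ennreal (4 * r * measure m (ball x r) * spread r) * (\<integral>\<^sup>+y\<in>ball x (2 * r). g y \<partial>m)"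
proof -
  let ?M = "ball_measure x r" and ?c = "ennreal (2 * r * measure m (ball x r) * spread r)" and ?G = "\<integral>\<^sup>+y\<in>ball x (2 * r). g y \<partial>m"
  interpret M: finite_measure ?M by (rule finite_ball_measure)
  interpret MM: pair_sigma_finite ?M ?M by standard
  have um: "u \<in> borel_measurable borel" by (rule borel_measurable_continuous_onI[OF u])
  have uM [measurable]: "u \<in> borel_measurable ?M" using um by (simp add: measurable_cong_sets[OF sets_ball_measure refl])
  define b where "b = measure m (ball x r)"
  have b: "0 < b" unfolding b_def using r by (rule measure_ball_pos)
  have Mb: "emeasure ?M (space ?M) = ennreal b"
    unfolding space_ball_measure using emeasure_ball_measure[of UNIV x r] by (simp add: b_def emeasure_ball)
  let ?I = "\<integral>\<^sup>+y. (\<integral>\<^sup>+z. ennreal (u y - u z) \<partial>?M) \<partial>?M"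
  have I: "?I \<le> ?c * ?G"
  proof (rule ennreal_le_epsilon)
    fix d :: real assume d: "0 < d"
    \<comment> \<open>Cutting off \<open>e\<close> changes the double integral by at most \<open>e\<close> times the measure of \<open>B \<times> B\<close>.\<close>
    define e where "e = d / (b * b)"
    have e: "0 < e" using d b by (simp add: e_def)
    have "?I \<le> (\<integral>\<^sup>+y. (\<integral>\<^sup>+z. ennreal (u y - u z - e) + ennreal e \<partial>?M) \<partial>?M)"
    proof (intro nn_integral_mono)
      fix y z
      have "ennreal (u y - u z) \<le> ennreal (max 0 (u y - u z - e) + e)" by (intro ennreal_leI) simp
      also have "\<dots> = ennreal (u y - u z - e) + ennreal e" using e by (subst ennreal_plus) (auto simp: ennreal_max_0)
      finally show "ennreal (u y - u z) \<le> ennreal (u y - u z - e) + ennreal e" .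
    qed
    also have "\<dots> = (\<integral>\<^sup>+y. (\<integral>\<^sup>+z. ennreal (u y - u z - e) \<partial>?M) \<partial>?M) + ennreal d"
    proof -
      have "(\<integral>\<^sup>+z. ennreal (u y - u z - e) + ennreal e \<partial>?M) = (\<integral>\<^sup>+z. ennreal (u y - u z - e) \<partial>?M) + ennreal e * ennreal b" for y
        by (subst nn_integral_add) (auto simp: Mb)
      then have "(\<integral>\<^sup>+y. (\<integral>\<^sup>+z. ennreal (u y - u z - e) + ennreal e \<partial>?M) \<partial>?M) = (\<integral>\<^sup>+y. (\<integral>\<^sup>+z. ennreal (u y - u z - e) \<partial>?M) + ennreal e * ennreal b \<partial>?M)" by simp
      also have "\<dots> = (\<integral>\<^sup>+y. (\<integral>\<^sup>+z. ennreal (u y - u z - e) \<partial>?M) \<partial>?M) + ennreal e * ennreal b * ennreal b"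
        by (subst nn_integral_add) (auto simp: Mb)
      also have "ennreal e * ennreal b * ennreal b = ennreal (e * b * b)" using e b by (simp add: ennreal_mult)
      also have "e * b * b = d" using b by (simp add: e_def)
      finally show ?thesis .
    qed
    also have "\<dots> \<le> ?c * ?G + ennreal d" by (intro add_right_mono pair_energy_below[OF u g r e fin])
    finally show "?I \<le> ?c * ?G + ennreal d" .
  qed
  have swap: "(\<integral>\<^sup>+y. (\<integral>\<^sup>+z. ennreal (u z - u y) \<partial>?M) \<partial>?M) = ?I"
  proof -
    have "(\<lambda>(y, z). ennreal (u y - u z)) \<in> borel_measurable (?M \<Otimes>\<^sub>M ?M)" by measurable
    from MM.Fubini'[OF this] show ?thesis by simp
  qed
  have "(\<integral>\<^sup>+y. (\<integral>\<^sup>+z. ennreal \<bar>u y - u z\<bar> \<partial>?M) \<partial>?M) = (\<integral>\<^sup>+y. (\<integral>\<^sup>+z. ennreal (u y - u z) + ennreal (u z - u y) \<partial>?M) \<partial>?M)"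
    by (intro nn_integral_cong) (auto simp: abs_if ennreal_neg)
  also have "\<dots> = (\<integral>\<^sup>+y. (\<integral>\<^sup>+z. ennreal (u y - u z) \<partial>?M) + (\<integral>\<^sup>+z. ennreal (u z - u y) \<partial>?M) \<partial>?M)"
    by (intro nn_integral_cong nn_integral_add) measurable
  also have "\<dots> = ?I + ?I"
    by (subst nn_integral_add) (measurable, simp add: swap)
  also have "\<dots> \<le> ?c * ?G + ?c * ?G" by (intro add_mono I)
  also have "\<dots> = (?c + ?c) * ?G" by (simp add: distrib_right)
  also have "?c + ?c = ennreal (4 * r * measure m (ball x r) * spread r)"
    using r spread_pos[of r] by (subst ennreal_plus[symmetric]) (auto intro!: mult_nonneg_nonneg)
  finally show ?thesis .
qed

text \<open>The factors \<open>cosh\<close> of \<open>spread\<close> and of the doubling estimate cancel.\<close>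

lemma spread_doubling:
  assumes "0 < r"
  shows "4 * r * spread r * measure m (ball x (2 * r))
    \<le> 2 powr (N + 2) * r * exp (sqrt ((N - 1) * \<bar>K\<bar>) * (2 * r)) * measure m (ball (x::'a) r)"
proof -
  let ?a = "curv * r"
  have c: "0 < cosh ?a" by (rule cosh_real_pos)
  have "4 * r * spread r * measure m (ball x (2 * r)) \<le> 4 * r * spread r * (2 powr N * cosh ?a powr (N - 1) * measure m (ball x r))"
    using assms spread_pos[of r] by (intro mult_left_mono measure_ball_double) auto
  also have "\<dots> = 4 * 2 powr N * r * (spread r * cosh ?a powr (N - 1)) * measure m (ball x r)" by (simp add: ac_simps)
  also have "spread r * cosh ?a powr (N - 1) = exp (2 * ?a) powr (N - 1)"
    using c by (simp add: spread_def powr_divide)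
  also have "exp (2 * ?a) powr (N - 1) = exp (sqrt ((N - 1) * \<bar>K\<bar>) * (2 * r))"
  proof -
    have "curv * (N - 1) = sqrt ((N - 1) * \<bar>K\<bar>)"
    proof (cases "N = 1")
      case False
      then have n: "0 < N - 1" using N by simp
      have "sqrt ((N - 1) * \<bar>K\<bar>) = sqrt (\<bar>K\<bar> / (N - 1) * (N - 1)\<^sup>2)" using n by (simp add: power2_eq_square ac_simps)
      also have "\<dots> = curv * (N - 1)" using n unfolding curv_def by (simp only: real_sqrt_mult real_sqrt_abs abs_of_pos)
      finally show ?thesis by simp
    qed simp
    then have "2 * ?a * (N - 1) = sqrt ((N - 1) * \<bar>K\<bar>) * (2 * r)" by (simp add: ac_simps)
    then show ?thesis by (simp add: exp_powr_real)
  qed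
  also have "4 * 2 powr N = (2::real) powr (N + 2)" by (simp add: powr_add)
  finally show ?thesis .
qed

text \<open>The deviation from the average is the average of differences. Finiteness of the double integral also yields the integrability of \<open>u\<close> on the ball, which the
  definition of the average does not presuppose.\<close>

theorem poincare_inequality:
  fixes x :: 'a and u :: "'a \<Rightarrow> real"
  assumes u: "continuous_on UNIV u" and g: "upper_gradient g u" and r: "0 < r"
  shows "nn_average m (ball x r) (\<lambda>y. ennreal \<bar>u y - average m (ball x r) u\<bar>)
    \<le> ennreal (2 powr (N + 2) * r * exp (sqrt ((N - 1) * \<bar>K\<bar>) * (2 * r))) * nn_average m (ball x (2 * r)) g"
proof -
  let ?M = "ball_measure x r" and ?G = "\<integral>\<^sup>+y\<in>ball x (2 * r). g y \<partial>m"
  define C where "C = 2 powr (N + 2) * r * exp (sqrt ((N - 1) * \<bar>K\<bar>) * (2 * r))"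
  have C: "0 < C" using r by (simp add: C_def)
  define b b2 where "b = measure m (ball x r)" and "b2 = measure m (ball x (2 * r))"
  have b: "0 < b" and b2: "0 < b2" unfolding b_def b2_def using r by (auto intro!: measure_ball_pos)
  have eb: "emeasure m (ball x r) = ennreal b" "emeasure m (ball x (2 * r)) = ennreal b2" by (simp_all add: b_def b2_def emeasure_ball)
  show ?thesis
  proof (cases "?G = \<infinity>")
    case True
    then have "nn_average m (ball x (2 * r)) g = \<infinity>" using b2 by (simp add: nn_average_def eb ennreal_top_divide)
    then show ?thesis using C unfolding C_def[symmetric] by (simp add: ennreal_mult_top)
  next
    case False
    then have fin: "?G < \<infinity>" by (simp add: less_top)
    interpret M: finite_measure ?M by (rule finite_ball_measure)
    have um [measurable]: "u \<in> borel_measurable borel" by (rule borel_measurable_continuous_onI[OF u])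
    have uM [measurable]: "u \<in> borel_measurable ?M" using um by (simp add: measurable_cong_sets[OF sets_ball_measure refl])
    have um' [measurable]: "u \<in> borel_measurable m" "ball x r \<in> sets m" using um by (simp_all add: measurable_cong_sets[OF sets_m refl] sets_m)
    have Mb: "measure ?M (space ?M) = b"
      unfolding space_ball_measure using emeasure_ball_measure[of UNIV x r] by (simp add: b_def measure_def)
    let ?P = "\<integral>\<^sup>+y. (\<integral>\<^sup>+z. ennreal \<bar>u y - u z\<bar> \<partial>?M) \<partial>?M"
    have P: "?P \<le> ennreal (4 * r * b * spread r) * ?G" unfolding b_def by (rule pair_energy[OF u g r fin])
    also have "\<dots> < \<infinity>" using fin by (simp add: ennreal_mult_less_top)
    finally have Pfin: "?P < \<infinity>" .
    have eM: "emeasure ?M (space ?M) = ennreal b" using M.emeasure_eq_measure[of "space ?M"] Mb by simp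
    have "\<exists>y. (\<integral>\<^sup>+z. ennreal \<bar>u y - u z\<bar> \<partial>?M) \<noteq> \<infinity>"
    proof (rule ccontr)
      assume "\<not> ?thesis"
      then have "(\<integral>\<^sup>+z. ennreal \<bar>u y - u z\<bar> \<partial>?M) = \<infinity>" for y by blast
      then have "?P = (\<integral>\<^sup>+y. \<infinity> \<partial>?M)" by (simp only:)
      also have "\<dots> = \<infinity> * ennreal b" unfolding eM[symmetric] by (rule nn_integral_const)
      also have "\<dots> = \<infinity>" using b by (simp add: ennreal_top_mult)
      finally show False using Pfin by simp
    qed
    then obtain y0 where y0: "(\<integral>\<^sup>+z. ennreal \<bar>u y0 - u z\<bar> \<partial>?M) \<noteq> \<infinity>" by blast
    have "integrable ?M (\<lambda>z. u y0 - u z)" using y0 by (intro integrableI_bounded) (auto simp: less_top)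
    from Bochner_Integration.integrable_diff[OF M.integrable_const[of "u y0"] this]
    have "integrable ?M (\<lambda>z. u y0 - (u y0 - u z))" .
    moreover have "(\<lambda>z. u y0 - (u y0 - u z)) = u" by (simp add: fun_eq_iff)
    ultimately have int: "integrable ?M u" by (simp only:)
    have avg: "average m (ball x r) u = (\<integral>z. u z \<partial>?M) / b"
    proof -
      have "(\<integral>z. u z \<partial>?M) = (\<integral>z. indicator (ball x r) z *\<^sub>R u z \<partial>m)"
        unfolding ball_measure_def by (intro integral_density) auto
      then show ?thesis by (simp add: average_def set_lebesgue_integral_def b_def)
    qed
    have pt: "ennreal \<bar>u y - average m (ball x r) u\<bar> \<le> ennreal (1 / b) * (\<integral>\<^sup>+z. ennreal \<bar>u y - u z\<bar> \<partial>?M)" for y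
    proof -
      have i: "integrable ?M (\<lambda>z. u y - u z)" using int by auto
      have "(\<integral>z. u y - u z \<partial>?M) = b * u y - (\<integral>z. u z \<partial>?M)" using int by (simp add: Mb)
      then have "u y - average m (ball x r) u = 1 / b * (\<integral>z. u y - u z \<partial>?M)" using b by (simp add: avg field_simps)
      then have "\<bar>u y - average m (ball x r) u\<bar> = 1 / b * \<bar>\<integral>z. u y - u z \<partial>?M\<bar>" using b by (simp add: abs_mult)
      also have "\<dots> \<le> 1 / b * (\<integral>z. \<bar>u y - u z\<bar> \<partial>?M)" using b by (intro mult_left_mono integral_abs_bound) auto
      finally have "ennreal \<bar>u y - average m (ball x r) u\<bar> \<le> ennreal (1 / b * (\<integral>z. \<bar>u y - u z\<bar> \<partial>?M))" by (rule ennreal_leI)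
      also have "\<dots> = ennreal (1 / b) * ennreal (\<integral>z. \<bar>u y - u z\<bar> \<partial>?M)" using b by (intro ennreal_mult) auto
      also have "ennreal (\<integral>z. \<bar>u y - u z\<bar> \<partial>?M) = (\<integral>\<^sup>+z. ennreal \<bar>u y - u z\<bar> \<partial>?M)"
        using i by (intro nn_integral_eq_integral[symmetric] integrable_abs) auto
      finally show ?thesis .
    qed
    have "(\<integral>\<^sup>+y\<in>ball x r. ennreal \<bar>u y - average m (ball x r) u\<bar> \<partial>m) = (\<integral>\<^sup>+y. ennreal \<bar>u y - average m (ball x r) u\<bar> \<partial>?M)"
      by (rule nn_integral_ball_measure[symmetric]) simp
    also have "\<dots> \<le> (\<integral>\<^sup>+y. ennreal (1 / b) * (\<integral>\<^sup>+z. ennreal \<bar>u y - u z\<bar> \<partial>?M) \<partial>?M)" by (intro nn_integral_mono pt)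
    also have "\<dots> = ennreal (1 / b) * ?P" by (rule nn_integral_cmult) measurable
    also have "\<dots> \<le> ennreal (1 / b) * (ennreal (4 * r * b * spread r) * ?G)" by (intro mult_left_mono P) simp
    also have "\<dots> = ennreal (4 * r * spread r) * ?G"
      using b r spread_pos[of r] by (simp add: mult.assoc[symmetric] ennreal_mult[symmetric])
    finally have "nn_average m (ball x r) (\<lambda>y. ennreal \<bar>u y - average m (ball x r) u\<bar>) \<le> ennreal (4 * r * spread r) * ?G / ennreal b"
      unfolding nn_average_def eb by (rule divide_right_mono_ennreal)
    also have "\<dots> = ennreal (4 * r * spread r / b) * ?G"
      using b r spread_pos[of r] by (simp add: divide_ennreal_def inverse_ennreal ennreal_mult'' divide_inverse ac_simps)
    also have "\<dots> \<le> ennreal (C / b2) * ?G"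
    proof (intro mult_right_mono ennreal_leI)
      have "4 * r * spread r * b2 \<le> C * b" unfolding C_def b_def b2_def by (rule spread_doubling[OF r])
      then show "4 * r * spread r / b \<le> C / b2" using b b2 by (simp add: field_simps)
    qed simp
    also have "\<dots> = ennreal C * nn_average m (ball x (2 * r)) g"
    proof -
      have "ennreal (C / b2) = ennreal C * inverse (ennreal b2)"
        using C b2 by (simp add: divide_inverse inverse_ennreal ennreal_mult'')
      then show ?thesis unfolding nn_average_def eb divide_ennreal_def by (simp only: ac_simps)
    qed
    finally show ?thesis unfolding C_def .
  qed
qed

end

theorem theorem1p2:
  fixes m :: "'a::complete_space measure" and K N :: real
  assumes "metric_measure_space m" and "K \<le> 0" and "1 \<le> N"
  shows "(CD_space m K N \<longrightarrow>
           (\<forall>u g x r. continuous_on UNIV u \<and> upper_gradient g u \<and> 0 < r \<longrightarrow>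
              nn_average m (ball x r) (\<lambda>y. ennreal \<bar>u y - average m (ball x r) u\<bar>)
                \<le> ennreal (2 powr (N + 2) * r * exp (sqrt ((N - 1) * \<bar>K\<bar>) * (2 * r)))
                   * nn_average m (ball x (2 * r)) g)) \<and>
         (CD_space m 0 N \<longrightarrow>
           (\<forall>u g x r. continuous_on UNIV u \<and> upper_gradient g u \<and> 0 < r \<longrightarrow>
              nn_average m (ball x r) (\<lambda>y. ennreal \<bar>u y - average m (ball x r) u\<bar>)
                \<le> ennreal (2 powr (N + 2) * r) * nn_average m (ball x (2 * r)) g))"
proof (intro conjI impI allI; elim conjE)
  fix u :: "'a \<Rightarrow> real" and g and x :: 'a and r :: real
  assume CD: "CD_space m K N" and A: "continuous_on UNIV u" "upper_gradient g u" "0 < r"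
  interpret cd_space m K N by unfold_locales (use assms CD in auto)
  show "nn_average m (ball x r) (\<lambda>y. ennreal \<bar>u y - average m (ball x r) u\<bar>)
    \<le> ennreal (2 powr (N + 2) * r * exp (sqrt ((N - 1) * \<bar>K\<bar>) * (2 * r))) * nn_average m (ball x (2 * r)) g"
    by (rule poincare_inequality[OF A])
next
  fix u :: "'a \<Rightarrow> real" and g and x :: 'a and r :: real
  assume CD: "CD_space m 0 N" and A: "continuous_on UNIV u" "upper_gradient g u" "0 < r"
  interpret cd_space m 0 N by unfold_locales (use assms CD in auto)
  show "nn_average m (ball x r) (\<lambda>y. ennreal \<bar>u y - average m (ball x r) u\<bar>)
    \<le> ennreal (2 powr (N + 2) * r) * nn_average m (ball x (2 * r)) g"
    using poincare_inequality[OF A, of x] by simp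
qed

end
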